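(* Let $N \leq n$ be natural numbers and suppose that for some natural $r$ the product $\prod_{i=1}^r w_{n-N+2i-1}(\xi_n)$ of Stiefel--Whitney classes of the regular bundle $\xi_n$ is not equal to $0$ in $H^*(B(\mathbb{R}^2,n),\mathbb{Z}_2)$. Then for any $N$-dimensional vector subspace $\mathcal{F}^N \subset C^0(\mathbb{R}^1,\mathbb{R}^1)$ there exist independent $n$-chord diagrams $\{(a_1,b_1),\dots,(a_n,b_n)\}$ for each of which the subspace of $\mathcal{F}^N$ consisting of all functions $f \in \mathcal{F}^N$ satisfying $f(a_i)=f(b_i)$ for $i=1,\dots,n$ is at least $r$-dimensional.
   Context: $C^0(\mathbb{R}^1,\mathbb{R}^1)$ is the space of continuous functions $\mathbb{R}^1\to\mathbb{R}^1$. A chord is an unordered pair $(a,b)$ of distinct points of $\mathbb{R}^1$; an $n$-chord diagram is an unordered collection of $n$ pairwise distinct chords $\{(a_1,b_1),\dots,(a_n,b_n)\}$. It is independent if the subalgebra of $C^0(\mathbb{R}^1,\mathbb{R}^1)$ consisting of all functions satisfying $f(a_i)=f(b_i)$, $i=1,\dots,n$, has codimension exactly $n$. $B(X,n)$ is the configuration space of unordered $n$-point subsets of a topological space $X$, naturally topologized. The regular bundle $\xi_n$ over $B(\mathbb{R}^2,n)$ is the $n$-dimensional real vector bundle whose fiber over an $n$-point configuration is the space of real-valued functions on this set of points; $w_k(\xi_n)\in H^k(B(\mathbb{R}^2,n),\mathbb{Z}_2)$ is its $k$-th Stiefel--Whitney class. *)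

theory Defs
  imports "HOL-Combinatorics.Permutations" "HOL-Algebra.QuotRing" "HOL-Homology.Homology"
    "HOL-Library.Z2" "HOL-Library.Function_Algebras"
begin

section \<open>Singular cohomology with coefficients in the two-element field\<close>

text \<open>
  A cochain is a family, indexed by the degree, of functions on singular simplices. The indexing is
  needed because the function representing a simplex does not determine its dimension. Cochains
  vanish on everything that is not a singular simplex of the space, and only finitely many of their
  homogeneous components are nonzero. There are no signs, since the coefficients are of
  characteristic two.
\<close>

type_synonym 'a cochain = "nat \<Rightarrow> ((nat \<Rightarrow> real) \<Rightarrow> 'a) \<Rightarrow> bit"

definition front_face :: "nat \<Rightarrow> ((nat \<Rightarrow> real) \<Rightarrow> 'a) \<Rightarrow> (nat \<Rightarrow> real) \<Rightarrow> 'a" where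
  "front_face p \<sigma> = restrict \<sigma> (standard_simplex p)"

text \<open>The face of a \<open>(p + q)\<close>-simplex spanned by its last \<open>q + 1\<close> vertices.\<close>

definition back_face :: "nat \<Rightarrow> nat \<Rightarrow> ((nat \<Rightarrow> real) \<Rightarrow> 'a) \<Rightarrow> (nat \<Rightarrow> real) \<Rightarrow> 'a" where
  "back_face p q \<sigma> = restrict (\<lambda>x. \<sigma> (\<lambda>i. if i < p then 0 else x (i - p))) (standard_simplex q)"

definition cochain_ring :: "'a topology \<Rightarrow> 'a cochain ring" where
  "cochain_ring X =
    \<lparr>carrier = {c. (\<forall>k \<sigma>. \<not> singular_simplex k X \<sigma> \<longrightarrow> c k \<sigma> = 0) \<and> finite {k. c k \<noteq> 0}},
     monoid.mult = (\<lambda>a b k \<sigma>. if singular_simplex k X \<sigma>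
        then \<Sum>p\<le>k. a p (front_face p \<sigma>) * b (k - p) (back_face p (k - p) \<sigma>) else 0),
     one = (\<lambda>k \<sigma>. if k = 0 \<and> singular_simplex 0 X \<sigma> then 1 else 0),
     ring.zero = (\<lambda>k \<sigma>. 0),
     add = (\<lambda>a b k \<sigma>. a k \<sigma> + b k \<sigma>)\<rparr>"

definition coboundary :: "'a topology \<Rightarrow> 'a cochain \<Rightarrow> 'a cochain" where
  "coboundary X c = (\<lambda>k \<sigma>. if k \<noteq> 0 \<and> singular_simplex k X \<sigma>
     then \<Sum>i\<le>k. c (k - 1) (singular_face k i \<sigma>) else 0)"

definition cocycle_ring :: "'a topology \<Rightarrow> 'a cochain ring" where
  "cocycle_ring X =
    cochain_ring X\<lparr>carrier := {c \<in> carrier (cochain_ring X). coboundary X c = (\<lambda>k \<sigma>. 0)}\<rparr>"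

definition coboundaries :: "'a topology \<Rightarrow> 'a cochain set" where
  "coboundaries X = coboundary X ` carrier (cochain_ring X)"

definition cohomology_ring :: "'a topology \<Rightarrow> 'a cochain set ring" where
  "cohomology_ring X = cocycle_ring X Quot coboundaries X"

definition cohomology_class :: "'a topology \<Rightarrow> 'a cochain \<Rightarrow> 'a cochain set" where
  "cohomology_class X c = coboundaries X +>\<^bsub>cocycle_ring X\<^esub> c"

definition cohomology :: "nat \<Rightarrow> 'a topology \<Rightarrow> 'a cochain set set" where
  "cohomology k X =
    cohomology_class X ` {c \<in> carrier (cocycle_ring X). \<forall>j. j \<noteq> k \<longrightarrow> c j = 0}"

definition cochain_pullback ::
    "'a topology \<Rightarrow> ('a \<Rightarrow> 'b) \<Rightarrow> 'b cochain \<Rightarrow> 'a cochain" where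
  "cochain_pullback X f c =
    (\<lambda>k \<sigma>. if singular_simplex k X \<sigma> then c k (simplex_map k f \<sigma>) else 0)"

text \<open>
  The homomorphism \<open>f\<^sup>*\<close> induced by a continuous map \<open>f\<close> defined on \<open>X\<close>. All members of
  the union are equal when \<open>A\<close> is a cohomology class, as in \<^const>\<open>rcoset_mult\<close>.
\<close>

definition cohomology_pullback ::
    "'a topology \<Rightarrow> ('a \<Rightarrow> 'b) \<Rightarrow> 'b cochain set \<Rightarrow> 'a cochain set" where
  "cohomology_pullback X f A = (\<Union>a\<in>A. cohomology_class X (cochain_pullback X f a))"


section \<open>Quotient topologies\<close>

definition quotient_topology :: "'a topology \<Rightarrow> ('a \<Rightarrow> 'b) \<Rightarrow> 'b topology" where
  "quotient_topology X f =
    topology (\<lambda>U. U \<subseteq> f ` topspace X \<and> openin X {x \<in> topspace X. f x \<in> U})"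

lemma openin_quotient_topology:
  "openin (quotient_topology X f) U \<longleftrightarrow>
    U \<subseteq> f ` topspace X \<and> openin X {x \<in> topspace X. f x \<in> U}"
proof -
  have "istopology (\<lambda>U. U \<subseteq> f ` topspace X \<and> openin X {x \<in> topspace X. f x \<in> U})"
    unfolding istopology_def
  proof (intro conjI allI impI)
    fix S T
    assume "S \<subseteq> f ` topspace X \<and> openin X {x \<in> topspace X. f x \<in> S}"
      and "T \<subseteq> f ` topspace X \<and> openin X {x \<in> topspace X. f x \<in> T}"
    moreover have "{x \<in> topspace X. f x \<in> S \<inter> T} =
        {x \<in> topspace X. f x \<in> S} \<inter> {x \<in> topspace X. f x \<in> T}"
      by auto
    ultimately show "S \<inter> T \<subseteq> f ` topspace X" "openin X {x \<in> topspace X. f x \<in> S \<inter> T}"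
      by (simp_all add: openin_Int le_infI1)
  next
    fix K
    assume K: "\<forall>S\<in>K. S \<subseteq> f ` topspace X \<and> openin X {x \<in> topspace X. f x \<in> S}"
    then show "\<Union> K \<subseteq> f ` topspace X"
      by (simp add: Union_least)
    have "{x \<in> topspace X. f x \<in> \<Union> K} = (\<Union>S\<in>K. {x \<in> topspace X. f x \<in> S})"
      by auto
    moreover have "openin X (\<Union>S\<in>K. {x \<in> topspace X. f x \<in> S})"
      using K by (intro openin_Union) blast
    ultimately show "openin X {x \<in> topspace X. f x \<in> \<Union> K}"
      by simp
  qed
  then show ?thesis
    by (simp add: quotient_topology_def topology_inverse')
qed

lemma topspace_quotient_topology [simp]:
  "topspace (quotient_topology X f) = f ` topspace X"
proof (rule antisym)
  show "topspace (quotient_topology X f) \<subseteq> f ` topspace X"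
    using openin_quotient_topology [of X f "topspace (quotient_topology X f)"] by simp
  have "{x \<in> topspace X. f x \<in> f ` topspace X} = topspace X"
    by auto
  then have "openin (quotient_topology X f) (f ` topspace X)"
    by (simp add: openin_quotient_topology)
  then show "f ` topspace X \<subseteq> topspace (quotient_topology X f)"
    by (rule openin_subset)
qed

lemma quotient_map_quotient_topology: "quotient_map X (quotient_topology X f) f"
  by (simp add: quotient_map_def openin_quotient_topology)


section \<open>Vector bundles and their Stiefel--Whitney classes\<close>

record ('x, 'e) vbundle =
  base_space :: "'x topology"
  total_space :: "'e topology"
  proj :: "'e \<Rightarrow> 'x"
  vadd :: "'e \<Rightarrow> 'e \<Rightarrow> 'e"
  vscale :: "real \<Rightarrow> 'e \<Rightarrow> 'e"

text \<open>
  The fibrewise linear local trivialisations force the operations to turn every fibre into a vector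
  space of dimension \<open>n\<close>.
\<close>

definition real_vector_bundle :: "nat \<Rightarrow> ('x, 'e) vbundle \<Rightarrow> bool" where
  "real_vector_bundle n \<xi> \<longleftrightarrow>
    continuous_map (total_space \<xi>) (base_space \<xi>) (proj \<xi>) \<and>
    (\<forall>x \<in> topspace (base_space \<xi>). \<exists>U \<phi>. openin (base_space \<xi>) U \<and> x \<in> U \<and>
      homeomorphic_map (prod_topology (subtopology (base_space \<xi>) U) (Euclidean_space n))
        (subtopology (total_space \<xi>) {e \<in> topspace (total_space \<xi>). proj \<xi> e \<in> U}) \<phi> \<and>
      (\<forall>y \<in> U. \<forall>u \<in> topspace (Euclidean_space n). proj \<xi> (\<phi> (y, u)) = y \<and>
        (\<forall>v \<in> topspace (Euclidean_space n).
          \<phi> (y, \<lambda>i. u i + v i) = vadd \<xi> (\<phi> (y, u)) (\<phi> (y, v))) \<and>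
        (\<forall>a. \<phi> (y, \<lambda>i. a * u i) = vscale \<xi> a (\<phi> (y, u)))))"

definition nonzero_vectors :: "('x, 'e) vbundle \<Rightarrow> 'e topology" where
  "nonzero_vectors \<xi> = subtopology (total_space \<xi>) {v. vscale \<xi> 0 v \<noteq> v}"

definition projectivization :: "('x, 'e) vbundle \<Rightarrow> 'e set topology" where
  "projectivization \<xi> = quotient_topology (nonzero_vectors \<xi>) (\<lambda>v. range (\<lambda>a. vscale \<xi> a v))"

definition projectivization_proj :: "('x, 'e) vbundle \<Rightarrow> 'e set \<Rightarrow> 'x" where
  "projectivization_proj \<xi> l = the_elem (proj \<xi> ` l)"

text \<open>
  The class in \<open>H\<^sup>1\<close> of the projectivization that classifies the tautological line bundle, i.e.
  the pullback of the generator of \<open>H\<^sup>1\<close> of the infinite projective space. Given an arbitrary (in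
  general discontinuous) choice \<open>s\<close> of a nonzero vector in each line, the representing cocycle
  vanishes on those paths of lines along which the orientation given by \<open>s\<close> at the start is
  transported to the one given by \<open>s\<close> at the end. Changing \<open>s\<close> changes the cocycle by the
  coboundary of a 0-cochain, so the class does not depend on \<open>s\<close>.
\<close>

definition tautological_cocycle :: "('x, 'e) vbundle \<Rightarrow> ('e set \<Rightarrow> 'e) \<Rightarrow> 'e set cochain" where
  "tautological_cocycle \<xi> s = (\<lambda>k \<sigma>.
    if k = 1 \<and> singular_simplex 1 (projectivization \<xi>) \<sigma> \<and>
      \<not> (\<exists>\<tau>. singular_simplex 1 (nonzero_vectors \<xi>) \<tau> \<and>
            (\<forall>x \<in> standard_simplex 1. \<tau> x \<in> \<sigma> x) \<and>
            (\<forall>i \<le> 1. \<exists>a>0.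
              simplicial_vertex i \<tau> = vscale \<xi> a (s (simplicial_vertex i \<sigma>))))
    then 1 else 0)"

definition tautological_class :: "('x, 'e) vbundle \<Rightarrow> 'e set cochain set" where
  "tautological_class \<xi> =
    (\<Union>s \<in> {s. \<forall>l \<in> topspace (projectivization \<xi>). s l \<in> l \<inter> topspace (nonzero_vectors \<xi>)}.
      cohomology_class (projectivization \<xi>) (tautological_cocycle \<xi> s))"

text \<open>
  \<open>w k\<close> is the \<open>k\<close>-th Stiefel--Whitney class of the \<open>n\<close>-dimensional bundle \<open>\<xi>\<close>. We use the
  definition through the projective bundle formula: by the Leray--Hirsch theorem the powers
  \<open>t\<^sup>0, \<dots>, t\<^sup>n\<^sup>-\<^sup>1\<close> of the tautological class form a basis of the cohomology of the
  projectivization over that of the base, and the Stiefel--Whitney classes are the (unique)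
  coefficients in \<open>\<Sum>k\<le>n. w k * t ^ (n - k) = 0\<close>, where \<open>w 0 = 1\<close>.
\<close>

definition stiefel_whitney_classes ::
    "nat \<Rightarrow> ('x, 'e) vbundle \<Rightarrow> (nat \<Rightarrow> 'x cochain set) \<Rightarrow> bool" where
  "stiefel_whitney_classes n \<xi> w \<longleftrightarrow>
    real_vector_bundle n \<xi> \<and>
    (\<forall>k. w k \<in> cohomology k (base_space \<xi>)) \<and>
    w 0 = \<one>\<^bsub>cohomology_ring (base_space \<xi>)\<^esub> \<and>
    (\<forall>k>n. w k = \<zero>\<^bsub>cohomology_ring (base_space \<xi>)\<^esub>) \<and>
    (\<Oplus>\<^bsub>cohomology_ring (projectivization \<xi>)\<^esub> k \<in> {..n}.
        cohomology_pullback (projectivization \<xi>) (projectivization_proj \<xi>) (w k)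
          \<otimes>\<^bsub>cohomology_ring (projectivization \<xi>)\<^esub>
        tautological_class \<xi> [^]\<^bsub>cohomology_ring (projectivization \<xi>)\<^esub> (n - k))
      = \<zero>\<^bsub>cohomology_ring (projectivization \<xi>)\<^esub>"


section \<open>Configuration spaces and their regular bundles\<close>

definition ordered_configurations :: "'a topology \<Rightarrow> nat \<Rightarrow> (nat \<Rightarrow> 'a) topology" where
  "ordered_configurations X n =
    subtopology (product_topology (\<lambda>i. X) {..<n}) {x. inj_on x {..<n}}"

definition configuration_space :: "'a topology \<Rightarrow> nat \<Rightarrow> 'a set topology" where
  "configuration_space X n = quotient_topology (ordered_configurations X n) (\<lambda>x. x ` {..<n})"

text \<open>
  The total space consists of all pairs of a configuration \<open>S\<close> and a real-valued function on
  \<open>S\<close>, topologized as the quotient of the product of the space of ordered configurations with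
  the space of \<open>n\<close>-tuples of values by the symmetric group.
\<close>

definition label_configuration ::
    "nat \<Rightarrow> (nat \<Rightarrow> 'a) \<times> (nat \<Rightarrow> real) \<Rightarrow> 'a set \<times> ('a \<Rightarrow> real)" where
  "label_configuration n = (\<lambda>(x, u). (x ` {..<n}, \<lambda>p \<in> x ` {..<n}. u (inv_into {..<n} x p)))"

definition regular_bundle :: "'a topology \<Rightarrow> nat \<Rightarrow> ('a set, 'a set \<times> ('a \<Rightarrow> real)) vbundle" where
  "regular_bundle X n =
    \<lparr>base_space = configuration_space X n,
     total_space = quotient_topology (prod_topology (ordered_configurations X n) (Euclidean_space n))
       (label_configuration n),
     proj = fst,
     vadd = (\<lambda>(S, f) (T, g). (S, \<lambda>p\<in>S. f p + g p)),
     vscale = (\<lambda>a (S, f). (S, \<lambda>p\<in>S. a * f p))\<rparr>"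

lemma reindex_configuration:
  assumes x: "x \<in> topspace (ordered_configurations X n)"
    and y: "y \<in> topspace (ordered_configurations X n)"
    and eq: "x ` {..<n} = y ` {..<n}"
  obtains \<pi> where "\<pi> permutes {..<n}" "y = (\<lambda>i\<in>{..<n}. x (\<pi> i))"
proof -
  have ix: "inj_on x {..<n}" and iy: "inj_on y {..<n}" and ey: "y \<in> extensional {..<n}"
    using x y by (auto simp: ordered_configurations_def PiE_iff)
  define \<pi> where "\<pi> i = (if i < n then inv_into {..<n} x (y i) else i)" for i
  have bx: "bij_betw (inv_into {..<n} x) (x ` {..<n}) {..<n}"
    by (rule bij_betw_inv_into) (simp add: bij_betw_def ix)
  have "bij_betw (inv_into {..<n} x \<circ> y) {..<n} {..<n}"
    by (rule bij_betw_trans [of y _ "x ` {..<n}"]) (use iy eq bx in \<open>auto simp: bij_betw_def\<close>)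
  then have "bij_betw \<pi> {..<n} {..<n}"
    by (rule bij_betw_cong [THEN iffD1, rotated]) (simp add: \<pi>_def)
  then have "\<pi> permutes {..<n}"
    by (rule bij_imp_permutes) (simp add: \<pi>_def)
  moreover have "x (\<pi> i) = y i" if "i < n" for i
    using that eq by (auto simp: \<pi>_def intro!: f_inv_into_f)
  then have "y = (\<lambda>i\<in>{..<n}. x (\<pi> i))"
    using ey by (auto simp: fun_eq_iff extensional_def)
  ultimately show thesis
    using that by blast
qed

lemma permute_configuration:
  assumes "\<pi> permutes {..<n}"
  shows "(\<lambda>i\<in>{..<n}. x (\<pi> i)) ` {..<n} = x ` {..<n}"
proof -
  have "(\<lambda>i\<in>{..<n}. x (\<pi> i)) ` {..<n} = x ` (\<pi> ` {..<n})"
    by (simp add: image_image)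
  then show ?thesis
    using permutes_image [OF assms] by simp
qed

lemma continuous_map_permute_configuration:
  assumes "\<pi> permutes {..<n}"
  shows "continuous_map (ordered_configurations X n) (ordered_configurations X n)
    (\<lambda>x. \<lambda>i\<in>{..<n}. x (\<pi> i))"
proof -
  have \<pi>: "\<pi> i \<in> {..<n}" if "i \<in> {..<n}" for i
    using that permutes_in_image [OF assms] by blast
  have "continuous_map (ordered_configurations X n) (product_topology (\<lambda>i. X) {..<n})
      (\<lambda>x. \<lambda>i\<in>{..<n}. x (\<pi> i))"
    unfolding continuous_map_componentwise ordered_configurations_def
    using \<pi> by (auto intro!: continuous_map_from_subtopology continuous_map_product_projection)
  moreover have "inj_on (\<lambda>i\<in>{..<n}. x (\<pi> i)) {..<n}" if "inj_on x {..<n}" for x :: "nat \<Rightarrow> 'a"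
    using that permutes_inj_on [OF assms, of "{..<n}"] \<pi>
    by (auto simp: inj_on_def)
  ultimately show ?thesis
    by (auto simp: ordered_configurations_def continuous_map_in_subtopology)
qed

lemma label_configuration_permute:
  assumes \<pi>: "\<pi> permutes {..<n}" and x: "inj_on x {..<n}"
  shows "label_configuration n (\<lambda>i\<in>{..<n}. x (\<pi> i), \<lambda>i. u (\<pi> i)) = label_configuration n (x, u)"
proof -
  let ?y = "\<lambda>i\<in>{..<n}. x (\<pi> i)"
  have im: "?y ` {..<n} = x ` {..<n}"
    by (rule permute_configuration [OF \<pi>])
  have inj: "inj_on ?y {..<n}"
    using x permutes_inj_on [OF \<pi>, of "{..<n}"] permutes_in_image [OF \<pi>]
    by (auto simp: inj_on_def)
  have "u (\<pi> (inv_into {..<n} ?y p)) = u (inv_into {..<n} x p)" if p: "p \<in> x ` {..<n}" for p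
  proof -
    let ?i = "inv_into {..<n} ?y p"
    have "?i \<in> {..<n}" "?y ?i = p"
      using p im by (metis inv_into_into, metis f_inv_into_f)
    then have "\<pi> ?i \<in> {..<n}" "x (\<pi> ?i) = p"
      using permutes_in_image [OF \<pi>] by auto
    then show ?thesis
      using inv_into_f_eq [OF x] by metis
  qed
  then show ?thesis
    unfolding label_configuration_def prod.case im
    by (intro arg_cong2 [where f = Pair] refl restrict_ext)
qed

lemma label_configuration_eqE:
  assumes x: "x \<in> topspace (ordered_configurations X n)" and u: "u \<in> topspace (Euclidean_space n)"
    and y: "y \<in> topspace (ordered_configurations X n)" and v: "v \<in> topspace (Euclidean_space n)"
    and eq: "label_configuration n (x, u) = label_configuration n (y, v)"
  obtains \<pi> where "\<pi> permutes {..<n}" "y = (\<lambda>i\<in>{..<n}. x (\<pi> i))" "v = (\<lambda>i. u (\<pi> i))"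
proof -
  have im: "x ` {..<n} = y ` {..<n}"
    using eq by (simp add: label_configuration_def)
  then obtain \<pi> where \<pi>: "\<pi> permutes {..<n}" "y = (\<lambda>i\<in>{..<n}. x (\<pi> i))"
    using reindex_configuration [OF x y] by blast
  have ix: "inj_on x {..<n}" and iy: "inj_on y {..<n}"
    using x y by (auto simp: ordered_configurations_def)
  have "v i = u (\<pi> i)" for i
  proof (cases "i < n")
    case True
    then have \<pi>i: "\<pi> i < n"
      using permutes_in_image [OF \<pi>(1), of i] by simp
    have "snd (label_configuration n (y, v)) (y i) = v i"
      using True iy by (simp add: label_configuration_def)
    moreover have "snd (label_configuration n (x, u)) (x (\<pi> i)) = u (\<pi> i)"
      using \<pi>i ix by (simp add: label_configuration_def)
    moreover have "y i = x (\<pi> i)"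
      using \<pi> True by simp
    ultimately show ?thesis
      using eq by metis
  next
    case False
    then have "\<pi> i = i"
      using permutes_not_in [OF \<pi>(1)] by simp
    with False show ?thesis
      using u v by (simp add: topspace_Euclidean_space)
  qed
  then show thesis
    using that \<pi> by blast
qed

lemma open_map_quotient_topology:
  assumes sat: "\<And>x y. \<lbrakk>x \<in> topspace X; y \<in> topspace X; f x = f y\<rbrakk> \<Longrightarrow> \<exists>g\<in>G. g x = y"
    and G: "\<And>g. g \<in> G \<Longrightarrow> continuous_map X X g" "\<And>g x. \<lbrakk>g \<in> G; x \<in> topspace X\<rbrakk> \<Longrightarrow> f (g x) = f x"
  shows "open_map X (quotient_topology X f) f"
  unfolding open_map_def
proof (intro allI impI)
  fix W
  assume W: "openin X W"
  have "{x \<in> topspace X. f x \<in> f ` W} = (\<Union>g\<in>G. {x \<in> topspace X. g x \<in> W})"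
  proof (intro equalityI subsetI)
    fix x assume "x \<in> {x \<in> topspace X. f x \<in> f ` W}"
    then obtain y where "x \<in> topspace X" "y \<in> W" "f x = f y" by blast
    then show "x \<in> (\<Union>g\<in>G. {x \<in> topspace X. g x \<in> W})"
      using sat [of x y] openin_subset [OF W] by blast
  next
    fix x assume "x \<in> (\<Union>g\<in>G. {x \<in> topspace X. g x \<in> W})"
    then obtain g where "g \<in> G" "x \<in> topspace X" "g x \<in> W" by blast
    then show "x \<in> {x \<in> topspace X. f x \<in> f ` W}"
      using G(2) [of g x] by (metis (mono_tags, lifting) CollectI image_eqI)
  qed
  moreover have "openin X (\<Union>g\<in>G. {x \<in> topspace X. g x \<in> W})"
    by (intro openin_Union) (use G(1) W openin_continuous_map_preimage in blast)
  ultimately show "openin (quotient_topology X f) (f ` W)"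
    using openin_subset [OF W] by (simp add: openin_quotient_topology image_mono)
qed

lemma open_map_configuration_space:
  fixes X :: "'a topology"
  shows "open_map (ordered_configurations X n) (configuration_space X n) (\<lambda>x. x ` {..<n})"
  unfolding configuration_space_def
proof (rule open_map_quotient_topology [where G = "(\<lambda>\<pi> x. \<lambda>i\<in>{..<n}. x (\<pi> i)) ` {\<pi>. \<pi> permutes {..<n}}"])
  fix x y
  assume "x \<in> topspace (ordered_configurations X n)" "y \<in> topspace (ordered_configurations X n)"
    "x ` {..<n} = y ` {..<n}"
  then obtain \<pi> where "\<pi> permutes {..<n}" "y = (\<lambda>i\<in>{..<n}. x (\<pi> i))"
    by (rule reindex_configuration)
  then show "\<exists>g\<in>(\<lambda>\<pi> x. \<lambda>i\<in>{..<n}. x (\<pi> i)) ` {\<pi>. \<pi> permutes {..<n}}. g x = y"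
    by auto
next
  fix g :: "(nat \<Rightarrow> 'a) \<Rightarrow> nat \<Rightarrow> 'a" and x
  assume "g \<in> (\<lambda>\<pi> x. \<lambda>i\<in>{..<n}. x (\<pi> i)) ` {\<pi>. \<pi> permutes {..<n}}"
  then obtain \<pi> where \<pi>: "\<pi> permutes {..<n}" and g: "g = (\<lambda>x. \<lambda>i\<in>{..<n}. x (\<pi> i))"
    by blast
  show "continuous_map (ordered_configurations X n) (ordered_configurations X n) g"
    unfolding g by (rule continuous_map_permute_configuration [OF \<pi>])
  show "g x ` {..<n} = x ` {..<n}"
    unfolding g by (rule permute_configuration [OF \<pi>])
qed

lemma open_map_label_configuration:
  fixes X :: "'a topology"
  shows "open_map (prod_topology (ordered_configurations X n) (Euclidean_space n))
    (total_space (regular_bundle X n)) (label_configuration n)"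
  unfolding regular_bundle_def vbundle.simps
proof (rule open_map_quotient_topology
    [where G = "(\<lambda>\<pi> (x, u). (\<lambda>i\<in>{..<n}. x (\<pi> i), \<lambda>i. u (\<pi> i))) ` {\<pi>. \<pi> permutes {..<n}}"])
  fix a b
  assume "a \<in> topspace (prod_topology (ordered_configurations X n) (Euclidean_space n))"
    "b \<in> topspace (prod_topology (ordered_configurations X n) (Euclidean_space n))"
    "label_configuration n a = label_configuration n b"
  then obtain \<pi> where "\<pi> permutes {..<n}" "fst b = (\<lambda>i\<in>{..<n}. fst a (\<pi> i))" "snd b = (\<lambda>i. snd a (\<pi> i))"
    using label_configuration_eqE [of "fst a" X n "snd a" "fst b" "snd b"]
    by (auto simp: mem_Times_iff)
  then show "\<exists>g\<in>(\<lambda>\<pi> (x, u). (\<lambda>i\<in>{..<n}. x (\<pi> i), \<lambda>i. u (\<pi> i))) ` {\<pi>. \<pi> permutes {..<n}}. g a = b"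
    by (cases a; cases b) auto
next
  fix g :: "(nat \<Rightarrow> 'a) \<times> (nat \<Rightarrow> real) \<Rightarrow> (nat \<Rightarrow> 'a) \<times> (nat \<Rightarrow> real)"
  assume "g \<in> (\<lambda>\<pi> (x, u). (\<lambda>i\<in>{..<n}. x (\<pi> i), \<lambda>i. u (\<pi> i))) ` {\<pi>. \<pi> permutes {..<n}}"
  then obtain \<pi> where \<pi>: "\<pi> permutes {..<n}"
    and g: "g = (\<lambda>(x, u). (\<lambda>i\<in>{..<n}. x (\<pi> i), \<lambda>i. u (\<pi> i)))"
    by blast
  have "continuous_map (Euclidean_space n) (Euclidean_space n) (\<lambda>u i. u (\<pi> i))"
  proof -
    have "continuous_map (Euclidean_space n) euclideanreal (\<lambda>u. u (\<pi> i))" for i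
      unfolding Euclidean_space_def
      by (intro continuous_map_from_subtopology continuous_map_product_projection) simp
    then have "continuous_map (Euclidean_space n) (powertop_real UNIV) (\<lambda>u i. u (\<pi> i))"
      by (simp add: continuous_map_componentwise_UNIV)
    moreover have "u (\<pi> i) = 0" if "u \<in> topspace (Euclidean_space n)" "i \<ge> n" for u i
      using that permutes_not_in [OF \<pi>, of i] by (simp add: topspace_Euclidean_space)
    ultimately show ?thesis
      by (subst (2) Euclidean_space_def) (auto simp: continuous_map_in_subtopology)
  qed
  then show "continuous_map (prod_topology (ordered_configurations X n) (Euclidean_space n))
      (prod_topology (ordered_configurations X n) (Euclidean_space n)) g"
    unfolding g continuous_map_prod_top
    using continuous_map_permute_configuration [OF \<pi>, of X] by blast
  show "label_configuration n (g a) = label_configuration n a"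
    if "a \<in> topspace (prod_topology (ordered_configurations X n) (Euclidean_space n))" for a
    using that label_configuration_permute [OF \<pi>] by (cases a) (auto simp: g ordered_configurations_def)
qed

lemma Hausdorff_separate_configuration:
  assumes "Hausdorff_space X" and x: "x \<in> topspace (ordered_configurations X n)"
  obtains V where "\<And>i. i < n \<Longrightarrow> openin X (V i)" "\<And>i. i < n \<Longrightarrow> x i \<in> V i"
    "\<And>i j. \<lbrakk>i < n; j < n; i \<noteq> j\<rbrakk> \<Longrightarrow> V i \<inter> V j = {}"
proof -
  have xX: "\<And>i. i < n \<Longrightarrow> x i \<in> topspace X" and inj: "inj_on x {..<n}"
    using x by (auto simp: ordered_configurations_def)
  have "\<exists>U V. openin X U \<and> openin X V \<and> x i \<in> U \<and> x j \<in> V \<and> disjnt U V"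
    if "i < n" "j < n" "i \<noteq> j" for i j
  proof -
    have "x i \<noteq> x j"
      using inj that by (simp add: inj_on_eq_iff)
    then show ?thesis
      using assms(1) xX that unfolding Hausdorff_space_def by simp
  qed
  then obtain U V where UV: "\<And>i j. \<lbrakk>i < n; j < n; i \<noteq> j\<rbrakk> \<Longrightarrow>
      openin X (U i j) \<and> openin X (V i j) \<and> x i \<in> U i j \<and> x j \<in> V i j \<and> disjnt (U i j) (V i j)"
    by metis
  define W where "W i = topspace X \<inter> (\<Inter>j\<in>{..<n} - {i}. U i j \<inter> V j i)" for i
  show thesis
  proof
    show "openin X (W i)" if "i < n" for i
    proof -
      have "openin X (U i j \<inter> V j i)" if "j \<in> {..<n} - {i}" for j
        using that UV[of i j] UV[of j i] \<open>i < n\<close> by auto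
      then have "openin X (\<Inter> (insert (topspace X) ((\<lambda>j. U i j \<inter> V j i) ` ({..<n} - {i}))))"
        by (intro openin_Inter) auto
      then show ?thesis
        by (simp add: W_def)
    qed
    show "x i \<in> W i" if "i < n" for i
      using that xX UV by (auto simp: W_def)
    show "W i \<inter> W j = {}" if "i < n" "j < n" "i \<noteq> j" for i j
    proof -
      have "W i \<subseteq> U i j" "W j \<subseteq> V i j"
        using that by (auto simp: W_def)
      then show ?thesis
        using UV [OF that] by (auto simp: disjnt_def)
    qed
  qed
qed

lemma label_configuration_apply:
  "fst (label_configuration n (x, u)) = x ` {..<n}"
  by (simp add: label_configuration_def)

lemma real_vector_bundle_regular_bundle:
  fixes X :: "'a topology"
  assumes "Hausdorff_space X"
  shows "real_vector_bundle n (regular_bundle X n)"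
proof -
  let ?F = "ordered_configurations X n" and ?R = "Euclidean_space n"
  let ?B = "configuration_space X n" and ?E = "total_space (regular_bundle X n)"
  let ?q = "\<lambda>x :: nat \<Rightarrow> 'a. x ` {..<n}" and ?Q = "label_configuration n :: _ \<Rightarrow> 'a set \<times> ('a \<Rightarrow> real)"
  have E: "?E = quotient_topology (prod_topology ?F ?R) ?Q"
    by (simp add: regular_bundle_def)
  have q: "quotient_map ?F ?B ?q" and Q: "quotient_map (prod_topology ?F ?R) ?E ?Q"
    unfolding configuration_space_def E by (rule quotient_map_quotient_topology)+
  have qc: "continuous_map ?F ?B ?q" and Qc: "continuous_map (prod_topology ?F ?R) ?E ?Q"
    using q Q by (auto simp: quotient_imp_continuous_map)
  have topE: "topspace ?E = ?Q ` (topspace ?F \<times> topspace ?R)"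
    by (simp add: E)
  have "continuous_map (prod_topology ?F ?R) ?B (?q \<circ> fst)"
    by (intro continuous_map_compose [OF continuous_map_fst qc])
  then have "continuous_map (prod_topology ?F ?R) ?B (fst \<circ> ?Q)"
    by (rule continuous_map_eq) (auto simp: label_configuration_def)
  then have proj: "continuous_map ?E ?B fst"
    by (rule continuous_compose_quotient_map [OF Q])
  have triv: "\<exists>U \<phi>. openin ?B U \<and> S \<in> U \<and>
      homeomorphic_map (prod_topology (subtopology ?B U) ?R)
        (subtopology ?E {e \<in> topspace ?E. fst e \<in> U}) \<phi> \<and>
      (\<forall>T \<in> U. \<forall>u \<in> topspace ?R. fst (\<phi> (T, u)) = T \<and>
        (\<forall>v \<in> topspace ?R. \<phi> (T, \<lambda>i. u i + v i) =
          vadd (regular_bundle X n) (\<phi> (T, u)) (\<phi> (T, v))) \<and>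
        (\<forall>a. \<phi> (T, \<lambda>i. a * u i) = vscale (regular_bundle X n) a (\<phi> (T, u))))"
    if S: "S \<in> topspace ?B" for S
  proof -
    obtain x0 where x0: "x0 \<in> topspace ?F" "S = ?q x0"
      using S by (auto simp: configuration_space_def)
    obtain V where V: "\<And>i. i < n \<Longrightarrow> openin X (V i)" "\<And>i. i < n \<Longrightarrow> x0 i \<in> V i"
      "\<And>i j. \<lbrakk>i < n; j < n; i \<noteq> j\<rbrakk> \<Longrightarrow> V i \<inter> V j = {}"
      using Hausdorff_separate_configuration [OF assms x0(1)] by metis
    define W where "W = topspace ?F \<inter> {x. \<forall>i<n. x i \<in> V i}"
    define U where "U = ?q ` W"
    have "openin (product_topology (\<lambda>i. X) {..<n}) (PiE {..<n} V)"
      using V(1) by (simp add: openin_PiE_gen)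
    then have "openin ?F (PiE {..<n} V \<inter> {x. inj_on x {..<n}})"
      unfolding ordered_configurations_def by (rule openin_subtopology_Int)
    moreover have "PiE {..<n} V \<inter> {x. inj_on x {..<n}} = W"
      using openin_subset [OF V(1)] by (auto simp: W_def ordered_configurations_def PiE_iff)
    ultimately have W: "openin ?F W"
      by simp
    have U: "openin ?B U"
      using open_map_configuration_space W unfolding open_map_def U_def by blast
    have rigid: "\<pi> = id" if \<pi>: "\<pi> permutes {..<n}" and "x \<in> W" "(\<lambda>i\<in>{..<n}. x (\<pi> i)) \<in> W" for \<pi> x
    proof
      fix i
      show "\<pi> i = id i"
      proof (cases "i < n")
        case True
        then have "\<pi> i < n"
          using permutes_in_image [OF \<pi>, of i] by simp
        then have "x (\<pi> i) \<in> V i \<inter> V (\<pi> i)"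
          using that True by (auto simp: W_def)
        then show ?thesis
          using V(3) [OF True \<open>\<pi> i < n\<close>] by (cases "i = \<pi> i") auto
      qed (use permutes_not_in [OF \<pi>, of i] in auto)
    qed
    have WF: "W \<subseteq> topspace ?F"
      by (auto simp: W_def)
    have ext: "(\<lambda>i\<in>{..<n}. x i) = x" if "x \<in> topspace ?F" for x
      using that by (auto simp: ordered_configurations_def PiE_iff extensional_restrict)
    have injq: "inj_on ?q W"
    proof (rule inj_onI)
      fix x y assume xy: "x \<in> W" "y \<in> W" "?q x = ?q y"
      then obtain \<pi> where \<pi>: "\<pi> permutes {..<n}" "y = (\<lambda>i\<in>{..<n}. x (\<pi> i))"
        using reindex_configuration [of x X n y] WF by blast
      then have "\<pi> = id"
        using rigid [OF \<pi>(1), of x] xy by simp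
      then show "x = y"
        using \<pi>(2) ext [of x] xy WF by auto
    qed
    have injQ: "inj_on ?Q (W \<times> topspace ?R)"
    proof (rule inj_onI)
      fix a b assume ab: "a \<in> W \<times> topspace ?R" "b \<in> W \<times> topspace ?R" "?Q a = ?Q b"
      obtain x u y v where [simp]: "a = (x, u)" "b = (y, v)" by (metis surj_pair)
      obtain \<pi> where \<pi>: "\<pi> permutes {..<n}" "y = (\<lambda>i\<in>{..<n}. x (\<pi> i))" "v = (\<lambda>i. u (\<pi> i))"
        using label_configuration_eqE [of x X n u y v] ab WF by auto
      then have "\<pi> = id"
        using rigid [OF \<pi>(1), of x] ab by simp
      then show "a = b"
        using \<pi> ext [of x] ab WF by auto
    qed
    have homq: "homeomorphic_map (subtopology ?F W) (subtopology ?B U) ?q"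
    proof (rule bijective_open_imp_homeomorphic_map)
      show "continuous_map (subtopology ?F W) (subtopology ?B U) ?q"
        using qc by (auto simp: continuous_map_in_subtopology U_def continuous_map_from_subtopology)
      show "open_map (subtopology ?F W) (subtopology ?B U) ?q"
        unfolding open_map_def openin_open_subtopology [OF W] openin_open_subtopology [OF U]
        using open_map_configuration_space [of X n] by (auto simp: open_map_def U_def)
      show "?q ` topspace (subtopology ?F W) = topspace (subtopology ?B U)"
        using WF openin_subset [OF U] by (simp add: U_def Int_absorb1)
      show "inj_on ?q (topspace (subtopology ?F W))"
        using injq WF by (simp add: Int_absorb1)
    qed
    define E' where "E' = {e \<in> topspace ?E. fst e \<in> U}"
    have E': "openin ?E E'"
      unfolding E'_def by (rule openin_continuous_map_preimage [OF proj U])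
    have imQ: "?Q ` (W \<times> topspace ?R) = E'"
    proof (intro equalityI subsetI)
      fix e assume "e \<in> ?Q ` (W \<times> topspace ?R)"
      then show "e \<in> E'"
        using WF by (auto simp: E'_def topE U_def label_configuration_apply)
    next
      fix e assume "e \<in> E'"
      then obtain x u y where e: "e = ?Q (x, u)" "x \<in> topspace ?F" "u \<in> topspace ?R"
          "y \<in> W" "?q x = ?q y"
        by (auto simp: E'_def topE U_def label_configuration_apply)
      then obtain \<pi> where \<pi>: "\<pi> permutes {..<n}" "y = (\<lambda>i\<in>{..<n}. x (\<pi> i))"
        using reindex_configuration [of x X n y] WF by blast
      have "e = ?Q (y, \<lambda>i. u (\<pi> i))"
        using label_configuration_permute [OF \<pi>(1), of x u] e \<pi>
        by (auto simp: ordered_configurations_def)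
      moreover have "(\<lambda>i. u (\<pi> i)) \<in> topspace ?R"
        using e(3) permutes_not_in [OF \<pi>(1)] by (auto simp: topspace_Euclidean_space)
      ultimately show "e \<in> ?Q ` (W \<times> topspace ?R)"
        using e by blast
    qed
    have WR: "openin (prod_topology ?F ?R) (W \<times> topspace ?R)"
      using W by (simp add: openin_prod_Times_iff)
    have "homeomorphic_map (subtopology (prod_topology ?F ?R) (W \<times> topspace ?R))
        (subtopology ?E E') ?Q"
    proof (rule bijective_open_imp_homeomorphic_map)
      have topW: "topspace (subtopology (prod_topology ?F ?R) (W \<times> topspace ?R)) = W \<times> topspace ?R"
        using WF by auto
      show "continuous_map (subtopology (prod_topology ?F ?R) (W \<times> topspace ?R)) (subtopology ?E E') ?Q"
        unfolding continuous_map_in_subtopology topW using Qc imQ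
        by (auto simp: continuous_map_from_subtopology)
      show "open_map (subtopology (prod_topology ?F ?R) (W \<times> topspace ?R)) (subtopology ?E E') ?Q"
        unfolding open_map_def openin_open_subtopology [OF WR] openin_open_subtopology [OF E']
        using open_map_label_configuration [of X n] imQ by (auto simp: open_map_def)
      show "?Q ` topspace (subtopology (prod_topology ?F ?R) (W \<times> topspace ?R)) =
          topspace (subtopology ?E E')"
        unfolding topW imQ using openin_subset [OF E'] by (simp add: Int_absorb1)
      show "inj_on ?Q (topspace (subtopology (prod_topology ?F ?R) (W \<times> topspace ?R)))"
        unfolding topW by (rule injQ)
    qed
    then have homQ: "homeomorphic_map (prod_topology (subtopology ?F W) ?R) (subtopology ?E E') ?Q"
      by (simp add: prod_topology_subtopology)
    obtain s where s: "homeomorphic_maps (subtopology ?F W) (subtopology ?B U) ?q s"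
      using homq by (meson homeomorphic_map_maps)
    then have "homeomorphic_maps (subtopology ?B U) (subtopology ?F W) s ?q"
      by (rule homeomorphic_maps_sym [THEN iffD1])
    then have "homeomorphic_maps (prod_topology (subtopology ?B U) ?R) (prod_topology (subtopology ?F W) ?R)
        (\<lambda>(T, u). (s T, u)) (\<lambda>(x, u). (?q x, u))"
      unfolding homeomorphic_maps_prod by (auto simp: homeomorphic_maps_def)
    then have "homeomorphic_map (prod_topology (subtopology ?B U) ?R)
        (prod_topology (subtopology ?F W) ?R) (\<lambda>(T, u). (s T, u))"
      by (meson homeomorphic_map_maps)
    then have hom: "homeomorphic_map (prod_topology (subtopology ?B U) ?R) (subtopology ?E E')
        (?Q \<circ> (\<lambda>(T, u). (s T, u)))"
      using homQ by (rule homeomorphic_map_compose)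
    have s': "?q (s T) = T" if "T \<in> U" for T
      using s that openin_subset [OF U]
      unfolding homeomorphic_maps_def topspace_subtopology by blast
    have "S \<in> U"
      using x0 V(2) by (auto simp: U_def W_def)
    moreover have "\<forall>T \<in> U. \<forall>u \<in> topspace ?R. fst ((?Q \<circ> (\<lambda>(T, u). (s T, u))) (T, u)) = T \<and>
        (\<forall>v \<in> topspace ?R. (?Q \<circ> (\<lambda>(T, u). (s T, u))) (T, \<lambda>i. u i + v i) =
          vadd (regular_bundle X n) ((?Q \<circ> (\<lambda>(T, u). (s T, u))) (T, u)) ((?Q \<circ> (\<lambda>(T, u). (s T, u))) (T, v))) \<and>
        (\<forall>a. (?Q \<circ> (\<lambda>(T, u). (s T, u))) (T, \<lambda>i. a * u i) =
          vscale (regular_bundle X n) a ((?Q \<circ> (\<lambda>(T, u). (s T, u))) (T, u)))"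
      using s' by (auto simp: label_configuration_def regular_bundle_def fun_eq_iff)
    ultimately show ?thesis
      using U hom unfolding E'_def by blast
  qed
  have bs: "base_space (regular_bundle X n) = ?B" "proj (regular_bundle X n) = fst"
    by (simp_all add: regular_bundle_def)
  show ?thesis
    unfolding real_vector_bundle_def bs using proj triv by blast
qed


section \<open>Chord diagrams\<close>

definition chord_diagram :: "nat \<Rightarrow> real set set \<Rightarrow> bool" where
  "chord_diagram n D \<longleftrightarrow> finite D \<and> card D = n \<and> (\<forall>c\<in>D. \<exists>a b. a \<noteq> b \<and> c = {a, b})"

definition respects_chords :: "real set set \<Rightarrow> (real \<Rightarrow> real) \<Rightarrow> bool" where
  "respects_chords D f \<longleftrightarrow> (\<forall>a b. {a, b} \<in> D \<longrightarrow> f a = f b)"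

definition continuous_functions :: "(real \<Rightarrow> real) set" where
  "continuous_functions = {f. continuous_on UNIV f}"

interpretation func: vector_space "\<lambda>(a::real) (f :: real \<Rightarrow> real) x. a * f x"
  by unfold_locales (simp_all add: fun_eq_iff distrib_left distrib_right)

text \<open>The library's \<open>dim\<close> is \<open>0\<close> for infinite-dimensional spaces.\<close>

definition has_dimension :: "(real \<Rightarrow> real) set \<Rightarrow> nat \<Rightarrow> bool" where
  "has_dimension F N \<longleftrightarrow> (\<exists>B. finite B \<and> card B = N \<and> func.independent B \<and> func.span B = F)"

text \<open>The residue classes of the members of \<open>B\<close> form a basis of the quotient \<open>V / W\<close>.\<close>

definition has_codimension :: "(real \<Rightarrow> real) set \<Rightarrow> (real \<Rightarrow> real) set \<Rightarrow> nat \<Rightarrow> bool" where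
  "has_codimension V W m \<longleftrightarrow>
    func.subspace V \<and> func.subspace W \<and> W \<subseteq> V \<and>
    (\<exists>B. finite B \<and> card B = m \<and> B \<subseteq> V \<and>
      (\<forall>f\<in>V. \<exists>!c. c \<in> extensional B \<and> (\<lambda>x. f x - (\<Sum>b\<in>B. c b * b x)) \<in> W))"

definition independent_chord_diagram :: "nat \<Rightarrow> real set set \<Rightarrow> bool" where
  "independent_chord_diagram n D \<longleftrightarrow>
    chord_diagram n D \<and>
    has_codimension continuous_functions {f \<in> continuous_functions. respects_chords D f} n"

end

(*
  For a configuration S of n points of the plane, the chords are the edges of a bipartite graph whose
  left and right vertices are the columns and rows of S after a continuous change of coordinates that
  depends on S. For suitable coordinates this graph has no cycles, hence the chord diagram is
  independent. A basis of F then gives a map from R^N to the fibre of the regular bundle over S, and r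
  mutually orthogonal vectors in its kernel are what is needed.

  If there are none, consider the space of all S together with r vectors u_i, up to signs, with classes
  x_i in degree one. It is covered by the open sets where u_i is not in the kernel, on which the
  polynomial P(x_i) = sum w_j x_i^(n-j) vanishes, and by those where u_i and u_j are not orthogonal, on
  which x_i + x_j vanishes. So the product of all P(x_i) and all x_i + x_j is zero. Modulo x_i^N = 0
  its coefficients are determinants of Stiefel--Whitney classes, one of which is the Hankel
  determinant of the w_{n-N+1+i+j}. The classes w_k with k > 0 have square zero: the same argument
  with the polynomials of degree less than n in one complex variable, whose real and imaginary parts do
  not both vanish on S, gives P(t)^2 = 0. In characteristic two the Hankel determinant therefore
  reduces to the product of its diagonal entries, which is the product of the theorem.
*)
theory Submission
  imports Defs "HOL-Analysis.Abstract_Topological_Spaces"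
begin

text \<open>The cover argument takes place on a space of configurations with lines, while the
  Stiefel--Whitney classes are given by a relation on a projectivization; the two have to be brought
  together. For the former no quotient by signs is formed: its cohomology is computed by the
  cochains on tuples of nonzero vectors that are invariant under sign changes, and there a class of
  degree one is the coboundary of a sign function that is not itself invariant. For the latter,
  simplices are lifted to nonzero vectors, which exhibits the tautological class in the same form.
  Classes are multiplied as cocycles that vanish on open sets, so subdivision into small simplices
  takes the place of relative cohomology. Coefficients are compared by a Gysin argument with
  cochains, one line after the other.

  The Hankel determinant is the coefficient of the monomial with exponents N - 1 - i, which requires
  r \<le> N; for r > N the last factor of the product has degree above n. Orthogonality of the
  vectors brings in the Vandermonde product of the x_i + x_j, and this product is what turns the
  coefficients into determinants.\<close>

declare add_bit_eq_xor [simp del] mult_bit_eq_and [simp del]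

lemma bit_add_self [simp]: "(a :: bit) + a = 0"
  by (cases a) simp_all

section \<open>Vertex operators on singular simplices\<close>

text \<open>The affine map that sends vertex j to vertex \<open>l j\<close>: coordinate i of the
  image collects the weights of all vertices sent to i. Faces, the two halves of the cup product and
  the reversal of vertices are all of this form, so their identities become identities between index
  functions.\<close>

definition vertex_map :: "nat \<Rightarrow> (nat \<Rightarrow> nat) \<Rightarrow> (nat \<Rightarrow> real) \<Rightarrow> nat \<Rightarrow> real" where
  "vertex_map m l x = (\<lambda>i. \<Sum>j\<le>m. if l j = i then x j else 0)"

definition simplex_act :: "nat \<Rightarrow> (nat \<Rightarrow> nat) \<Rightarrow> ((nat \<Rightarrow> real) \<Rightarrow> 'a) \<Rightarrow> (nat \<Rightarrow> real) \<Rightarrow> 'a" where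
  "simplex_act m l \<sigma> = restrict (\<sigma> \<circ> vertex_map m l) (standard_simplex m)"

definition skip :: "nat \<Rightarrow> nat \<Rightarrow> nat" where
  "skip i j = (if j < i then j else Suc j)"

lemma vertex_map_in_simplex:
  assumes "l ` {..m} \<subseteq> {..k}" "x \<in> standard_simplex m"
  shows "vertex_map m l x \<in> standard_simplex k"
proof -
  have x: "\<And>i. 0 \<le> x i" "sum x {..m} = 1"
    using assms by (auto simp: standard_simplex_def)
  have "(\<Sum>i\<le>k. vertex_map m l x i) = (\<Sum>j\<le>m. \<Sum>i\<le>k. if l j = i then x j else 0)"
    unfolding vertex_map_def by (rule sum.swap)
  also have "\<dots> = (\<Sum>j\<le>m. x j)"
    using assms(1) by (intro sum.cong) auto
  finally have "(\<Sum>i\<le>k. vertex_map m l x i) = 1"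
    using x by simp
  moreover have "0 \<le> vertex_map m l x i" for i
    unfolding vertex_map_def using x by (intro sum_nonneg) auto
  moreover have "vertex_map m l x i \<le> 1" for i
  proof -
    have "vertex_map m l x i \<le> sum x {..m}"
      unfolding vertex_map_def using x by (intro sum_mono) auto
    with x show ?thesis by simp
  qed
  moreover have "vertex_map m l x i = 0" if "i > k" for i
    unfolding vertex_map_def using assms(1) that by (intro sum.neutral) fastforce
  ultimately show ?thesis
    by (simp add: standard_simplex_def)
qed

lemma continuous_map_vertex_map:
  "continuous_map (powertop_real UNIV) (powertop_real UNIV) (vertex_map m l)"
  unfolding vertex_map_def continuous_map_componentwise_UNIV
proof
  fix i
  have "continuous_map (powertop_real UNIV) euclideanreal (\<lambda>x. if l j = i then x j else 0)" for j
    by (cases "l j = i") (auto intro: continuous_map_product_projection)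
  then show "continuous_map (powertop_real UNIV) euclideanreal (\<lambda>x. \<Sum>j\<le>m. if l j = i then x j else 0)"
    by (intro continuous_map_sum) auto
qed

lemma continuous_map_vertex_map_simplex:
  assumes "l ` {..m} \<subseteq> {..k}"
  shows "continuous_map (subtopology (powertop_real UNIV) (standard_simplex m))
           (subtopology (powertop_real UNIV) (standard_simplex k)) (vertex_map m l)"
  using vertex_map_in_simplex [OF assms] continuous_map_vertex_map
  by (auto simp: continuous_map_in_subtopology continuous_map_from_subtopology)

lemma singular_simplex_simplex_act:
  assumes "singular_simplex k X \<sigma>" "l ` {..m} \<subseteq> {..k}"
  shows "singular_simplex m X (simplex_act m l \<sigma>)"
  using assms continuous_map_compose [OF continuous_map_vertex_map_simplex [OF assms(2)]]
  by (auto simp: singular_simplex_def simplex_act_def)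

lemma vertex_map_compose:
  assumes "l' ` {..p} \<subseteq> {..m}"
  shows "vertex_map m l (vertex_map p l' x) = vertex_map p (l \<circ> l') x"
proof
  fix i
  have "vertex_map m l (vertex_map p l' x) i
      = (\<Sum>j\<le>m. \<Sum>j'\<le>p. if l j = i \<and> l' j' = j then x j' else 0)"
    unfolding vertex_map_def by (intro sum.cong) auto
  also have "\<dots> = (\<Sum>j'\<le>p. \<Sum>j\<le>m. if l j = i \<and> l' j' = j then x j' else 0)"
    by (rule sum.swap)
  also have "\<dots> = (\<Sum>j'\<le>p. \<Sum>j\<le>m. if j = l' j' then (if l (l' j') = i then x j' else 0) else 0)"
    by (intro sum.cong) auto
  also have "\<dots> = vertex_map p (l \<circ> l') x i"
    unfolding vertex_map_def using assms by (intro sum.cong) auto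
  finally show "vertex_map m l (vertex_map p l' x) i = vertex_map p (l \<circ> l') x i" .
qed

text \<open>The action is contravariant. Together with \<open>simplex_act_cong\<close> this reduces
  every simplicial identity below to a comparison of functions on an initial segment of the
  naturals.\<close>

lemma simplex_act_compose:
  assumes "l' ` {..p} \<subseteq> {..m}"
  shows "simplex_act p l' (simplex_act m l \<sigma>) = simplex_act p (l \<circ> l') \<sigma>"
  using vertex_map_in_simplex [OF assms] vertex_map_compose [OF assms, of l]
  by (auto simp: simplex_act_def intro!: restrict_ext)

lemma simplex_act_cong:
  assumes "\<And>j. j \<le> m \<Longrightarrow> l j = l' j"
  shows "simplex_act m l \<sigma> = simplex_act m l' \<sigma>"
  using assms by (simp add: simplex_act_def vertex_map_def comp_def)

lemma simplex_map_simplex_act: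
  assumes "l ` {..m} \<subseteq> {..k}"
  shows "simplex_map m g (simplex_act m l \<sigma>) = simplex_act m l (simplex_map k g \<sigma>)"
  using vertex_map_in_simplex [OF assms]
  by (auto simp: simplex_act_def simplex_map_def fun_eq_iff)

lemma vertex_map_id:
  assumes "x \<in> standard_simplex m"
  shows "vertex_map m (\<lambda>j. j) x = x"
  using assms by (auto simp: vertex_map_def standard_simplex_def fun_eq_iff)

lemma simplex_act_id:
  assumes "singular_simplex k X \<sigma>"
  shows "simplex_act k (\<lambda>j. j) \<sigma> = \<sigma>"
  using assms by (auto simp: simplex_act_def vertex_map_id singular_simplex_def fun_eq_iff extensional_def)

lemma front_face_eq: "front_face p \<sigma> = simplex_act p (\<lambda>j. j) \<sigma>"
  by (auto simp: front_face_def simplex_act_def vertex_map_id fun_eq_iff)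

lemma back_face_eq: "back_face p q \<sigma> = simplex_act q (\<lambda>j. p + j) \<sigma>"
proof -
  have "vertex_map q ((+) p) x = (\<lambda>i. if i < p then 0 else x (i - p))" if "x \<in> standard_simplex q" for x
  proof
    fix i
    have *: "(\<Sum>j\<le>q. if p + j = i then x j else 0) = (\<Sum>j\<le>q. if j = i - p then x j else 0)" if "\<not> i < p"
      using that by (intro sum.cong) auto
    show "vertex_map q ((+) p) x i = (if i < p then 0 else x (i - p))"
      using that * by (auto simp: vertex_map_def standard_simplex_def intro!: sum.neutral)
  qed
  then show ?thesis
    by (auto simp: back_face_def simplex_act_def intro!: restrict_ext)
qed

lemma singular_face_eq:
  assumes "1 \<le> k" "i \<le> k"
  shows "singular_face k i \<sigma> = simplex_act (k - 1) (skip i) \<sigma>"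
proof -
  have "vertex_map (k - 1) (skip i) x = simplical_face i x" if x: "x \<in> standard_simplex (k - 1)" for x
  proof
    fix a
    have x0: "x j = 0" if "j > k - 1" for j
      using x that by (auto simp: standard_simplex_def)
    consider "a < i" | "a = i" | "a > i" by linarith
    then show "vertex_map (k - 1) (skip i) x a = simplical_face i x a"
    proof cases
      case 1
      then have "skip i j = a \<longleftrightarrow> j = a" for j
        by (auto simp: skip_def)
      with 1 x0 show ?thesis by (auto simp: vertex_map_def simplical_face_def)
    next
      case 2
      then have "skip i j \<noteq> a" for j
        by (auto simp: skip_def)
      with 2 show ?thesis by (auto simp: vertex_map_def simplical_face_def)
    next
      case 3
      then have "skip i j = a \<longleftrightarrow> j = a - 1" for j
        by (auto simp: skip_def)
      with 3 x0 show ?thesis by (auto simp: vertex_map_def simplical_face_def)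
    qed
  qed
  then show ?thesis
    using assms by (auto simp: singular_face_def simplex_act_def intro!: restrict_ext)
qed

lemma skip_image: "i \<le> Suc k \<Longrightarrow> skip i ` {..k} \<subseteq> {..Suc k}"
  by (auto simp: skip_def)

section \<open>Invariant cochains\<close>

text \<open>
  The invariant cochains of a free action compute the cohomology of the orbit space, but no
  quotient has to be formed. The set \<open>G\<close> consists of generators: it need not be closed under
  composition.
\<close>

definition acts_on :: "'a topology \<Rightarrow> ('a \<Rightarrow> 'a) set \<Rightarrow> bool" where
  "acts_on X G \<longleftrightarrow> (\<forall>g\<in>G. continuous_map X X g)"

definition invariant_cochain :: "'a topology \<Rightarrow> ('a \<Rightarrow> 'a) set \<Rightarrow> 'a cochain \<Rightarrow> bool" where
  "invariant_cochain X G c \<longleftrightarrow>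
    (\<forall>g\<in>G. \<forall>k \<sigma>. singular_simplex k X \<sigma> \<longrightarrow> c k (simplex_map k g \<sigma>) = c k \<sigma>)"

definition inv_cochains :: "'a topology \<Rightarrow> ('a \<Rightarrow> 'a) set \<Rightarrow> 'a cochain set" where
  "inv_cochains X G = {c \<in> carrier (cochain_ring X). invariant_cochain X G c}"

definition inv_cocycles :: "'a topology \<Rightarrow> ('a \<Rightarrow> 'a) set \<Rightarrow> 'a cochain set" where
  "inv_cocycles X G = {c \<in> inv_cochains X G. coboundary X c = 0}"

definition inv_coboundaries :: "'a topology \<Rightarrow> ('a \<Rightarrow> 'a) set \<Rightarrow> 'a cochain set" where
  "inv_coboundaries X G = coboundary X ` inv_cochains X G"

definition cup :: "'a topology \<Rightarrow> 'a cochain \<Rightarrow> 'a cochain \<Rightarrow> 'a cochain" where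
  "cup X a b = (\<lambda>k \<sigma>. if singular_simplex k X \<sigma> then
     \<Sum>p\<le>k. a p (simplex_act p (\<lambda>j. j) \<sigma>) * b (k - p) (simplex_act (k - p) (\<lambda>j. p + j) \<sigma>) else 0)"

definition unit_cochain :: "'a topology \<Rightarrow> 'a cochain" where
  "unit_cochain X = (\<lambda>k \<sigma>. if k = 0 \<and> singular_simplex 0 X \<sigma> then 1 else 0)"

lemma cochain_ring_simps:
  "monoid.mult (cochain_ring X) = cup X" "one (cochain_ring X) = unit_cochain X"
  "ring.zero (cochain_ring X) = 0" "add (cochain_ring X) = (+)"
  by (auto simp: cochain_ring_def cup_def fun_eq_iff front_face_eq back_face_eq unit_cochain_def)

lemma inv_cochains_iff:
  "c \<in> inv_cochains X G \<longleftrightarrow> (\<forall>k \<sigma>. \<not> singular_simplex k X \<sigma> \<longrightarrow> c k \<sigma> = 0) \<and>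
     finite {k. c k \<noteq> 0} \<and> invariant_cochain X G c"
  by (auto simp: inv_cochains_def cochain_ring_def)

lemma coboundary_eq:
  "coboundary X c = (\<lambda>k \<sigma>. if k \<noteq> 0 \<and> singular_simplex k X \<sigma>
     then \<Sum>i\<le>k. c (k - 1) (simplex_act (k - 1) (skip i) \<sigma>) else 0)"
  by (auto simp: coboundary_def fun_eq_iff singular_face_eq)

lemma cochain_add_self [simp]: "(c :: 'a cochain) + c = 0"
  by (auto simp: fun_eq_iff)

lemma coboundary_add: "coboundary X (a + b) = coboundary X a + coboundary X b"
  by (intro ext) (simp add: coboundary_def sum.distrib)

lemma coboundary_0 [simp]: "coboundary X 0 = 0"
  by (auto simp: coboundary_def fun_eq_iff)

section \<open>The cup product, the Leibniz rule and the square of the coboundary\<close>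

lemma cup_add_left: "cup X (a + b) c = cup X a c + cup X b c"
  by (intro ext) (simp add: cup_def sum.distrib distrib_right)

lemma cup_add_right: "cup X a (b + c) = cup X a b + cup X a c"
  by (intro ext) (simp add: cup_def sum.distrib distrib_left)

lemma cup_0 [simp]: "cup X 0 a = 0" "cup X a 0 = 0"
  by (auto simp: cup_def fun_eq_iff)

lemma cup_assoc: "cup X (cup X a b) c = cup X a (cup X b c)"
proof (intro ext)
  fix k and \<sigma> :: "(nat \<Rightarrow> real) \<Rightarrow> 'a"
  show "cup X (cup X a b) c k \<sigma> = cup X a (cup X b c) k \<sigma>"
  proof (cases "singular_simplex k X \<sigma>")
    case True
    let ?A = "\<lambda>p. a p (simplex_act p (\<lambda>j. j) \<sigma>)"
    let ?B = "\<lambda>p q. b q (simplex_act q (\<lambda>j. p + j) \<sigma>)"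
    let ?C = "\<lambda>p. c (k - p) (simplex_act (k - p) (\<lambda>j. p + j) \<sigma>)"
    have "cup X (cup X a b) c k \<sigma> = (\<Sum>p\<le>k. (\<Sum>q\<le>p. ?A q * ?B q (p - q)) * ?C p)"
    proof -
      have "cup X a b p (simplex_act p (\<lambda>j. j) \<sigma>) = (\<Sum>q\<le>p. ?A q * ?B q (p - q))" if "p \<le> k" for p
      proof -
        have "singular_simplex p X (simplex_act p (\<lambda>j. j) \<sigma>)"
          using True that by (intro singular_simplex_simplex_act) auto
        moreover have "simplex_act q (\<lambda>j. j) (simplex_act p (\<lambda>j. j) \<sigma>) = simplex_act q (\<lambda>j. j) \<sigma>"
          "simplex_act (p - q) (\<lambda>j. q + j) (simplex_act p (\<lambda>j. j) \<sigma>) = simplex_act (p - q) (\<lambda>j. q + j) \<sigma>"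
          if "q \<le> p" for q
          using that by (subst simplex_act_compose; auto simp: comp_def)+
        ultimately show ?thesis
          by (auto simp: cup_def intro!: sum.cong)
      qed
      then show ?thesis
        using True unfolding cup_def [of X "cup X a b" c] by (auto intro!: sum.cong)
    qed
    also have "\<dots> = (\<Sum>p\<le>k. \<Sum>q\<le>p. ?A q * ?B q (p - q) * ?C p)"
      by (simp add: sum_distrib_right)
    also have "\<dots> = (\<Sum>(p,q) \<in> (SIGMA p:{..k}. {..p}). ?A q * ?B q (p - q) * ?C p)"
      by (rule sum.Sigma) auto
    \<comment> \<open>Both bracketings are sums over two cut points. The pair of positions q \<le> p
      is replaced here by the lengths q and r = p - q of the first two pieces.\<close>
    also have "\<dots> = (\<Sum>(q,r) \<in> (SIGMA q:{..k}. {..k - q}). ?A q * ?B q r * ?C (q + r))"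
      by (rule sum.reindex_bij_witness [where i = "\<lambda>(q,r). (q + r, q)" and j = "\<lambda>(p,q). (q, p - q)"]) auto
    also have "\<dots> = (\<Sum>q\<le>k. \<Sum>r\<le>k - q. ?A q * ?B q r * ?C (q + r))"
      by (rule sum.Sigma [symmetric]) auto
    also have "\<dots> = (\<Sum>q\<le>k. ?A q * (\<Sum>r\<le>k - q. ?B q r * ?C (q + r)))"
      by (simp add: sum_distrib_left mult.assoc)
    also have "\<dots> = cup X a (cup X b c) k \<sigma>"
    proof -
      have "cup X b c (k - q) (simplex_act (k - q) (\<lambda>j. q + j) \<sigma>) = (\<Sum>r\<le>k - q. ?B q r * ?C (q + r))"
        if "q \<le> k" for q
      proof -
        have "singular_simplex (k - q) X (simplex_act (k - q) (\<lambda>j. q + j) \<sigma>)"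
          using True that by (intro singular_simplex_simplex_act) auto
        moreover have "simplex_act r (\<lambda>j. j) (simplex_act (k - q) (\<lambda>j. q + j) \<sigma>) = simplex_act r (\<lambda>j. q + j) \<sigma>"
          "simplex_act (k - q - r) (\<lambda>j. r + j) (simplex_act (k - q) (\<lambda>j. q + j) \<sigma>)
            = simplex_act (k - (q + r)) (\<lambda>j. q + r + j) \<sigma>"
          if "r \<le> k - q" for r
          using that by (subst simplex_act_compose; auto simp: comp_def add.assoc intro: simplex_act_cong)+
        ultimately show ?thesis
          by (auto simp: cup_def intro!: sum.cong)
      qed
      then show ?thesis
        using True unfolding cup_def [of X a "cup X b c"] by (auto intro!: sum.cong)
    qed
    finally show ?thesis .
  qed (simp add: cup_def)
qed

text \<open>For a fixed cut p, deleting a vertex i \<le> p affects the front factor and deleting one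
  with i > p the back factor. The right hand side contains two further terms: the last face of the
  front factor of dimension p + 1 and the zeroth face of the back factor of dimension n - p + 1.
  Both are the product of the first p + 1 with the last n - p + 1 vertices, and they cancel in
  characteristic two.\<close>

lemma coboundary_cup:
  "coboundary X (cup X a b) = cup X (coboundary X a) b + cup X a (coboundary X b)"
proof (intro ext)
  have [simp]: "(+) (Suc p) = (\<lambda>j. Suc (p + j))" for p :: nat
    by auto
  fix k and \<sigma> :: "(nat \<Rightarrow> real) \<Rightarrow> 'a"
  show "coboundary X (cup X a b) k \<sigma> = (cup X (coboundary X a) b + cup X a (coboundary X b)) k \<sigma>"
  proof (cases "singular_simplex k X \<sigma>")
    case True
    show ?thesis
    proof (cases k)
      case 0
      then show ?thesis by (simp add: coboundary_def cup_def)
    next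
      case (Suc n)
      let ?A = "\<lambda>p l. a p (simplex_act p l \<sigma>)" and ?B = "\<lambda>p l. b p (simplex_act p l \<sigma>)"
      have 1: "coboundary X (cup X a b) k \<sigma>
          = (\<Sum>i\<le>Suc n. \<Sum>p\<le>n. ?A p (skip i) * ?B (n - p) (\<lambda>j. skip i (p + j)))"
      proof -
        have "cup X a b n (simplex_act n (skip i) \<sigma>) = (\<Sum>p\<le>n. ?A p (skip i) * ?B (n - p) (\<lambda>j. skip i (p + j)))"
          if "i \<le> Suc n" for i
        proof -
          have "singular_simplex n X (simplex_act n (skip i) \<sigma>)"
            using True skip_image [OF that] by (auto simp: Suc intro: singular_simplex_simplex_act)
          moreover have "simplex_act p (\<lambda>j. j) (simplex_act n (skip i) \<sigma>) = simplex_act p (skip i) \<sigma>"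
            "simplex_act (n - p) (\<lambda>j. p + j) (simplex_act n (skip i) \<sigma>) = simplex_act (n - p) (\<lambda>j. skip i (p + j)) \<sigma>"
            if "p \<le> n" for p
            using that by (subst simplex_act_compose; auto simp: comp_def)+
          ultimately show ?thesis
            by (auto simp: cup_def intro!: sum.cong)
        qed
        then show ?thesis
          using True by (auto simp: coboundary_eq Suc simp del: sum.atMost_Suc intro!: sum.cong)
      qed
      have 2: "cup X (coboundary X a) b k \<sigma>
          = (\<Sum>p\<le>n. \<Sum>i\<le>Suc p. ?A p (skip i) * ?B (n - p) (\<lambda>j. Suc p + j))"
      proof -
        have "coboundary X a (Suc p) (simplex_act (Suc p) (\<lambda>j. j) \<sigma>) = (\<Sum>i\<le>Suc p. ?A p (skip i))"
          if "p \<le> n" for p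
        proof -
          have "singular_simplex (Suc p) X (simplex_act (Suc p) (\<lambda>j. j) \<sigma>)"
            using True that by (intro singular_simplex_simplex_act) (auto simp: Suc)
          moreover have "simplex_act p (skip i) (simplex_act (Suc p) (\<lambda>j. j) \<sigma>) = simplex_act p (skip i) \<sigma>"
            if "i \<le> Suc p" for i
            using skip_image [OF that] by (subst simplex_act_compose) (auto simp: comp_def)
          ultimately show ?thesis
            by (auto simp: coboundary_eq simp del: sum.atMost_Suc intro!: sum.cong)
        qed
        moreover have "coboundary X a 0 s = 0" for s
          by (simp add: coboundary_def)
        moreover have "(+) (Suc p) = (\<lambda>j. Suc (p + j))" for p
          by auto
        ultimately show ?thesis
          using True by (auto simp: cup_def Suc sum.atMost_Suc_shift sum_distrib_right distrib_right
              simp del: sum.atMost_Suc intro!: sum.cong)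
      qed
      have 3: "cup X a (coboundary X b) k \<sigma>
          = (\<Sum>p\<le>n. \<Sum>i\<le>Suc n - p. ?A p (\<lambda>j. j) * ?B (n - p) (\<lambda>j. p + skip i j))"
      proof -
        have "coboundary X b (Suc n - p) (simplex_act (Suc n - p) (\<lambda>j. p + j) \<sigma>)
            = (\<Sum>i\<le>Suc n - p. ?B (n - p) (\<lambda>j. p + skip i j))"
          if "p \<le> n" for p
        proof -
          have "singular_simplex (Suc n - p) X (simplex_act (Suc n - p) (\<lambda>j. p + j) \<sigma>)"
            using True that by (intro singular_simplex_simplex_act) (auto simp: Suc)
          moreover have "simplex_act (n - p) (skip i) (simplex_act (Suc n - p) (\<lambda>j. p + j) \<sigma>)
              = simplex_act (n - p) (\<lambda>j. p + skip i j) \<sigma>"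
            if "i \<le> Suc n - p" for i
            using \<open>p \<le> n\<close> skip_image [of i "n - p"] that
            by (subst simplex_act_compose) (auto simp: comp_def Suc_diff_le)
          ultimately show ?thesis
            using that by (auto simp: coboundary_eq Suc_diff_le simp del: sum.atMost_Suc intro!: sum.cong)
        qed
        moreover have "coboundary X b 0 s = 0" for s
          by (simp add: coboundary_def)
        ultimately show ?thesis
          using True by (auto simp: cup_def Suc sum_distrib_left intro!: sum.cong)
      qed
      have 4: "(\<Sum>i\<le>Suc n. ?A p (skip i) * ?B (n - p) (\<lambda>j. skip i (p + j)))
          = (\<Sum>i\<le>Suc p. ?A p (skip i) * ?B (n - p) (\<lambda>j. Suc p + j))
          + (\<Sum>i\<le>Suc n - p. ?A p (\<lambda>j. j) * ?B (n - p) (\<lambda>j. p + skip i j))"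
        if p: "p \<le> n" for p
      proof -
        have sk: "?A p (skip i) = ?A p (\<lambda>j. j)" if "p < i" for i
          using that by (intro arg_cong [of _ _ "a p"] simplex_act_cong) (auto simp: skip_def)
        have l: "(\<Sum>i\<le>Suc p. ?A p (skip i) * ?B (n - p) (\<lambda>j. Suc p + j))
            = (\<Sum>i\<le>p. ?A p (skip i) * ?B (n - p) (\<lambda>j. skip i (p + j)))
              + ?A p (\<lambda>j. j) * ?B (n - p) (\<lambda>j. Suc p + j)"
          by (simp add: sk) (auto simp: skip_def intro!: sum.cong)
        have "(\<Sum>i\<in>{Suc p..Suc n}. ?A p (skip i) * ?B (n - p) (\<lambda>j. skip i (p + j)))
            = (\<Sum>i\<le>n - p. ?A p (\<lambda>j. j) * ?B (n - p) (\<lambda>j. p + skip (Suc i) j))"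
          using p by (intro sum.reindex_bij_witness [where j = "\<lambda>i. i - Suc p" and i = "\<lambda>i. Suc p + i"])
            (auto simp: sk intro!: arg_cong2 [where f = "(*)"] arg_cong [where f = "b (n - p)"]
              simplex_act_cong simp: skip_def)
        moreover have "(\<Sum>i\<le>Suc n - p. ?A p (\<lambda>j. j) * ?B (n - p) (\<lambda>j. p + skip i j))
            = ?A p (\<lambda>j. j) * ?B (n - p) (\<lambda>j. Suc p + j)
              + (\<Sum>i\<le>n - p. ?A p (\<lambda>j. j) * ?B (n - p) (\<lambda>j. p + skip (Suc i) j))"
          using p by (simp add: Suc_diff_le sum.atMost_Suc_shift skip_def del: sum.atMost_Suc)
        moreover have "(\<Sum>i\<le>Suc n. f i) = (\<Sum>i\<le>p. f i) + (\<Sum>i\<in>{Suc p..Suc n}. f i)" for f :: "nat \<Rightarrow> bit"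
        proof -
          have "{..Suc n} = {..p} \<union> {Suc p..Suc n}" using p by auto
          then show ?thesis by (simp add: sum.union_disjoint)
        qed
        moreover have "(+) (Suc p) = (\<lambda>j. Suc (p + j))"
          by auto
        ultimately show ?thesis
          unfolding l by (simp add: add.assoc del: sum.atMost_Suc)
      qed
      show ?thesis
        using 4 unfolding plus_fun_apply 1 2 3 sum.swap [of _ "{..n}" "{..Suc n}"] sum.distrib [symmetric]
        by (intro sum.cong) auto
    qed
  qed (simp add: coboundary_def cup_def)
qed

text \<open>The pairs of deleted vertices split into those with j < i and those with i \<le> j, and
  (i, j) \<mapsto> (j, i - 1) is a bijection from the first kind to the second that preserves the
  face. Every term therefore occurs twice.\<close>

lemma coboundary_coboundary: "coboundary X (coboundary X c) = 0"
proof (intro ext)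
  fix k and \<sigma> :: "(nat \<Rightarrow> real) \<Rightarrow> 'a"
  show "coboundary X (coboundary X c) k \<sigma> = (0 :: 'a cochain) k \<sigma>"
  proof (cases "singular_simplex k X \<sigma> \<and> (\<exists>n. k = Suc (Suc n))")
    case True
    then obtain n where k: "k = Suc (Suc n)" and s: "singular_simplex k X \<sigma>" by blast
    define A where "A = {(i, j). i \<le> k \<and> j < i}"
    define B where "B = {(i, j). i \<le> j \<and> j \<le> Suc n}"
    let ?f = "\<lambda>(i, j). c n (simplex_act n (skip i \<circ> skip j) \<sigma>)"
    have "coboundary X (coboundary X c) k \<sigma> = (\<Sum>i\<le>k. \<Sum>j\<le>Suc n. ?f (i, j))"
    proof -
      have "coboundary X c (Suc n) (simplex_act (Suc n) (skip i) \<sigma>) = (\<Sum>j\<le>Suc n. ?f (i, j))" if "i \<le> k" for i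
      proof -
        have "singular_simplex (Suc n) X (simplex_act (Suc n) (skip i) \<sigma>)"
          using s skip_image [of i "Suc n"] that by (auto simp: k intro: singular_simplex_simplex_act)
        then show ?thesis
          using skip_image [of _ n]
          by (simp add: coboundary_eq simplex_act_compose del: sum.atMost_Suc)
      qed
      then show ?thesis
        using s by (auto simp: coboundary_eq [of X "coboundary X c"] k simp del: sum.atMost_Suc intro!: sum.cong)
    qed
    also have "\<dots> = sum ?f ({..k} \<times> {..Suc n})"
      by (simp add: sum.cartesian_product del: sum.atMost_Suc)
    also have "\<dots> = sum ?f (A \<union> B)"
      by (rule arg_cong [where f = "sum ?f"]) (auto simp: A_def B_def k)
    also have "\<dots> = sum ?f A + sum ?f B"
    proof (rule sum.union_disjoint)
      show "finite A" "finite B"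
        by (rule finite_subset [of _ "{..k} \<times> {..k}"]; auto simp: k A_def B_def)+
    qed (auto simp: A_def B_def)
    also have "sum ?f A = sum ?f B"
    proof (rule sum.reindex_bij_witness [where i = "\<lambda>(i, j). (Suc j, i)" and j = "\<lambda>(i, j). (j, i - 1)"])
      fix a assume "a \<in> A"
      then obtain i j where a: "a = (i, j)" "i \<le> k" "j < i" by (auto simp: A_def)
      have "simplex_act n (skip j \<circ> skip (i - 1)) \<sigma> = simplex_act n (skip i \<circ> skip j) \<sigma>"
        using a by (intro simplex_act_cong) (auto simp: skip_def)
      then show "?f (case a of (i, j) \<Rightarrow> (j, i - 1)) = ?f a"
        by (simp add: a)
    qed (auto simp: k A_def B_def)
    finally show ?thesis by (simp only: bit_add_self zero_fun_apply)
  next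
    case False
    then have "\<not> singular_simplex k X \<sigma> \<or> k = 0 \<or> k = Suc 0"
      using nat.exhaust by (cases k; cases "k - 1") auto
    then show ?thesis
      by (auto simp: coboundary_def [of X "coboundary X c"]) (auto simp: coboundary_def)
  qed
qed

lemma coboundary_unit: "coboundary X (unit_cochain X) = 0"
proof (intro ext)
  fix k and \<sigma> :: "(nat \<Rightarrow> real) \<Rightarrow> 'a"
  show "coboundary X (unit_cochain X) k \<sigma> = (0 :: 'a cochain) k \<sigma>"
  proof (cases "k = 1 \<and> singular_simplex k X \<sigma>")
    case True
    then have "singular_simplex 0 X (simplex_act 0 (skip i) \<sigma>)" if "i \<le> 1" for i
      using that skip_image [of i 0] by (intro singular_simplex_simplex_act) auto
    then show ?thesis
      using True by (simp add: coboundary_eq unit_cochain_def)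
  next
    case False
    then have "k = 0 \<or> \<not> singular_simplex k X \<sigma> \<or> k - 1 \<noteq> 0"
      by (cases k) auto
    then show ?thesis by (auto simp: coboundary_def unit_cochain_def)
  qed
qed



section \<open>Closure properties of the invariant cochains\<close>

lemma inv_cochain_outside: "c \<in> inv_cochains X G \<Longrightarrow> \<not> singular_simplex k X \<sigma> \<Longrightarrow> c k \<sigma> = 0"
  by (simp add: inv_cochains_iff)

lemma cup_unit_left:
  assumes "c \<in> inv_cochains X G"
  shows "cup X (unit_cochain X) c = c"
proof (intro ext)
  fix k \<sigma>
  have "(\<Sum>p\<le>k. unit_cochain X p (simplex_act p (\<lambda>j. j) \<sigma>) * c (k - p) (simplex_act (k - p) (\<lambda>j. p + j) \<sigma>))
      = (\<Sum>p\<in>{0}. c (k - p) (simplex_act (k - p) (\<lambda>j. p + j) \<sigma>))" if "singular_simplex k X \<sigma>"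
    using singular_simplex_simplex_act [OF that, of "\<lambda>j. j" 0]
    by (intro sum.mono_neutral_cong_right) (auto simp: unit_cochain_def)
  then have "cup X (unit_cochain X) c k \<sigma> = c k \<sigma>" if "singular_simplex k X \<sigma>"
    using that simplex_act_id [OF that] by (simp add: cup_def)
  then show "cup X (unit_cochain X) c k \<sigma> = c k \<sigma>"
    using inv_cochain_outside [OF assms, of k \<sigma>] by (cases "singular_simplex k X \<sigma>") (simp_all add: cup_def)
qed

lemma cup_unit_right:
  assumes "c \<in> inv_cochains X G"
  shows "cup X c (unit_cochain X) = c"
proof (intro ext)
  fix k \<sigma>
  have "(\<Sum>p\<le>k. c p (simplex_act p (\<lambda>j. j) \<sigma>) * unit_cochain X (k - p) (simplex_act (k - p) (\<lambda>j. p + j) \<sigma>))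
      = (\<Sum>p\<in>{k}. c p (simplex_act p (\<lambda>j. j) \<sigma>))" if "singular_simplex k X \<sigma>"
    using singular_simplex_simplex_act [OF that, of "\<lambda>j. k + j" 0]
    by (intro sum.mono_neutral_cong_right) (auto simp: unit_cochain_def)
  then have "cup X c (unit_cochain X) k \<sigma> = c k \<sigma>" if "singular_simplex k X \<sigma>"
    using that simplex_act_id [OF that] by (simp add: cup_def)
  then show "cup X c (unit_cochain X) k \<sigma> = c k \<sigma>"
    using inv_cochain_outside [OF assms, of k \<sigma>] by (cases "singular_simplex k X \<sigma>") (simp_all add: cup_def)
qed

lemma acts_on_simplex:
  "\<lbrakk>acts_on X G; g \<in> G; singular_simplex k X \<sigma>\<rbrakk> \<Longrightarrow> singular_simplex k X (simplex_map k g \<sigma>)"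
  by (auto simp: acts_on_def intro: singular_simplex_simplex_map)

lemma inv_cochains_0 [simp]: "0 \<in> inv_cochains X G"
  by (auto simp: inv_cochains_iff invariant_cochain_def)

lemma inv_cochains_add:
  assumes "a \<in> inv_cochains X G" "b \<in> inv_cochains X G"
  shows "a + b \<in> inv_cochains X G"
proof -
  have "finite ({k. a k \<noteq> 0} \<union> {k. b k \<noteq> 0})"
    using assms by (simp add: inv_cochains_iff)
  moreover have "{k. (a + b) k \<noteq> 0} \<subseteq> {k. a k \<noteq> 0} \<union> {k. b k \<noteq> 0}"
    by auto
  ultimately have "finite {k. (a + b) k \<noteq> 0}"
    by (rule finite_subset [rotated])
  with assms show ?thesis
    by (simp add: inv_cochains_iff invariant_cochain_def)
qed

lemma inv_cochains_coboundary:
  assumes G: "acts_on X G" and c: "c \<in> inv_cochains X G"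
  shows "coboundary X c \<in> inv_cochains X G"
proof -
  have "finite {k. coboundary X c k \<noteq> 0}"
  proof (rule finite_subset)
    show "{k. coboundary X c k \<noteq> 0} \<subseteq> Suc ` {k. c k \<noteq> 0}"
    proof
      fix k assume "k \<in> {k. coboundary X c k \<noteq> 0}"
      then obtain \<sigma> where "coboundary X c k \<sigma> \<noteq> 0"
        by (auto simp: fun_eq_iff)
      then have "k \<noteq> 0" "c (k - 1) \<noteq> 0"
        by (auto simp: coboundary_def split: if_splits)
      then show "k \<in> Suc ` {k. c k \<noteq> 0}"
        by (intro image_eqI [of _ _ "k - 1"]) (simp_all del: bit_not_zero_iff)
    qed
  qed (use c in \<open>simp add: inv_cochains_iff\<close>)
  moreover have "coboundary X c k (simplex_map k g \<sigma>) = coboundary X c k \<sigma>"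
    if g: "g \<in> G" and s: "singular_simplex k X \<sigma>" for g k \<sigma>
  proof (cases k)
    case (Suc n)
    have "c n (simplex_act n (skip i) (simplex_map k g \<sigma>)) = c n (simplex_act n (skip i) \<sigma>)" if "i \<le> k" for i
    proof -
      have "simplex_act n (skip i) (simplex_map k g \<sigma>) = simplex_map n g (simplex_act n (skip i) \<sigma>)"
        using skip_image [of i n] that by (subst simplex_map_simplex_act) (auto simp: Suc)
      moreover have "singular_simplex n X (simplex_act n (skip i) \<sigma>)"
        using s skip_image [of i n] that by (auto simp: Suc intro: singular_simplex_simplex_act)
      ultimately show ?thesis
        using c g by (simp add: inv_cochains_iff invariant_cochain_def)
    qed
    then have "(\<Sum>i\<le>Suc n. c n (simplex_act n (skip i) (simplex_map k g \<sigma>))) = (\<Sum>i\<le>Suc n. c n (simplex_act n (skip i) \<sigma>))"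
      by (intro sum.cong) (auto simp: Suc)
    then show ?thesis
      using s acts_on_simplex [OF G g s] by (simp add: coboundary_eq Suc del: sum.atMost_Suc)
  qed (simp add: coboundary_def)
  moreover have "coboundary X c k \<sigma> = 0" if "\<not> singular_simplex k X \<sigma>" for k \<sigma>
    using that by (simp add: coboundary_def)
  ultimately show ?thesis
    by (auto simp: inv_cochains_iff invariant_cochain_def)
qed

lemma inv_cochains_cup:
  assumes G: "acts_on X G" and a: "a \<in> inv_cochains X G" and b: "b \<in> inv_cochains X G"
  shows "cup X a b \<in> inv_cochains X G"
proof -
  have "finite {k. cup X a b k \<noteq> 0}"
  proof (rule finite_subset)
    show "{k. cup X a b k \<noteq> 0} \<subseteq> (\<lambda>(p, q). p + q) ` ({p. a p \<noteq> 0} \<times> {q. b q \<noteq> 0})"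
    proof
      fix k assume "k \<in> {k. cup X a b k \<noteq> 0}"
      then obtain \<sigma> where "(\<Sum>p\<le>k. a p (simplex_act p (\<lambda>j. j) \<sigma>) * b (k - p) (simplex_act (k - p) (\<lambda>j. p + j) \<sigma>)) \<noteq> 0"
        by (auto simp: cup_def fun_eq_iff split: if_splits)
      then obtain p where "p \<le> k" "a p (simplex_act p (\<lambda>j. j) \<sigma>) * b (k - p) (simplex_act (k - p) (\<lambda>j. p + j) \<sigma>) \<noteq> 0"
        by (meson atMost_iff sum.not_neutral_contains_not_neutral)
      then have "p \<le> k" "a p \<noteq> 0" "b (k - p) \<noteq> 0"
        by (auto simp: fun_eq_iff)
      then show "k \<in> (\<lambda>(p, q). p + q) ` ({p. a p \<noteq> 0} \<times> {q. b q \<noteq> 0})"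
        by (intro image_eqI [of _ _ "(p, k - p)"]) auto
    qed
  qed (use a b in \<open>simp add: inv_cochains_iff\<close>)
  moreover have "cup X a b k (simplex_map k g \<sigma>) = cup X a b k \<sigma>"
    if g: "g \<in> G" and s: "singular_simplex k X \<sigma>" for g k \<sigma>
  proof -
    have 1: "a p (simplex_act p (\<lambda>j. j) (simplex_map k g \<sigma>)) = a p (simplex_act p (\<lambda>j. j) \<sigma>)" if "p \<le> k" for p
    proof -
      have "simplex_act p (\<lambda>j. j) (simplex_map k g \<sigma>) = simplex_map p g (simplex_act p (\<lambda>j. j) \<sigma>)"
        using that by (subst simplex_map_simplex_act) auto
      moreover have "singular_simplex p X (simplex_act p (\<lambda>j. j) \<sigma>)"
        using s that by (auto intro: singular_simplex_simplex_act)
      ultimately show ?thesis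
        using a g by (simp add: inv_cochains_iff invariant_cochain_def)
    qed
    have 2: "b (k - p) (simplex_act (k - p) (\<lambda>j. p + j) (simplex_map k g \<sigma>)) = b (k - p) (simplex_act (k - p) (\<lambda>j. p + j) \<sigma>)"
      if "p \<le> k" for p
    proof -
      have "simplex_act (k - p) (\<lambda>j. p + j) (simplex_map k g \<sigma>) = simplex_map (k - p) g (simplex_act (k - p) (\<lambda>j. p + j) \<sigma>)"
        using that by (subst simplex_map_simplex_act) auto
      moreover have "singular_simplex (k - p) X (simplex_act (k - p) (\<lambda>j. p + j) \<sigma>)"
        using s that by (auto intro: singular_simplex_simplex_act)
      ultimately show ?thesis
        using b g by (simp add: inv_cochains_iff invariant_cochain_def)
    qed
    have "(\<Sum>p\<le>k. a p (simplex_act p (\<lambda>j. j) (simplex_map k g \<sigma>)) * b (k - p) (simplex_act (k - p) (\<lambda>j. p + j) (simplex_map k g \<sigma>)))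
        = (\<Sum>p\<le>k. a p (simplex_act p (\<lambda>j. j) \<sigma>) * b (k - p) (simplex_act (k - p) (\<lambda>j. p + j) \<sigma>))"
      by (rule sum.cong [OF refl]) (metis 1 2 atMost_iff)
    then show ?thesis
      using s acts_on_simplex [OF G g s] by (simp add: cup_def)
  qed
  moreover have "cup X a b k \<sigma> = 0" if "\<not> singular_simplex k X \<sigma>" for k \<sigma>
    using that by (simp add: cup_def)
  ultimately show ?thesis
    by (auto simp: inv_cochains_iff invariant_cochain_def)
qed

lemma inv_cochains_unit:
  assumes G: "acts_on X G"
  shows "unit_cochain X \<in> inv_cochains X G"
proof -
  have "finite {k. unit_cochain X k \<noteq> 0}"
    by (rule finite_subset [of _ "{0}"]) (auto simp: unit_cochain_def fun_eq_iff)
  then show ?thesis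
    using acts_on_simplex [OF G] by (auto simp: inv_cochains_iff invariant_cochain_def unit_cochain_def)
qed

lemma inv_cocycles_closed:
  assumes G: "acts_on X G"
  shows "0 \<in> inv_cocycles X G" "unit_cochain X \<in> inv_cocycles X G"
    "a \<in> inv_cocycles X G \<Longrightarrow> b \<in> inv_cocycles X G \<Longrightarrow> a + b \<in> inv_cocycles X G"
    "a \<in> inv_cocycles X G \<Longrightarrow> b \<in> inv_cocycles X G \<Longrightarrow> cup X a b \<in> inv_cocycles X G"
  by (auto simp: inv_cocycles_def inv_cochains_add inv_cochains_cup [OF G] inv_cochains_unit [OF G]
      coboundary_add coboundary_cup coboundary_unit)

lemma inv_coboundaries_subset:
  assumes G: "acts_on X G"
  shows "inv_coboundaries X G \<subseteq> inv_cocycles X G"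
  by (auto simp: inv_coboundaries_def inv_cocycles_def coboundary_coboundary inv_cochains_coboundary [OF G])

lemma inv_coboundaries_0: "0 \<in> inv_coboundaries X G"
  unfolding inv_coboundaries_def by (rule image_eqI [of _ _ 0]) auto

lemma inv_coboundaries_add:
  "a \<in> inv_coboundaries X G \<Longrightarrow> b \<in> inv_coboundaries X G \<Longrightarrow> a + b \<in> inv_coboundaries X G"
  unfolding inv_coboundaries_def
  by (auto simp flip: coboundary_add intro!: imageI inv_cochains_add)

lemma inv_coboundaries_cup:
  assumes G: "acts_on X G" and a: "a \<in> inv_coboundaries X G" and b: "b \<in> inv_cocycles X G"
  shows "cup X a b \<in> inv_coboundaries X G" "cup X b a \<in> inv_coboundaries X G"
proof -
  obtain d where d: "a = coboundary X d" "d \<in> inv_cochains X G"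
    using a by (auto simp: inv_coboundaries_def)
  have b': "coboundary X b = 0" "b \<in> inv_cochains X G"
    using b by (auto simp: inv_cocycles_def)
  show "cup X a b \<in> inv_coboundaries X G"
    unfolding inv_coboundaries_def
    by (rule image_eqI [of _ _ "cup X d b"]) (simp_all add: d b' coboundary_cup inv_cochains_cup [OF G])
  show "cup X b a \<in> inv_coboundaries X G"
    unfolding inv_coboundaries_def
    by (rule image_eqI [of _ _ "cup X b d"]) (simp_all add: d b' coboundary_cup inv_cochains_cup [OF G])
qed

section \<open>The cohomology ring of the invariant cochains\<close>

definition inv_cocycle_ring :: "'a topology \<Rightarrow> ('a \<Rightarrow> 'a) set \<Rightarrow> 'a cochain ring" where
  "inv_cocycle_ring X G = cochain_ring X\<lparr>carrier := inv_cocycles X G\<rparr>"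

definition inv_cohomology_ring :: "'a topology \<Rightarrow> ('a \<Rightarrow> 'a) set \<Rightarrow> 'a cochain set ring" where
  "inv_cohomology_ring X G = inv_cocycle_ring X G Quot inv_coboundaries X G"

definition inv_class :: "'a topology \<Rightarrow> ('a \<Rightarrow> 'a) set \<Rightarrow> 'a cochain \<Rightarrow> 'a cochain set" where
  "inv_class X G c = inv_coboundaries X G +>\<^bsub>inv_cocycle_ring X G\<^esub> c"

lemma inv_cocycle_ring_simps:
  "carrier (inv_cocycle_ring X G) = inv_cocycles X G"
  "monoid.mult (inv_cocycle_ring X G) = cup X" "one (inv_cocycle_ring X G) = unit_cochain X"
  "ring.zero (inv_cocycle_ring X G) = 0" "add (inv_cocycle_ring X G) = (+)"
  using cochain_ring_simps [of X] by (simp_all add: inv_cocycle_ring_def)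

lemma invariant_cochain_empty [simp]: "invariant_cochain X {} c"
  by (simp add: invariant_cochain_def)

lemma acts_on_empty [simp]: "acts_on X {}"
  by (simp add: acts_on_def)

lemma inv_cocycle_ring_empty: "inv_cocycle_ring X {} = cocycle_ring X"
proof -
  have "inv_cocycles X {} = {c \<in> carrier (cochain_ring X). coboundary X c = (\<lambda>k \<sigma>. 0)}"
    by (auto simp: inv_cocycles_def inv_cochains_def zero_fun_def)
  then show ?thesis
    by (simp add: inv_cocycle_ring_def cocycle_ring_def)
qed

lemma inv_coboundaries_empty: "inv_coboundaries X {} = coboundaries X"
  by (auto simp: inv_coboundaries_def coboundaries_def inv_cochains_def)

text \<open>The bridge to ordinary cohomology. The configuration space and the projectivization are
  treated as spaces with an empty set of symmetries, so that one theory serves for both kinds of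
  rings.\<close>

lemma inv_cohomology_ring_empty: "inv_cohomology_ring X {} = cohomology_ring X"
  by (simp add: inv_cohomology_ring_def cohomology_ring_def inv_cocycle_ring_empty inv_coboundaries_empty)

lemma inv_class_empty: "inv_class X {} c = cohomology_class X c"
  by (simp add: inv_class_def cohomology_class_def inv_cocycle_ring_empty inv_coboundaries_empty)

lemma ring_inv_cocycle_ring:
  assumes G: "acts_on X G"
  shows "ring (inv_cocycle_ring X G)"
proof (rule ringI)
  note cl = inv_cocycles_closed [OF G]
  have cup_unit: "cup X (unit_cochain X) c = c" "cup X c (unit_cochain X) = c" if "c \<in> inv_cocycles X G" for c
    using that cup_unit_left cup_unit_right by (auto simp: inv_cocycles_def)
  show "abelian_group (inv_cocycle_ring X G)"
  proof (rule abelian_groupI)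
    fix x assume "x \<in> carrier (inv_cocycle_ring X G)"
    then show "\<exists>y\<in>carrier (inv_cocycle_ring X G). y \<oplus>\<^bsub>inv_cocycle_ring X G\<^esub> x = \<zero>\<^bsub>inv_cocycle_ring X G\<^esub>"
      by (intro bexI [of _ x]) (simp_all add: inv_cocycle_ring_simps)
  qed (auto simp: inv_cocycle_ring_simps cl add_ac)
  show "Group.monoid (inv_cocycle_ring X G)"
    by (rule monoidI)
      (auto simp: inv_cocycle_ring_simps cl cup_assoc cup_unit)
qed (auto simp: inv_cocycle_ring_simps cup_add_left cup_add_right)

lemma ideal_inv_coboundaries:
  assumes G: "acts_on X G"
  shows "ideal (inv_coboundaries X G) (inv_cocycle_ring X G)"
proof (rule idealI)
  show "ring (inv_cocycle_ring X G)"
    by (rule ring_inv_cocycle_ring [OF G])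
  then interpret ring "inv_cocycle_ring X G" .
  have "\<ominus>\<^bsub>inv_cocycle_ring X G\<^esub> a = a" if "a \<in> inv_cocycles X G" for a
    by (rule minus_equality) (use that in \<open>simp_all add: inv_cocycle_ring_simps\<close>)
  then show "subgroup (inv_coboundaries X G) (add_monoid (inv_cocycle_ring X G))"
    using inv_coboundaries_subset [OF G] inv_coboundaries_0 [of X G]
    by (intro add.subgroupI)
      (auto simp: inv_cocycle_ring_simps inv_coboundaries_add a_inv_def [symmetric] subset_iff)
qed (auto simp: inv_cocycle_ring_simps inv_coboundaries_cup [OF G])

lemma ring_inv_cohomology_ring:
  "acts_on X G \<Longrightarrow> ring (inv_cohomology_ring X G)"
  unfolding inv_cohomology_ring_def by (rule ideal.quotient_is_ring [OF ideal_inv_coboundaries])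

lemma inv_class_hom:
  assumes G: "acts_on X G"
  shows "inv_class X G \<in> ring_hom (inv_cocycle_ring X G) (inv_cohomology_ring X G)"
  using ideal.rcos_ring_hom [OF ideal_inv_coboundaries [OF G]]
  by (simp add: inv_cohomology_ring_def inv_class_def [abs_def])

lemma inv_class_simps:
  assumes G: "acts_on X G"
  shows "a \<in> inv_cocycles X G \<Longrightarrow> inv_class X G a \<in> carrier (inv_cohomology_ring X G)"
    "a \<in> inv_cocycles X G \<Longrightarrow> b \<in> inv_cocycles X G \<Longrightarrow>
       inv_class X G (a + b) = inv_class X G a \<oplus>\<^bsub>inv_cohomology_ring X G\<^esub> inv_class X G b"
    "a \<in> inv_cocycles X G \<Longrightarrow> b \<in> inv_cocycles X G \<Longrightarrow>
       inv_class X G (cup X a b) = inv_class X G a \<otimes>\<^bsub>inv_cohomology_ring X G\<^esub> inv_class X G b"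
    "inv_class X G (unit_cochain X) = \<one>\<^bsub>inv_cohomology_ring X G\<^esub>"
  using ring_hom_closed [OF inv_class_hom [OF G]] ring_hom_add [OF inv_class_hom [OF G]]
    ring_hom_mult [OF inv_class_hom [OF G]] ring_hom_one [OF inv_class_hom [OF G]]
  by (simp_all add: inv_cocycle_ring_simps)

lemma inv_cohomology_carrier:
  "carrier (inv_cohomology_ring X G) = inv_class X G ` inv_cocycles X G"
  by (auto simp: inv_cohomology_ring_def FactRing_def A_RCOSETS_def' inv_class_def inv_cocycle_ring_simps(1))

lemma mem_inv_class: "b \<in> inv_class X G a \<longleftrightarrow> (\<exists>d \<in> inv_coboundaries X G. b = d + a)"
  by (auto simp: inv_class_def a_r_coset_def r_coset_def inv_cocycle_ring_simps)

lemma inv_class_eq_iff: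
  "inv_class X G a = inv_class X G b \<longleftrightarrow> a + b \<in> inv_coboundaries X G"
proof
  assume "inv_class X G a = inv_class X G b"
  moreover have "a \<in> inv_class X G a"
    unfolding mem_inv_class using inv_coboundaries_0 [of X G] by (intro bexI [of _ 0]) auto
  ultimately have "a \<in> inv_class X G b" by simp
  then obtain d where "d \<in> inv_coboundaries X G" "a = d + b"
    unfolding mem_inv_class by blast
  then show "a + b \<in> inv_coboundaries X G"
    by (simp add: add.assoc)
next
  assume ab: "a + b \<in> inv_coboundaries X G"
  have *: "inv_class X G a \<subseteq> inv_class X G b" if "a + b \<in> inv_coboundaries X G" for a b
  proof
    fix c assume "c \<in> inv_class X G a"
    then obtain d where "d \<in> inv_coboundaries X G" "c = d + a"
      unfolding mem_inv_class by blast
    moreover have "d + a = (d + (a + b)) + b"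
      by (simp add: add.assoc)
    ultimately show "c \<in> inv_class X G b"
      unfolding mem_inv_class using that inv_coboundaries_add by metis
  qed
  show "inv_class X G a = inv_class X G b"
    using * [OF ab] * [of b a] ab by (simp add: add.commute)
qed

lemma inv_cohomology_zero: "\<zero>\<^bsub>inv_cohomology_ring X G\<^esub> = inv_class X G 0"
proof -
  have "inv_coboundaries X G = inv_class X G 0"
    by (auto simp: mem_inv_class)
  then show ?thesis
    by (simp add: inv_cohomology_ring_def FactRing_def)
qed

lemma inv_class_eq_zero_iff:
  "inv_class X G a = \<zero>\<^bsub>inv_cohomology_ring X G\<^esub> \<longleftrightarrow> a \<in> inv_coboundaries X G"
  by (simp add: inv_cohomology_zero inv_class_eq_iff)

section \<open>Induced homomorphisms\<close>

text \<open>A condition on generators only, so no homomorphism of groups has to be named. The first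
  alternative is separate because H need not contain the identity: it occurs for projections that
  forget a coordinate on which the generator acts.\<close>

definition equivariant_map ::
    "'a topology \<Rightarrow> ('a \<Rightarrow> 'a) set \<Rightarrow> 'b topology \<Rightarrow> ('b \<Rightarrow> 'b) set \<Rightarrow> ('a \<Rightarrow> 'b) \<Rightarrow> bool" where
  "equivariant_map X G Y H f \<longleftrightarrow> continuous_map X Y f \<and>
    (\<forall>g\<in>G. (\<forall>x\<in>topspace X. f (g x) = f x) \<or> (\<exists>h\<in>H. \<forall>x\<in>topspace X. f (g x) = h (f x)))"

lemma inv_simplex_act:
  assumes c: "c \<in> inv_cochains X G" and "g \<in> G" "singular_simplex k X \<sigma>" "l ` {..m} \<subseteq> {..k}"
  shows "c m (simplex_act m l (simplex_map k g \<sigma>)) = c m (simplex_act m l \<sigma>)"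
  using assms singular_simplex_simplex_act [OF assms(3,4)]
  by (simp add: simplex_map_simplex_act [OF assms(4), symmetric] inv_cochains_iff invariant_cochain_def)

lemma cochain_pullback_add: "cochain_pullback X f (a + b) = cochain_pullback X f a + cochain_pullback X f b"
  by (intro ext) (simp add: cochain_pullback_def)

lemma cochain_pullback_0 [simp]: "cochain_pullback X f 0 = 0"
  by (intro ext) (simp add: cochain_pullback_def)

lemma cochain_pullback_coboundary:
  assumes f: "continuous_map X Y f"
  shows "cochain_pullback X f (coboundary Y c) = coboundary X (cochain_pullback X f c)"
proof (intro ext)
  fix k \<sigma>
  show "cochain_pullback X f (coboundary Y c) k \<sigma> = coboundary X (cochain_pullback X f c) k \<sigma>"
  proof (cases "singular_simplex k X \<sigma> \<and> k \<noteq> 0")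
    case True
    then obtain n where k: "k = Suc n" and s: "singular_simplex k X \<sigma>"
      using not0_implies_Suc by auto
    have "(\<Sum>i\<le>Suc n. c n (simplex_act n (skip i) (simplex_map k f \<sigma>)))
        = (\<Sum>i\<le>Suc n. cochain_pullback X f c n (simplex_act n (skip i) \<sigma>))"
    proof (rule sum.cong [OF refl])
      fix i assume "i \<in> {..Suc n}"
      then have i: "skip i ` {..n} \<subseteq> {..k}"
        using skip_image [of i n] by (simp add: k)
      show "c n (simplex_act n (skip i) (simplex_map k f \<sigma>)) = cochain_pullback X f c n (simplex_act n (skip i) \<sigma>)"
        using singular_simplex_simplex_act [OF s i] simplex_map_simplex_act [OF i, of f \<sigma>]
        by (simp add: cochain_pullback_def)
    qed
    then show ?thesis
      using s singular_simplex_simplex_map [OF s f]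
      by (simp add: cochain_pullback_def coboundary_eq k del: sum.atMost_Suc cong: if_cong)
  qed (auto simp: cochain_pullback_def coboundary_def)
qed

lemma cochain_pullback_cup:
  assumes f: "continuous_map X Y f"
  shows "cochain_pullback X f (cup Y a b) = cup X (cochain_pullback X f a) (cochain_pullback X f b)"
proof (intro ext)
  fix k \<sigma>
  show "cochain_pullback X f (cup Y a b) k \<sigma> = cup X (cochain_pullback X f a) (cochain_pullback X f b) k \<sigma>"
  proof (cases "singular_simplex k X \<sigma>")
    case True
    have "(\<Sum>p\<le>k. a p (simplex_act p (\<lambda>j. j) (simplex_map k f \<sigma>)) *
                 b (k - p) (simplex_act (k - p) (\<lambda>j. p + j) (simplex_map k f \<sigma>)))
        = (\<Sum>p\<le>k. cochain_pullback X f a p (simplex_act p (\<lambda>j. j) \<sigma>) *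
                 cochain_pullback X f b (k - p) (simplex_act (k - p) (\<lambda>j. p + j) \<sigma>))"
    proof (rule sum.cong [OF refl])
      fix p assume "p \<in> {..k}"
      then have p: "(\<lambda>j. j) ` {..p} \<subseteq> {..k}" "(\<lambda>j. p + j) ` {..k - p} \<subseteq> {..k}"
        by auto
      show "a p (simplex_act p (\<lambda>j. j) (simplex_map k f \<sigma>)) *
                 b (k - p) (simplex_act (k - p) (\<lambda>j. p + j) (simplex_map k f \<sigma>))
        = cochain_pullback X f a p (simplex_act p (\<lambda>j. j) \<sigma>) *
                 cochain_pullback X f b (k - p) (simplex_act (k - p) (\<lambda>j. p + j) \<sigma>)"
        using singular_simplex_simplex_act [OF True p(1)] singular_simplex_simplex_act [OF True p(2)]
          simplex_map_simplex_act [OF p(1), of f \<sigma>] simplex_map_simplex_act [OF p(2), of f \<sigma>]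
        by (simp add: cochain_pullback_def)
    qed
    then show ?thesis
      using True singular_simplex_simplex_map [OF True f] by (simp add: cochain_pullback_def cup_def)
  qed (simp add: cochain_pullback_def cup_def)
qed

lemma cochain_pullback_unit:
  assumes f: "continuous_map X Y f"
  shows "cochain_pullback X f (unit_cochain Y) = unit_cochain X"
proof (intro ext)
  fix k \<sigma>
  show "cochain_pullback X f (unit_cochain Y) k \<sigma> = unit_cochain X k \<sigma>"
    using singular_simplex_simplex_map [OF _ f, of k \<sigma>] by (auto simp: cochain_pullback_def unit_cochain_def)
qed

lemma cochain_pullback_compose:
  assumes f: "continuous_map X Y f"
  shows "cochain_pullback X f (cochain_pullback Y g c) = cochain_pullback X (g \<circ> f) c"
proof (intro ext)
  fix k \<sigma>
  show "cochain_pullback X f (cochain_pullback Y g c) k \<sigma> = cochain_pullback X (g \<circ> f) c k \<sigma>"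
    using singular_simplex_simplex_map [OF _ f, of k \<sigma>]
    by (auto simp: cochain_pullback_def simplex_map_compose)
qed

lemma cochain_pullback_cong:
  assumes "\<And>x. x \<in> topspace X \<Longrightarrow> f x = g x"
  shows "cochain_pullback X f c = cochain_pullback X g c"
proof (intro ext)
  fix k \<sigma>
  show "cochain_pullback X f c k \<sigma> = cochain_pullback X g c k \<sigma>"
    using simplex_map_eq [of k X \<sigma> f g] assms by (auto simp: cochain_pullback_def)
qed

lemma cochain_pullback_id:
  assumes "c \<in> inv_cochains X G" "\<And>x. x \<in> topspace X \<Longrightarrow> f x = x"
  shows "cochain_pullback X f c = c"
proof (intro ext)
  fix k \<sigma>
  show "cochain_pullback X f c k \<sigma> = c k \<sigma>"
    using simplex_map_id_gen [of k X \<sigma> f] assms inv_cochain_outside [OF assms(1), of k \<sigma>]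
    by (auto simp: cochain_pullback_def)
qed

lemma cochain_pullback_invariant:
  assumes c: "c \<in> inv_cochains X G" and g: "g \<in> G"
  shows "cochain_pullback X g c = c"
proof (intro ext)
  fix k \<sigma>
  show "cochain_pullback X g c k \<sigma> = c k \<sigma>"
    using c g inv_cochain_outside [OF c, of k \<sigma>]
    by (auto simp: cochain_pullback_def inv_cochains_iff invariant_cochain_def)
qed

lemma invariant_cochain_iff:
  assumes "\<And>k \<sigma>. \<not> singular_simplex k X \<sigma> \<Longrightarrow> c k \<sigma> = 0"
  shows "invariant_cochain X G c \<longleftrightarrow> (\<forall>g\<in>G. cochain_pullback X g c = c)"
proof -
  have "(\<forall>k \<sigma>. singular_simplex k X \<sigma> \<longrightarrow> c k (simplex_map k g \<sigma>) = c k \<sigma>) \<longleftrightarrow> cochain_pullback X g c = c" for g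
    using assms by (auto simp: cochain_pullback_def fun_eq_iff)
  then show ?thesis
    by (auto simp: invariant_cochain_def)
qed

lemma finite_support_pullback:
  assumes "finite {k. c k \<noteq> 0}"
  shows "finite {k. cochain_pullback X f c k \<noteq> 0}"
  by (rule finite_subset [OF _ assms]) (auto simp: cochain_pullback_def fun_eq_iff)

lemma inv_cochains_pullback:
  assumes f: "equivariant_map X G Y H f" and G: "acts_on X G" and c: "c \<in> inv_cochains Y H"
  shows "cochain_pullback X f c \<in> inv_cochains X G"
proof -
  have fc: "continuous_map X Y f"
    using f by (simp add: equivariant_map_def)
  have "cochain_pullback X g (cochain_pullback X f c) = cochain_pullback X f c" if g: "g \<in> G" for g
  proof -
    have gc: "continuous_map X X g"
      using G g by (simp add: acts_on_def)
    consider "\<forall>x\<in>topspace X. f (g x) = f x" | h where "h \<in> H" "\<forall>x\<in>topspace X. f (g x) = h (f x)"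
      using f g by (auto simp: equivariant_map_def)
    then have "cochain_pullback X (f \<circ> g) c = cochain_pullback X f c"
    proof cases
      case 1
      then show ?thesis by (intro cochain_pullback_cong) simp
    next
      case 2
      then have "cochain_pullback X (f \<circ> g) c = cochain_pullback X (h \<circ> f) c"
        by (intro cochain_pullback_cong) simp
      also have "\<dots> = cochain_pullback X f (cochain_pullback Y h c)"
        by (simp add: cochain_pullback_compose [OF fc])
      finally show ?thesis
        using cochain_pullback_invariant [OF c 2(1)] by simp
    qed
    then show ?thesis
      by (simp add: cochain_pullback_compose [OF gc])
  qed
  moreover have "cochain_pullback X f c k \<sigma> = 0" if "\<not> singular_simplex k X \<sigma>" for k \<sigma>
    using that by (simp add: cochain_pullback_def)
  ultimately show ?thesis
    using c finite_support_pullback [of c X f] by (simp add: inv_cochains_iff invariant_cochain_iff)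
qed

lemma inv_cocycles_pullback:
  assumes f: "equivariant_map X G Y H f" and G: "acts_on X G" and c: "c \<in> inv_cocycles Y H"
  shows "cochain_pullback X f c \<in> inv_cocycles X G"
  using c inv_cochains_pullback [OF f G] cochain_pullback_coboundary [of X Y f c] f
  by (simp add: inv_cocycles_def equivariant_map_def)

lemma inv_coboundaries_pullback:
  assumes f: "equivariant_map X G Y H f" and G: "acts_on X G" and c: "c \<in> inv_coboundaries Y H"
  shows "cochain_pullback X f c \<in> inv_coboundaries X G"
proof -
  obtain d where d: "d \<in> inv_cochains Y H" "c = coboundary Y d"
    using c by (auto simp: inv_coboundaries_def)
  then have "cochain_pullback X f c = coboundary X (cochain_pullback X f d)"
    using cochain_pullback_coboundary [of X Y f d] f by (simp add: equivariant_map_def)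
  with inv_cochains_pullback [OF f G d(1)] show ?thesis
    by (auto simp: inv_coboundaries_def)
qed

definition inv_pullback ::
    "'a topology \<Rightarrow> ('a \<Rightarrow> 'a) set \<Rightarrow> ('a \<Rightarrow> 'b) \<Rightarrow> 'b cochain set \<Rightarrow> 'a cochain set" where
  "inv_pullback X G f A = (\<Union>a\<in>A. inv_class X G (cochain_pullback X f a))"

lemma inv_pullback_empty: "inv_pullback X {} f A = cohomology_pullback X f A"
  by (simp add: inv_pullback_def cohomology_pullback_def inv_class_empty)

lemma inv_pullback_class:
  assumes f: "equivariant_map X G Y H f" and G: "acts_on X G"
  shows "inv_pullback X G f (inv_class Y H a) = inv_class X G (cochain_pullback X f a)"
proof -
  have "inv_class X G (cochain_pullback X f b) = inv_class X G (cochain_pullback X f a)"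
    if b: "b \<in> inv_class Y H a" for b
  proof -
    obtain d where "d \<in> inv_coboundaries Y H" "b = d + a"
      using b by (auto simp: mem_inv_class)
    then show ?thesis
      using inv_coboundaries_pullback [OF f G]
      by (simp add: inv_class_eq_iff cochain_pullback_add add.assoc)
  qed
  moreover have "a \<in> inv_class Y H a"
    using inv_coboundaries_0 [of Y H] by (auto simp: mem_inv_class)
  ultimately show ?thesis
    unfolding inv_pullback_def by blast
qed

lemma inv_pullback_hom:
  assumes f: "equivariant_map X G Y H f" and G: "acts_on X G" and H: "acts_on Y H"
  shows "inv_pullback X G f \<in> ring_hom (inv_cohomology_ring Y H) (inv_cohomology_ring X G)"
proof -
  have fc: "continuous_map X Y f"
    using f by (simp add: equivariant_map_def)
  note s = inv_class_simps [OF G] inv_pullback_class [OF f G] inv_cocycles_pullback [OF f G]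
  note t = inv_class_simps(2-4) [OF H, symmetric]
  have c: "\<exists>a\<in>inv_cocycles Y H. A = inv_class Y H a" if "A \<in> carrier (inv_cohomology_ring Y H)" for A
    using that by (auto simp: inv_cohomology_carrier)
  show ?thesis
  proof (rule ring_hom_memI)
    fix A assume "A \<in> carrier (inv_cohomology_ring Y H)"
    then obtain a where "a \<in> inv_cocycles Y H" "A = inv_class Y H a" using c by blast
    then show "inv_pullback X G f A \<in> carrier (inv_cohomology_ring X G)"
      by (simp add: s)
  next
    fix A B assume "A \<in> carrier (inv_cohomology_ring Y H)" "B \<in> carrier (inv_cohomology_ring Y H)"
    then obtain a b where ab: "a \<in> inv_cocycles Y H" "A = inv_class Y H a" "b \<in> inv_cocycles Y H" "B = inv_class Y H b"
      using c by metis
    show "inv_pullback X G f (A \<otimes>\<^bsub>inv_cohomology_ring Y H\<^esub> B) =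
        inv_pullback X G f A \<otimes>\<^bsub>inv_cohomology_ring X G\<^esub> inv_pullback X G f B"
      using ab by (simp add: s t(2) cochain_pullback_cup [OF fc] flip: inv_class_simps(3) [OF G])
    show "inv_pullback X G f (A \<oplus>\<^bsub>inv_cohomology_ring Y H\<^esub> B) =
        inv_pullback X G f A \<oplus>\<^bsub>inv_cohomology_ring X G\<^esub> inv_pullback X G f B"
      using ab by (simp add: s t(1) cochain_pullback_add flip: inv_class_simps(2) [OF G])
  next
    show "inv_pullback X G f \<one>\<^bsub>inv_cohomology_ring Y H\<^esub> = \<one>\<^bsub>inv_cohomology_ring X G\<^esub>"
      by (simp add: t(3) s cochain_pullback_unit [OF fc])
  qed
qed

section \<open>Chain homotopies\<close>

text \<open>The combinatorics shared by the two prism operators below. \<open>M i j\<close> is face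
  j of the i-th simplex of a prism. Faces i and i + 1 are inner faces between consecutive simplices
  and telescope to the two ends \<open>\<mu> 0\<close> and \<open>\<mu> (Suc k)\<close>; all other
  faces belong to the prism over some face v and are collected in \<open>P v i\<close>.\<close>

lemma prism_sum:
  fixes M P :: "nat \<Rightarrow> nat \<Rightarrow> bit"
  assumes A: "\<And>i j. \<lbrakk>j < i; i \<le> k\<rbrakk> \<Longrightarrow> M i j = P j (i - 1)"
    and B: "\<And>i. i \<le> k \<Longrightarrow> M i i = \<mu> i"
    and C: "\<And>i. i \<le> k \<Longrightarrow> M i (Suc i) = \<mu> (Suc i)"
    and D: "\<And>i j. \<lbrakk>Suc i < j; j \<le> Suc k\<rbrakk> \<Longrightarrow> M i j = P (j - 1) i"
  shows "(\<Sum>i\<le>k. \<Sum>j\<le>Suc k. M i j) = \<mu> 0 + \<mu> (Suc k) + (\<Sum>v\<le>k. \<Sum>i<k. P v i)"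
proof -
  have 1: "(\<Sum>j\<le>Suc k. M i j) = \<mu> i + \<mu> (Suc i) + ((\<Sum>j<i. P j (i - 1)) + (\<Sum>v\<in>{Suc i..k}. P v i))"
    if "i \<le> k" for i
  proof -
    have "{..Suc k} = {..<i} \<union> {i..Suc k}"
      using that by auto
    then have "(\<Sum>j\<le>Suc k. M i j) = (\<Sum>j<i. M i j) + (\<Sum>j\<in>{i..Suc k}. M i j)"
      by (metis finite_atLeastAtMost finite_lessThan ivl_disj_int_one(4) sum.union_disjoint)
    also have "(\<Sum>j\<in>{i..Suc k}. M i j) = M i i + (M i (Suc i) + (\<Sum>j\<in>{Suc (Suc i)..Suc k}. M i j))"
      using that by (simp only: sum.atLeast_Suc_atMost le_SucI Suc_le_mono)
    also have "(\<Sum>j<i. M i j) = (\<Sum>j<i. P j (i - 1))"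
      using A that by (intro sum.cong) auto
    also have "(\<Sum>j\<in>{Suc (Suc i)..Suc k}. M i j) = (\<Sum>v\<in>{Suc i..k}. P v i)"
      by (rule sum.reindex_bij_witness [where i = Suc and j = "\<lambda>j. j - 1"]) (use D in auto)
    finally show ?thesis
      using B C that by (simp add: add_ac)
  qed
  have tel: "(\<Sum>i\<le>n. \<mu> i + \<mu> (Suc i)) = \<mu> 0 + \<mu> (Suc n)" for n
    by (induction n) (simp_all add: add_ac)
  have 2: "(\<Sum>i\<le>k. \<Sum>j<i. P j (i - 1)) = (\<Sum>i<k. \<Sum>v\<le>i. P v i)"
    by (simp add: sum.atMost_shift lessThan_Suc_atMost)
  have 3: "(\<Sum>i\<le>k. \<Sum>v\<in>{Suc i..k}. P v i) = (\<Sum>i<k. \<Sum>v\<in>{Suc i..k}. P v i)"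
    by (simp flip: lessThan_Suc_atMost)
  have 4: "(\<Sum>v\<le>i. P v i) + (\<Sum>v\<in>{Suc i..k}. P v i) = (\<Sum>v\<le>k. P v i)" if "i < k" for i
  proof -
    have "{..k} = {..i} \<union> {Suc i..k}" using that by auto
    then show ?thesis by (simp add: sum.union_disjoint)
  qed
  have "(\<Sum>i\<le>k. \<Sum>j\<le>Suc k. M i j)
      = (\<Sum>i\<le>k. \<mu> i + \<mu> (Suc i)) + ((\<Sum>i<k. \<Sum>v\<le>i. P v i) + (\<Sum>i<k. \<Sum>v\<in>{Suc i..k}. P v i))"
    unfolding 2 [symmetric] 3 [symmetric] sum.distrib [symmetric] using 1 by (intro sum.cong) auto
  also have "(\<Sum>i<k. \<Sum>v\<le>i. P v i) + (\<Sum>i<k. \<Sum>v\<in>{Suc i..k}. P v i) = (\<Sum>i<k. \<Sum>v\<le>k. P v i)"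
    unfolding sum.distrib [symmetric] using 4 by (intro sum.cong) auto
  also have "\<dots> = (\<Sum>v\<le>k. \<Sum>i<k. P v i)"
    by (rule sum.swap)
  finally show ?thesis
    by (simp only: tel)
qed

section \<open>Commutativity of the cohomology ring by reversal of the vertices\<close>

definition reversal :: "'a topology \<Rightarrow> 'a cochain \<Rightarrow> 'a cochain" where
  "reversal X c = (\<lambda>k \<sigma>. if singular_simplex k X \<sigma> then c k (simplex_act k (\<lambda>j. k - j) \<sigma>) else 0)"

text \<open>The vertex sequence 0, ..., i, k, k - 1, ..., i of a degenerate simplex. Deleting the
  first i gives 0, ..., i - 1, k, ..., i and deleting the second gives 0, ..., i, k, ..., i + 1.
  These are consecutive stages of a passage from the complete reversal to the identity, which is why
  the sum over i is a homotopy between them.\<close>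

definition fold_back :: "nat \<Rightarrow> nat \<Rightarrow> nat \<Rightarrow> nat" where
  "fold_back k i j = (if j \<le> i then j else Suc k + i - j)"

definition reversal_homotopy :: "'a topology \<Rightarrow> 'a cochain \<Rightarrow> 'a cochain" where
  "reversal_homotopy X c = (\<lambda>k \<sigma>. if singular_simplex k X \<sigma>
     then \<Sum>i\<le>k. c (Suc k) (simplex_act (Suc k) (fold_back k i) \<sigma>) else 0)"

lemma fold_back_image: "i \<le> k \<Longrightarrow> fold_back k i ` {..Suc k} \<subseteq> {..k}"
  by (auto simp: fold_back_def)

lemma reversal_homotopy:
  assumes c: "c \<in> inv_cochains X G"
  shows "reversal X c + c = coboundary X (reversal_homotopy X c) + reversal_homotopy X (coboundary X c)"
proof (intro ext)
  fix k \<sigma>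
  show "(reversal X c + c) k \<sigma> = (coboundary X (reversal_homotopy X c) + reversal_homotopy X (coboundary X c)) k \<sigma>"
  proof (cases "singular_simplex k X \<sigma>")
    case s: True
    let ?c = "\<lambda>l. c k (simplex_act k l \<sigma>)"
    \<comment> \<open>Positions after i carry the vertices in descending order. Enumerating them
      backwards makes j = i + 1 the deletion of the second i and puts the remaining faces into the
      order that \<open>prism_sum\<close> expects.\<close>
    define M where "M i j = ?c (fold_back k i \<circ> skip (if j \<le> i then j else Suc (Suc k) + i - j))" for i j
    define P where "P v i = ?c (skip v \<circ> fold_back (k - 1) i)" for v i
    define \<mu> where "\<mu> i = ?c (\<lambda>j. if j < i then j else k + i - j)" for i
    have M: "(\<Sum>i\<le>k. \<Sum>j\<le>Suc k. M i j) = \<mu> 0 + \<mu> (Suc k) + (\<Sum>v\<le>k. \<Sum>i<k. P v i)"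
    proof (rule prism_sum)
      show "M i j = P j (i - 1)" if "j < i" "i \<le> k" for i j
        unfolding M_def P_def using that
        by (intro arg_cong [where f = "c k"] simplex_act_cong) (auto simp: skip_def fold_back_def)
      show "M i i = \<mu> i" if "i \<le> k" for i
        unfolding M_def \<mu>_def using that
        by (intro arg_cong [where f = "c k"] simplex_act_cong) (auto simp: skip_def fold_back_def)
      show "M i (Suc i) = \<mu> (Suc i)" if "i \<le> k" for i
        unfolding M_def \<mu>_def using that
        by (intro arg_cong [where f = "c k"] simplex_act_cong) (auto simp: skip_def fold_back_def)
      show "M i j = P (j - 1) i" if "Suc i < j" "j \<le> Suc k" for i j
        unfolding M_def P_def using that
        by (intro arg_cong [where f = "c k"] simplex_act_cong) (auto simp: skip_def fold_back_def)
    qed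
    have "reversal_homotopy X (coboundary X c) k \<sigma> = (\<Sum>i\<le>k. \<Sum>j\<le>Suc k. ?c (fold_back k i \<circ> skip j))"
    proof -
      have "coboundary X c (Suc k) (simplex_act (Suc k) (fold_back k i) \<sigma>) = (\<Sum>j\<le>Suc k. ?c (fold_back k i \<circ> skip j))"
        if "i \<le> k" for i
      proof -
        have "simplex_act k (skip j) (simplex_act (Suc k) (fold_back k i) \<sigma>) = simplex_act k (fold_back k i \<circ> skip j) \<sigma>"
          if "j \<le> Suc k" for j
          using skip_image [OF that] by (rule simplex_act_compose)
        then show ?thesis
          using singular_simplex_simplex_act [OF s fold_back_image [OF that]]
          by (simp add: coboundary_eq del: sum.atMost_Suc)
      qed
      then show ?thesis
        using s by (simp add: reversal_homotopy_def del: sum.atMost_Suc)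
    qed
    also have "\<dots> = (\<Sum>i\<le>k. \<Sum>j\<le>Suc k. M i j)"
    proof (rule sum.cong [OF refl])
      fix i assume "i \<in> {..k}"
      then show "(\<Sum>j\<le>Suc k. ?c (fold_back k i \<circ> skip j)) = (\<Sum>j\<le>Suc k. M i j)"
        unfolding M_def
        by (intro sum.reindex_bij_witness [where i = "\<lambda>j. if j \<le> i then j else Suc (Suc k) + i - j"
              and j = "\<lambda>j. if j \<le> i then j else Suc (Suc k) + i - j"]) auto
    qed
    finally have 1: "reversal_homotopy X (coboundary X c) k \<sigma> = (\<Sum>i\<le>k. \<Sum>j\<le>Suc k. M i j)" .
    have 2: "(\<Sum>v\<le>k. \<Sum>i<k. P v i) = coboundary X (reversal_homotopy X c) k \<sigma>"
    proof (cases k)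
      case (Suc n)
      have "reversal_homotopy X c n (simplex_act n (skip v) \<sigma>) = (\<Sum>i\<le>n. P v i)" if "v \<le> k" for v
      proof -
        have v: "skip v ` {..n} \<subseteq> {..k}"
          using skip_image [of v n] that by (simp add: Suc)
        have "simplex_act (Suc n) (fold_back n i) (simplex_act n (skip v) \<sigma>) = simplex_act k (skip v \<circ> fold_back n i) \<sigma>"
          if "i \<le> n" for i
          unfolding Suc using fold_back_image [OF that] by (rule simplex_act_compose)
        then show ?thesis
          using singular_simplex_simplex_act [OF s v] unfolding reversal_homotopy_def P_def by (simp add: Suc)
      qed
      then show ?thesis
        using s by (simp add: coboundary_eq Suc lessThan_Suc_atMost del: sum.atMost_Suc)
    qed (simp add: coboundary_def)
    have "reversal_homotopy X (coboundary X c) k \<sigma>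
        = \<mu> 0 + \<mu> (Suc k) + coboundary X (reversal_homotopy X c) k \<sigma>"
      unfolding 1 M 2 ..
    moreover have "\<mu> 0 = reversal X c k \<sigma>"
      using s by (simp add: \<mu>_def reversal_def)
    moreover have "\<mu> (Suc k) = c k \<sigma>"
    proof -
      have "simplex_act k (\<lambda>j. if j < Suc k then j else k + Suc k - j) \<sigma> = simplex_act k (\<lambda>j. j) \<sigma>"
        by (rule simplex_act_cong) simp
      then show ?thesis
        using simplex_act_id [OF s] by (simp add: \<mu>_def)
    qed
    ultimately show ?thesis
      by (simp add: add_ac)
  next
    case False
    then show ?thesis
      using inv_cochain_outside [OF c] by (simp add: reversal_def coboundary_def reversal_homotopy_def)
  qed
qed

lemma reversal_cup: "reversal X (cup X a b) = cup X (reversal X b) (reversal X a)"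
proof (intro ext)
  fix k \<sigma>
  show "reversal X (cup X a b) k \<sigma> = cup X (reversal X b) (reversal X a) k \<sigma>"
  proof (cases "singular_simplex k X \<sigma>")
    case s: True
    have 1: "(\<lambda>j. k - j) ` {..k} \<subseteq> {..k}"
      by auto
    have "reversal X (cup X a b) k \<sigma> =
        (\<Sum>p\<le>k. a p (simplex_act p (\<lambda>j. k - j) \<sigma>) * b (k - p) (simplex_act (k - p) (\<lambda>j. k - (p + j)) \<sigma>))"
    proof -
      have "simplex_act p (\<lambda>j. j) (simplex_act k (\<lambda>j. k - j) \<sigma>) = simplex_act p (\<lambda>j. k - j) \<sigma>"
        "simplex_act (k - p) (\<lambda>j. p + j) (simplex_act k (\<lambda>j. k - j) \<sigma>) = simplex_act (k - p) (\<lambda>j. k - (p + j)) \<sigma>"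
        if "p \<le> k" for p
        using that by (subst simplex_act_compose; auto simp: comp_def)+
      then show ?thesis
        using s singular_simplex_simplex_act [OF s 1] by (simp add: reversal_def cup_def)
    qed
    also have "\<dots> = (\<Sum>p\<le>k. b p (simplex_act p (\<lambda>j. p - j) \<sigma>) * a (k - p) (simplex_act (k - p) (\<lambda>j. p + (k - p - j)) \<sigma>))"
    proof (rule sum.reindex_bij_witness [where i = "\<lambda>p. k - p" and j = "\<lambda>p. k - p"])
      fix p assume p: "p \<in> {..k}"
      have "simplex_act (k - (k - p)) (\<lambda>j. (k - p) + (k - (k - p) - j)) \<sigma> = simplex_act p (\<lambda>j. k - j) \<sigma>"
        using p by (simp, intro simplex_act_cong) auto
      moreover have "simplex_act (k - p) (\<lambda>j. k - p - j) \<sigma> = simplex_act (k - p) (\<lambda>j. k - (p + j)) \<sigma>"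
        by simp
      ultimately show "b (k - p) (simplex_act (k - p) (\<lambda>j. k - p - j) \<sigma>) *
          a (k - (k - p)) (simplex_act (k - (k - p)) (\<lambda>j. k - p + (k - (k - p) - j)) \<sigma>) =
          a p (simplex_act p (\<lambda>j. k - j) \<sigma>) * b (k - p) (simplex_act (k - p) (\<lambda>j. k - (p + j)) \<sigma>)"
        using p by (simp add: mult.commute)
    qed auto
    also have "\<dots> = cup X (reversal X b) (reversal X a) k \<sigma>"
    proof -
      have "reversal X b p (simplex_act p (\<lambda>j. j) \<sigma>) = b p (simplex_act p (\<lambda>j. p - j) \<sigma>)"
        "reversal X a (k - p) (simplex_act (k - p) (\<lambda>j. p + j) \<sigma>)
          = a (k - p) (simplex_act (k - p) (\<lambda>j. p + (k - p - j)) \<sigma>)"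
        if "p \<le> k" for p
      proof -
        have p: "(\<lambda>j. j) ` {..p} \<subseteq> {..k}" "(\<lambda>j. p + j) ` {..k - p} \<subseteq> {..k}"
          using that by auto
        have "simplex_act p (\<lambda>j. p - j) (simplex_act p (\<lambda>j. j) \<sigma>) = simplex_act p (\<lambda>j. p - j) \<sigma>"
          "simplex_act (k - p) (\<lambda>j. k - p - j) (simplex_act (k - p) (\<lambda>j. p + j) \<sigma>)
            = simplex_act (k - p) (\<lambda>j. p + (k - p - j)) \<sigma>"
          by (subst simplex_act_compose; auto simp: comp_def)+
        then show "reversal X b p (simplex_act p (\<lambda>j. j) \<sigma>) = b p (simplex_act p (\<lambda>j. p - j) \<sigma>)"
          "reversal X a (k - p) (simplex_act (k - p) (\<lambda>j. p + j) \<sigma>)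
            = a (k - p) (simplex_act (k - p) (\<lambda>j. p + (k - p - j)) \<sigma>)"
          using singular_simplex_simplex_act [OF s p(1)] singular_simplex_simplex_act [OF s p(2)]
          by (simp_all add: reversal_def del: diff_diff_left)
      qed
      then show ?thesis
        using s by (simp add: cup_def)
    qed
    finally show ?thesis .
  qed (simp add: reversal_def cup_def)
qed

lemma inv_cochains_reversal_homotopy:
  assumes G: "acts_on X G" and c: "c \<in> inv_cochains X G"
  shows "reversal_homotopy X c \<in> inv_cochains X G"
proof -
  have "finite {k. reversal_homotopy X c k \<noteq> 0}"
  proof (rule finite_subset)
    show "{k. reversal_homotopy X c k \<noteq> 0} \<subseteq> (\<lambda>k. k - 1) ` {k. c k \<noteq> 0}"
    proof
      fix k assume "k \<in> {k. reversal_homotopy X c k \<noteq> 0}"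
      then obtain \<sigma> where "reversal_homotopy X c k \<sigma> \<noteq> 0"
        by (auto simp: fun_eq_iff)
      then have "c (Suc k) \<noteq> 0"
        by (auto simp: reversal_homotopy_def split: if_splits)
      then show "k \<in> (\<lambda>k. k - 1) ` {k. c k \<noteq> 0}"
        by (intro image_eqI [of _ _ "Suc k"]) simp_all
    qed
  qed (use c in \<open>simp add: inv_cochains_iff\<close>)
  moreover have "reversal_homotopy X c k (simplex_map k g \<sigma>) = reversal_homotopy X c k \<sigma>"
    if "g \<in> G" "singular_simplex k X \<sigma>" for g k \<sigma>
    using that acts_on_simplex [OF G that] fold_back_image inv_simplex_act [OF c that]
    by (simp add: reversal_homotopy_def)
  moreover have "reversal_homotopy X c k \<sigma> = 0" if "\<not> singular_simplex k X \<sigma>" for k \<sigma>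
    using that by (simp add: reversal_homotopy_def)
  ultimately show ?thesis
    by (auto simp: inv_cochains_iff invariant_cochain_def)
qed

lemma reversal_homotopic:
  assumes G: "acts_on X G" and c: "c \<in> inv_cocycles X G"
  shows "reversal X c + c \<in> inv_coboundaries X G"
proof -
  have c': "c \<in> inv_cochains X G" "coboundary X c = 0"
    using c by (auto simp: inv_cocycles_def)
  have "reversal_homotopy X 0 = 0"
    by (intro ext) (simp add: reversal_homotopy_def)
  then have "reversal X c + c = coboundary X (reversal_homotopy X c)"
    using reversal_homotopy [OF c'(1)] c' by simp
  with inv_cochains_reversal_homotopy [OF G c'(1)] show ?thesis
    by (auto simp: inv_coboundaries_def)
qed

text \<open>
  Reversing the order of the vertices is an antihomomorphism for the cup product and homotopic to
  the identity.
\<close>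

theorem cring_inv_cohomology_ring:
  assumes G: "acts_on X G"
  shows "cring (inv_cohomology_ring X G)"
proof (rule cring.intro [OF ring_inv_cohomology_ring [OF G]])
  interpret ring "inv_cohomology_ring X G"
    by (rule ring_inv_cohomology_ring [OF G])
  show "comm_monoid (inv_cohomology_ring X G)"
  proof
    fix A B assume "A \<in> carrier (inv_cohomology_ring X G)" "B \<in> carrier (inv_cohomology_ring X G)"
    then obtain a b where ab: "a \<in> inv_cocycles X G" "A = inv_class X G a" "b \<in> inv_cocycles X G" "B = inv_class X G b"
      by (auto simp: inv_cohomology_carrier)
    have r: "inv_class X G (reversal X c) = inv_class X G c" "reversal X c \<in> inv_cocycles X G"
      if "c \<in> inv_cocycles X G" for c
    proof -
      show "inv_class X G (reversal X c) = inv_class X G c"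
        using reversal_homotopic [OF G that] by (simp add: inv_class_eq_iff)
      have "reversal X c = (reversal X c + c) + c"
        by (simp add: add.assoc)
      then show "reversal X c \<in> inv_cocycles X G"
        using reversal_homotopic [OF G that] inv_coboundaries_subset [OF G] inv_cocycles_closed(3) [OF G] that
        by (metis subsetD)
    qed
    note s = inv_class_simps(3) [OF G]
    have "A \<otimes>\<^bsub>inv_cohomology_ring X G\<^esub> B = inv_class X G (cup X a b)"
      using ab by (simp add: s)
    also have "\<dots> = inv_class X G (reversal X (cup X a b))"
      using ab by (simp add: r inv_cocycles_closed(4) [OF G])
    also have "\<dots> = B \<otimes>\<^bsub>inv_cohomology_ring X G\<^esub> A"
      using ab by (simp add: reversal_cup s r)
    finally show "A \<otimes>\<^bsub>inv_cohomology_ring X G\<^esub> B = B \<otimes>\<^bsub>inv_cohomology_ring X G\<^esub> A" .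
  qed
qed

section \<open>Homotopy invariance\<close>

definition prism_simplex ::
    "('a \<times> real \<Rightarrow> 'b) \<Rightarrow> nat \<Rightarrow> (nat \<Rightarrow> nat) \<Rightarrow> (nat \<Rightarrow> bool) \<Rightarrow> ((nat \<Rightarrow> real) \<Rightarrow> 'a) \<Rightarrow> (nat \<Rightarrow> real) \<Rightarrow> 'b" where
  "prism_simplex F m l \<theta> \<sigma> =
    (\<lambda>x\<in>standard_simplex m. F (\<sigma> (vertex_map m l x), \<Sum>j\<le>m. if \<theta> j then x j else 0))"

text \<open>In \<open>prism_simplex\<close> vertex j lies over vertex \<open>l j\<close>, at time 1
  if \<open>\<theta> j\<close> holds and at time 0 otherwise. The i-th simplex of the prism runs
  through 0, ..., i at time 0 and then through i, ..., k at time 1.\<close>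

definition homotopy_operator :: "'a topology \<Rightarrow> ('a \<times> real \<Rightarrow> 'b) \<Rightarrow> 'b cochain \<Rightarrow> 'a cochain" where
  "homotopy_operator X F c = (\<lambda>k \<sigma>. if singular_simplex k X \<sigma> then
     \<Sum>i\<le>k. c (Suc k) (prism_simplex F (Suc k) (\<lambda>j. if j \<le> i then j else j - 1) (\<lambda>j. j > i) \<sigma>) else 0)"

lemma prism_time:
  assumes "x \<in> standard_simplex m"
  shows "(\<Sum>j\<le>m. if \<theta> j then x j else 0) \<in> {0..1}"
proof -
  have x: "\<And>i. 0 \<le> x i" "sum x {..m} = 1"
    using assms by (auto simp: standard_simplex_def)
  have "(\<Sum>j\<le>m. if \<theta> j then x j else 0) \<le> sum x {..m}"
    using x by (intro sum_mono) auto
  then show ?thesis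
    using x by (auto intro!: sum_nonneg)
qed

lemma singular_simplex_prism_simplex:
  assumes F: "continuous_map (prod_topology X (top_of_set {0..1})) Y F"
    and s: "singular_simplex k X \<sigma>" and l: "l ` {..m} \<subseteq> {..k}"
  shows "singular_simplex m Y (prism_simplex F m l \<theta> \<sigma>)"
proof -
  let ?S = "subtopology (powertop_real UNIV) (standard_simplex m)"
  have "continuous_map ?S X (\<sigma> \<circ> vertex_map m l)"
    using s continuous_map_compose [OF continuous_map_vertex_map_simplex [OF l]]
    by (auto simp: singular_simplex_def)
  moreover have "continuous_map ?S euclideanreal (\<lambda>x. \<Sum>j\<le>m. if \<theta> j then x j else 0)"
  proof -
    have "continuous_map ?S euclideanreal (\<lambda>x. if \<theta> j then x j else 0)" for j
      by (cases "\<theta> j") (auto intro: continuous_map_from_subtopology continuous_map_product_projection)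
    then show ?thesis
      by (intro continuous_map_sum) auto
  qed
  then have "continuous_map ?S (top_of_set {0..1}) (\<lambda>x. \<Sum>j\<le>m. if \<theta> j then x j else 0)"
    using prism_time by (auto simp: continuous_map_in_subtopology)
  ultimately have "continuous_map ?S (prod_topology X (top_of_set {0..1}))
      (\<lambda>x. (\<sigma> (vertex_map m l x), \<Sum>j\<le>m. if \<theta> j then x j else 0))"
    by (simp add: continuous_map_pairwise comp_def)
  from continuous_map_compose [OF this F] show ?thesis
    by (simp add: singular_simplex_def prism_simplex_def comp_def)
qed

lemma prism_simplex_act:
  assumes "l' ` {..p} \<subseteq> {..m}"
  shows "simplex_act p l' (prism_simplex F m l \<theta> \<sigma>) = prism_simplex F p (l \<circ> l') (\<theta> \<circ> l') \<sigma>"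
proof -
  have "(\<Sum>j\<le>m. if \<theta> j then vertex_map p l' x j else 0) = (\<Sum>i\<le>p. if \<theta> (l' i) then x i else 0)" for x
  proof -
    have "(\<Sum>j\<le>m. if \<theta> j then vertex_map p l' x j else 0) = (\<Sum>j\<le>m. \<Sum>i\<le>p. if \<theta> j \<and> l' i = j then x i else 0)"
      unfolding vertex_map_def by (intro sum.cong) auto
    also have "\<dots> = (\<Sum>i\<le>p. \<Sum>j\<le>m. if \<theta> j \<and> l' i = j then x i else 0)"
      by (rule sum.swap)
    also have "\<dots> = (\<Sum>i\<le>p. \<Sum>j\<le>m. if j = l' i then (if \<theta> (l' i) then x i else 0) else 0)"
      by (intro sum.cong) auto
    also have "\<dots> = (\<Sum>i\<le>p. if \<theta> (l' i) then x i else 0)"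
      using assms by (intro sum.cong) auto
    finally show ?thesis .
  qed
  then show ?thesis
    using vertex_map_in_simplex [OF assms] vertex_map_compose [OF assms, of l]
    by (auto simp: simplex_act_def prism_simplex_def intro!: restrict_ext)
qed

lemma prism_simplex_of_act:
  assumes "l ` {..m} \<subseteq> {..k}"
  shows "prism_simplex F m l \<theta> (simplex_act k l' \<sigma>) = prism_simplex F m (l' \<circ> l) \<theta> \<sigma>"
  using vertex_map_in_simplex [OF assms] vertex_map_compose [OF assms, of l']
  by (auto simp: simplex_act_def prism_simplex_def intro!: restrict_ext)

lemma prism_simplex_cong:
  assumes "\<And>j. j \<le> m \<Longrightarrow> l j = l' j" "\<And>j. j \<le> m \<Longrightarrow> \<theta> j = \<theta>' j"
  shows "prism_simplex F m l \<theta> \<sigma> = prism_simplex F m l' \<theta>' \<sigma>"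
proof -
  have "vertex_map m l x = vertex_map m l' x" for x
    using assms(1) by (simp add: vertex_map_def)
  moreover have "(\<Sum>j\<le>m. if \<theta> j then x j else 0) = (\<Sum>j\<le>m. if \<theta>' j then x j else 0)" for x :: "nat \<Rightarrow> real"
    using assms(2) by (intro sum.cong) auto
  ultimately show ?thesis
    by (simp add: prism_simplex_def)
qed

lemma homotopy_operator:
  assumes F: "continuous_map (prod_topology X (top_of_set {0..1})) Y F"
  shows "cochain_pullback X (\<lambda>x. F (x, 0)) c + cochain_pullback X (\<lambda>x. F (x, 1)) c
    = coboundary X (homotopy_operator X F c) + homotopy_operator X F (coboundary Y c)"
proof (intro ext)
  fix k \<sigma>
  let ?d = "\<lambda>i j. if j \<le> i then j else j - 1 :: nat"
  have d: "?d i ` {..Suc n} \<subseteq> {..n}" if "i \<le> n" for i n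
    using that by auto
  show "(cochain_pullback X (\<lambda>x. F (x, 0)) c + cochain_pullback X (\<lambda>x. F (x, 1)) c) k \<sigma>
    = (coboundary X (homotopy_operator X F c) + homotopy_operator X F (coboundary Y c)) k \<sigma>"
  proof (cases "singular_simplex k X \<sigma>")
    case s: True
    let ?c = "\<lambda>l \<theta>. c k (prism_simplex F k l \<theta> \<sigma>)"
    define M where "M i j = ?c (?d i \<circ> skip j) ((\<lambda>a. a > i) \<circ> skip j)" for i j
    define P where "P v i = ?c (skip v \<circ> ?d i) (\<lambda>a. a > i)" for v i
    \<comment> \<open>The stage at which the vertices from i on have been moved to time 1: i = 0 is
      the end of the homotopy and i = k + 1 its beginning.\<close>
    define \<mu> where "\<mu> i = ?c (\<lambda>j. j) (\<lambda>a. a \<ge> i)" for i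
    have M: "(\<Sum>i\<le>k. \<Sum>j\<le>Suc k. M i j) = \<mu> 0 + \<mu> (Suc k) + (\<Sum>v\<le>k. \<Sum>i<k. P v i)"
    proof (rule prism_sum)
      show "M i j = P j (i - 1)" if "j < i" "i \<le> k" for i j
        unfolding M_def P_def using that
        by (intro arg_cong [where f = "c k"] prism_simplex_cong) (auto simp: skip_def)
      show "M i i = \<mu> i" if "i \<le> k" for i
        unfolding M_def \<mu>_def using that
        by (intro arg_cong [where f = "c k"] prism_simplex_cong) (auto simp: skip_def)
      show "M i (Suc i) = \<mu> (Suc i)" if "i \<le> k" for i
        unfolding M_def \<mu>_def using that
        by (intro arg_cong [where f = "c k"] prism_simplex_cong) (auto simp: skip_def)
      show "M i j = P (j - 1) i" if "Suc i < j" "j \<le> Suc k" for i j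
        unfolding M_def P_def using that
        by (intro arg_cong [where f = "c k"] prism_simplex_cong) (auto simp: skip_def)
    qed
    have 1: "homotopy_operator X F (coboundary Y c) k \<sigma> = (\<Sum>i\<le>k. \<Sum>j\<le>Suc k. M i j)"
    proof -
      have "coboundary Y c (Suc k) (prism_simplex F (Suc k) (?d i) (\<lambda>j. j > i) \<sigma>) = (\<Sum>j\<le>Suc k. M i j)"
        if "i \<le> k" for i
      proof -
        have "c k (simplex_act k (skip j) (prism_simplex F (Suc k) (?d i) (\<lambda>j. j > i) \<sigma>)) = M i j"
          if "j \<le> Suc k" for j
          unfolding M_def using skip_image [OF that] by (subst prism_simplex_act) auto
        then show ?thesis
          using singular_simplex_prism_simplex [OF F s d [OF that]]
          by (simp add: coboundary_eq del: sum.atMost_Suc)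
      qed
      then show ?thesis
        using s by (simp add: homotopy_operator_def del: sum.atMost_Suc)
    qed
    have 2: "(\<Sum>v\<le>k. \<Sum>i<k. P v i) = coboundary X (homotopy_operator X F c) k \<sigma>"
    proof (cases k)
      case (Suc n)
      have "homotopy_operator X F c n (simplex_act n (skip v) \<sigma>) = (\<Sum>i\<le>n. P v i)" if "v \<le> k" for v
      proof -
        have v: "skip v ` {..n} \<subseteq> {..k}"
          using skip_image [of v n] that by (simp add: Suc)
        have "c (Suc n) (prism_simplex F (Suc n) (?d i) (\<lambda>j. j > i) (simplex_act n (skip v) \<sigma>)) = P v i"
          if "i \<le> n" for i
          unfolding P_def Suc using d [OF that] by (subst prism_simplex_of_act) auto
        then show ?thesis
          using singular_simplex_simplex_act [OF s v] unfolding homotopy_operator_def by simp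
      qed
      then show ?thesis
        using s by (simp add: coboundary_eq Suc lessThan_Suc_atMost del: sum.atMost_Suc)
    qed (simp add: coboundary_def)
    have "\<mu> 0 = cochain_pullback X (\<lambda>x. F (x, 1)) c k \<sigma>"
    proof -
      have "prism_simplex F k (\<lambda>j. j) (\<lambda>a. a \<ge> 0) \<sigma> = simplex_map k (\<lambda>x. F (x, 1)) \<sigma>"
        by (auto simp: prism_simplex_def simplex_map_def vertex_map_id standard_simplex_def intro!: restrict_ext)
      then show ?thesis
        using s by (simp add: \<mu>_def cochain_pullback_def)
    qed
    moreover have "\<mu> (Suc k) = cochain_pullback X (\<lambda>x. F (x, 0)) c k \<sigma>"
    proof -
      have "prism_simplex F k (\<lambda>j. j) (\<lambda>a. a \<ge> Suc k) \<sigma> = simplex_map k (\<lambda>x. F (x, 0)) \<sigma>"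
        by (auto simp: prism_simplex_def simplex_map_def vertex_map_id intro!: restrict_ext)
      then show ?thesis
        using s by (simp add: \<mu>_def cochain_pullback_def)
    qed
    ultimately show ?thesis
      unfolding plus_fun_apply 1 M 2 by (simp add: add_ac)
  qed (simp add: cochain_pullback_def coboundary_def homotopy_operator_def)
qed

text \<open>A generator must be matched by the same alternative, with the same h, at all times. The
  prism over a moved simplex is then the unchanged or the moved prism, so the homotopy operator
  produces an invariant cochain.\<close>

lemma homotopic_pullback:
  fixes F :: "'a \<times> real \<Rightarrow> 'b"
  assumes F: "continuous_map (prod_topology X (top_of_set {0..1})) Y F"
    and G: "acts_on X G" and c: "c \<in> inv_cocycles Y H"
    and FG: "\<And>g. g \<in> G \<Longrightarrow> (\<forall>x\<in>topspace X. \<forall>t\<in>{0..1}. F (g x, t) = F (x, t)) \<or>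
      (\<exists>h\<in>H. \<forall>x\<in>topspace X. \<forall>t\<in>{0..1}. F (g x, t) = h (F (x, t)))"
  shows "cochain_pullback X (\<lambda>x. F (x, 0)) c + cochain_pullback X (\<lambda>x. F (x, 1)) c \<in> inv_coboundaries X G"
proof -
  have c': "c \<in> inv_cochains Y H" "coboundary Y c = 0"
    using c by (auto simp: inv_cocycles_def)
  let ?h = "homotopy_operator X F c"
  have "finite {k. ?h k \<noteq> 0}"
  proof (rule finite_subset)
    show "{k. ?h k \<noteq> 0} \<subseteq> (\<lambda>k. k - 1) ` {k. c k \<noteq> 0}"
    proof
      fix k assume "k \<in> {k. ?h k \<noteq> 0}"
      then obtain \<sigma> where "?h k \<sigma> \<noteq> 0"
        by (auto simp: fun_eq_iff)
      then have "c (Suc k) \<noteq> 0"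
        by (auto simp: homotopy_operator_def split: if_splits)
      then show "k \<in> (\<lambda>k. k - 1) ` {k. c k \<noteq> 0}"
        by (intro image_eqI [of _ _ "Suc k"]) simp_all
    qed
  qed (use c'(1) in \<open>simp add: inv_cochains_iff\<close>)
  moreover have "?h k (simplex_map k g \<sigma>) = ?h k \<sigma>"
    if g: "g \<in> G" and s: "singular_simplex k X \<sigma>" for g k \<sigma>
  proof -
    have sX: "\<sigma> x \<in> topspace X" if "x \<in> standard_simplex k" for x
      using s that by (auto simp: singular_simplex_def continuous_map_def)
    have "c m (prism_simplex F m l \<theta> (simplex_map k g \<sigma>)) = c m (prism_simplex F m l \<theta> \<sigma>)"
      if l: "l ` {..m} \<subseteq> {..k}" for l m \<theta>
      using FG [OF g]
    proof
      assume *: "\<forall>x\<in>topspace X. \<forall>t\<in>{0..1}. F (g x, t) = F (x, t)"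
      have "prism_simplex F m l \<theta> (simplex_map k g \<sigma>) = prism_simplex F m l \<theta> \<sigma>"
        using vertex_map_in_simplex [OF l] sX * prism_time
        by (auto simp: prism_simplex_def simplex_map_def intro!: restrict_ext)
      then show ?thesis by simp
    next
      assume "\<exists>h\<in>H. \<forall>x\<in>topspace X. \<forall>t\<in>{0..1}. F (g x, t) = h (F (x, t))"
      then obtain h where h: "h \<in> H" "\<And>x t. x \<in> topspace X \<Longrightarrow> t \<in> {0..1} \<Longrightarrow> F (g x, t) = h (F (x, t))"
        by blast
      have "prism_simplex F m l \<theta> (simplex_map k g \<sigma>) = simplex_map m h (prism_simplex F m l \<theta> \<sigma>)"
        using vertex_map_in_simplex [OF l] sX h(2) prism_time
        by (auto simp: prism_simplex_def simplex_map_def intro!: restrict_ext)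
      then show ?thesis
        using c'(1) h(1) singular_simplex_prism_simplex [OF F s l]
        by (simp add: inv_cochains_iff invariant_cochain_def)
    qed
    moreover have "(\<lambda>j. if j \<le> i then j else j - 1) ` {..Suc k} \<subseteq> {..k}" if "i \<le> k" for i
      using that by auto
    ultimately show ?thesis
      using s acts_on_simplex [OF G g s] by (simp add: homotopy_operator_def)
  qed
  moreover have "?h k \<sigma> = 0" if "\<not> singular_simplex k X \<sigma>" for k \<sigma>
    using that by (simp add: homotopy_operator_def)
  ultimately have "?h \<in> inv_cochains X G"
    by (auto simp: inv_cochains_iff invariant_cochain_def)
  moreover have "homotopy_operator X F 0 = 0"
    by (intro ext) (simp add: homotopy_operator_def)
  ultimately show ?thesis
    using homotopy_operator [OF F, of c] c'(2) by (auto simp: inv_coboundaries_def)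
qed

section \<open>Evaluation on chains and barycentric subdivision\<close>

text \<open>The pairing of a cochain in one degree with an integral chain, reduced modulo two. It
  transfers subdivision from singular chains to cochains.\<close>

definition eval_chain :: "(((nat \<Rightarrow> real) \<Rightarrow> 'a) \<Rightarrow> bit) \<Rightarrow> 'a chain \<Rightarrow> bit" where
  "eval_chain f c = (\<Sum>\<sigma>\<in>Poly_Mapping.keys c. of_int (Poly_Mapping.lookup c \<sigma>) * f \<sigma>)"

lemma eval_chain_superset:
  assumes "finite A" "Poly_Mapping.keys c \<subseteq> A"
  shows "eval_chain f c = (\<Sum>\<sigma>\<in>A. of_int (Poly_Mapping.lookup c \<sigma>) * f \<sigma>)"
  unfolding eval_chain_def using assms
  by (intro sum.mono_neutral_left) (auto simp: in_keys_iff)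

lemma eval_chain_0 [simp]: "eval_chain f 0 = 0"
  by (simp add: eval_chain_def)

lemma eval_chain_of [simp]: "eval_chain f (frag_of \<sigma>) = f \<sigma>"
  by (simp add: eval_chain_def)

lemma eval_chain_add: "eval_chain f (a + b) = eval_chain f a + eval_chain f b"
proof -
  let ?A = "Poly_Mapping.keys a \<union> Poly_Mapping.keys b"
  have "eval_chain f c = (\<Sum>\<sigma>\<in>?A. of_int (Poly_Mapping.lookup c \<sigma>) * f \<sigma>)" if "c \<in> {a, b, a + b}" for c
    using that keys_add [of a b] by (intro eval_chain_superset) auto
  then show ?thesis
    by (simp add: lookup_add distrib_right sum.distrib)
qed

lemma eval_chain_cmul: "eval_chain f (frag_cmul n c) = of_int n * eval_chain f c"
proof -
  have "eval_chain f (frag_cmul n c) = (\<Sum>\<sigma>\<in>Poly_Mapping.keys c. of_int (Poly_Mapping.lookup (frag_cmul n c) \<sigma>) * f \<sigma>)"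
    by (intro eval_chain_superset) (auto simp: in_keys_iff)
  then show ?thesis
    by (simp add: eval_chain_def sum_distrib_left mult.assoc)
qed

lemma eval_chain_minus [simp]: "eval_chain f (- c) = eval_chain f c"
  using eval_chain_cmul [of f "-1" c] by simp

lemma eval_chain_diff: "eval_chain f (a - b) = eval_chain f a + eval_chain f b"
  using eval_chain_add [of f a "- b"] by simp

lemma eval_chain_sum: "eval_chain f (sum g I) = (\<Sum>i\<in>I. eval_chain f (g i))"
  by (induction I rule: infinite_finite_induct) (simp_all add: eval_chain_add)

lemma eval_chain_cong:
  assumes "\<And>\<sigma>. \<sigma> \<in> Poly_Mapping.keys c \<Longrightarrow> f \<sigma> = g \<sigma>"
  shows "eval_chain f c = eval_chain g c"
  using assms by (simp add: eval_chain_def)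

lemma eval_chain_extend: "eval_chain f (frag_extend b c) = eval_chain (\<lambda>\<sigma>. eval_chain f (b \<sigma>)) c"
  by (simp add: frag_extend_def eval_chain_sum eval_chain_cmul eval_chain_def [of _ c])

lemma eval_chain_map: "eval_chain f (chain_map p g c) = eval_chain (\<lambda>\<sigma>. f (simplex_map p g \<sigma>)) c"
  by (simp add: chain_map_def eval_chain_extend)

lemma eval_chain_boundary:
  assumes "singular_chain (Suc p) X ch"
  shows "eval_chain (c p) (chain_boundary (Suc p) ch) = eval_chain (coboundary X c (Suc p)) ch"
proof -
  have "eval_chain (c p) (chain_boundary (Suc p) ch)
      = eval_chain (\<lambda>\<sigma>. \<Sum>k\<le>Suc p. c p (singular_face (Suc p) k \<sigma>)) ch"
    by (simp add: chain_boundary_def eval_chain_extend eval_chain_sum eval_chain_cmul eval_chain_add)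
  also have "\<dots> = eval_chain (coboundary X c (Suc p)) ch"
    using assms by (intro eval_chain_cong) (auto simp: coboundary_def singular_chain_def)
  finally show ?thesis .
qed

text \<open>The homotopy for the identity of the standard simplex, transported along each simplex.
  Defined in this way it is natural in the space, and naturality is what makes its dual preserve
  invariance.\<close>

definition subdivision_chain_homotopy :: "nat \<Rightarrow> 'a chain \<Rightarrow> 'a chain" where
  "subdivision_chain_homotopy p =
    frag_extend (\<lambda>f. chain_map (Suc p) f (subd p (frag_of (restrict id (standard_simplex p)))))"

lemma chain_map_simplicial_cong:
  assumes "simplicial_chain q S d" "\<And>x. x \<in> S \<Longrightarrow> f x = g x"
  shows "chain_map q f d = chain_map q g d"
proof (rule chain_map_eq)
  show "singular_chain q (subtopology (powertop_real UNIV) S) d"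
    by (rule simplicial_imp_singular_chain [OF assms(1)])
qed (use assms(2) in auto)

text \<open>Everything is transported from the universal case, the identity of the standard simplex.
  What remains is the boundary term: the homotopy of a face of the model is the image, under the
  inclusion of that face, of the homotopy of the smaller model.\<close>

lemma subdivision_chain_homotopy_boundary:
  assumes s: "singular_simplex p X \<sigma>"
  shows "chain_boundary (Suc p) (subdivision_chain_homotopy p (frag_of \<sigma>))
      + subdivision_chain_homotopy (p - 1) (chain_boundary p (frag_of \<sigma>))
    = singular_subdivision p (frag_of \<sigma>) - frag_of \<sigma>"
proof -
  let ?\<iota> = "\<lambda>p. frag_of (restrict id (standard_simplex p)) :: (nat \<Rightarrow> real) chain"
  let ?T = "subtopology (powertop_real UNIV) (standard_simplex p)"
  have \<iota>: "simplicial_chain q (standard_simplex q) (?\<iota> q)" for q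
    by simp
  have D: "simplicial_chain (Suc q) (standard_simplex q) (subd q (?\<iota> q))" for q
    by (rule chain_homotopic_simplicial_subdivision2 [OF \<iota>])
  have "chain_boundary (Suc p) (subdivision_chain_homotopy p (frag_of \<sigma>))
      = chain_map p \<sigma> (chain_boundary (Suc p) (subd p (?\<iota> p)))"
    using chain_boundary_chain_map [OF simplicial_imp_singular_chain [OF D [of p]], of \<sigma>]
    by (simp add: subdivision_chain_homotopy_def)
  also have "\<dots> = singular_subdivision p (frag_of \<sigma>) - frag_of \<sigma> - chain_map p \<sigma> (subd (p - 1) (chain_boundary p (?\<iota> p)))"
    using chain_homotopic_simplicial_subdivision3 [OF \<iota> [of p]] singular_simplex_chain_map_id [OF s]
    by (simp add: chain_map_diff singular_subdivision_def)
  also have "chain_map p \<sigma> (subd (p - 1) (chain_boundary p (?\<iota> p)))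
      = subdivision_chain_homotopy (p - 1) (chain_boundary p (frag_of \<sigma>))"
  proof (cases p)
    case 0
    then show ?thesis
      by (simp add: chain_boundary_def subdivision_chain_homotopy_def)
  next
    case (Suc n)
    have 1: "chain_map p \<sigma> (subd n (frag_of (singular_face p k id)))
        = subdivision_chain_homotopy n (frag_of (singular_face p k \<sigma>))"
      if k: "k \<le> p" for k
    proof -
      have ss: "simplicial_simplex n (standard_simplex p) (singular_face p k id)"
        using simplicial_simplex_singular_face [of p "standard_simplex p" "restrict id (standard_simplex p)" k] k
        by (simp add: Suc)
      have "chain_map n (singular_face p k id) (?\<iota> n) = frag_of (singular_face p k id)"
        using singular_simplex_chain_map_id simplicial_imp_singular_simplex [OF ss] by blast
      then have "subd n (frag_of (singular_face p k id)) = chain_map (Suc n) (singular_face p k id) (subd n (?\<iota> n))"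
        using chain_homotopic_simplicial_subdivision1 [OF \<iota> ss] by simp
      then have "chain_map p \<sigma> (subd n (frag_of (singular_face p k id)))
          = chain_map p (\<sigma> \<circ> singular_face p k id) (subd n (?\<iota> n))"
        by (simp add: chain_map_compose Suc)
      also have "\<dots> = chain_map p (singular_face p k \<sigma>) (subd n (?\<iota> n))"
      proof (rule chain_map_simplicial_cong)
        show "simplicial_chain p (standard_simplex n) (subd n (?\<iota> n))"
          using D [of n] by (simp add: Suc)
      qed (simp add: singular_face_def Suc)
      finally show ?thesis
        by (simp add: subdivision_chain_homotopy_def Suc)
    qed
    have "chain_map p \<sigma> (subd n (chain_boundary p (?\<iota> p)))
        = chain_map p \<sigma> (\<Sum>k\<le>p. frag_cmul ((-1) ^ k) (subd n (frag_of (singular_face p k id))))"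
      by (simp add: chain_boundary_of Suc subd_power_sum subd_power_uminus comp_def del: sum.atMost_Suc subd.simps)
    also have "\<dots> = (\<Sum>k\<le>p. frag_cmul ((-1) ^ k) (subdivision_chain_homotopy n (frag_of (singular_face p k \<sigma>))))"
      using 1 by (simp add: chain_map_sum comp_def del: subd.simps)
    also have "\<dots> = subdivision_chain_homotopy n (chain_boundary p (frag_of \<sigma>))"
      by (simp add: chain_boundary_of Suc subdivision_chain_homotopy_def frag_extend_sum frag_extend_cmul comp_def
          del: sum.atMost_Suc)
    finally show ?thesis
      by (simp add: Suc del: subd.simps)
  qed
  finally show ?thesis
    by simp
qed

lemma singular_chain_subdivision_chain_homotopy:
  assumes "singular_simplex p X \<sigma>"
  shows "singular_chain (Suc p) X (subdivision_chain_homotopy p (frag_of \<sigma>))"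
proof -
  have "simplicial_chain (Suc p) (standard_simplex p) (subd p (frag_of (restrict id (standard_simplex p))))"
    by (rule chain_homotopic_simplicial_subdivision2) simp
  then have "singular_chain (Suc p) X (chain_map (Suc p) \<sigma> (subd p (frag_of (restrict id (standard_simplex p)))))"
    using assms by (intro singular_chain_chain_map [OF simplicial_imp_singular_chain]) (auto simp: singular_simplex_def)
  then show ?thesis
    by (simp add: subdivision_chain_homotopy_def)
qed

lemma subdivision_chain_homotopy_natural:
  "subdivision_chain_homotopy p (frag_of (simplex_map p g \<sigma>))
    = chain_map (Suc p) g (subdivision_chain_homotopy p (frag_of \<sigma>))"
proof -
  have D: "simplicial_chain (Suc p) (standard_simplex p) (subd p (frag_of (restrict id (standard_simplex p))))"
    by (rule chain_homotopic_simplicial_subdivision2) simp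
  have "chain_map (Suc p) (simplex_map p g \<sigma>) (subd p (frag_of (restrict id (standard_simplex p))))
      = chain_map (Suc p) (g \<circ> \<sigma>) (subd p (frag_of (restrict id (standard_simplex p))))"
    by (rule chain_map_simplicial_cong [OF D]) (simp add: simplex_map_def)
  then show ?thesis
    by (simp add: subdivision_chain_homotopy_def chain_map_compose)
qed

section \<open>Subdivision of cochains and small simplices\<close>

definition cochain_subdivision :: "'a topology \<Rightarrow> 'a cochain \<Rightarrow> 'a cochain" where
  "cochain_subdivision X c = (\<lambda>k \<sigma>. if singular_simplex k X \<sigma>
     then eval_chain (c k) (singular_subdivision k (frag_of \<sigma>)) else 0)"

definition subdivision_homotopy :: "'a topology \<Rightarrow> 'a cochain \<Rightarrow> 'a cochain" where
  "subdivision_homotopy X c = (\<lambda>k \<sigma>. if singular_simplex k X \<sigma>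
     then eval_chain (c (Suc k)) (subdivision_chain_homotopy k (frag_of \<sigma>)) else 0)"

lemma subdivision_homotopy:
  assumes c: "c \<in> inv_cochains X G"
  shows "coboundary X (subdivision_homotopy X c) + subdivision_homotopy X (coboundary X c)
    = cochain_subdivision X c + c"
proof (intro ext)
  fix k \<sigma>
  show "(coboundary X (subdivision_homotopy X c) + subdivision_homotopy X (coboundary X c)) k \<sigma>
    = (cochain_subdivision X c + c) k \<sigma>"
  proof (cases "singular_simplex k X \<sigma>")
    case s: True
    have 1: "subdivision_homotopy X (coboundary X c) k \<sigma>
        = eval_chain (c k) (chain_boundary (Suc k) (subdivision_chain_homotopy k (frag_of \<sigma>)))"
      using eval_chain_boundary [OF singular_chain_subdivision_chain_homotopy [OF s]] s
      by (simp add: subdivision_homotopy_def)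
    have 2: "coboundary X (subdivision_homotopy X c) k \<sigma>
        = eval_chain (c k) (subdivision_chain_homotopy (k - 1) (chain_boundary k (frag_of \<sigma>)))"
    proof (cases k)
      case 0
      then show ?thesis by (simp add: coboundary_def chain_boundary_def subdivision_chain_homotopy_def)
    next
      case (Suc n)
      have "subdivision_chain_homotopy n (chain_boundary k (frag_of \<sigma>))
          = (\<Sum>i\<le>k. frag_cmul ((-1) ^ i) (subdivision_chain_homotopy n (frag_of (singular_face k i \<sigma>))))"
        by (simp add: chain_boundary_of Suc subdivision_chain_homotopy_def frag_extend_sum frag_extend_cmul comp_def
          del: sum.atMost_Suc)
      moreover have "subdivision_homotopy X c n (singular_face k i \<sigma>)
          = eval_chain (c k) (subdivision_chain_homotopy n (frag_of (singular_face k i \<sigma>)))" if "i \<le> k" for i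
        using singular_simplex_singular_face [OF s _ that] by (simp add: Suc subdivision_homotopy_def)
      ultimately show ?thesis
        using s by (simp add: coboundary_def Suc eval_chain_sum eval_chain_cmul del: sum.atMost_Suc)
    qed
    have "(coboundary X (subdivision_homotopy X c) + subdivision_homotopy X (coboundary X c)) k \<sigma>
        = eval_chain (c k) (chain_boundary (Suc k) (subdivision_chain_homotopy k (frag_of \<sigma>))
           + subdivision_chain_homotopy (k - 1) (chain_boundary k (frag_of \<sigma>)))"
      unfolding plus_fun_apply 1 2 by (simp add: eval_chain_add add.commute)
    also have "\<dots> = (cochain_subdivision X c + c) k \<sigma>"
      unfolding subdivision_chain_homotopy_boundary [OF s]
      using s by (simp add: eval_chain_diff cochain_subdivision_def)
    finally show ?thesis .
  next
    case False
    then show ?thesis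
      using inv_cochain_outside [OF c] by (simp add: cochain_subdivision_def coboundary_def subdivision_homotopy_def)
  qed
qed

lemma eval_chain_invariant:
  assumes c: "c \<in> inv_cochains X G" and g: "g \<in> G" and ch: "singular_chain k X ch"
  shows "eval_chain (c k) (chain_map k g ch) = eval_chain (c k) ch"
  unfolding eval_chain_map using assms
  by (intro eval_chain_cong) (auto simp: inv_cochains_iff invariant_cochain_def singular_chain_def)

lemma inv_cochains_subdivision_homotopy:
  assumes G: "acts_on X G" and c: "c \<in> inv_cochains X G"
  shows "subdivision_homotopy X c \<in> inv_cochains X G"
proof -
  have "finite {k. subdivision_homotopy X c k \<noteq> 0}"
  proof (rule finite_subset)
    show "{k. subdivision_homotopy X c k \<noteq> 0} \<subseteq> (\<lambda>k. k - 1) ` {k. c k \<noteq> 0}"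
    proof
      fix k assume "k \<in> {k. subdivision_homotopy X c k \<noteq> 0}"
      then obtain \<sigma> where "subdivision_homotopy X c k \<sigma> \<noteq> 0"
        by (auto simp: fun_eq_iff)
      then have "c (Suc k) \<noteq> 0"
        by (auto simp: subdivision_homotopy_def eval_chain_def split: if_splits)
      then show "k \<in> (\<lambda>k. k - 1) ` {k. c k \<noteq> 0}"
        by (intro image_eqI [of _ _ "Suc k"]) simp_all
    qed
  qed (use c in \<open>simp add: inv_cochains_iff\<close>)
  moreover have "subdivision_homotopy X c k (simplex_map k g \<sigma>) = subdivision_homotopy X c k \<sigma>"
    if "g \<in> G" "singular_simplex k X \<sigma>" for g k \<sigma>
    using that acts_on_simplex [OF G that]
      eval_chain_invariant [OF c that(1) singular_chain_subdivision_chain_homotopy [OF that(2)]]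
    by (simp add: subdivision_homotopy_def subdivision_chain_homotopy_natural)
  moreover have "subdivision_homotopy X c k \<sigma> = 0" if "\<not> singular_simplex k X \<sigma>" for k \<sigma>
    using that by (simp add: subdivision_homotopy_def)
  ultimately show ?thesis
    by (auto simp: inv_cochains_iff invariant_cochain_def)
qed

lemma inv_cocycles_subdivision:
  assumes G: "acts_on X G" and c: "c \<in> inv_cocycles X G"
  shows "cochain_subdivision X c \<in> inv_cocycles X G"
    and "coboundary X (subdivision_homotopy X c) = cochain_subdivision X c + c"
proof -
  have c': "c \<in> inv_cochains X G" "coboundary X c = 0"
    using c by (auto simp: inv_cocycles_def)
  have "subdivision_homotopy X 0 = 0"
    by (intro ext) (simp add: subdivision_homotopy_def eval_chain_def)
  then show eq: "coboundary X (subdivision_homotopy X c) = cochain_subdivision X c + c"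
    using subdivision_homotopy [OF c'(1)] c'(2) by simp
  then have "cochain_subdivision X c = coboundary X (subdivision_homotopy X c) + c"
    by (simp add: add.assoc)
  then show "cochain_subdivision X c \<in> inv_cocycles X G"
    using inv_coboundaries_subset [OF G] inv_cocycles_closed(3) [OF G] c
      inv_cochains_subdivision_homotopy [OF G c'(1)]
    by (auto simp: inv_coboundaries_def)
qed

lemma eval_chain_subdivision_power:
  assumes "singular_chain k X ch"
  shows "eval_chain ((cochain_subdivision X ^^ m) c k) ch = eval_chain (c k) ((singular_subdivision k ^^ m) ch)"
  using assms
proof (induction m arbitrary: ch)
  case (Suc m)
  have "eval_chain ((cochain_subdivision X ^^ Suc m) c k) ch
      = eval_chain (\<lambda>\<sigma>. eval_chain ((cochain_subdivision X ^^ m) c k) (singular_subdivision k (frag_of \<sigma>))) ch"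
    using Suc.prems by (intro eval_chain_cong) (auto simp: cochain_subdivision_def singular_chain_def)
  also have "\<dots> = eval_chain ((cochain_subdivision X ^^ m) c k) (singular_subdivision k ch)"
    by (simp add: singular_subdivision_def eval_chain_extend)
  also have "\<dots> = eval_chain (c k) ((singular_subdivision k ^^ m) (singular_subdivision k ch))"
    by (rule Suc.IH [OF singular_chain_singular_subdivision [OF Suc.prems]])
  finally show ?case
    by (simp only: funpow_Suc_right comp_apply)
qed simp

text \<open>
  With \<open>S\<close> the subdivision operator and \<open>T\<close> the homotopy from it to the identity, the primitive is
  the locally finite sum of the \<open>T (S\<^sup>m c)\<close>. It is invariant because \<open>S\<close> and \<open>T\<close> are natural.
\<close>

lemma small_cocycle_is_coboundary:
  assumes G: "acts_on X G" and c: "c \<in> inv_cocycles X G"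
    and op: "\<And>U. U \<in> \<C> \<Longrightarrow> openin X U" and cover: "topspace X \<subseteq> \<Union>\<C>"
    and small: "\<And>k \<sigma> U. \<lbrakk>U \<in> \<C>; singular_simplex k X \<sigma>; \<sigma> \<in> standard_simplex k \<rightarrow> U\<rbrakk> \<Longrightarrow> c k \<sigma> = 0"
  shows "c \<in> inv_coboundaries X G"
proof -
  let ?S = "\<lambda>m. (cochain_subdivision X ^^ m) c"
  have S: "?S m \<in> inv_cocycles X G" for m
    by (induction m) (simp_all add: c inv_cocycles_subdivision(1) [OF G])
  \<comment> \<open>Iterated subdivision of the cochain amounts to iterated subdivision of the
    chain, and after finitely many steps every simplex of the latter lies in a member of the
    cover.\<close>
  have ev0: "\<exists>M. \<forall>m\<ge>M. eval_chain (?S m k) ch = 0" if ch: "singular_chain k X ch" for k ch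
  proof -
    obtain M where M: "\<And>m f. \<lbrakk>M \<le> m; f \<in> Poly_Mapping.keys ((singular_subdivision k ^^ m) ch)\<rbrakk>
        \<Longrightarrow> \<exists>V \<in> \<C>. f \<in> standard_simplex k \<rightarrow> V"
      using sufficient_iterated_singular_subdivision_exists [OF op cover ch] by metis
    have "eval_chain (?S m k) ch = 0" if "M \<le> m" for m
    proof -
      have "singular_chain k X ((singular_subdivision k ^^ m) ch)"
        by (induction m) (simp_all add: ch singular_chain_singular_subdivision)
      then have "c k f = 0" if "f \<in> Poly_Mapping.keys ((singular_subdivision k ^^ m) ch)" for f
        using that M [OF \<open>M \<le> m\<close> that] small [of _ k f] by (auto simp: singular_chain_def)
      then have "eval_chain (c k) ((singular_subdivision k ^^ m) ch) = 0"
        by (simp add: eval_chain_def)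
      with eval_chain_subdivision_power [OF ch] show ?thesis
        by (rule trans)
    qed
    then show ?thesis by blast
  qed
  define B where "B m = (\<Sum>i<m. subdivision_homotopy X (?S i))" for m
  have B_0: "B 0 = 0" and B_Suc: "B (Suc m) = B m + subdivision_homotopy X (?S m)" for m
    by (simp_all add: B_def)
  have B: "B m \<in> inv_cochains X G" for m
  proof (induction m)
    case (Suc m)
    have "?S m \<in> inv_cochains X G"
      using S [of m] by (simp add: inv_cocycles_def)
    then show ?case
      unfolding B_Suc by (intro inv_cochains_add Suc inv_cochains_subdivision_homotopy [OF G])
  next
    case 0
    show ?case
      unfolding B_0 by (rule inv_cochains_0)
  qed
  \<comment> \<open>The sum telescopes, because the i-th homotopy bounds the sum of the i-th and the
    next subdivision of c. On any given simplex the first summand disappears for large m.\<close>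
  have dB: "coboundary X (B m) = ?S m + c" for m
  proof (induction m)
    case (Suc m)
    have "coboundary X (B (Suc m)) = ?S m + c + (cochain_subdivision X (?S m) + ?S m)"
      unfolding B_Suc coboundary_add Suc inv_cocycles_subdivision(2) [OF G S [of m]] ..
    moreover have "x + c + (y + x) = y + c" for x y
      by (intro ext) (simp add: add_ac)
    ultimately show ?case by simp
  next
    case 0
    show ?case
      unfolding B_0 coboundary_0 by simp
  qed
  have stable: "\<exists>M. \<forall>m\<ge>M. B m k \<sigma> = B M k \<sigma>" for k \<sigma>
  proof -
    have "\<exists>M. \<forall>m\<ge>M. subdivision_homotopy X (?S m) k \<sigma> = 0"
      using ev0 [OF singular_chain_subdivision_chain_homotopy, of k \<sigma>]
      by (auto simp: subdivision_homotopy_def)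
    then obtain M where M: "\<And>m. m \<ge> M \<Longrightarrow> subdivision_homotopy X (?S m) k \<sigma> = 0"
      by blast
    have "B m k \<sigma> = B M k \<sigma>" if "m \<ge> M" for m
      using that by (induction m rule: dec_induct) (simp_all add: B_Suc M)
    then show ?thesis by blast
  qed
  define N where "N k \<sigma> = (SOME M. \<forall>m\<ge>M. B m k \<sigma> = B M k \<sigma>)" for k \<sigma>
  have N: "B m k \<sigma> = B (N k \<sigma>) k \<sigma>" if "m \<ge> N k \<sigma>" for m k \<sigma>
    using someI_ex [OF stable [of k \<sigma>]] that unfolding N_def by blast
  define b where "b = (\<lambda>k \<sigma>. B (N k \<sigma>) k \<sigma>)"
  have b: "b k \<sigma> = B m k \<sigma>" if "m \<ge> N k \<sigma>" for m k \<sigma>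
    using N [OF that] by (simp add: b_def)
  have "b \<in> inv_cochains X G"
  proof -
    have "b k \<sigma> = 0" if "\<not> singular_simplex k X \<sigma>" for k \<sigma>
      using inv_cochain_outside [OF B that] by (simp add: b_def)
    moreover have "b k (simplex_map k g \<sigma>) = b k \<sigma>" if "g \<in> G" "singular_simplex k X \<sigma>" for g k \<sigma>
    proof -
      let ?m = "max (N k (simplex_map k g \<sigma>)) (N k \<sigma>)"
      have "B ?m k (simplex_map k g \<sigma>) = B ?m k \<sigma>"
        using B [of ?m] that by (simp add: inv_cochains_iff invariant_cochain_def)
      then show ?thesis
        by (simp add: b [of k _ ?m])
    qed
    moreover have "finite {k. b k \<noteq> 0}"
    proof (rule finite_subset)
      show "{k. b k \<noteq> 0} \<subseteq> (\<lambda>k. k - 1) ` {k. c k \<noteq> 0}"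
      proof
        fix k assume k: "k \<in> {k. b k \<noteq> 0}"
        have "c (Suc k) \<noteq> 0"
        proof
          assume c0: "c (Suc k) = 0"
          have "?S m (Suc k) = 0" for m
            by (induction m) (auto simp: c0 cochain_subdivision_def fun_eq_iff eval_chain_def)
          then have "B m k = 0" for m
            by (induction m) (auto simp: B_0 B_Suc subdivision_homotopy_def fun_eq_iff eval_chain_def)
          with k show False
            by (auto simp: b_def fun_eq_iff)
        qed
        then show "k \<in> (\<lambda>k. k - 1) ` {k. c k \<noteq> 0}"
          by (intro image_eqI [of _ _ "Suc k"]) simp_all
      qed
    qed (use c in \<open>simp add: inv_cochains_iff inv_cocycles_def\<close>)
    ultimately show ?thesis
      by (auto simp: inv_cochains_iff invariant_cochain_def)
  qed
  moreover have "coboundary X b = c"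
  proof (intro ext)
    fix k \<sigma>
    show "coboundary X b k \<sigma> = c k \<sigma>"
    proof (cases "singular_simplex k X \<sigma>")
      case s: True
      obtain M where M: "\<And>m. m \<ge> M \<Longrightarrow> ?S m k \<sigma> = 0"
        using ev0 [of k "frag_of \<sigma>"] s by (auto simp: singular_chain_of)
      \<comment> \<open>One index that serves the simplex and all its faces: the subdivided cocycle
        vanishes on the simplex, and the partial sums are stable on each face.\<close>
      define m where "m = M + (\<Sum>i\<le>k. N (k - 1) (singular_face k i \<sigma>))"
      have "N (k - 1) (singular_face k i \<sigma>) \<le> m" if "i \<le> k" for i
        using member_le_sum [of i "{..k}" "\<lambda>i. N (k - 1) (singular_face k i \<sigma>)"] that by (simp add: m_def)
      then have "b (k - 1) (singular_face k i \<sigma>) = B m (k - 1) (singular_face k i \<sigma>)" if "i \<le> k" for i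
        using that b by blast
      then have "coboundary X b k \<sigma> = coboundary X (B m) k \<sigma>"
        by (simp add: coboundary_def)
      also have "\<dots> = c k \<sigma>"
        using M [of m] by (simp add: dB m_def)
      finally show ?thesis .
    next
      case False
      then show ?thesis
        using c inv_cochain_outside [of c X G k \<sigma>] by (simp add: coboundary_def inv_cocycles_def)
    qed
  qed
  ultimately show ?thesis
    by (auto simp: inv_coboundaries_def)
qed

section \<open>Polynomial identities in characteristic two\<close>

text \<open>An orbit of length two contributes the same value twice, hence zero; the induction
  removes one such orbit at a time and leaves the fixed points.\<close>

lemma sum_involution:
  fixes f :: "'b \<Rightarrow> 'a :: comm_ring_1"
  assumes char2: "\<And>x :: 'a. x + x = 0" and "finite S"
    and g: "\<And>x. x \<in> S \<Longrightarrow> g x \<in> S" "\<And>x. x \<in> S \<Longrightarrow> g (g x) = x" "\<And>x. x \<in> S \<Longrightarrow> f (g x) = f x"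
  shows "sum f S = sum f {x \<in> S. g x = x}"
  using assms(2-)
proof (induction "card S" arbitrary: S rule: less_induct)
  case less
  show ?case
  proof (cases "\<forall>x\<in>S. g x = x")
    case True
    then have "{x \<in> S. g x = x} = S" by auto
    then show ?thesis by simp
  next
    case False
    then obtain x where x: "x \<in> S" "g x \<noteq> x" by blast
    define T where "T = S - {x, g x}"
    have S: "S = insert x (insert (g x) T)" and T: "x \<notin> T" "g x \<notin> T" "finite T"
      using x less.prems by (auto simp: T_def)
    have "card T < card S"
      using x less.prems by (intro psubset_card_mono) (auto simp: T_def)
    then have "sum f T = sum f {x \<in> T. g x = x}"
    proof (rule less.hyps)
      show "g y \<in> T" if "y \<in> T" for y
      proof -
        have "y \<in> S" "y \<noteq> x" "y \<noteq> g x" using that by (auto simp: T_def)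
        moreover have "g y \<noteq> x" "g y \<noteq> g x"
          using \<open>y \<in> S\<close> \<open>y \<noteq> x\<close> \<open>y \<noteq> g x\<close> x less.prems(3) by metis+
        ultimately show ?thesis
          using less.prems(2) by (auto simp: T_def)
      qed
    qed (use less.prems in \<open>auto simp: T_def\<close>)
    moreover have "{y \<in> S. g y = y} = {y \<in> T. g y = y}"
      using x less.prems(3) [OF x(1)] by (auto simp: S)
    moreover have "sum f S = f x + (f x + sum f T)"
      using x T less.prems(4) [OF x(1)] by (simp add: S)
    ultimately show ?thesis
      by (simp add: char2 flip: add.assoc)
  qed
qed

text \<open>In characteristic two this is also the determinant.\<close>

definition permanent :: "nat \<Rightarrow> (nat \<Rightarrow> nat \<Rightarrow> 'a) \<Rightarrow> 'a :: comm_ring_1" where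
  "permanent r A = (\<Sum>\<sigma> | \<sigma> permutes {..<r}. \<Prod>i<r. A i (\<sigma> i))"

text \<open>Composition with the transposition of p and q is an involution of the permutations that
  preserves the products and has no fixed points.\<close>

lemma permanent_equal_columns:
  fixes A :: "nat \<Rightarrow> nat \<Rightarrow> 'a :: comm_ring_1"
  assumes char2: "\<And>x :: 'a. x + x = 0"
    and pq: "p < r" "q < r" "p \<noteq> q" and eq: "\<And>i. i < r \<Longrightarrow> A i p = A i q"
  shows "permanent r A = 0"
proof -
  let ?g = "\<lambda>\<sigma>. Transposition.transpose p q \<circ> \<sigma>"
  have "permanent r A = (\<Sum>\<sigma>\<in>{\<sigma> \<in> {\<sigma>. \<sigma> permutes {..<r}}. ?g \<sigma> = \<sigma>}. \<Prod>i<r. A i (\<sigma> i))"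
    unfolding permanent_def
  proof (rule sum_involution [OF char2])
    show "finite {\<sigma>. \<sigma> permutes {..<r}}"
      by (rule finite_permutations) simp
    fix \<sigma> assume "\<sigma> \<in> {\<sigma>. \<sigma> permutes {..<r}}"
    then have \<sigma>: "\<sigma> permutes {..<r}" by simp
    show "?g \<sigma> \<in> {\<sigma>. \<sigma> permutes {..<r}}"
      using pq \<sigma> by (auto intro!: permutes_compose permutes_swap_id)
    show "?g (?g \<sigma>) = \<sigma>"
      by (simp add: fun_eq_iff)
    show "(\<Prod>i<r. A i (?g \<sigma> i)) = (\<Prod>i<r. A i (\<sigma> i))"
      using eq by (intro prod.cong) (auto simp: Transposition.transpose_def)
  qed
  moreover have "\<not> ?g \<sigma> = \<sigma>" if "\<sigma> permutes {..<r}" for \<sigma>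
  proof
    assume "?g \<sigma> = \<sigma>"
    then have "?g \<sigma> (inv_into UNIV \<sigma> p) = \<sigma> (inv_into UNIV \<sigma> p)" by simp
    then show False
      using pq permutes_inverses(1) [OF that] by simp
  qed
  then have no: "{\<sigma> \<in> {\<sigma>. \<sigma> permutes {..<r}}. ?g \<sigma> = \<sigma>} = {}"
    by blast
  ultimately show ?thesis
    by (simp only: no sum.empty)
qed

text \<open>A permutation meets column r in the single row \<open>inv_into UNIV \<sigma> r\<close>.
  Separating that row shows that the permanent is linear in the last column.\<close>

lemma permanent_last_column:
  "permanent (Suc r) (\<lambda>i j. if j = r then B i else A i j)
    = (\<Sum>\<sigma> | \<sigma> permutes {..<Suc r}. B (inv_into UNIV \<sigma> r) * (\<Prod>i\<in>{..<Suc r} - {inv_into UNIV \<sigma> r}. A i (\<sigma> i)))"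
  unfolding permanent_def
proof (rule sum.cong [OF refl])
  fix \<sigma> assume "\<sigma> \<in> {\<sigma>. \<sigma> permutes {..<Suc r}}"
  then have \<sigma>: "\<sigma> permutes {..<Suc r}" by simp
  have k: "inv_into UNIV \<sigma> r \<in> {..<Suc r}" "\<sigma> (inv_into UNIV \<sigma> r) = r"
    using permutes_in_image [OF permutes_inv [OF \<sigma>]] permutes_inverses [OF \<sigma>] by auto
  have "\<sigma> i \<noteq> r" if "i \<noteq> inv_into UNIV \<sigma> r" for i
    using that permutes_inverses(2) [OF \<sigma>, of i] by auto
  then show "(\<Prod>i<Suc r. if \<sigma> i = r then B i else A i (\<sigma> i))
      = B (inv_into UNIV \<sigma> r) * (\<Prod>i\<in>{..<Suc r} - {inv_into UNIV \<sigma> r}. A i (\<sigma> i))"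
    using k by (subst prod.remove [OF _ k(1)]) (auto intro!: arg_cong2 [where f = "(*)"] prod.cong)
qed

lemma prod_monic_linear:
  fixes x :: "nat \<Rightarrow> 'a :: comm_ring_1"
  shows "\<exists>e. e r = 1 \<and> (\<forall>z. (\<Prod>i<r. z + x i) = (\<Sum>j\<le>r. e j * z ^ j))"
proof (induction r)
  case 0
  show ?case by (intro exI [of _ "\<lambda>_. 1"]) simp
next
  case (Suc r)
  then obtain e where e: "e r = 1" "\<And>z. (\<Prod>i<r. z + x i) = (\<Sum>j\<le>r. e j * z ^ j)"
    by blast
  let ?e = "\<lambda>j. (if j = 0 then 0 else e (j - 1)) + (if j \<le> r then x r * e j else 0)"
  have "(\<Prod>i<Suc r. z + x i) = (\<Sum>j\<le>Suc r. ?e j * z ^ j)" for z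
  proof -
    have "(\<Sum>j\<le>Suc r. (if j = 0 then 0 else e (j - 1)) * z ^ j) = (\<Sum>j\<le>r. e j * z ^ j) * z"
      by (simp add: sum.atMost_Suc_shift sum_distrib_left mult_ac del: sum.atMost_Suc)
    moreover have "(\<Sum>j\<le>Suc r. (if j \<le> r then x r * e j else 0) * z ^ j) = (\<Sum>j\<le>r. e j * z ^ j) * x r"
      by (simp add: sum_distrib_left mult_ac)
    ultimately show ?thesis
      by (simp add: e(2) distrib_left distrib_right sum.distrib del: sum.atMost_Suc)
  qed
  then show ?case
    using e(1) by (intro exI [of _ ?e]) simp
qed

text \<open>In the last column x_i ^ r may be replaced by the value at x_i of the monic polynomial
  with roots x_0, ..., x_{r-1}: the lower powers are already columns and contribute permanents with
  two equal columns. After the replacement only the last row has a nonzero entry in that column,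
  namely the new factor of the product.\<close>

lemma Vandermonde_char2:
  fixes x :: "nat \<Rightarrow> 'a :: comm_ring_1"
  assumes char2: "\<And>x :: 'a. x + x = 0"
  shows "(\<Prod>j<r. \<Prod>i<j. x j + x i) = permanent r (\<lambda>i j. x i ^ j)"
proof (induction r)
  case 0
  then show ?case by (simp add: permanent_def)
next
  case (Suc r)
  obtain e where e: "e r = 1" "\<And>z. (\<Prod>i<r. z + x i) = (\<Sum>j\<le>r. e j * z ^ j)"
    using prod_monic_linear [of r x] by blast
  let ?A = "\<lambda>i j. x i ^ j"
  let ?P = "\<lambda>B. permanent (Suc r) (\<lambda>i j. if j = r then B i else ?A i j)"
  have lin: "?P (\<lambda>i. \<Prod>k<r. x i + x k) = (\<Sum>j\<le>r. e j * ?P (\<lambda>i. x i ^ j))"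
  proof -
    have "?P (\<lambda>i. \<Prod>k<r. x i + x k)
        = (\<Sum>\<sigma> | \<sigma> permutes {..<Suc r}. \<Sum>j\<le>r. e j * (x (inv_into UNIV \<sigma> r) ^ j * (\<Prod>i\<in>{..<Suc r} - {inv_into UNIV \<sigma> r}. ?A i (\<sigma> i))))"
      unfolding permanent_last_column e(2) by (simp add: sum_distrib_right mult.assoc)
    also have "\<dots> = (\<Sum>j\<le>r. e j * ?P (\<lambda>i. x i ^ j))"
      unfolding permanent_last_column sum_distrib_left by (rule sum.swap)
    finally show ?thesis .
  qed
  have "?P (\<lambda>i. x i ^ j) = 0" if "j < r" for j
    using that by (intro permanent_equal_columns [OF char2, of j _ r]) auto
  then have "(\<Sum>j\<le>r. e j * ?P (\<lambda>i. x i ^ j)) = (\<Sum>j\<in>{r}. e j * ?P (\<lambda>i. x i ^ j))"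
    by (intro sum.mono_neutral_right) auto
  also have "\<dots> = ?P (\<lambda>i. x i ^ r)"
    by (simp add: e(1))
  also have "\<dots> = permanent (Suc r) ?A"
    by (rule arg_cong [where f = "permanent (Suc r)"]) (auto simp: fun_eq_iff)
  finally have 1: "permanent (Suc r) ?A = ?P (\<lambda>i. \<Prod>k<r. x i + x k)"
    using lin by simp
  have "?P (\<lambda>i. \<Prod>k<r. x i + x k)
      = (\<Sum>\<sigma>\<in>{\<sigma>. \<sigma> permutes {..<r}}. (\<Prod>k<r. x (inv_into UNIV \<sigma> r) + x k) * (\<Prod>i\<in>{..<Suc r} - {inv_into UNIV \<sigma> r}. ?A i (\<sigma> i)))"
    unfolding permanent_last_column
  proof (rule sum.mono_neutral_right)
    show "finite {\<sigma>. \<sigma> permutes {..<Suc r}}"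
      by (rule finite_permutations) simp
    show "{\<sigma>. \<sigma> permutes {..<r}} \<subseteq> {\<sigma>. \<sigma> permutes {..<Suc r}}"
      by (auto intro: permutes_subset)
    show "\<forall>\<sigma>\<in>{\<sigma>. \<sigma> permutes {..<Suc r}} - {\<sigma>. \<sigma> permutes {..<r}}.
        (\<Prod>k<r. x (inv_into UNIV \<sigma> r) + x k) * (\<Prod>i\<in>{..<Suc r} - {inv_into UNIV \<sigma> r}. ?A i (\<sigma> i)) = 0"
    proof
      fix \<sigma> assume "\<sigma> \<in> {\<sigma>. \<sigma> permutes {..<Suc r}} - {\<sigma>. \<sigma> permutes {..<r}}"
      then have \<sigma>: "\<sigma> permutes {..<Suc r}" and n: "\<not> \<sigma> permutes {..<r}" by auto
      have "inv_into UNIV \<sigma> r \<noteq> r"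
      proof
        assume "inv_into UNIV \<sigma> r = r"
        then have "\<sigma> r = r"
          using permutes_inverses(1) [OF \<sigma>, of r] by simp
        then have "\<sigma> permutes {..<r}"
          by (intro permutes_superset [OF \<sigma>]) (auto simp: less_Suc_eq)
        with n show False by simp
      qed
      then have "inv_into UNIV \<sigma> r \<in> {..<r}"
        using permutes_in_image [OF permutes_inv [OF \<sigma>], of r] by auto
      then have "(\<Prod>k<r. x (inv_into UNIV \<sigma> r) + x k) = 0"
        by (intro prod_zero finite_lessThan bexI [of _ "inv_into UNIV \<sigma> r"]) (auto simp: char2)
      then show "(\<Prod>k<r. x (inv_into UNIV \<sigma> r) + x k) * (\<Prod>i\<in>{..<Suc r} - {inv_into UNIV \<sigma> r}. ?A i (\<sigma> i)) = 0"
        by simp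
    qed
  qed
  also have "\<dots> = (\<Prod>k<r. x r + x k) * permanent r ?A"
    unfolding permanent_def sum_distrib_left
  proof (rule sum.cong [OF refl])
    fix \<sigma> assume "\<sigma> \<in> {\<sigma>. \<sigma> permutes {..<r}}"
    then have \<sigma>: "\<sigma> permutes {..<r}" by simp
    have "inv_into UNIV \<sigma> r = r"
      using permutes_not_in [OF permutes_inv [OF \<sigma>], of r] by simp
    moreover have "{..<Suc r} - {r} = {..<r}" by auto
    ultimately show "(\<Prod>k<r. x (inv_into UNIV \<sigma> r) + x k) * (\<Prod>i\<in>{..<Suc r} - {inv_into UNIV \<sigma> r}. ?A i (\<sigma> i))
        = (\<Prod>k<r. x r + x k) * (\<Prod>i<r. x i ^ \<sigma> i)"
      by simp
  qed
  finally show ?case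
    using 1 Suc by (simp add: mult.commute)
qed

text \<open>Inverting a permutation does not change its product, because the entries depend on i + j
  only, so just the involutions remain. An involution other than the identity exchanges some i with
  another index and so contains the same entry twice; that square is zero.\<close>

lemma Hankel_char2:
  fixes h :: "nat \<Rightarrow> 'a :: comm_ring_1"
  assumes char2: "\<And>x :: 'a. x + x = 0" and sq: "\<And>m. h m * h m = 0"
  shows "permanent r (\<lambda>i j. h (i + j)) = (\<Prod>i<r. h (2 * i))"
proof -
  let ?S = "{\<sigma>. \<sigma> permutes {..<r}}" and ?f = "\<lambda>\<sigma>. \<Prod>i<r. h (i + \<sigma> i)"
  have fin: "finite ?S"
    by (rule finite_permutations) simp
  have "permanent r (\<lambda>i j. h (i + j)) = sum ?f {\<sigma> \<in> ?S. inv_into UNIV \<sigma> = \<sigma>}"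
    unfolding permanent_def
  proof (rule sum_involution [OF char2 fin])
    fix \<sigma> assume "\<sigma> \<in> ?S"
    then have \<sigma>: "\<sigma> permutes {..<r}" by simp
    show "inv_into UNIV \<sigma> \<in> ?S"
      using permutes_inv [OF \<sigma>] by simp
    show "inv_into UNIV (inv_into UNIV \<sigma>) = \<sigma>"
      by (rule permutes_inv_inv [OF \<sigma>])
    show "?f (inv_into UNIV \<sigma>) = ?f \<sigma>"
      using prod.permutes_inv [OF \<sigma>, of "\<lambda>a b. h (a + b)"] by (simp add: add.commute)
  qed
  also have "\<dots> = sum ?f {id}"
  proof (rule sum.mono_neutral_right)
    show "\<forall>\<sigma>\<in>{\<sigma> \<in> ?S. inv_into UNIV \<sigma> = \<sigma>} - {id}. ?f \<sigma> = 0"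
    proof
      fix \<sigma> assume "\<sigma> \<in> {\<sigma> \<in> ?S. inv_into UNIV \<sigma> = \<sigma>} - {id}"
      then have \<sigma>: "\<sigma> permutes {..<r}" "inv_into UNIV \<sigma> = \<sigma>" "\<sigma> \<noteq> id" by auto
      then obtain i where i: "\<sigma> i \<noteq> i" by (auto simp: fun_eq_iff)
      have ir: "i \<in> {..<r}" "\<sigma> i \<in> {..<r}" and ii: "\<sigma> (\<sigma> i) = i"
        using i permutes_not_in [OF \<sigma>(1), of i] permutes_in_image [OF \<sigma>(1), of i]
          permutes_inverses(2) [OF \<sigma>(1), of i] \<sigma>(2) by auto
      have "?f \<sigma> = h (i + \<sigma> i) * (h (\<sigma> i + i) * (\<Prod>k\<in>{..<r} - {i} - {\<sigma> i}. h (k + \<sigma> k)))"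
        using ir i ii by (subst prod.remove [of _ i]; simp; subst prod.remove [of _ "\<sigma> i"]; simp)
      also have "\<dots> = 0"
        using sq by (simp add: add.commute flip: mult.assoc)
      finally show "?f \<sigma> = 0" .
    qed
  qed (auto simp: fin permutes_id)
  also have "\<dots> = (\<Prod>i<r. h (2 * i))"
    by (simp add: mult_2)
  finally show ?thesis .
qed

text \<open>The coefficients are determinants as in the Porteous formula for degeneracy loci.
  Expanding the Vandermonde product as a permanent allows to multiply the i-th polynomial by the
  power of x_i with exponent \<open>\<sigma> i\<close>; modulo the N-th power of x_i this shifts the
  indices of W. The convention that W vanishes above n makes the shifted sums uniform.\<close>

lemma porteous_expansion:
  fixes x W :: "nat \<Rightarrow> 'a :: comm_ring_1"
  assumes char2: "\<And>x :: 'a. x + x = 0" and "N \<le> n"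
    and W: "\<And>j. j > n \<Longrightarrow> W j = 0" and x: "\<And>i. i < r \<Longrightarrow> x i ^ N = 0"
  shows "(\<Prod>j<r. \<Prod>i<j. x j + x i) * (\<Prod>i<r. \<Sum>j\<le>n. W j * x i ^ (n - j))
    = (\<Sum>e\<in>PiE {..<r} (\<lambda>_. {..<N}). permanent r (\<lambda>i j. W (n + j - e i)) * (\<Prod>i<r. x i ^ e i))"
proof -
  have 1: "x i ^ s * (\<Sum>j\<le>n. W j * x i ^ (n - j)) = (\<Sum>m<N. W (n + s - m) * x i ^ m)" if "i < r" for i s
  proof -
    have x0: "x i ^ m = 0" if "m \<ge> N" for m
    proof -
      have "x i ^ m = x i ^ N * x i ^ (m - N)"
        using that by (simp flip: power_add)
      then show ?thesis
        using x [OF \<open>i < r\<close>] by simp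
    qed
    have "x i ^ s * (\<Sum>j\<le>n. W j * x i ^ (n - j)) = (\<Sum>j\<le>n. W j * x i ^ (n + s - j))"
      unfolding sum_distrib_left
    proof (rule sum.cong [OF refl])
      fix j assume "j \<in> {..n}"
      then have "n + s - j = s + (n - j)" by simp
      then show "x i ^ s * (W j * x i ^ (n - j)) = W j * x i ^ (n + s - j)"
        by (simp add: power_add mult_ac)
    qed
    also have "\<dots> = (\<Sum>j\<le>n + s. W j * x i ^ (n + s - j))"
      by (intro sum.mono_neutral_left) (auto simp: W)
    also have "\<dots> = (\<Sum>m\<le>n + s. W (n + s - m) * x i ^ m)"
      by (rule sum.reindex_bij_witness [where i = "\<lambda>m. n + s - m" and j = "\<lambda>m. n + s - m"]) auto
    also have "\<dots> = (\<Sum>m<N. W (n + s - m) * x i ^ m)"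
      using \<open>N \<le> n\<close> by (intro sum.mono_neutral_right) (auto simp: x0)
    finally show ?thesis .
  qed
  have "(\<Prod>j<r. \<Prod>i<j. x j + x i) * (\<Prod>i<r. \<Sum>j\<le>n. W j * x i ^ (n - j))
      = (\<Sum>\<sigma> | \<sigma> permutes {..<r}. \<Prod>i<r. x i ^ \<sigma> i * (\<Sum>j\<le>n. W j * x i ^ (n - j)))"
    by (simp add: Vandermonde_char2 [OF char2] permanent_def sum_distrib_right prod.distrib)
  also have "\<dots> = (\<Sum>\<sigma> | \<sigma> permutes {..<r}. \<Prod>i<r. \<Sum>m<N. W (n + \<sigma> i - m) * x i ^ m)"
    by (intro sum.cong prod.cong) (auto simp: 1)
  also have "\<dots> = (\<Sum>\<sigma> | \<sigma> permutes {..<r}. \<Sum>e\<in>PiE {..<r} (\<lambda>_. {..<N}). \<Prod>i<r. W (n + \<sigma> i - e i) * x i ^ e i)"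
    by (simp add: prod_sum_PiE)
  also have "\<dots> = (\<Sum>e\<in>PiE {..<r} (\<lambda>_. {..<N}). \<Sum>\<sigma> | \<sigma> permutes {..<r}. \<Prod>i<r. W (n + \<sigma> i - e i) * x i ^ e i)"
    by (rule sum.swap)
  also have "\<dots> = (\<Sum>e\<in>PiE {..<r} (\<lambda>_. {..<N}). permanent r (\<lambda>i j. W (n + j - e i)) * (\<Prod>i<r. x i ^ e i))"
    by (simp add: permanent_def sum_distrib_right prod.distrib)
  finally show ?thesis .
qed

lemma sum_square_char2:
  fixes f :: "'b \<Rightarrow> 'a :: comm_ring_1"
  assumes char2: "\<And>x :: 'a. x + x = 0"
  shows "sum f A * sum f A = (\<Sum>a\<in>A. f a * f a)"
proof (induction A rule: infinite_finite_induct)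
  case (insert a A)
  have "(f a + sum f A) * (f a + sum f A) = f a * f a + sum f A * sum f A + (f a * sum f A + f a * sum f A)"
    by (simp add: algebra_simps)
  with insert show ?case
    by (simp add: char2)
qed auto

section \<open>Calculating in a commutative ring of characteristic two\<close>

text \<open>
  The product of all commutative rings of characteristic two whose carrier is of a given type, as a
  type of class \<^class>\<open>comm_ring_1\<close>. The second factor makes sure that \<open>0 \<noteq> 1\<close>.
\<close>

definition cring2 :: "'r ring \<Rightarrow> bool" where
  "cring2 R \<longleftrightarrow> cring R \<and> (\<forall>x\<in>carrier R. x \<oplus>\<^bsub>R\<^esub> x = \<zero>\<^bsub>R\<^esub>)"

text \<open>The value outside \<open>cring2\<close> is fixed, so that an element is determined by
  its components and the additional bit.\<close>

typedef 'r ring_product =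
  "{(f :: 'r ring \<Rightarrow> 'r, b :: bit). \<forall>R. if cring2 R then f R \<in> carrier R else f R = undefined}"
  by (rule exI [of _ "(\<lambda>R. if cring2 R then \<zero>\<^bsub>R\<^esub> else undefined, 0)"])
    (auto simp: cring2_def intro: cring.cring_simprules(2))

definition component :: "'r ring \<Rightarrow> 'r ring_product \<Rightarrow> 'r" where
  "component R x = fst (Rep_ring_product x) R"

definition of_components :: "('r ring \<Rightarrow> 'r) \<Rightarrow> bit \<Rightarrow> 'r ring_product" where
  "of_components f b = Abs_ring_product (\<lambda>R. if cring2 R then f R else undefined, b)"

lemma Rep_of_components:
  assumes "\<And>R. cring2 R \<Longrightarrow> f R \<in> carrier R"
  shows "Rep_ring_product (of_components f b) = (\<lambda>R. if cring2 R then f R else undefined, b)"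
  unfolding of_components_def by (rule Abs_ring_product_inverse) (use assms in auto)

lemma component_of_components:
  assumes "\<And>R. cring2 R \<Longrightarrow> f R \<in> carrier R" "cring2 R"
  shows "component R (of_components f b) = f R"
  by (simp add: component_def Rep_of_components [OF assms(1)] assms(2))

lemma component_closed [simp]: "cring2 R \<Longrightarrow> component R x \<in> carrier R"
  using Rep_ring_product [of x] by (force simp: component_def split: prod.splits)

lemma ring_product_eqI:
  assumes "\<And>R. cring2 R \<Longrightarrow> component R x = component R y"
    and "snd (Rep_ring_product x) = snd (Rep_ring_product y)"
  shows "x = y"
proof -
  have "fst (Rep_ring_product x) R = fst (Rep_ring_product y) R" for R
    using assms(1) [of R] Rep_ring_product [of x] Rep_ring_product [of y]
    by (cases "cring2 R") (auto simp: component_def split: prod.splits)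
  then show ?thesis
    using assms(2) by (metis Rep_ring_product_inject ext prod_eqI)
qed

instantiation ring_product :: (type) comm_ring_1
begin

definition "0 = of_components (\<lambda>R. \<zero>\<^bsub>R\<^esub>) 0"
definition "1 = of_components (\<lambda>R. \<one>\<^bsub>R\<^esub>) 1"
definition "x + y = of_components (\<lambda>R. component R x \<oplus>\<^bsub>R\<^esub> component R y)
  (snd (Rep_ring_product x) + snd (Rep_ring_product y))"
definition "x * y = of_components (\<lambda>R. component R x \<otimes>\<^bsub>R\<^esub> component R y)
  (snd (Rep_ring_product x) * snd (Rep_ring_product y))"
definition "- (x :: 'a ring_product) = x"
definition "(x :: 'a ring_product) - y = x + y"

lemma cring2_D: "cring2 R \<Longrightarrow> cring R"
  by (simp add: cring2_def)

lemma component_simps: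
  assumes R: "cring2 R"
  shows "component R 0 = \<zero>\<^bsub>R\<^esub>" "component R 1 = \<one>\<^bsub>R\<^esub>"
    "component R (x + y) = component R x \<oplus>\<^bsub>R\<^esub> component R y"
    "component R (x * y) = component R x \<otimes>\<^bsub>R\<^esub> component R y"
  unfolding zero_ring_product_def one_ring_product_def plus_ring_product_def times_ring_product_def
  by (rule component_of_components; use R in \<open>simp add: cring.cring_simprules [OF cring2_D]\<close>)+

lemma snd_Rep_simps:
  "snd (Rep_ring_product (0 :: 'a ring_product)) = 0" "snd (Rep_ring_product (1 :: 'a ring_product)) = 1"
  "snd (Rep_ring_product ((x :: 'a ring_product) + y)) = snd (Rep_ring_product x) + snd (Rep_ring_product y)"
  "snd (Rep_ring_product (x * y)) = snd (Rep_ring_product x) * snd (Rep_ring_product y)"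
  unfolding zero_ring_product_def one_ring_product_def plus_ring_product_def times_ring_product_def
  by (subst Rep_of_components; simp add: cring.cring_simprules [OF cring2_D])+

instance
proof
  fix x y z :: "'a ring_product"
  show "x * y * z = x * (y * z)" "x * y = y * x" "1 * x = x"
    "x + y + z = x + (y + z)" "x + y = y + x" "0 + x = x" "(x + y) * z = x * z + y * z"
    by (rule ring_product_eqI; simp add: component_simps snd_Rep_simps
        cring.cring_simprules [OF cring2_D] algebra_simps)+
  show "- x + x = 0"
    unfolding uminus_ring_product_def
    by (rule ring_product_eqI) (auto simp: component_simps snd_Rep_simps cring2_def)
  show "x - y = x + - y"
    by (simp add: uminus_ring_product_def minus_ring_product_def)
  have "snd (Rep_ring_product (0 :: 'a ring_product)) \<noteq> snd (Rep_ring_product (1 :: 'a ring_product))"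
    by (simp add: snd_Rep_simps)
  then show "(0 :: 'a ring_product) \<noteq> 1"
    by metis
qed

end

lemma ring_product_add_self: "(x :: 'r ring_product) + x = 0"
  using left_minus [of x] by (simp add: uminus_ring_product_def)

text \<open>Extension by zero in all other factors. It respects sums and products but does not map
  one to one, which is why \<open>embed_component_pow\<close> is stated for positive exponents.
  Power zero of an embedded element is the one of the whole product and still has the right
  component.\<close>

definition embed_component :: "'r ring \<Rightarrow> 'r \<Rightarrow> 'r ring_product" where
  "embed_component R a = of_components (\<lambda>S. if S = R then a else \<zero>\<^bsub>S\<^esub>) 0"

lemma component_embed:
  assumes "a \<in> carrier R" "cring2 S"
  shows "component S (embed_component R a) = (if S = R then a else \<zero>\<^bsub>S\<^esub>)"
  unfolding embed_component_def using assms
  by (intro component_of_components) (auto simp: cring.cring_simprules [OF cring2_D])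

lemma component_embed_self [simp]:
  "\<lbrakk>a \<in> carrier R; cring2 R\<rbrakk> \<Longrightarrow> component R (embed_component R a) = a"
  by (simp add: component_embed)

lemma snd_Rep_embed: "a \<in> carrier R \<Longrightarrow> snd (Rep_ring_product (embed_component R a)) = 0"
  unfolding embed_component_def by (subst Rep_of_components) (auto simp: cring.cring_simprules [OF cring2_D])

lemma embed_component_hom:
  assumes R: "cring2 R"
  shows "embed_component R \<zero>\<^bsub>R\<^esub> = 0"
    "\<lbrakk>a \<in> carrier R; b \<in> carrier R\<rbrakk> \<Longrightarrow> embed_component R (a \<oplus>\<^bsub>R\<^esub> b) = embed_component R a + embed_component R b"
    "\<lbrakk>a \<in> carrier R; b \<in> carrier R\<rbrakk> \<Longrightarrow> embed_component R (a \<otimes>\<^bsub>R\<^esub> b) = embed_component R a * embed_component R b"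
  by (rule ring_product_eqI;
      use R in \<open>auto simp: component_embed component_simps snd_Rep_simps snd_Rep_embed
        cring.cring_simprules [OF cring2_D]\<close>)+

lemma embed_component_pow:
  assumes R: "cring2 R" and a: "a \<in> carrier R" and "k > 0"
  shows "embed_component R (a [^]\<^bsub>R\<^esub> k) = embed_component R a ^ k"
  using \<open>k > 0\<close>
proof (induction k)
  case (Suc k)
  interpret cring R by (rule cring2_D [OF R])
  show ?case
    using Suc a embed_component_hom(3) [OF R, of "a [^]\<^bsub>R\<^esub> k" a]
    by (cases "k = 0") (simp_all add: mult.commute)
qed simp

lemma component_pow: "cring2 R \<Longrightarrow> component R (x ^ k) = component R x [^]\<^bsub>R\<^esub> k"
proof (induction k)
  case (Suc k)
  interpret cring R by (rule cring2_D [OF Suc.prems])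
  show ?case
    using Suc by (simp add: component_simps m_comm)
qed (simp add: component_simps)

lemma component_sum:
  assumes R: "cring2 R" and "finite A"
  shows "component R (\<Sum>a\<in>A. f a) = (\<Oplus>\<^bsub>R\<^esub> a\<in>A. component R (f a))"
proof -
  interpret cring R by (rule cring2_D [OF R])
  show ?thesis
    using \<open>finite A\<close> by (induction A) (simp_all add: component_simps R)
qed

lemma component_prod:
  assumes R: "cring2 R" and "finite A"
  shows "component R (\<Prod>a\<in>A. f a) = (\<Otimes>\<^bsub>R\<^esub> a\<in>A. component R (f a))"
proof -
  interpret cring R by (rule cring2_D [OF R])
  show ?thesis
    using \<open>finite A\<close> by (induction A) (simp_all add: component_simps R)
qed

section \<open>Products of classes that vanish on open sets\<close>

lemma cring2_inv_cohomology_ring: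
  assumes G: "acts_on X G"
  shows "cring2 (inv_cohomology_ring X G)"
  unfolding cring2_def
proof (intro conjI cring_inv_cohomology_ring [OF G] ballI)
  fix A assume "A \<in> carrier (inv_cohomology_ring X G)"
  then obtain a where "a \<in> inv_cocycles X G" "A = inv_class X G a"
    by (auto simp: inv_cohomology_carrier)
  then show "A \<oplus>\<^bsub>inv_cohomology_ring X G\<^esub> A = \<zero>\<^bsub>inv_cohomology_ring X G\<^esub>"
    by (simp add: inv_cohomology_zero flip: inv_class_simps(2) [OF G])
qed

lemma equivariant_map_compose:
  assumes f: "equivariant_map X G Y H f" and g: "equivariant_map Y H Z K g"
  shows "equivariant_map X G Z K (g \<circ> f)"
  unfolding equivariant_map_def
proof (intro conjI ballI)
  have fc: "continuous_map X Y f" and gc: "continuous_map Y Z g"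
    using f g by (auto simp: equivariant_map_def)
  then show "continuous_map X Z (g \<circ> f)"
    by (rule continuous_map_compose)
  have fY: "f x \<in> topspace Y" if "x \<in> topspace X" for x
    using fc that by (auto simp: continuous_map_def)
  fix s assume "s \<in> G"
  then consider "\<forall>x\<in>topspace X. f (s x) = f x" | h where "h \<in> H" "\<forall>x\<in>topspace X. f (s x) = h (f x)"
    using f by (auto simp: equivariant_map_def)
  then show "(\<forall>x\<in>topspace X. (g \<circ> f) (s x) = (g \<circ> f) x) \<or> (\<exists>k\<in>K. \<forall>x\<in>topspace X. (g \<circ> f) (s x) = k ((g \<circ> f) x))"
  proof cases
    case 2
    then have "(\<forall>y\<in>topspace Y. g (h y) = g y) \<or> (\<exists>k\<in>K. \<forall>y\<in>topspace Y. g (h y) = k (g y))"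
      using g by (auto simp: equivariant_map_def)
    then show ?thesis
      using 2 fY by auto
  qed auto
qed

lemma inv_pullback_compose:
  assumes f: "equivariant_map X G Y H f" and g: "equivariant_map Y H Z K g"
    and G: "acts_on X G" and H: "acts_on Y H" and A: "A \<in> carrier (inv_cohomology_ring Z K)"
  shows "inv_pullback X G f (inv_pullback Y H g A) = inv_pullback X G (g \<circ> f) A"
proof -
  obtain a where "a \<in> inv_cocycles Z K" "A = inv_class Z K a"
    using A by (auto simp: inv_cohomology_carrier)
  then show ?thesis
    using inv_pullback_class [OF f G] inv_pullback_class [OF g H]
      inv_pullback_class [OF equivariant_map_compose [OF f g] G] cochain_pullback_compose [of X Y f g a] f
    by (simp add: equivariant_map_def)
qed

lemma inv_pullback_cong:
  assumes "\<And>x. x \<in> topspace X \<Longrightarrow> f x = g x"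
  shows "inv_pullback X G f A = inv_pullback X G g A"
  using cochain_pullback_cong [of X f g] assms by (simp add: inv_pullback_def)

lemma inv_pullback_id:
  assumes G: "acts_on X G" and A: "A \<in> carrier (inv_cohomology_ring X G)"
  shows "inv_pullback X G (\<lambda>x. x) A = A"
proof -
  obtain a where a: "a \<in> inv_cocycles X G" "A = inv_class X G a"
    using A by (auto simp: inv_cohomology_carrier)
  have "equivariant_map X G X G (\<lambda>x. x)"
    by (auto simp: equivariant_map_def)
  from inv_pullback_class [OF this G] show ?thesis
    using a cochain_pullback_id [of a X G "\<lambda>x. x"] by (simp add: inv_cocycles_def)
qed

lemma inv_pullback_closed:
  assumes "equivariant_map X G Y H f" "acts_on X G" "acts_on Y H" "A \<in> carrier (inv_cohomology_ring Y H)"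
  shows "inv_pullback X G f A \<in> carrier (inv_cohomology_ring X G)"
  by (rule ring_hom_closed [OF inv_pullback_hom [OF assms(1-3)] assms(4)])

lemma inv_pullback_zero:
  assumes "equivariant_map X G Y H f" "acts_on X G"
  shows "inv_pullback X G f \<zero>\<^bsub>inv_cohomology_ring Y H\<^esub> = \<zero>\<^bsub>inv_cohomology_ring X G\<^esub>"
  using inv_pullback_class [OF assms, of 0] by (simp add: inv_cohomology_zero)

text \<open>An equivalence rather than an implication, since generators are not assumed invertible.
  The direction from the image back to the point is what makes the extension by zero of an invariant
  cochain invariant.\<close>

definition stable_set :: "'a topology \<Rightarrow> ('a \<Rightarrow> 'a) set \<Rightarrow> 'a set \<Rightarrow> bool" where
  "stable_set X G U \<longleftrightarrow> (\<forall>g\<in>G. \<forall>x\<in>topspace X. g x \<in> U \<longleftrightarrow> x \<in> U)"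

lemma acts_on_subtopology:
  assumes "acts_on X G" "stable_set X G U"
  shows "acts_on (subtopology X U) G"
  using assms by (auto simp: acts_on_def stable_set_def continuous_map_in_subtopology continuous_map_from_subtopology)

lemma equivariant_map_inclusion:
  assumes "U \<subseteq> V"
  shows "equivariant_map (subtopology X U) G (subtopology X V) G (\<lambda>x. x)"
  using assms by (auto simp: equivariant_map_def continuous_map_in_subtopology continuous_map_from_subtopology)

lemma equivariant_map_inclusion_UNIV:
  "equivariant_map (subtopology X U) G X G (\<lambda>x. x)"
  by (auto simp: equivariant_map_def continuous_map_from_subtopology)

text \<open>Cochains vanish off the simplices of their space, so extension by zero is literally the
  same function. A generator maps simplices in U to simplices in U and all others to others.\<close>

lemma inv_cochains_extend:
  assumes G: "acts_on X G" and U: "stable_set X G U" and d: "d \<in> inv_cochains (subtopology X U) G"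
  shows "d \<in> inv_cochains X G"
proof -
  have "d k (simplex_map k g \<sigma>) = d k \<sigma>" if g: "g \<in> G" and s: "singular_simplex k X \<sigma>" for g k \<sigma>
  proof (cases "singular_simplex k (subtopology X U) \<sigma>")
    case True
    then show ?thesis
      using d g by (simp add: inv_cochains_iff invariant_cochain_def)
  next
    case False
    have "\<sigma> x \<in> topspace X" if "x \<in> standard_simplex k" for x
      using s that by (auto simp: singular_simplex_def continuous_map_def)
    then have "\<not> singular_simplex k (subtopology X U) (simplex_map k g \<sigma>)"
      using False s g U acts_on_simplex [OF G g s]
      by (auto simp: singular_simplex_subtopology simplex_map_def stable_set_def image_subset_iff)
    with False show ?thesis
      using inv_cochain_outside [OF d] by simp
  qed
  moreover have "d k \<sigma> = 0" if "\<not> singular_simplex k X \<sigma>" for k \<sigma>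
    using that inv_cochain_outside [OF d, of k \<sigma>] by (simp add: singular_simplex_subtopology)
  ultimately show ?thesis
    using d by (auto simp: inv_cochains_iff invariant_cochain_def)
qed

text \<open>A primitive on U is a cochain on the whole space after extension by zero; adding its
  coboundary changes the cocycle within its class and makes it vanish on the simplices in U. This
  lifts a class to one relative to U without introducing relative groups.\<close>

lemma cohomologous_to_vanishing:
  assumes G: "acts_on X G" and U: "stable_set X G U" and a: "a \<in> inv_cocycles X G"
    and z: "cochain_pullback (subtopology X U) (\<lambda>x. x) a \<in> inv_coboundaries (subtopology X U) G"
  obtains b where "b \<in> inv_cocycles X G" "inv_class X G b = inv_class X G a"
    "\<And>k \<sigma>. singular_simplex k (subtopology X U) \<sigma> \<Longrightarrow> b k \<sigma> = 0"
proof -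
  obtain d where d: "d \<in> inv_cochains (subtopology X U) G"
      "cochain_pullback (subtopology X U) (\<lambda>x. x) a = coboundary (subtopology X U) d"
    using z by (auto simp: inv_coboundaries_def)
  have dX: "d \<in> inv_cochains X G"
    by (rule inv_cochains_extend [OF G U d(1)])
  then have db: "coboundary X d \<in> inv_coboundaries X G"
    by (auto simp: inv_coboundaries_def)
  have 1: "a + coboundary X d \<in> inv_cocycles X G"
    using db inv_coboundaries_subset [OF G] by (intro inv_cocycles_closed(3) [OF G] a) auto
  have 2: "inv_class X G (a + coboundary X d) = inv_class X G a"
    using db by (simp add: inv_class_eq_iff add.commute [of a] add.assoc)
  have 3: "(a + coboundary X d) k \<sigma> = 0" if s: "singular_simplex k (subtopology X U) \<sigma>" for k \<sigma>
  proof -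
    have sX: "singular_simplex k X \<sigma>"
      using s by (simp add: singular_simplex_subtopology)
    have "a k \<sigma> = cochain_pullback (subtopology X U) (\<lambda>x. x) a k \<sigma>"
      using s simplex_map_id_gen [OF s, of "\<lambda>x. x"] by (simp add: cochain_pullback_def)
    also have "\<dots> = coboundary X d k \<sigma>"
      using s sX by (simp add: d(2) coboundary_def)
    finally show ?thesis by simp
  qed
  show thesis
    by (rule that [OF 1 2 3])
qed

definition vanishes_on :: "'a topology \<Rightarrow> ('a \<Rightarrow> 'a) set \<Rightarrow> 'a set \<Rightarrow> 'a cochain set \<Rightarrow> bool" where
  "vanishes_on X G U A \<longleftrightarrow> openin X U \<and> stable_set X G U \<and> A \<in> carrier (inv_cohomology_ring X G) \<and>
     inv_pullback (subtopology X U) G (\<lambda>x. x) A = \<zero>\<^bsub>inv_cohomology_ring (subtopology X U) G\<^esub>"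

text \<open>Both classes are represented by cocycles that vanish on the simplices in U and in V,
  respectively. The faces of a simplex inside one of the two sets stay inside it, so the cup product
  vanishes on all simplices that are small for the cover, and such a cocycle is a
  coboundary.\<close>

lemma vanishes_on_cover_mult:
  assumes G: "acts_on X G" and a: "vanishes_on X G U A" and b: "vanishes_on X G V B"
    and UV: "topspace X \<subseteq> U \<union> V"
  shows "A \<otimes>\<^bsub>inv_cohomology_ring X G\<^esub> B = \<zero>\<^bsub>inv_cohomology_ring X G\<^esub>"
proof -
  have rep: "\<exists>a. a \<in> inv_cocycles X G \<and> A = inv_class X G a \<and>
      (\<forall>k \<sigma>. singular_simplex k (subtopology X U) \<sigma> \<longrightarrow> a k \<sigma> = 0)"
    if A: "vanishes_on X G U A" for U A
  proof -
    obtain a where a: "a \<in> inv_cocycles X G" "A = inv_class X G a"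
      using A by (auto simp: vanishes_on_def inv_cohomology_carrier)
    have U: "stable_set X G U"
      using A by (simp add: vanishes_on_def)
    have "cochain_pullback (subtopology X U) (\<lambda>x. x) a \<in> inv_coboundaries (subtopology X U) G"
      using A a inv_pullback_class [OF equivariant_map_inclusion_UNIV acts_on_subtopology [OF G U]]
      by (simp add: vanishes_on_def inv_class_eq_zero_iff)
    from cohomologous_to_vanishing [OF G U a(1) this] show ?thesis
      using a(2) by metis
  qed
  obtain c where c: "c \<in> inv_cocycles X G" "A = inv_class X G c"
      "\<And>k \<sigma>. singular_simplex k (subtopology X U) \<sigma> \<Longrightarrow> c k \<sigma> = 0"
    using rep [OF a] by blast
  obtain d where d: "d \<in> inv_cocycles X G" "B = inv_class X G d"
      "\<And>k \<sigma>. singular_simplex k (subtopology X V) \<sigma> \<Longrightarrow> d k \<sigma> = 0"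
    using rep [OF b] by blast
  have "cup X c d \<in> inv_coboundaries X G"
  proof (rule small_cocycle_is_coboundary [OF G])
    show "cup X c d \<in> inv_cocycles X G"
      by (rule inv_cocycles_closed(4) [OF G c(1) d(1)])
    show "topspace X \<subseteq> \<Union>{U, V}"
      using UV by simp
    show "openin X W" if "W \<in> {U, V}" for W
      using that a b by (auto simp: vanishes_on_def)
    fix k \<sigma> W assume W: "W \<in> {U, V}" and s: "singular_simplex k X \<sigma>" and \<sigma>: "\<sigma> \<in> standard_simplex k \<rightarrow> W"
    have sW: "singular_simplex k (subtopology X W) \<sigma>"
      using s \<sigma> by (auto simp: singular_simplex_subtopology)
    have "c p (simplex_act p (\<lambda>j. j) \<sigma>) * d (k - p) (simplex_act (k - p) (\<lambda>j. p + j) \<sigma>) = 0" if "p \<le> k" for p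
    proof -
      have "singular_simplex p (subtopology X W) (simplex_act p (\<lambda>j. j) \<sigma>)"
        "singular_simplex (k - p) (subtopology X W) (simplex_act (k - p) (\<lambda>j. p + j) \<sigma>)"
        using that by (auto intro!: singular_simplex_simplex_act [OF sW])
      then show ?thesis
        using W c(3) d(3) by auto
    qed
    then show "cup X c d k \<sigma> = 0"
      unfolding cup_def by (auto intro!: sum.neutral simp del: mult_eq_0_iff)
  qed
  then show ?thesis
    using c d by (simp add: inv_class_eq_zero_iff flip: inv_class_simps(3) [OF G])
qed

lemma vanishes_on_restrict:
  assumes G: "acts_on X G" and A: "vanishes_on X G U A" and W: "stable_set X G W" "U \<subseteq> W"
  shows "vanishes_on (subtopology X W) G U (inv_pullback (subtopology X W) G (\<lambda>x. x) A)"
proof -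
  have U: "openin X U" "stable_set X G U" "A \<in> carrier (inv_cohomology_ring X G)"
    "inv_pullback (subtopology X U) G (\<lambda>x. x) A = \<zero>\<^bsub>inv_cohomology_ring (subtopology X U) G\<^esub>"
    using A by (auto simp: vanishes_on_def)
  have sub: "subtopology (subtopology X W) U = subtopology X U"
    using W(2) by (simp add: subtopology_subtopology Int_absorb1)
  have GW: "acts_on (subtopology X W) G" and GU: "acts_on (subtopology X U) G"
    using acts_on_subtopology [OF G] W U by auto
  have "inv_pullback (subtopology X U) G (\<lambda>x. x) (inv_pullback (subtopology X W) G (\<lambda>x. x) A)
      = \<zero>\<^bsub>inv_cohomology_ring (subtopology X U) G\<^esub>"
    using inv_pullback_compose [OF equivariant_map_inclusion [OF W(2)] equivariant_map_inclusion_UNIV GU GW U(3)] U(4)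
    by (simp add: comp_def)
  moreover have "openin (subtopology X W) U"
    using U(1) W(2) by (metis openin_subtopology_Int2 inf.absorb_iff2)
  moreover have "stable_set (subtopology X W) G U"
    using U(2) by (auto simp: stable_set_def)
  ultimately show ?thesis
    unfolding vanishes_on_def sub
    using inv_pullback_closed [OF equivariant_map_inclusion_UNIV GW G U(3)] by simp
qed

lemma vanishes_on_mult:
  assumes G: "acts_on X G" and a: "vanishes_on X G U A" and b: "vanishes_on X G V B"
  shows "vanishes_on X G (U \<union> V) (A \<otimes>\<^bsub>inv_cohomology_ring X G\<^esub> B)"
proof -
  let ?W = "U \<union> V"
  have W: "stable_set X G ?W" "openin X ?W"
    using a b by (auto simp: vanishes_on_def stable_set_def)
  have GW: "acts_on (subtopology X ?W) G"
    by (rule acts_on_subtopology [OF G W(1)])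
  have AB: "A \<in> carrier (inv_cohomology_ring X G)" "B \<in> carrier (inv_cohomology_ring X G)"
    using a b by (auto simp: vanishes_on_def)
  interpret cring "inv_cohomology_ring X G"
    by (rule cring_inv_cohomology_ring [OF G])
  note hom = inv_pullback_hom [OF equivariant_map_inclusion_UNIV GW G]
  have "inv_pullback (subtopology X ?W) G (\<lambda>x. x) (A \<otimes>\<^bsub>inv_cohomology_ring X G\<^esub> B)
      = \<zero>\<^bsub>inv_cohomology_ring (subtopology X ?W) G\<^esub>"
    unfolding ring_hom_mult [OF hom AB]
    by (rule vanishes_on_cover_mult [OF GW vanishes_on_restrict [OF G a W(1)] vanishes_on_restrict [OF G b W(1)]]) auto
  then show ?thesis
    using W AB by (simp add: vanishes_on_def)
qed

lemma vanishes_on_prod: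
  assumes G: "acts_on X G" and "finite I"
    and a: "\<And>i. i \<in> I \<Longrightarrow> vanishes_on X G (U i) (component (inv_cohomology_ring X G) (a i))"
  shows "vanishes_on X G (\<Union>i\<in>I. U i) (component (inv_cohomology_ring X G) (\<Prod>i\<in>I. a i))"
  using assms(2,3)
proof (induction I)
  case empty
  \<comment> \<open>The empty product is one, and one restricts to zero on the empty space, which
    has no simplices.\<close>
  have "subtopology X {} = trivial_topology"
    by simp
  have "acts_on (subtopology X {}) G"
    by (rule acts_on_subtopology [OF G]) (simp add: stable_set_def)
  have "unit_cochain (subtopology X {}) = 0"
    using singular_simplex_empty [of "subtopology X {}"] by (intro ext) (simp add: unit_cochain_def)
  moreover have "inv_pullback (subtopology X {}) G (\<lambda>x. x) \<one>\<^bsub>inv_cohomology_ring X G\<^esub>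
      = inv_class (subtopology X {}) G (unit_cochain (subtopology X {}))"
    using ring_hom_one [OF inv_pullback_hom [OF equivariant_map_inclusion_UNIV \<open>acts_on (subtopology X {}) G\<close> G]]
      inv_class_simps(4) [OF \<open>acts_on (subtopology X {}) G\<close>] by simp
  ultimately show ?case
    using cring.cring_simprules(6) [OF cring_inv_cohomology_ring [OF G]]
    by (simp add: vanishes_on_def component_simps cring2_inv_cohomology_ring [OF G] inv_cohomology_zero stable_set_def)
next
  case (insert i I)
  then show ?case
    using vanishes_on_mult [OF G, of "U i" "component (inv_cohomology_ring X G) (a i)" "\<Union>i\<in>I. U i"]
    by (simp add: component_simps cring2_inv_cohomology_ring [OF G])
qed

lemma vanishes_on_topspace:
  assumes G: "acts_on X G" and A: "vanishes_on X G U A" and "topspace X \<subseteq> U"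
  shows "A = \<zero>\<^bsub>inv_cohomology_ring X G\<^esub>"
proof -
  have "subtopology X U = X"
    using assms(3) subtopology_superset by blast
  then show ?thesis
    using A inv_pullback_id [OF G, of A] by (simp add: vanishes_on_def)
qed

section \<open>Classes of coboundaries of functions that change under the symmetries\<close>

definition point_cochain :: "'a topology \<Rightarrow> ('a \<Rightarrow> bit) \<Rightarrow> 'a cochain" where
  "point_cochain X e = (\<lambda>k \<sigma>. if k = 0 \<and> singular_simplex 0 X \<sigma> then e (\<sigma> (\<lambda>j. if j = 0 then 1 else 0)) else 0)"

text \<open>The cocycle compares the values of e at the two ends of a path. It is a coboundary of
  ordinary cochains, but e may change by a constant under each generator; then its point cochain is
  not an invariant primitive, and the class measures these sign changes.\<close>

definition sign_class :: "'a topology \<Rightarrow> ('a \<Rightarrow> 'a) set \<Rightarrow> ('a \<Rightarrow> bit) \<Rightarrow> 'a cochain set" where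
  "sign_class X G e = inv_class X G (coboundary X (point_cochain X e))"

definition sign_function :: "'a topology \<Rightarrow> ('a \<Rightarrow> 'a) set \<Rightarrow> ('a \<Rightarrow> bit) \<Rightarrow> bool" where
  "sign_function X G e \<longleftrightarrow> (\<forall>g\<in>G. \<exists>b. \<forall>x\<in>topspace X. e (g x) = e x + b)"

lemma point_in_simplex [simp]: "(\<lambda>j. if j = 0 then 1 else 0) \<in> standard_simplex 0"
  by simp

lemma singular_simplex_point:
  assumes "singular_simplex 0 X \<sigma>"
  shows "\<sigma> (\<lambda>j. if j = 0 then 1 else 0) \<in> topspace X"
  using assms point_in_simplex by (auto simp: singular_simplex_def continuous_map_def simp del: point_in_simplex)

lemma point_cochain_add: "point_cochain X (\<lambda>x. e x + e' x) = point_cochain X e + point_cochain X e'"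
  by (intro ext) (simp add: point_cochain_def)

lemma point_cochain_one: "point_cochain X (\<lambda>x. 1) = unit_cochain X"
  by (intro ext) (simp add: point_cochain_def unit_cochain_def)

lemma coboundary_point_const: "coboundary X (point_cochain X (\<lambda>x. b)) = 0"
proof (cases b)
  case zero
  then have "point_cochain X (\<lambda>x. b) = 0"
    by (intro ext) (simp add: point_cochain_def)
  then show ?thesis by simp
qed (simp add: point_cochain_one coboundary_unit)

lemma point_cochain_cong:
  assumes "\<And>x. x \<in> topspace X \<Longrightarrow> e x = e' x"
  shows "point_cochain X e = point_cochain X e'"
  using singular_simplex_point [of X] assms by (intro ext) (auto simp: point_cochain_def)

lemma cochain_pullback_point:
  assumes "continuous_map X Y f"
  shows "cochain_pullback X f (point_cochain Y e) = point_cochain X (\<lambda>x. e (f x))"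
  using singular_simplex_simplex_map [OF _ assms, of 0]
  by (intro ext) (auto simp: cochain_pullback_def point_cochain_def simplex_map_def)

lemma finite_support_point: "finite {k. point_cochain X e k \<noteq> 0}"
  by (rule finite_subset [of _ "{0}"]) (auto simp: point_cochain_def fun_eq_iff)

lemma point_cochain_invariant:
  assumes G: "acts_on X G" and e: "\<And>g x. \<lbrakk>g \<in> G; x \<in> topspace X\<rbrakk> \<Longrightarrow> e (g x) = e x"
  shows "point_cochain X e \<in> inv_cochains X G"
proof -
  have "cochain_pullback X g (point_cochain X e) = point_cochain X e" if "g \<in> G" for g
  proof -
    have "continuous_map X X g"
      using G that by (simp add: acts_on_def)
    then show ?thesis
      using e that by (simp add: cochain_pullback_point point_cochain_cong [of X "\<lambda>x. e (g x)" e])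
  qed
  moreover have "point_cochain X e k \<sigma> = 0" if "\<not> singular_simplex k X \<sigma>" for k \<sigma>
    using that by (auto simp: point_cochain_def)
  ultimately show ?thesis
    by (simp add: inv_cochains_iff finite_support_point invariant_cochain_iff)
qed

lemma sign_cocycle:
  assumes G: "acts_on X G" and e: "sign_function X G e"
  shows "coboundary X (point_cochain X e) \<in> inv_cocycles X G"
proof -
  have "point_cochain X e \<in> inv_cochains X {}"
    by (rule point_cochain_invariant) auto
  then have "coboundary X (point_cochain X e) \<in> inv_cochains X {}"
    by (intro inv_cochains_coboundary) auto
  moreover have "cochain_pullback X g (coboundary X (point_cochain X e)) = coboundary X (point_cochain X e)"
    if g: "g \<in> G" for g
  proof -
    have gc: "continuous_map X X g"
      using G g by (simp add: acts_on_def)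
    obtain b where b: "\<forall>x\<in>topspace X. e (g x) = e x + b"
      using e g by (auto simp: sign_function_def)
    have "cochain_pullback X g (coboundary X (point_cochain X e)) = coboundary X (point_cochain X (\<lambda>x. e (g x)))"
      by (simp add: cochain_pullback_coboundary [OF gc] cochain_pullback_point [OF gc])
    also have "point_cochain X (\<lambda>x. e (g x)) = point_cochain X e + point_cochain X (\<lambda>x. b)"
      unfolding point_cochain_add [symmetric] using b by (intro point_cochain_cong) simp
    finally show ?thesis
      unfolding coboundary_add coboundary_point_const add_0_right .
  qed
  ultimately show ?thesis
    by (simp add: inv_cocycles_def coboundary_coboundary inv_cochains_iff invariant_cochain_iff)
qed

lemma sign_class_closed:
  assumes "acts_on X G" "sign_function X G e"
  shows "sign_class X G e \<in> carrier (inv_cohomology_ring X G)"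
  unfolding sign_class_def by (rule inv_class_simps(1) [OF assms(1) sign_cocycle [OF assms]])

lemma sign_class_pullback:
  assumes f: "equivariant_map X G Y H f" and G: "acts_on X G"
  shows "inv_pullback X G f (sign_class Y H e) = sign_class X G (\<lambda>x. e (f x))"
  using f inv_pullback_class [OF f G]
  by (simp add: sign_class_def cochain_pullback_coboundary cochain_pullback_point equivariant_map_def)

text \<open>If e and e' change in the same way then their sum is invariant, and its point cochain is
  an invariant primitive of the difference of the two cocycles.\<close>

lemma sign_class_cong:
  assumes G: "acts_on X G" and "\<And>g x. \<lbrakk>g \<in> G; x \<in> topspace X\<rbrakk> \<Longrightarrow> e (g x) + e' (g x) = e x + e' x"
  shows "sign_class X G e = sign_class X G e'"
proof -
  have "point_cochain X (\<lambda>x. e x + e' x) \<in> inv_cochains X G"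
    by (rule point_cochain_invariant [OF G]) (use assms(2) in auto)
  then show ?thesis
    by (simp add: sign_class_def inv_class_eq_iff inv_coboundaries_def point_cochain_add flip: coboundary_add)
qed

lemma sign_class_zero:
  assumes G: "acts_on X G" and "\<And>g x. \<lbrakk>g \<in> G; x \<in> topspace X\<rbrakk> \<Longrightarrow> e (g x) = e x"
  shows "sign_class X G e = \<zero>\<^bsub>inv_cohomology_ring X G\<^esub>"
proof -
  have "sign_class X G e = sign_class X G (\<lambda>_. 0)"
    by (rule sign_class_cong [OF G]) (use assms(2) in auto)
  then show ?thesis
    using coboundary_point_const [of X 0] by (simp add: sign_class_def inv_cohomology_zero)
qed

section \<open>Adjoining a projective space\<close>

definition punctured :: "nat \<Rightarrow> (nat \<Rightarrow> real) topology" where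
  "punctured m = subtopology (powertop_real UNIV) {v. (\<forall>i\<ge>m. v i = 0) \<and> v \<noteq> (\<lambda>_. 0)}"

text \<open>The sign of the first nonzero coordinate: a discontinuous choice of one vector from each
  antipodal pair. It enters the arguments through the fact that negation changes it by one.\<close>

definition vector_sign :: "(nat \<Rightarrow> real) \<Rightarrow> bit" where
  "vector_sign v = (if v (LEAST i. v i \<noteq> 0) > 0 then 1 else 0)"

abbreviation vector_neg :: "(nat \<Rightarrow> real) \<Rightarrow> nat \<Rightarrow> real" where
  "vector_neg v \<equiv> \<lambda>i. - v i"

lemma topspace_punctured: "topspace (punctured m) = {v. (\<forall>i\<ge>m. v i = 0) \<and> v \<noteq> (\<lambda>_. 0)}"
  by (simp add: punctured_def)

lemma vector_sign_neg:
  assumes "v \<noteq> (\<lambda>_. 0)"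
  shows "vector_sign (vector_neg v) = vector_sign v + 1"
proof -
  have "v (LEAST i. v i \<noteq> 0) \<noteq> 0"
    using assms by (intro LeastI_ex [where P = "\<lambda>i. v i \<noteq> 0"]) (auto simp: fun_eq_iff)
  then show ?thesis
    by (auto simp: vector_sign_def)
qed

lemma continuous_map_into_punctured:
  "continuous_map X (punctured m) f \<longleftrightarrow>
    (\<forall>i. continuous_map X euclideanreal (\<lambda>x. f x i)) \<and>
    (\<forall>x\<in>topspace X. (\<forall>i\<ge>m. f x i = 0) \<and> f x \<noteq> (\<lambda>_. 0))"
  by (auto simp: punctured_def continuous_map_in_subtopology continuous_map_componentwise_UNIV)

lemma continuous_map_punctured_component:
  "continuous_map (punctured m) euclideanreal (\<lambda>v. v i)"
  unfolding punctured_def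
  by (intro continuous_map_from_subtopology continuous_map_product_projection) simp

text \<open>In terms of orbit spaces this multiplies, for positive m, by a space of the homotopy
  type of the real projective space of dimension m - 1; \<open>line_class\<close> is the first
  Stiefel--Whitney class of its tautological line bundle. All spheres consist of sequences that
  vanish from m on, so passing from m to m + 1 is the identity on points.\<close>

definition line_space :: "'a topology \<Rightarrow> nat \<Rightarrow> ('a \<times> (nat \<Rightarrow> real)) topology" where
  "line_space X m = prod_topology X (punctured m)"

definition line_group :: "('a \<Rightarrow> 'a) set \<Rightarrow> ('a \<times> (nat \<Rightarrow> real) \<Rightarrow> 'a \<times> (nat \<Rightarrow> real)) set" where
  "line_group G = insert (\<lambda>(x, v). (x, vector_neg v)) ((\<lambda>g (x, v). (g x, v)) ` G)"

definition line_class :: "'a topology \<Rightarrow> ('a \<Rightarrow> 'a) set \<Rightarrow> nat \<Rightarrow> ('a \<times> (nat \<Rightarrow> real)) cochain set" where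
  "line_class X G m = sign_class (line_space X m) (line_group G) (\<lambda>p. vector_sign (snd p))"

lemma topspace_line_space:
  "topspace (line_space X m) = topspace X \<times> {v. (\<forall>i\<ge>m. v i = 0) \<and> v \<noteq> (\<lambda>_. 0)}"
  by (simp add: line_space_def topspace_punctured)

lemma continuous_map_line_space_fst: "continuous_map (line_space X m) X fst"
  by (simp add: line_space_def continuous_map_fst)

lemma continuous_map_line_space_component: "continuous_map (line_space X m) euclideanreal (\<lambda>p. snd p i)"
  using continuous_map_compose [OF continuous_map_snd continuous_map_punctured_component]
  by (simp add: line_space_def comp_def)

lemma continuous_map_into_line_space:
  "continuous_map Y (line_space X m) f \<longleftrightarrow> continuous_map Y X (\<lambda>y. fst (f y)) \<and>
    (\<forall>i. continuous_map Y euclideanreal (\<lambda>y. snd (f y) i)) \<and>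
    (\<forall>y\<in>topspace Y. (\<forall>i\<ge>m. snd (f y) i = 0) \<and> snd (f y) \<noteq> (\<lambda>_. 0))"
  by (simp add: line_space_def continuous_map_pairwise comp_def continuous_map_into_punctured)

lemma continuous_map_line_space_neg:
  "continuous_map (line_space X m) (line_space X m) (\<lambda>(x, v). (x, vector_neg v))"
  using continuous_map_line_space_fst [of X m] continuous_map_line_space_component [of X m]
  by (auto simp: continuous_map_into_line_space case_prod_beta topspace_line_space fun_eq_iff
      intro!: continuous_map_minus)

lemma continuous_map_line_space_lift:
  assumes "continuous_map X X g"
  shows "continuous_map (line_space X m) (line_space X m) (\<lambda>(x, v). (g x, v))"
  using continuous_map_compose [OF continuous_map_line_space_fst [of X m] assms]
    continuous_map_line_space_component [of X m]
  by (auto simp: continuous_map_into_line_space case_prod_beta topspace_line_space comp_def)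

lemma acts_on_lift:
  "acts_on X G \<Longrightarrow> acts_on (line_space X m) ((\<lambda>g (x, v). (g x, v)) ` G)"
  using continuous_map_line_space_lift by (auto simp: acts_on_def)

lemma acts_on_line_group:
  assumes "acts_on X G"
  shows "acts_on (line_space X m) (line_group G)"
  using acts_on_lift [OF assms, of m] continuous_map_line_space_neg
  by (auto simp: acts_on_def line_group_def)

lemma equivariant_map_line_fst: "equivariant_map (line_space X m) (line_group G) X G fst"
  by (auto simp: equivariant_map_def continuous_map_line_space_fst line_group_def)

lemma sign_function_line: "sign_function (line_space X m) (line_group G) (\<lambda>p. vector_sign (snd p))"
proof -
  have "\<exists>b. \<forall>p\<in>topspace (line_space X m). vector_sign (snd (g p)) = vector_sign (snd p) + b" if "g \<in> line_group G" for g
  proof (cases "g = (\<lambda>(x, v). (x, vector_neg v))")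
    case True
    then show ?thesis
      by (intro exI [of _ 1]) (auto simp: topspace_line_space vector_sign_neg)
  next
    case False
    then show ?thesis
      using that by (intro exI [of _ 0]) (auto simp: line_group_def)
  qed
  then show ?thesis
    by (simp add: sign_function_def)
qed

lemma line_class_closed:
  "acts_on X G \<Longrightarrow> line_class X G m \<in> carrier (inv_cohomology_ring (line_space X m) (line_group G))"
  unfolding line_class_def by (intro sign_class_closed acts_on_line_group sign_function_line)

lemma equivariant_map_line_inclusion:
  "equivariant_map (line_space X m) (line_group G) (line_space X (Suc m)) (line_group G) (\<lambda>p. p)"
  using continuous_map_line_space_fst [of X m] continuous_map_line_space_component [of X m]
  by (auto simp: equivariant_map_def continuous_map_into_line_space topspace_line_space)

text \<open>
  If \<open>x\<close> is an invariant cocycle and \<open>x \<smile> \<delta>\<epsilon> = \<delta>y\<close> then \<open>u = y + x \<smile> \<epsilon>\<close> is a cocycle with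
  \<open>u + \<tau>\<^sup>*u = x\<close>, where \<open>\<tau>\<close> is the antipodal map; and \<open>u\<close> becomes a pullback from \<open>X\<close> on the next
  smaller sphere, because that sphere is contractible in the bigger one.
\<close>

lemma gysin:
  assumes G: "acts_on X G"
    and A: "A \<in> carrier (inv_cohomology_ring (line_space X (Suc m)) (line_group G))"
    and z: "A \<otimes>\<^bsub>inv_cohomology_ring (line_space X (Suc m)) (line_group G)\<^esub> line_class X G (Suc m)
      = \<zero>\<^bsub>inv_cohomology_ring (line_space X (Suc m)) (line_group G)\<^esub>"
  shows "inv_pullback (line_space X m) (line_group G) (\<lambda>p. p) A
      = \<zero>\<^bsub>inv_cohomology_ring (line_space X m) (line_group G)\<^esub>"
proof -
  let ?W = "line_space X (Suc m)" and ?Y = "line_space X m"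
  let ?G1 = "(\<lambda>g (x, v :: nat \<Rightarrow> real). (g x, v)) ` G" and ?\<tau> = "\<lambda>(x :: 'a, v). (x, vector_neg v)"
  note LG = line_group_def [of G]
  have W: "acts_on ?W (line_group G)" "acts_on ?W ?G1" and Y: "acts_on ?Y (line_group G)" "acts_on ?Y ?G1"
    using acts_on_line_group [OF G] acts_on_lift [OF G] by auto
  obtain x where x: "x \<in> inv_cocycles ?W (line_group G)" "A = inv_class ?W (line_group G) x"
    using A by (auto simp: inv_cohomology_carrier)
  let ?\<epsilon> = "point_cochain ?W (\<lambda>p. vector_sign (snd p))"
  have t: "coboundary ?W ?\<epsilon> \<in> inv_cocycles ?W (line_group G)"
    by (rule sign_cocycle [OF W(1) sign_function_line])
  have "cup ?W x (coboundary ?W ?\<epsilon>) \<in> inv_coboundaries ?W (line_group G)"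
    using z x t unfolding line_class_def sign_class_def
    by (simp add: inv_class_eq_zero_iff flip: inv_class_simps(3) [OF W(1)])
  then obtain y where y: "y \<in> inv_cochains ?W (line_group G)" "cup ?W x (coboundary ?W ?\<epsilon>) = coboundary ?W y"
    by (auto simp: inv_coboundaries_def)
  have mono: "c \<in> inv_cochains ?W ?G1" if "c \<in> inv_cochains ?W (line_group G)" for c
    using that by (auto simp: inv_cochains_iff invariant_cochain_def LG)
  have \<epsilon>: "?\<epsilon> \<in> inv_cochains ?W ?G1"
    by (rule point_cochain_invariant [OF W(2)]) auto
  have x': "x \<in> inv_cochains ?W (line_group G)" "coboundary ?W x = 0"
    using x(1) by (auto simp: inv_cocycles_def)
  define u where "u = y + cup ?W x ?\<epsilon>"
  have u: "u \<in> inv_cocycles ?W ?G1"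
    unfolding inv_cocycles_def u_def
    using mono [OF y(1)] mono [OF x'(1)] \<epsilon>
    by (simp add: inv_cochains_add inv_cochains_cup [OF W(2)] coboundary_add coboundary_cup x'(2) y(2))
  have \<tau>W: "continuous_map ?W ?W ?\<tau>" and \<tau>Y: "continuous_map ?Y ?Y ?\<tau>"
    by (rule continuous_map_line_space_neg)+
  have "?\<tau> \<in> line_group G"
    by (simp add: LG)
  have \<tau>u: "cochain_pullback ?W ?\<tau> u + u = x"
  proof -
    have "cochain_pullback ?W ?\<tau> ?\<epsilon> = ?\<epsilon> + point_cochain ?W (\<lambda>_. 1)"
      unfolding cochain_pullback_point [OF \<tau>W] point_cochain_add [symmetric]
      by (rule point_cochain_cong) (auto simp: topspace_line_space vector_sign_neg)
    then have "cochain_pullback ?W ?\<tau> u = y + cup ?W x (?\<epsilon> + unit_cochain ?W)"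
      unfolding u_def cochain_pullback_add cochain_pullback_cup [OF \<tau>W]
      using cochain_pullback_invariant [OF y(1) \<open>?\<tau> \<in> line_group G\<close>]
        cochain_pullback_invariant [OF x'(1) \<open>?\<tau> \<in> line_group G\<close>]
      by (simp only: point_cochain_one)
    also have "\<dots> = y + (cup ?W x ?\<epsilon> + x)"
      by (simp only: cup_add_right cup_unit_right [OF x'(1)])
    finally have eq: "cochain_pullback ?W ?\<tau> u = y + (cup ?W x ?\<epsilon> + x)" .
    show ?thesis
      unfolding eq unfolding u_def by (intro ext) (simp add: add_ac)
  qed
  \<comment> \<open>Straight segments to the m-th basis vector. They avoid the origin, because the
    vectors of the smaller space have m-th coordinate zero: for s \<noteq> 0 the m-th coordinate is
    s, and for s = 0 the vector is v.\<close>
  let ?F = "\<lambda>((x, v), s). (x, \<lambda>i. (1 - s) * v i + s * (if i = m then 1 else 0 :: real))"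
  have "continuous_map (prod_topology ?Y (top_of_set {0..1})) ?W ?F"
  proof -
    let ?Z = "prod_topology ?Y (top_of_set {0..1 :: real})"
    have 1: "continuous_map ?Z X (\<lambda>z. fst (fst z))"
      using continuous_map_compose [OF continuous_map_fst continuous_map_line_space_fst] by (simp add: comp_def)
    have 2: "continuous_map ?Z euclideanreal (\<lambda>z. snd (fst z) i)" for i
      using continuous_map_compose [OF continuous_map_fst continuous_map_line_space_component] by (simp add: comp_def)
    have 3: "continuous_map ?Z euclideanreal snd"
      using continuous_map_snd continuous_map_into_fulltopology by blast
    have "continuous_map ?Z euclideanreal (\<lambda>z. (1 - snd z) * snd (fst z) i + snd z * (if i = m then 1 else 0))" for i
      by (intro continuous_map_add continuous_map_real_mult continuous_map_diff 2 3 continuous_map_const [THEN iffD2]) auto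
    moreover have "(\<lambda>i. (1 - s) * v i + s * (if i = m then 1 else 0)) \<noteq> (\<lambda>_. 0)"
      if "\<forall>i\<ge>m. v i = 0" "v \<noteq> (\<lambda>_. 0)" for v and s :: real
    proof
      assume eq: "(\<lambda>i. (1 - s) * v i + s * (if i = m then 1 else 0)) = (\<lambda>_. 0)"
      have "s = 0"
        using fun_cong [OF eq, of m] that(1) by simp
      with eq that(2) show False
        by (auto simp: fun_eq_iff)
    qed
    ultimately show ?thesis
      using 1 by (auto simp: continuous_map_into_line_space case_prod_beta topspace_line_space)
  qed
  moreover have "(\<forall>p\<in>topspace ?Y. \<forall>t\<in>{0..1}. ?F (g p, t) = ?F (p, t)) \<or>
      (\<exists>h\<in>?G1. \<forall>p\<in>topspace ?Y. \<forall>t\<in>{0..1}. ?F (g p, t) = h (?F (p, t)))" if "g \<in> ?G1" for g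
    using that by (intro disjI2 bexI [of _ g]) auto
  ultimately have "cochain_pullback ?Y (\<lambda>p. ?F (p, 0)) u + cochain_pullback ?Y (\<lambda>p. ?F (p, 1)) u \<in> inv_coboundaries ?Y ?G1"
    by (rule homotopic_pullback [OF _ Y(2) u])
  moreover have "cochain_pullback ?Y (\<lambda>p. ?F (p, 0)) u = cochain_pullback ?Y (\<lambda>p. p) u"
    by (rule cochain_pullback_cong) auto
  ultimately obtain w where w: "w \<in> inv_cochains ?Y ?G1"
      "cochain_pullback ?Y (\<lambda>p. p) u + cochain_pullback ?Y (\<lambda>p. ?F (p, 1)) u = coboundary ?Y w"
    by (auto simp: inv_coboundaries_def)
  define q where "q = cochain_pullback ?Y (\<lambda>p. ?F (p, 1)) u"
  have iu: "cochain_pullback ?Y (\<lambda>p. p) u = coboundary ?Y w + q"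
    unfolding w(2) [symmetric] q_def by (simp only: add.assoc cochain_add_self add_0_right)
  \<comment> \<open>The map at the end of the homotopy forgets the vector, so it does not notice the
    antipode.\<close>
  have \<tau>q: "cochain_pullback ?Y ?\<tau> q = q"
    unfolding q_def cochain_pullback_compose [OF \<tau>Y] by (rule cochain_pullback_cong) (auto simp: fun_eq_iff)
  have inc: "continuous_map ?Y ?W (\<lambda>p. p)"
    using equivariant_map_line_inclusion by (auto simp: equivariant_map_def)
  \<comment> \<open>Since x is the sum of u and its antipodal translate, the two copies of q cancel.
    What is left is the coboundary of w plus its antipodal translate, and this sum is invariant
    under the antipode too, although w need not be.\<close>
  have "cochain_pullback ?Y (\<lambda>p. p) x
      = cochain_pullback ?Y (\<lambda>p. p) (cochain_pullback ?W ?\<tau> u) + cochain_pullback ?Y (\<lambda>p. p) u"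
    by (simp only: \<tau>u flip: cochain_pullback_add)
  also have "cochain_pullback ?Y (\<lambda>p. p) (cochain_pullback ?W ?\<tau> u) = cochain_pullback ?Y ?\<tau> (cochain_pullback ?Y (\<lambda>p. p) u)"
    by (simp add: cochain_pullback_compose [OF inc] cochain_pullback_compose [OF \<tau>Y] comp_def)
  also have "\<dots> + cochain_pullback ?Y (\<lambda>p. p) u = coboundary ?Y (cochain_pullback ?Y ?\<tau> w + w)"
    unfolding iu cochain_pullback_add \<tau>q coboundary_add cochain_pullback_coboundary [OF \<tau>Y]
    by (intro ext) (simp add: add_ac)
  finally have ix: "cochain_pullback ?Y (\<lambda>p. p) x = coboundary ?Y (cochain_pullback ?Y ?\<tau> w + w)" .
  have "equivariant_map ?Y ?G1 ?Y ?G1 ?\<tau>"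
    unfolding equivariant_map_def using \<tau>Y by auto
  then have \<tau>w: "cochain_pullback ?Y ?\<tau> w \<in> inv_cochains ?Y ?G1"
    by (rule inv_cochains_pullback [OF _ Y(2) w(1)])
  have "cochain_pullback ?Y ?\<tau> (cochain_pullback ?Y ?\<tau> w) = w"
    unfolding cochain_pullback_compose [OF \<tau>Y] by (rule cochain_pullback_id [OF w(1)]) auto
  then have "cochain_pullback ?Y ?\<tau> (cochain_pullback ?Y ?\<tau> w + w) = cochain_pullback ?Y ?\<tau> w + w"
    by (simp only: cochain_pullback_add add.commute)
  moreover have inv1: "cochain_pullback ?Y ?\<tau> w + w \<in> inv_cochains ?Y ?G1"
    by (rule inv_cochains_add [OF \<tau>w w(1)])
  ultimately have "cochain_pullback ?Y ?\<tau> w + w \<in> inv_cochains ?Y (line_group G)"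
    using inv1 by (simp only: inv_cochains_iff) (auto simp: invariant_cochain_iff LG)
  then show ?thesis
    using inv_pullback_class [OF equivariant_map_line_inclusion Y(1)] ix
    by (auto simp: x(2) inv_class_eq_zero_iff inv_coboundaries_def)
qed

text \<open>
  A ring homomorphism does not extend to the product rings. This relation allows to apply it to
  polynomial expressions nevertheless.
\<close>

definition matches :: "('r \<Rightarrow> 's) \<Rightarrow> 'r ring \<Rightarrow> 's ring \<Rightarrow> 'r ring_product \<Rightarrow> 's ring_product \<Rightarrow> bool" where
  "matches h R S x y \<longleftrightarrow> h (component R x) = component S y"

context
  fixes R :: "'r ring" and S :: "'s ring" and h
  assumes R: "cring2 R" and S: "cring2 S" and h: "h \<in> ring_hom R S"
begin

lemma matches_embed: "a \<in> carrier R \<Longrightarrow> matches h R S (embed_component R a) (embed_component S (h a))"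
  using ring_hom_closed [OF h] by (simp add: matches_def R S)

lemma matches_zero: "matches h R S 0 0"
proof -
  interpret R: cring R by (rule cring2_D [OF R])
  interpret S: cring S by (rule cring2_D [OF S])
  show ?thesis
    using ring_hom_zero [OF h R.ring_axioms S.ring_axioms] by (simp add: matches_def component_simps R S)
qed

lemma matches_one: "matches h R S 1 1"
  using ring_hom_one [OF h] by (simp add: matches_def component_simps R S)

lemma matches_add: "matches h R S x y \<Longrightarrow> matches h R S x' y' \<Longrightarrow> matches h R S (x + x') (y + y')"
  using ring_hom_add [OF h, of "component R x" "component R x'"] by (simp add: matches_def component_simps R S)

lemma matches_mult: "matches h R S x y \<Longrightarrow> matches h R S x' y' \<Longrightarrow> matches h R S (x * x') (y * y')"
  using ring_hom_mult [OF h, of "component R x" "component R x'"] by (simp add: matches_def component_simps R S)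

lemma matches_pow: "matches h R S x y \<Longrightarrow> matches h R S (x ^ k) (y ^ k)"
  by (induction k) (simp_all add: matches_one matches_mult)

lemma matches_sum: "(\<And>a. a \<in> A \<Longrightarrow> matches h R S (f a) (g a)) \<Longrightarrow> matches h R S (sum f A) (sum g A)"
  by (induction A rule: infinite_finite_induct) (simp_all add: matches_zero matches_add)

lemma matches_prod: "(\<And>a. a \<in> A \<Longrightarrow> matches h R S (f a) (g a)) \<Longrightarrow> matches h R S (prod f A) (prod g A)"
  by (induction A rule: infinite_finite_induct) (simp_all add: matches_one matches_mult)

end

text \<open>Restriction to a constant vector kills the line class, so the relation yields
  \<open>c 0\<close> = 0. The rest is A times the line class, with a polynomial A of one degree
  less. By \<open>gysin\<close> the restriction of A to the next smaller sphere is zero, which is a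
  relation of the same kind with one power less; the loss of one dimension is exactly what the
  induction on m affords.\<close>

theorem line_class_independent:
  assumes G: "acts_on X G" and c: "\<And>j. j < m \<Longrightarrow> c j \<in> carrier (inv_cohomology_ring X G)"
    and z: "component (inv_cohomology_ring (line_space X m) (line_group G))
      (\<Sum>j<m. embed_component (inv_cohomology_ring (line_space X m) (line_group G))
          (inv_pullback (line_space X m) (line_group G) fst (c j)) *
        embed_component (inv_cohomology_ring (line_space X m) (line_group G)) (line_class X G m) ^ j)
      = \<zero>\<^bsub>inv_cohomology_ring (line_space X m) (line_group G)\<^esub>"
    and "j < m"
  shows "c j = \<zero>\<^bsub>inv_cohomology_ring X G\<^esub>"
  using c z \<open>j < m\<close>
proof (induction m arbitrary: c j)
  case (Suc m)
  let ?W = "line_space X (Suc m)" and ?Y = "line_space X m" and ?L = "line_group G"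
  let ?HX = "inv_cohomology_ring X G" and ?HW = "inv_cohomology_ring ?W ?L" and ?HY = "inv_cohomology_ring ?Y ?L"
  let ?t = "embed_component ?HW (line_class X G (Suc m))"
  let ?p = "\<lambda>j. embed_component ?HW (inv_pullback ?W ?L fst (c j))"
  have W: "acts_on ?W ?L" and Y: "acts_on ?Y ?L"
    using acts_on_line_group [OF G] by auto
  note cX = cring2_inv_cohomology_ring [OF G] and cW = cring2_inv_cohomology_ring [OF W]
    and cY = cring2_inv_cohomology_ring [OF Y]
  have tW: "line_class X G (Suc m) \<in> carrier ?HW" and tY: "line_class X G m \<in> carrier ?HY"
    using line_class_closed [OF G] by auto
  have pW: "inv_pullback ?W ?L fst (c j) \<in> carrier ?HW" if "j < Suc m" for j
    by (rule inv_pullback_closed [OF equivariant_map_line_fst W G Suc.prems(1) [OF that]])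
  have c0: "c 0 = \<zero>\<^bsub>?HX\<^esub>"
  proof -
    \<comment> \<open>A constant vector is a section of the projection, so the coefficients are
      recovered by pulling back along it, while the sign of the vector no longer varies.\<close>
    let ?s = "\<lambda>x. (x, \<lambda>i. if i = 0 then 1 else 0 :: real)"
    have s: "equivariant_map X G ?W ?L ?s"
      unfolding equivariant_map_def
    proof (intro conjI ballI disjI2)
      show "continuous_map X ?W ?s"
        by (auto simp: continuous_map_into_line_space fun_eq_iff)
      show "\<exists>h\<in>?L. \<forall>x\<in>topspace X. ?s (g x) = h (?s x)" if "g \<in> G" for g
        using that by (intro bexI [of _ "\<lambda>(x, v). (g x, v)"]) (auto simp: line_group_def)
    qed
    note hom = inv_pullback_hom [OF s G W]
    have "inv_pullback X G ?s (line_class X G (Suc m)) = \<zero>\<^bsub>?HX\<^esub>"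
      unfolding line_class_def sign_class_pullback [OF s G] by (rule sign_class_zero [OF G]) simp
    then have st: "matches (inv_pullback X G ?s) ?HW ?HX ?t 0"
      using matches_embed [OF cW cX hom tW] by (simp add: embed_component_hom(1) [OF cX])
    have sp: "matches (inv_pullback X G ?s) ?HW ?HX (?p j) (embed_component ?HX (c j))" if "j < Suc m" for j
    proof -
      have "inv_pullback X G ?s (inv_pullback ?W ?L fst (c j)) = c j"
        using inv_pullback_compose [OF s equivariant_map_line_fst G W Suc.prems(1) [OF that]]
          inv_pullback_id [OF G Suc.prems(1) [OF that]] by (simp add: comp_def)
      then show ?thesis
        using matches_embed [OF cW cX hom pW [OF that]] by simp
    qed
    have "matches (inv_pullback X G ?s) ?HW ?HX (\<Sum>j<Suc m. ?p j * ?t ^ j)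
        (\<Sum>j<Suc m. embed_component ?HX (c j) * 0 ^ j)"
      by (intro matches_sum [OF cW cX hom] matches_mult [OF cW cX hom] matches_pow [OF cW cX hom] sp st) simp
    moreover have "(\<Sum>j<Suc m. embed_component ?HX (c j) * 0 ^ j) = embed_component ?HX (c 0)"
      by (simp add: sum.lessThan_Suc_shift del: sum.lessThan_Suc)
    ultimately show ?thesis
      using Suc.prems(1) [of 0] Suc.prems(2) inv_pullback_zero [OF s G] by (simp add: matches_def cX del: sum.lessThan_Suc)
  qed
  define A where "A = component ?HW (\<Sum>j<m. ?p (Suc j) * ?t ^ j)"
  have "?p 0 = 0"
    using inv_pullback_zero [OF equivariant_map_line_fst W] by (simp add: c0 embed_component_hom(1) [OF cW])
  then have "(\<Sum>j<Suc m. ?p j * ?t ^ j) = (\<Sum>j<m. ?p (Suc j) * ?t ^ j) * ?t"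
    by (simp add: sum.lessThan_Suc_shift sum_distrib_left mult_ac del: sum.lessThan_Suc)
  then have "A \<otimes>\<^bsub>?HW\<^esub> line_class X G (Suc m) = \<zero>\<^bsub>?HW\<^esub>"
    using Suc.prems(2) tW by (simp add: A_def component_simps cW)
  moreover have "A \<in> carrier ?HW"
    by (simp add: A_def cW)
  ultimately have iA: "inv_pullback ?Y ?L (\<lambda>p. p) A = \<zero>\<^bsub>?HY\<^esub>"
    using gysin [OF G] by blast
  note inc = equivariant_map_line_inclusion [of X m G]
  note hom = inv_pullback_hom [OF inc Y W]
  have it: "inv_pullback ?Y ?L (\<lambda>p. p) (line_class X G (Suc m)) = line_class X G m"
    by (simp add: line_class_def sign_class_pullback [OF inc Y])
  have ip: "inv_pullback ?Y ?L (\<lambda>p. p) (inv_pullback ?W ?L fst (c j)) = inv_pullback ?Y ?L fst (c j)"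
    if "j < Suc m" for j
    using inv_pullback_compose [OF inc equivariant_map_line_fst Y W Suc.prems(1) [OF that]] by (simp add: comp_def)
  have "matches (inv_pullback ?Y ?L (\<lambda>p. p)) ?HW ?HY (\<Sum>j<m. ?p (Suc j) * ?t ^ j)
      (\<Sum>j<m. embed_component ?HY (inv_pullback ?Y ?L fst (c (Suc j))) * embed_component ?HY (line_class X G m) ^ j)"
    using matches_embed [OF cW cY hom tW] matches_embed [OF cW cY hom pW]
    by (intro matches_sum [OF cW cY hom] matches_mult [OF cW cY hom] matches_pow [OF cW cY hom]) (simp_all add: it ip)
  then have "component ?HY (\<Sum>j<m. embed_component ?HY (inv_pullback ?Y ?L fst (c (Suc j))) *
      embed_component ?HY (line_class X G m) ^ j) = \<zero>\<^bsub>?HY\<^esub>"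
    using iA by (simp add: matches_def A_def)
  then have "c (Suc i) = \<zero>\<^bsub>?HX\<^esub>" if "i < m" for i
    using Suc.IH [of "\<lambda>j. c (Suc j)" i] Suc.prems(1) that by simp
  then show ?case
    using c0 Suc.prems(3) by (cases j) auto
qed simp

section \<open>Adjoining several projective spaces\<close>

text \<open>All vectors are put into one product instead of iterating \<open>line_space\<close>, so
  that the r classes appear symmetrically in the Vandermonde product. The iteration is used in
  \<open>lines_classes_independent\<close> only.\<close>

definition lines_space :: "'b topology \<Rightarrow> nat \<Rightarrow> nat \<Rightarrow> ('b \<times> (nat \<Rightarrow> nat \<Rightarrow> real)) topology" where
  "lines_space B N r = prod_topology B (product_topology (\<lambda>_. punctured N) {..<r})"

definition flip_line :: "nat \<Rightarrow> 'b \<times> (nat \<Rightarrow> nat \<Rightarrow> real) \<Rightarrow> 'b \<times> (nat \<Rightarrow> nat \<Rightarrow> real)" where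
  "flip_line i = (\<lambda>(b, u). (b, u(i := vector_neg (u i))))"

abbreviation lines_ring :: "'b topology \<Rightarrow> nat \<Rightarrow> nat \<Rightarrow> ('b \<times> (nat \<Rightarrow> nat \<Rightarrow> real)) cochain set ring" where
  "lines_ring B N r \<equiv> inv_cohomology_ring (lines_space B N r) (flip_line ` {..<r})"

definition lines_class :: "'b topology \<Rightarrow> nat \<Rightarrow> nat \<Rightarrow> nat \<Rightarrow> ('b \<times> (nat \<Rightarrow> nat \<Rightarrow> real)) cochain set" where
  "lines_class B N r i = sign_class (lines_space B N r) (flip_line ` {..<r}) (\<lambda>p. vector_sign (snd p i))"

abbreviation lines_pullback ::
    "'b topology \<Rightarrow> nat \<Rightarrow> nat \<Rightarrow> 'b cochain set \<Rightarrow> ('b \<times> (nat \<Rightarrow> nat \<Rightarrow> real)) cochain set" where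
  "lines_pullback B N r \<equiv> inv_pullback (lines_space B N r) (flip_line ` {..<r}) fst"

lemma topspace_lines_space:
  "topspace (lines_space B N r) = topspace B \<times> (PiE {..<r} (\<lambda>_. topspace (punctured N)))"
  by (simp add: lines_space_def)

lemma continuous_map_lines_fst: "continuous_map (lines_space B N r) B fst"
  by (simp add: lines_space_def continuous_map_fst)

lemma continuous_map_lines_component:
  "i < r \<Longrightarrow> continuous_map (lines_space B N r) (punctured N) (\<lambda>p. snd p i)"
  using continuous_map_compose [OF continuous_map_snd continuous_map_product_projection, of i "{..<r}" _ "\<lambda>_. punctured N"]
  by (simp add: lines_space_def comp_def)

lemma continuous_map_into_lines_space:
  "continuous_map Y (lines_space B N r) f \<longleftrightarrow> continuous_map Y B (\<lambda>y. fst (f y)) \<and>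
    (\<forall>y\<in>topspace Y. snd (f y) \<in> extensional {..<r}) \<and>
    (\<forall>i<r. continuous_map Y (punctured N) (\<lambda>y. snd (f y) i))"
  by (auto simp: lines_space_def continuous_map_pairwise comp_def continuous_map_componentwise)

lemma continuous_map_vector_neg: "continuous_map (punctured N) (punctured N) vector_neg"
  using continuous_map_punctured_component
  by (auto simp: continuous_map_into_punctured topspace_punctured fun_eq_iff intro!: continuous_map_minus)

lemma acts_on_lines:
  fixes B :: "'b topology"
  shows "acts_on (lines_space B N r) (flip_line ` {..<r})"
  unfolding acts_on_def
proof
  fix g :: "'b \<times> (nat \<Rightarrow> nat \<Rightarrow> real) \<Rightarrow> 'b \<times> (nat \<Rightarrow> nat \<Rightarrow> real)"
  assume "g \<in> flip_line ` {..<r}"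
  then obtain i where i: "i < r" "g = flip_line i" by auto
  have "continuous_map (lines_space B N r) (punctured N) (\<lambda>p. vector_neg (snd p i))"
    using continuous_map_compose [OF continuous_map_lines_component [OF i(1)] continuous_map_vector_neg]
    by (simp add: comp_def)
  then have "continuous_map (lines_space B N r) (punctured N) (\<lambda>p. ((snd p)(i := vector_neg (snd p i))) k)"
    if "k < r" for k
    using that continuous_map_lines_component [of k r B N] by (cases "k = i") auto
  then show "continuous_map (lines_space B N r) (lines_space B N r) g"
    unfolding continuous_map_into_lines_space i(2) flip_line_def
    using continuous_map_lines_fst i(1) by (auto simp: case_prod_beta topspace_lines_space extensional_def PiE_iff)
qed

lemma equivariant_map_lines_fst: "equivariant_map (lines_space B N r) (flip_line ` {..<r}) B {} fst"
  by (auto simp: equivariant_map_def continuous_map_lines_fst flip_line_def)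

lemma sign_function_lines:
  fixes B :: "'b topology"
  assumes "i < r"
  shows "sign_function (lines_space B N r) (flip_line ` {..<r}) (\<lambda>p. vector_sign (snd p i))"
  unfolding sign_function_def
proof
  fix g :: "'b \<times> (nat \<Rightarrow> nat \<Rightarrow> real) \<Rightarrow> 'b \<times> (nat \<Rightarrow> nat \<Rightarrow> real)"
  assume "g \<in> flip_line ` {..<r}"
  then obtain k where k: "g = flip_line k" by auto
  have "vector_sign (snd (g p) i) = vector_sign (snd p i) + (if k = i then 1 else 0)"
    if "p \<in> topspace (lines_space B N r)" for p
    using that assms by (auto simp: k flip_line_def topspace_lines_space topspace_punctured vector_sign_neg PiE_iff)
  then show "\<exists>b. \<forall>p\<in>topspace (lines_space B N r). vector_sign (snd (g p) i) = vector_sign (snd p i) + b"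
    by blast
qed

lemma lines_class_closed: "i < r \<Longrightarrow> lines_class B N r i \<in> carrier (lines_ring B N r)"
  unfolding lines_class_def by (intro sign_class_closed acts_on_lines sign_function_lines)

lemma cring2_lines: "cring2 (lines_ring B N r)"
  by (rule cring2_inv_cohomology_ring [OF acts_on_lines])

lemma lines_pullback_closed:
  "c \<in> carrier (inv_cohomology_ring B {}) \<Longrightarrow> lines_pullback B N r c \<in> carrier (lines_ring B N r)"
  by (rule inv_pullback_closed [OF equivariant_map_lines_fst acts_on_lines acts_on_empty])

lemma PiE_lessThan_Suc:
  "PiE {..<Suc r} (\<lambda>_. S) = (\<lambda>(j, e). e(r := j)) ` (S \<times> PiE {..<r} (\<lambda>_. S))"
  by (simp add: lessThan_Suc PiE_insert_eq)

lemma sum_PiE_lessThan_Suc: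
  fixes f :: "(nat \<Rightarrow> nat) \<Rightarrow> 'a :: comm_monoid_add"
  shows "(\<Sum>e\<in>PiE {..<Suc r} (\<lambda>_. {..<N}). f e) = (\<Sum>j<N. \<Sum>e\<in>PiE {..<r} (\<lambda>_. {..<N}). f (e(r := j)))"
proof -
  have "inj_on (\<lambda>(j, e). e(r := j)) ({..<N} \<times> PiE {..<r} (\<lambda>_. {..<N}))"
    by (rule inj_combinator) simp
  then show ?thesis
    unfolding PiE_lessThan_Suc sum.cartesian_product
    by (subst sum.reindex) (simp_all add: case_prod_beta comp_def)
qed

text \<open>Induction on the number of lines. The map that inserts the last vector into the tuple
  carries the relation over to \<open>line_space\<close> of the smaller space. Sorted by powers of
  the last class, it has coefficients that are polynomials in the other classes; these vanish by
  \<open>line_class_independent\<close> and are relations for one line less.\<close>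

theorem lines_classes_independent:
  fixes B :: "'b topology"
  assumes c: "\<And>e. e \<in> PiE {..<r} (\<lambda>_. {..<N}) \<Longrightarrow> c e \<in> carrier (inv_cohomology_ring B {})"
    and z: "component (lines_ring B N r)
      (\<Sum>e\<in>PiE {..<r} (\<lambda>_. {..<N}). embed_component (lines_ring B N r) (lines_pullback B N r (c e)) *
        (\<Prod>i<r. embed_component (lines_ring B N r) (lines_class B N r i) ^ e i))
      = \<zero>\<^bsub>lines_ring B N r\<^esub>"
    and "e \<in> PiE {..<r} (\<lambda>_. {..<N})"
  shows "c e = \<zero>\<^bsub>inv_cohomology_ring B {}\<^esub>"
  using assms
proof (induction r arbitrary: c e)
  case 0
  \<comment> \<open>The product over no indices is a single point, and including B at this point
    inverts the pullback.\<close>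
  let ?s = "\<lambda>b :: 'b. (b, \<lambda>_ :: nat. undefined :: nat \<Rightarrow> real)"
  have s: "equivariant_map B {} (lines_space B N 0) (flip_line ` {..<0}) ?s"
    by (auto simp: equivariant_map_def continuous_map_into_lines_space)
  have e: "e = (\<lambda>_. undefined)"
    using 0 by simp
  have ce: "c e \<in> carrier (inv_cohomology_ring B {})"
    using 0 by simp
  have "lines_pullback B N 0 (c e) = \<zero>\<^bsub>lines_ring B N 0\<^esub>"
    using 0 ce lines_pullback_closed [OF ce, of N 0] by (simp add: e cring2_lines [of B N 0, simplified])
  then have "inv_pullback B {} ?s (lines_pullback B N 0 (c e)) = \<zero>\<^bsub>inv_cohomology_ring B {}\<^esub>"
    using inv_pullback_zero [OF s acts_on_empty] by simp
  then show ?case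
    using inv_pullback_compose [OF s equivariant_map_lines_fst acts_on_empty acts_on_lines ce]
      inv_pullback_id [OF acts_on_empty ce] by (simp add: comp_def)
next
  case (Suc r)
  let ?X = "lines_space B N r" and ?G = "flip_line ` {..<r} :: ('b \<times> (nat \<Rightarrow> nat \<Rightarrow> real) \<Rightarrow> _) set"
  let ?Y = "line_space ?X N" and ?L = "line_group ?G"
  let ?HB = "inv_cohomology_ring B {}"
  let ?HX = "lines_ring B N r" and ?HY = "inv_cohomology_ring ?Y ?L" and ?HS = "lines_ring B N (Suc r)"
  let ?\<phi> = "\<lambda>((b :: 'b, u), v). (b, u(r := v)) :: 'b \<times> (nat \<Rightarrow> nat \<Rightarrow> real)"
  note X = acts_on_lines [of B N r] and S = acts_on_lines [of B N "Suc r"]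
  have Y: "acts_on ?Y ?L"
    by (rule acts_on_line_group [OF X])
  note cX = cring2_lines [of B N r] and cS = cring2_lines [of B N "Suc r"] and cY = cring2_inv_cohomology_ring [OF Y]
  have \<phi>: "equivariant_map ?Y ?L (lines_space B N (Suc r)) (flip_line ` {..<Suc r}) ?\<phi>"
    unfolding equivariant_map_def
  proof (intro conjI ballI disjI2)
    have 1: "continuous_map ?Y B (\<lambda>y. fst (fst y))"
      using continuous_map_compose [OF continuous_map_line_space_fst continuous_map_lines_fst] by (simp add: comp_def)
    have 2: "continuous_map ?Y (punctured N) (\<lambda>y. ((snd (fst y))(r := snd y)) i)" if "i < Suc r" for i
    proof (cases "i = r")
      case True
      then show ?thesis by (simp add: line_space_def continuous_map_snd)
    next
      case False
      then show ?thesis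
        using that continuous_map_compose [OF continuous_map_line_space_fst continuous_map_lines_component, of i r]
        by (simp add: comp_def)
    qed
    show "continuous_map ?Y (lines_space B N (Suc r)) ?\<phi>"
      unfolding continuous_map_into_lines_space using 1 2
      by (auto simp: case_prod_beta topspace_line_space topspace_lines_space PiE_iff extensional_def)
    fix g assume "g \<in> ?L"
    then consider "g = (\<lambda>(x, v). (x, vector_neg v))" | i where "i < r" "g = (\<lambda>(x, v). (flip_line i x, v))"
      by (auto simp: line_group_def)
    then show "\<exists>h\<in>flip_line ` {..<Suc r}. \<forall>y\<in>topspace ?Y. ?\<phi> (g y) = h (?\<phi> y)"
    proof cases
      case 1
      then show ?thesis
        by (intro bexI [of _ "flip_line r"]) (auto simp: flip_line_def)
    next
      case 2
      then show ?thesis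
        by (intro bexI [of _ "flip_line i"]) (auto simp: flip_line_def fun_upd_twist)
    qed
  qed
  note hom\<phi> = inv_pullback_hom [OF \<phi> Y S] and homf = inv_pullback_hom [OF equivariant_map_line_fst Y X]
  let ?f = "inv_pullback ?Y ?L fst"
  have \<phi>r: "inv_pullback ?Y ?L ?\<phi> (lines_class B N (Suc r) r) = line_class ?X ?G N"
    by (simp add: lines_class_def line_class_def sign_class_pullback [OF \<phi> Y] case_prod_beta)
  have \<phi>i: "inv_pullback ?Y ?L ?\<phi> (lines_class B N (Suc r) i) = ?f (lines_class B N r i)" if "i < r" for i
    using that by (simp add: lines_class_def sign_class_pullback [OF \<phi> Y]
        sign_class_pullback [OF equivariant_map_line_fst Y] case_prod_beta)
  have \<phi>p: "inv_pullback ?Y ?L ?\<phi> (lines_pullback B N (Suc r) a) = ?f (lines_pullback B N r a)"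
    if "a \<in> carrier ?HB" for a
    using inv_pullback_compose [OF \<phi> equivariant_map_lines_fst Y S that]
      inv_pullback_compose [OF equivariant_map_line_fst equivariant_map_lines_fst Y X that]
      inv_pullback_cong [of ?Y "fst \<circ> ?\<phi>" "fst \<circ> fst" ?L a] by (simp add: case_prod_beta)
  let ?E = "PiE {..<r} (\<lambda>_. {..<N})" and ?E' = "PiE {..<Suc r} (\<lambda>_. {..<N})"
  have upd: "e(r := j) \<in> ?E'" if "e \<in> ?E" "j < N" for e :: "nat \<Rightarrow> nat" and j
    using that by (auto simp: PiE_lessThan_Suc)
  define d where "d j = (\<Sum>e\<in>?E. embed_component ?HX (lines_pullback B N r (c (e(r := j)))) *
      (\<Prod>i<r. embed_component ?HX (lines_class B N r i) ^ e i))" for j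
  define d' where "d' j = (\<Sum>e\<in>?E. embed_component ?HY (?f (lines_pullback B N r (c (e(r := j))))) *
      (\<Prod>i<r. embed_component ?HY (?f (lines_class B N r i)) ^ e i))" for j
  have dd': "?f (component ?HX (d j)) = component ?HY (d' j)" if "j < N" for j
  proof -
    have "matches ?f ?HX ?HY (d j) (d' j)"
      unfolding d_def d'_def
      by (intro matches_sum [OF cX cY homf] matches_mult [OF cX cY homf] matches_prod [OF cX cY homf]
          matches_pow [OF cX cY homf] matches_embed [OF cX cY homf] lines_pullback_closed lines_class_closed
          Suc.prems(1) upd that) auto
    then show ?thesis by (simp add: matches_def)
  qed
  let ?t = "embed_component ?HY (line_class ?X ?G N)"
  have "matches (inv_pullback ?Y ?L ?\<phi>) ?HS ?HY
      (\<Sum>e\<in>?E'. embed_component ?HS (lines_pullback B N (Suc r) (c e)) *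
        (\<Prod>i<Suc r. embed_component ?HS (lines_class B N (Suc r) i) ^ e i))
      (\<Sum>e\<in>?E'. embed_component ?HY (inv_pullback ?Y ?L ?\<phi> (lines_pullback B N (Suc r) (c e))) *
        (\<Prod>i<Suc r. embed_component ?HY (inv_pullback ?Y ?L ?\<phi> (lines_class B N (Suc r) i)) ^ e i))"
    by (intro matches_sum [OF cS cY hom\<phi>] matches_mult [OF cS cY hom\<phi>] matches_prod [OF cS cY hom\<phi>]
        matches_pow [OF cS cY hom\<phi>] matches_embed [OF cS cY hom\<phi>] lines_pullback_closed lines_class_closed
        Suc.prems(1)) auto
  also have "(\<Sum>e\<in>?E'. embed_component ?HY (inv_pullback ?Y ?L ?\<phi> (lines_pullback B N (Suc r) (c e))) *
        (\<Prod>i<Suc r. embed_component ?HY (inv_pullback ?Y ?L ?\<phi> (lines_class B N (Suc r) i)) ^ e i))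
      = (\<Sum>e\<in>?E'. embed_component ?HY (?f (lines_pullback B N r (c e))) *
        ((\<Prod>i<r. embed_component ?HY (?f (lines_class B N r i)) ^ e i) * ?t ^ e r))"
    using Suc.prems(1) by (intro sum.cong) (simp_all add: \<phi>p \<phi>r \<phi>i)
  also have "\<dots> = (\<Sum>j<N. d' j * ?t ^ j)"
    unfolding sum_PiE_lessThan_Suc d'_def sum_distrib_right by (intro sum.cong) (simp_all add: mult.assoc)
  finally have "component ?HY (\<Sum>j<N. d' j * ?t ^ j) = \<zero>\<^bsub>?HY\<^esub>"
    unfolding matches_def Suc.prems(2) inv_pullback_zero [OF \<phi> Y] by (rule sym)
  \<comment> \<open>\<open>d j\<close> is a polynomial in the product of all rings;
    \<open>line_class_independent\<close> is about pullbacks of single classes, so the component of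
    \<open>d j\<close> in the ring of the first r lines is taken.\<close>
  moreover have "component ?HY (\<Sum>j<N. d' j * ?t ^ j)
      = component ?HY (\<Sum>j<N. embed_component ?HY (?f (component ?HX (d j))) * ?t ^ j)"
  proof -
    interpret cring ?HY by (rule cring2_D [OF cY])
    show ?thesis
      unfolding component_sum [OF cY finite_lessThan]
      by (rule add.finprod_cong') (simp_all add: component_simps cY dd')
  qed
  ultimately have "component ?HX (d j) = \<zero>\<^bsub>?HX\<^esub>" if "j < N" for j
    using line_class_independent [OF X, of N "\<lambda>j. component ?HX (d j)" j] cX that by simp
  then have d0: "component ?HX (d j) = \<zero>\<^bsub>?HX\<^esub>" if "j < N" for j
    using that .
  have c0: "c (e(r := j)) = \<zero>\<^bsub>?HB\<^esub>" if e: "e \<in> ?E" and j: "j < N" for e j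
  proof (rule Suc.IH [of "\<lambda>e. c (e(r := j))", OF _ _ e])
    show "c (e'(r := j)) \<in> carrier ?HB" if "e' \<in> ?E" for e'
      by (rule Suc.prems(1) [OF upd [OF that j]])
  qed (rule d0 [OF j, unfolded d_def])
  obtain j e0 where e: "e = e0(r := j)" "e0 \<in> ?E" "j < N"
    using Suc.prems(3) unfolding PiE_lessThan_Suc by auto
  show ?case
    unfolding e(1) by (rule c0 [OF e(2,3)])
qed

section \<open>The projectivization of the regular bundle\<close>

abbreviation bundle_space :: "'a topology \<Rightarrow> nat \<Rightarrow> ('a set \<times> ('a \<Rightarrow> real)) topology" where
  "bundle_space X n \<equiv> total_space (regular_bundle X n)"

abbreviation nonzero_space :: "'a topology \<Rightarrow> nat \<Rightarrow> ('a set \<times> ('a \<Rightarrow> real)) topology" where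
  "nonzero_space X n \<equiv> nonzero_vectors (regular_bundle X n)"

abbreviation projective_space :: "'a topology \<Rightarrow> nat \<Rightarrow> ('a set \<times> ('a \<Rightarrow> real)) set topology" where
  "projective_space X n \<equiv> projectivization (regular_bundle X n)"

definition fscale :: "real \<Rightarrow> 'a set \<times> ('a \<Rightarrow> real) \<Rightarrow> 'a set \<times> ('a \<Rightarrow> real)" where
  "fscale a e = (fst e, \<lambda>p\<in>fst e. a * snd e p)"

lemma regular_bundle_simps:
  "base_space (regular_bundle X n) = configuration_space X n"
  "proj (regular_bundle X n) = fst"
  "vscale (regular_bundle X n) = fscale"
  by (auto simp: regular_bundle_def fscale_def fun_eq_iff)

lemma fscale_simps [simp]:
  "fst (fscale a e) = fst e" "p \<in> fst e \<Longrightarrow> snd (fscale a e) p = a * snd e p"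
  "fscale a (fscale b e) = fscale (a * b) e"
  by (auto simp: fscale_def mult.assoc intro!: restrict_ext)

lemma topspace_configuration_space:
  "S \<in> topspace (configuration_space X n) \<longleftrightarrow> (\<exists>x\<in>topspace (ordered_configurations X n). S = x ` {..<n})"
  by (auto simp: configuration_space_def)

lemma finite_configuration: "S \<in> topspace (configuration_space X n) \<Longrightarrow> finite S"
  by (auto simp: topspace_configuration_space)

lemma quotient_map_label:
  "quotient_map (prod_topology (ordered_configurations X n) (Euclidean_space n)) (bundle_space X n) (label_configuration n)"
  by (simp add: regular_bundle_def quotient_map_quotient_topology)

lemma quotient_map_configuration:
  "quotient_map (ordered_configurations X n) (configuration_space X n) (\<lambda>x. x ` {..<n})"
  by (simp add: configuration_space_def quotient_map_quotient_topology)

lemma label_configuration_value: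
  assumes "x \<in> topspace (ordered_configurations X n)" "i < n"
  shows "snd (label_configuration n (x, u)) (x i) = u i"
  using assms by (simp add: label_configuration_def ordered_configurations_def)

lemma topspace_bundle_space:
  "topspace (bundle_space X n) = {e. fst e \<in> topspace (configuration_space X n) \<and> snd e \<in> extensional (fst e)}"
proof (intro equalityI subsetI)
  fix e assume "e \<in> topspace (bundle_space X n)"
  then obtain x u where "e = label_configuration n (x, u)" "x \<in> topspace (ordered_configurations X n)"
    by (auto simp: regular_bundle_def)
  then show "e \<in> {e. fst e \<in> topspace (configuration_space X n) \<and> snd e \<in> extensional (fst e)}"
    by (auto simp: label_configuration_def topspace_configuration_space)
next
  fix e :: "'a set \<times> ('a \<Rightarrow> real)"
  assume "e \<in> {e. fst e \<in> topspace (configuration_space X n) \<and> snd e \<in> extensional (fst e)}"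
  then obtain x where x: "x \<in> topspace (ordered_configurations X n)" "fst e = x ` {..<n}"
      and ext: "snd e \<in> extensional (fst e)"
    by (auto simp: topspace_configuration_space)
  define u where "u i = (if i < n then snd e (x i) else 0)" for i
  have "label_configuration n (x, u) = e"
  proof (rule prod_eqI)
    show "snd (label_configuration n (x, u)) = snd e"
    proof
      fix p show "snd (label_configuration n (x, u)) p = snd e p"
      proof (cases "p \<in> fst e")
        case True
        then obtain i where "i < n" "p = x i" using x by auto
        then show ?thesis
          using label_configuration_value [OF x(1), of i u] by (simp add: u_def)
      next
        case False
        then show ?thesis
          using ext x(2) by (auto simp: label_configuration_def extensional_def)
      qed
    qed
  qed (simp add: label_configuration_def x(2))
  moreover have "u \<in> topspace (Euclidean_space n)"
    by (simp add: topspace_Euclidean_space u_def)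
  ultimately show "e \<in> topspace (bundle_space X n)"
    using x(1) by (auto simp: regular_bundle_def)
qed

lemma fscale_one: "e \<in> topspace (bundle_space X n) \<Longrightarrow> fscale 1 e = e"
  by (auto simp: fscale_def topspace_bundle_space prod_eq_iff extensional_restrict)

lemma topspace_nonzero_space:
  "topspace (nonzero_space X n) = {e \<in> topspace (bundle_space X n). \<exists>p\<in>fst e. snd e p \<noteq> 0}"
proof -
  have "fscale 0 e \<noteq> e \<longleftrightarrow> (\<exists>p\<in>fst e. snd e p \<noteq> 0)" if e: "e \<in> topspace (bundle_space X n)" for e
  proof
    assume ne: "fscale 0 e \<noteq> e"
    show "\<exists>p\<in>fst e. snd e p \<noteq> 0"
    proof (rule ccontr)
      assume "\<not> (\<exists>p\<in>fst e. snd e p \<noteq> 0)"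
      then have "fscale 0 e = fscale 1 e"
        by (auto simp: fscale_def intro!: restrict_ext)
      then show False
        using ne fscale_one [OF e] by simp
    qed
  next
    assume "\<exists>p\<in>fst e. snd e p \<noteq> 0"
    then obtain p where p: "p \<in> fst e" "snd e p \<noteq> 0" by blast
    show "fscale 0 e \<noteq> e"
    proof
      assume "fscale 0 e = e"
      then show False
        using fscale_simps(2) [OF p(1), of 0] p(2) by simp
    qed
  qed
  then have "topspace (bundle_space X n) \<inter> {v. fscale 0 v \<noteq> v} = {e \<in> topspace (bundle_space X n). \<exists>p\<in>fst e. snd e p \<noteq> 0}"
    by blast
  then show ?thesis
    by (simp add: nonzero_vectors_def regular_bundle_simps)
qed

lemma fscale_bundle_space: "e \<in> topspace (bundle_space X n) \<Longrightarrow> fscale a e \<in> topspace (bundle_space X n)"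
  by (auto simp: topspace_bundle_space fscale_def)

lemma fscale_nonzero:
  assumes e: "e \<in> topspace (nonzero_space X n)"
  shows "fscale a e \<in> topspace (nonzero_space X n) \<longleftrightarrow> a \<noteq> 0"
proof -
  have "(\<exists>p\<in>fst (fscale a e). snd (fscale a e) p \<noteq> 0) \<longleftrightarrow> (\<exists>p\<in>fst e. a * snd e p \<noteq> 0)"
    by (simp add: fscale_def)
  then show ?thesis
    using e fscale_bundle_space [of e X n a] by (simp add: topspace_nonzero_space)
qed

lemma fscale_inject:
  assumes "e \<in> topspace (nonzero_space X n)" "fscale a e = fscale b e"
  shows "a = b"
proof -
  obtain p where "p \<in> fst e" "snd e p \<noteq> 0"
    using assms(1) by (auto simp: topspace_nonzero_space)
  have "a * snd e p = b * snd e p"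
    unfolding fscale_simps(2) [OF \<open>p \<in> fst e\<close>, symmetric] assms(2) ..
  with \<open>snd e p \<noteq> 0\<close> show ?thesis by simp
qed

lemma continuous_map_into_Euclidean_space:
  "continuous_map Z (Euclidean_space n) f \<longleftrightarrow>
    (\<forall>i. continuous_map Z euclideanreal (\<lambda>z. f z i)) \<and> (\<forall>z\<in>topspace Z. \<forall>i\<ge>n. f z i = 0)"
  by (auto simp: Euclidean_space_def continuous_map_in_subtopology continuous_map_componentwise_UNIV)

lemma continuous_map_Euclidean_component: "continuous_map (Euclidean_space n) euclideanreal (\<lambda>u. u i)"
  unfolding Euclidean_space_def
  by (intro continuous_map_from_subtopology continuous_map_product_projection) simp

text \<open>Scaling is tested after the labelling map. The product of that quotient map with the
  identity of the real line is again a quotient map, because the line is locally compact.\<close>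

lemma continuous_map_fscale:
  fixes X :: "'a topology"
  assumes f: "continuous_map Z (bundle_space X n) f" and s: "continuous_map Z euclideanreal s"
  shows "continuous_map Z (bundle_space X n) (\<lambda>z. fscale (s z) (f z))"
proof -
  let ?D = "prod_topology (ordered_configurations X n) (Euclidean_space n)"
  let ?Q = "label_configuration n :: _ \<Rightarrow> 'a set \<times> ('a \<Rightarrow> real)"
  have q: "quotient_map (prod_topology ?D euclideanreal) (prod_topology (bundle_space X n) euclideanreal) (\<lambda>(w, a). (?Q w, a))"
    by (rule quotient_map_prod_left [OF _ _ quotient_map_label])
      (auto simp: locally_compact_space_euclidean)
  have "continuous_map (prod_topology ?D euclideanreal) ?D (\<lambda>((x, u), a). (x, \<lambda>i. a * u i))"
  proof -
    have "continuous_map (prod_topology ?D euclideanreal) (ordered_configurations X n) (\<lambda>w. fst (fst w))"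
      using continuous_map_compose [OF continuous_map_fst continuous_map_fst] by (simp add: comp_def)
    moreover have "continuous_map (prod_topology ?D euclideanreal) euclideanreal (\<lambda>w. snd w * snd (fst w) i)" for i
    proof -
      have "continuous_map (prod_topology ?D euclideanreal) (Euclidean_space n) (\<lambda>w. snd (fst w))"
        using continuous_map_compose [OF continuous_map_fst continuous_map_snd] by (simp add: comp_def)
      from continuous_map_compose [OF this continuous_map_Euclidean_component [of n i]] show ?thesis
        by (intro continuous_map_real_mult continuous_map_snd) (simp add: comp_def)
    qed
    ultimately show ?thesis
      by (auto simp: continuous_map_pairwise comp_def continuous_map_into_Euclidean_space case_prod_beta
          topspace_Euclidean_space)
  qed
  from continuous_map_compose [OF this quotient_imp_continuous_map [OF quotient_map_label]]
  have "continuous_map (prod_topology ?D euclideanreal) (bundle_space X n) (?Q \<circ> (\<lambda>((x, u), a). (x, \<lambda>i. a * u i)))" .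
  moreover have "(?Q \<circ> (\<lambda>((x, u), a). (x, \<lambda>i. a * u i))) = (\<lambda>(e, a). fscale a e) \<circ> (\<lambda>(w, a). (?Q w, a))"
    by (auto simp: fun_eq_iff fscale_def label_configuration_def)
  ultimately have "continuous_map (prod_topology (bundle_space X n) euclideanreal) (bundle_space X n) (\<lambda>(e, a). fscale a e)"
    using continuous_compose_quotient_map [OF q, of "bundle_space X n" "\<lambda>(e, a). fscale a e"] by simp
  moreover have "continuous_map Z (prod_topology (bundle_space X n) euclideanreal) (\<lambda>z. (f z, s z))"
    using f s by (simp add: continuous_map_pairwise comp_def)
  ultimately show ?thesis
    using continuous_map_compose [of Z "prod_topology (bundle_space X n) euclideanreal" "\<lambda>z. (f z, s z)"
        "bundle_space X n" "\<lambda>(e, a). fscale a e"] by (simp add: comp_def)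
qed

lemma continuous_map_bundle_fst: "continuous_map (bundle_space X n) (configuration_space X n) fst"
proof (rule continuous_compose_quotient_map [OF quotient_map_label])
  have "continuous_map (prod_topology (ordered_configurations X n) (Euclidean_space n)) (configuration_space X n)
      ((\<lambda>x. x ` {..<n}) \<circ> fst)"
    by (rule continuous_map_compose [OF continuous_map_fst quotient_imp_continuous_map [OF quotient_map_configuration]])
  then show "continuous_map (prod_topology (ordered_configurations X n) (Euclidean_space n)) (configuration_space X n)
      (fst \<circ> label_configuration n)"
    by (rule continuous_map_eq) (auto simp: label_configuration_def)
qed

text \<open>A norm on the fibres that does not depend on the labelling and is continuous on the
  total space. Lifts of a line of norm one are unique up to sign; besides, the norm detects the zero
  section.\<close>

definition fiber_norm :: "'a set \<times> ('a \<Rightarrow> real) \<Rightarrow> real" where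
  "fiber_norm e = (\<Sum>p\<in>fst e. \<bar>snd e p\<bar>)"

lemma continuous_map_fiber_norm: "continuous_map (bundle_space X n) euclideanreal fiber_norm"
proof (rule continuous_compose_quotient_map [OF quotient_map_label])
  let ?D = "prod_topology (ordered_configurations X n) (Euclidean_space n)"
  have "continuous_map ?D euclideanreal (\<lambda>w. \<bar>snd w i\<bar>)" for i
    using continuous_map_compose [OF continuous_map_snd continuous_map_Euclidean_component [of n i]]
    by (intro continuous_map_real_abs) (simp add: comp_def)
  then have "continuous_map ?D euclideanreal (\<lambda>w. \<Sum>i<n. \<bar>snd w i\<bar>)"
    by (intro continuous_map_sum) auto
  then show "continuous_map ?D euclideanreal (fiber_norm \<circ> label_configuration n)"
  proof (rule continuous_map_eq)
    fix w assume "w \<in> topspace ?D"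
    then obtain x u where w: "w = (x, u)" "x \<in> topspace (ordered_configurations X n)" by auto
    have "inj_on x {..<n}"
      using w(2) by (simp add: ordered_configurations_def)
    then have "(fiber_norm \<circ> label_configuration n) w = (\<Sum>i<n. \<bar>snd (label_configuration n w) (x i)\<bar>)"
      by (simp add: fiber_norm_def w(1) label_configuration_apply sum.reindex)
    also have "\<dots> = (\<Sum>i<n. \<bar>snd w i\<bar>)"
      using label_configuration_value [OF w(2)] by (simp add: w(1))
    finally show "(\<Sum>i<n. \<bar>snd w i\<bar>) = (fiber_norm \<circ> label_configuration n) w" ..
  qed
qed

lemma fiber_norm_fscale: "fiber_norm (fscale a e) = \<bar>a\<bar> * fiber_norm e"
  by (simp add: fiber_norm_def fscale_def abs_mult sum_distrib_left)

lemma fiber_norm_pos: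
  assumes "e \<in> topspace (nonzero_space X n)"
  shows "fiber_norm e > 0"
proof -
  obtain p where "p \<in> fst e" "snd e p \<noteq> 0" and "finite (fst e)"
    using assms finite_configuration by (auto simp: topspace_nonzero_space topspace_bundle_space)
  then have "\<bar>snd e p\<bar> \<le> fiber_norm e"
    using member_le_sum [of p "fst e" "\<lambda>p. \<bar>snd e p\<bar>"] by (simp add: fiber_norm_def)
  with \<open>snd e p \<noteq> 0\<close> show ?thesis by linarith
qed

text \<open>A local trivialization has a coordinate that is not zero at e0; V is the open set over
  its domain where this coordinate does not vanish. It orients all lines in V at once, and its
  linearity along lines is what the later sign comparisons use.\<close>

lemma local_coordinate:
  fixes X :: "'a topology"
  assumes "Hausdorff_space X" and e0: "e0 \<in> topspace (nonzero_space X n)"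
  obtains V \<kappa> where "openin (bundle_space X n) V" "e0 \<in> V" "V \<subseteq> topspace (nonzero_space X n)"
    "continuous_map (subtopology (bundle_space X n) V) euclideanreal \<kappa>"
    "\<forall>e\<in>V. \<kappa> e \<noteq> 0"
    "\<forall>e\<in>V. \<forall>a. a \<noteq> 0 \<longrightarrow> fscale a e \<in> V \<and> \<kappa> (fscale a e) = a * \<kappa> e"
proof -
  let ?E = "bundle_space X n" and ?B = "configuration_space X n" and ?R = "Euclidean_space n"
  have e0E: "e0 \<in> topspace ?E" and fst0: "fst e0 \<in> topspace ?B"
    using e0 by (auto simp: topspace_nonzero_space topspace_bundle_space)
  note triv = real_vector_bundle_regular_bundle [OF assms(1), of n, unfolded real_vector_bundle_def regular_bundle_simps,
      THEN conjunct2, THEN bspec, OF fst0]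
  have "\<exists>U \<phi>. openin ?B U \<and> fst e0 \<in> U \<and> homeomorphic_map (prod_topology (subtopology ?B U) ?R)
      (subtopology ?E {e \<in> topspace ?E. fst e \<in> U}) \<phi> \<and>
      (\<forall>y\<in>U. \<forall>u\<in>topspace ?R. fst (\<phi> (y, u)) = y \<and> (\<forall>a. \<phi> (y, \<lambda>i. a * u i) = fscale a (\<phi> (y, u))))"
    using triv unfolding Ball_def
    by (elim ex_forward conj_forward all_forward imp_forward) (assumption | erule conjunct2)+
  then obtain U \<phi> where t: "openin ?B U \<and> fst e0 \<in> U \<and> homeomorphic_map (prod_topology (subtopology ?B U) ?R)
      (subtopology ?E {e \<in> topspace ?E. fst e \<in> U}) \<phi> \<and>
      (\<forall>y\<in>U. \<forall>u\<in>topspace ?R. fst (\<phi> (y, u)) = y \<and> (\<forall>a. \<phi> (y, \<lambda>i. a * u i) = fscale a (\<phi> (y, u))))"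
    by (elim exE) (rule that)
  note U = conjunct1 [OF t] conjunct1 [OF conjunct2 [OF t]]
  note hom = conjunct1 [OF conjunct2 [OF conjunct2 [OF t]]]
  have lin: "\<phi> (y, \<lambda>i. a * u i) = fscale a (\<phi> (y, u))" if "y \<in> U" "u \<in> topspace ?R" for y u a
    by (rule spec [OF conjunct2 [OF bspec [OF bspec [OF conjunct2 [OF conjunct2 [OF conjunct2 [OF t]]] that(1)] that(2)]]])
  define EU where "EU = {e \<in> topspace ?E. fst e \<in> U}"
  obtain \<psi> where \<psi>: "homeomorphic_maps (prod_topology (subtopology ?B U) ?R) (subtopology ?E EU) \<phi> \<psi>"
    using hom unfolding EU_def [symmetric] homeomorphic_map_maps by (elim exE) (rule that)
  have EU: "openin ?E EU"
    unfolding EU_def by (rule openin_continuous_map_preimage [OF continuous_map_bundle_fst U(1)])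
  have UB: "topspace (subtopology ?B U) = U"
    unfolding topspace_subtopology using openin_subset [OF U(1)] by (rule Int_absorb1)
  have EUE: "topspace (subtopology ?E EU) = EU"
    unfolding topspace_subtopology using openin_subset [OF EU] by (rule Int_absorb1)
  note hm = \<psi> [unfolded homeomorphic_maps_def]
  note \<phi>c = conjunct1 [OF hm] and \<psi>c = conjunct1 [OF conjunct2 [OF hm]]
  note \<psi>\<phi> = bspec [OF conjunct1 [OF conjunct2 [OF conjunct2 [OF hm]]]]
  note \<phi>\<psi> = bspec [OF conjunct2 [OF conjunct2 [OF conjunct2 [OF hm]]]]
  have \<psi>1: "fst (\<psi> e) \<in> U" "snd (\<psi> e) \<in> topspace ?R" "\<phi> (\<psi> e) = e" if "e \<in> EU" for e
  proof -
    have "\<psi> e \<in> topspace (prod_topology (subtopology ?B U) ?R)"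
      using continuous_map_image_subset_topspace [OF \<psi>c] that EUE by (metis image_subset_iff)
    then show "fst (\<psi> e) \<in> U" "snd (\<psi> e) \<in> topspace ?R"
      unfolding topspace_prod_topology UB by (auto simp: mem_Times_iff)
    show "\<phi> (\<psi> e) = e"
      using \<phi>\<psi> that EUE by metis
  qed
  have \<psi>2: "\<psi> (\<phi> (y, u)) = (y, u)" "\<phi> (y, u) \<in> EU" if "y \<in> U" "u \<in> topspace ?R" for y u
  proof -
    have yu: "(y, u) \<in> topspace (prod_topology (subtopology ?B U) ?R)"
      unfolding topspace_prod_topology UB using that by simp
    then show "\<psi> (\<phi> (y, u)) = (y, u)"
      by (rule \<psi>\<phi>)
    show "\<phi> (y, u) \<in> EU"
      using continuous_map_image_subset_topspace [OF \<phi>c] yu EUE by (metis image_subset_iff)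
  qed
  have sc: "fscale a e \<in> EU" "snd (\<psi> (fscale a e)) = (\<lambda>i. a * snd (\<psi> e) i)" if e: "e \<in> EU" for e a
  proof -
    have r: "(\<lambda>i. a * snd (\<psi> e) i) \<in> topspace ?R"
      using \<psi>1(2) [OF e] by (simp add: topspace_Euclidean_space)
    have "fscale a e = \<phi> (fst (\<psi> e), \<lambda>i. a * snd (\<psi> e) i)"
      using lin [OF \<psi>1(1,2) [OF e], of a] \<psi>1(3) [OF e] by simp
    then show "fscale a e \<in> EU" "snd (\<psi> (fscale a e)) = (\<lambda>i. a * snd (\<psi> e) i)"
      using \<psi>2 [OF \<psi>1(1) [OF e] r] by simp_all
  qed
  have e0U: "e0 \<in> EU"
    using e0E U(2) by (simp add: EU_def)
  have "snd (\<psi> e0) \<noteq> (\<lambda>_. 0)"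
  proof
    assume 0: "snd (\<psi> e0) = (\<lambda>_. 0)"
    have "fscale 0 e0 = \<phi> (fst (\<psi> e0), \<lambda>i. 0 * snd (\<psi> e0) i)"
      using lin [OF \<psi>1(1,2) [OF e0U], of 0] \<psi>1(3) [OF e0U] by simp
    also have "\<dots> = e0"
    proof -
      have "(\<lambda>i. 0 * snd (\<psi> e0) i) = snd (\<psi> e0)"
        by (simp add: 0)
      then show ?thesis
        using \<psi>1(3) [OF e0U] by simp
    qed
    finally show False
      using fscale_nonzero [OF e0, of 0] e0 by simp
  qed
  then obtain i where i: "snd (\<psi> e0) i \<noteq> 0" by auto
  define \<kappa> where "\<kappa> e = snd (\<psi> e) i" for e
  define V where "V = {e \<in> EU. \<kappa> e \<noteq> 0}"
  have "continuous_map (subtopology ?E EU) ?R (\<lambda>e. snd (\<psi> e))"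
    using continuous_map_compose [OF \<psi>c continuous_map_snd] by (simp add: comp_def)
  from continuous_map_compose [OF this continuous_map_Euclidean_component [of n i]]
  have \<kappa>: "continuous_map (subtopology ?E EU) euclideanreal \<kappa>"
    by (simp add: \<kappa>_def [abs_def] comp_def)
  have VE: "V \<subseteq> EU" by (auto simp: V_def)
  have "openin (subtopology ?E EU) {e \<in> topspace (subtopology ?E EU). \<kappa> e \<in> - {0}}"
    by (rule openin_continuous_map_preimage [OF \<kappa>]) (simp add: open_Compl)
  moreover have "{e \<in> topspace (subtopology ?E EU). \<kappa> e \<in> - {0}} = V"
    unfolding EUE V_def by blast
  ultimately have "openin (subtopology ?E EU) V"
    by (simp only:)
  then have 1: "openin ?E V"
    by (rule openin_trans_full [OF _ EU])
  have 2: "e0 \<in> V"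
    using e0U i by (simp add: V_def \<kappa>_def)
  have sV: "fscale a e \<in> V \<and> \<kappa> (fscale a e) = a * \<kappa> e" if "e \<in> V" "a \<noteq> 0" for e a
  proof -
    have e: "e \<in> EU" "\<kappa> e \<noteq> 0"
      using that(1) by (simp_all add: V_def)
    have "\<kappa> (fscale a e) = a * \<kappa> e"
      unfolding \<kappa>_def sc(2) [OF e(1)] ..
    then show ?thesis
      using sc(1) [OF e(1), of a] e(2) that(2) by (simp add: V_def)
  qed
  have 3: "continuous_map (subtopology ?E V) euclideanreal \<kappa>"
    by (rule continuous_map_from_subtopology_mono [OF \<kappa> VE])
  have 4: "V \<subseteq> topspace (nonzero_space X n)"
  proof
    fix e assume e: "e \<in> V"
    then have eE: "e \<in> topspace ?E" by (simp add: V_def EU_def)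
    moreover have "\<exists>p\<in>fst e. snd e p \<noteq> 0"
    proof (rule ccontr)
      assume "\<not> (\<exists>p\<in>fst e. snd e p \<noteq> 0)"
      \<comment> \<open>On the zero section scaling by two has no effect, whereas it doubles the
        coordinate.\<close>
      then have "fscale 2 e = fscale 1 e"
        unfolding fscale_def by (intro arg_cong2 [where f = Pair] refl restrict_ext) simp
      then have "\<kappa> e = 2 * \<kappa> e"
        using sV [OF e, of 2] fscale_one [OF eE] by simp
      with e show False by (simp add: V_def)
    qed
    ultimately show "e \<in> topspace (nonzero_space X n)"
      by (simp add: topspace_nonzero_space)
  qed
  have 5: "\<kappa> e \<noteq> 0" if "e \<in> V" for e
    using that by (simp add: V_def)
  show thesis
    by (rule that [OF 1 2 4 3]) (use 5 sV in \<open>simp_all del: fscale_simps\<close>)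
qed

lemma nonzero_space_subtopology: "nonzero_space X n = subtopology (bundle_space X n) (topspace (nonzero_space X n))"
  unfolding nonzero_vectors_def topspace_subtopology by (rule subtopology_restrict [symmetric])

lemma continuous_map_into_nonzero_space:
  "continuous_map Z (nonzero_space X n) f \<longleftrightarrow>
    continuous_map Z (bundle_space X n) f \<and> (\<forall>z\<in>topspace Z. f z \<in> topspace (nonzero_space X n))"
  (is "?l \<longleftrightarrow> ?r")
proof -
  have "?l \<longleftrightarrow> continuous_map Z (subtopology (bundle_space X n) (topspace (nonzero_space X n))) f"
    using nonzero_space_subtopology [of X n] by argo
  also have "\<dots> \<longleftrightarrow> ?r"
    unfolding continuous_map_in_subtopology by blast
  finally show ?thesis .
qed

section \<open>Lines as points of the projectivization\<close>

abbreviation ray_line :: "'a set \<times> ('a \<Rightarrow> real) \<Rightarrow> ('a set \<times> ('a \<Rightarrow> real)) set" where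
  "ray_line e \<equiv> range (\<lambda>a. fscale a e)"

lemma quotient_map_ray_line:
  "quotient_map (nonzero_space X n) (projective_space X n) ray_line"
  by (simp add: projectivization_def regular_bundle_simps quotient_map_quotient_topology)

lemma ray_line_eqI:
  assumes "e \<in> topspace (nonzero_space X n)" "e' \<in> topspace (nonzero_space X n)" "e' \<in> ray_line e"
  shows "ray_line e' = ray_line e" "\<exists>a. a \<noteq> 0 \<and> e' = fscale a e"
proof -
  obtain a where a: "e' = fscale a e" using assms(3) by auto
  then have "a \<noteq> 0"
    using fscale_nonzero [OF assms(1)] assms(2) by simp
  with a show "\<exists>a. a \<noteq> 0 \<and> e' = fscale a e" by blast
  have "fscale b e = fscale (b / a) e'" "fscale b e' = fscale (b * a) e" for b
    using a \<open>a \<noteq> 0\<close> by simp_all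
  then show "ray_line e' = ray_line e"
    by (metis (no_types, lifting) image_subset_iff rangeI subset_antisym)
qed

lemma mem_ray_line: "e \<in> topspace (nonzero_space X n) \<Longrightarrow> e \<in> ray_line e"
  using fscale_one [of e X n] by (auto simp: topspace_nonzero_space intro!: image_eqI [of _ _ 1])

lemma projectivization_cases:
  assumes "l \<in> topspace (projective_space X n)"
  obtains e where "e \<in> topspace (nonzero_space X n)" "l = ray_line e"
  using assms quotient_imp_surjective_map [OF quotient_map_ray_line [of X n]] by blast

lemma local_unit_section:
  fixes X :: "'a topology"
  assumes X: "Hausdorff_space X" and l0: "l0 \<in> topspace (projective_space X n)"
  obtains W s where "openin (projective_space X n) W" "l0 \<in> W"
    "continuous_map (subtopology (projective_space X n) W) (nonzero_space X n) s"
    "\<And>l. l \<in> W \<Longrightarrow> s l \<in> l \<and> fiber_norm (s l) = 1"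
proof -
  let ?P = "projective_space X n" and ?E0 = "nonzero_space X n"
  obtain e0 where e0: "e0 \<in> topspace ?E0" "l0 = ray_line e0"
    using projectivization_cases [OF l0] .
  obtain V \<kappa> where V: "openin (bundle_space X n) V" "e0 \<in> V" "V \<subseteq> topspace ?E0"
    and \<kappa>: "continuous_map (subtopology (bundle_space X n) V) euclideanreal \<kappa>" and k: "\<forall>e\<in>V. \<kappa> e \<noteq> 0"
    and sck: "\<forall>e\<in>V. \<forall>a. a \<noteq> 0 \<longrightarrow> fscale a e \<in> V \<and> \<kappa> (fscale a e) = a * \<kappa> e"
    using local_coordinate [OF X e0(1)] .
  note \<kappa> = \<kappa> k [rule_format]
  note sc = sck [rule_format]
  \<comment> \<open>The sign of the coordinate divided by the norm. Rescaling e changes this factor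
    inversely, so the product depends on the line only: it is the vector of norm one with positive
    coordinate.\<close>
  let ?c = "\<lambda>e. \<kappa> e / (\<bar>\<kappa> e\<bar> * fiber_norm e)"
  define g where "g e = fscale (?c e) e" for e :: "'a set \<times> ('a \<Rightarrow> real)"
  have c0: "?c e \<noteq> 0" if "e \<in> V" for e
    using \<kappa>(2) [OF that] fiber_norm_pos [of e X n] V(3) that by auto
  have g_const: "g (fscale a e) = g e" if "e \<in> V" "a \<noteq> 0" for e a
  proof -
    have \<kappa>a: "\<kappa> (fscale a e) = a * \<kappa> e"
      using sc [OF that] by (rule conjunct2)
    have "?c (fscale a e) * a = ((a * a) * \<kappa> e) / ((\<bar>a\<bar> * \<bar>a\<bar>) * (\<bar>\<kappa> e\<bar> * fiber_norm e))"
      unfolding \<kappa>a fiber_norm_fscale abs_mult times_divide_eq_left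
      by (intro arg_cong2 [where f = "(/)"]) (simp_all only: mult_ac)
    also have "\<dots> = ?c e"
      using that(2) unfolding abs_mult_self_eq by simp
    finally have "?c (fscale a e) * a = ?c e" .
    then show ?thesis
      by (simp add: g_def)
  qed
  define W where "W = ray_line ` V"
  have sat: "{e \<in> topspace ?E0. ray_line e \<in> W} = V"
  proof (intro equalityI subsetI)
    fix e assume "e \<in> {e \<in> topspace ?E0. ray_line e \<in> W}"
    then obtain v where v: "e \<in> topspace ?E0" "v \<in> V" "ray_line e = ray_line v"
      by (auto simp: W_def)
    then obtain a where "a \<noteq> 0" "e = fscale a v"
      using ray_line_eqI(2) [of v X n e] mem_ray_line [OF v(1)] V(3) by auto
    then show "e \<in> V"
      using sc v(2) by blast
  qed (use V(3) in \<open>auto simp: W_def\<close>)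
  have VE: "subtopology ?E0 V = subtopology (bundle_space X n) V"
    by (metis V(3) nonzero_space_subtopology subtopology_subtopology inf.absorb_iff2)
  have "openin (subtopology (bundle_space X n) (topspace ?E0)) V"
    using openin_subtopology_Int [OF V(1), of "topspace ?E0"] V(3) by (simp add: Int_absorb2)
  then have V0: "openin ?E0 V"
    using nonzero_space_subtopology [of X n] by argo
  have "W \<subseteq> ray_line ` topspace ?E0"
    unfolding W_def by (rule image_mono [OF V(3)])
  then have W: "openin ?P W"
    unfolding projectivization_def regular_bundle_simps openin_quotient_topology sat using V0 by (rule conjI)
  have q: "quotient_map (subtopology ?E0 V) (subtopology ?P W) ray_line"
    by (rule quotient_map_restriction [OF quotient_map_ray_line sat disjI1 [OF W]])
  define s where "s l = g (SOME e. e \<in> V \<and> ray_line e = l)" for l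
  have s: "s (ray_line e) = g e" if "e \<in> V" for e
  proof -
    define v where "v = (SOME v. v \<in> V \<and> ray_line v = ray_line e)"
    have v: "v \<in> V \<and> ray_line v = ray_line e"
      unfolding v_def by (rule someI [of _ e]) (simp add: that)
    have vE: "v \<in> topspace ?E0" "e \<in> topspace ?E0"
      using v that V(3) by auto
    have "v \<in> ray_line e"
      using mem_ray_line [OF vE(1)] v by argo
    then obtain a where a: "a \<noteq> 0" "v = fscale a e"
      using ray_line_eqI(2) [OF vE(2,1)] by blast
    show ?thesis
      unfolding s_def v_def [symmetric] a(2) by (rule g_const [OF that a(1)])
  qed
  show thesis
  proof
    show "openin ?P W" by (rule W)
    show "l0 \<in> W" using V(2) by (simp add: W_def e0)
    have gV: "g e \<in> topspace ?E0" if "e \<in> V" for e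
      using fscale_nonzero [of e X n] V(3) that c0 [OF that] by (auto simp: g_def)
    have "continuous_map (subtopology (bundle_space X n) V) (bundle_space X n) g"
      unfolding g_def
    proof (rule continuous_map_fscale)
      show "continuous_map (subtopology (bundle_space X n) V) (bundle_space X n) (\<lambda>e. e)"
        by (simp add: continuous_map_from_subtopology)
      have "\<bar>\<kappa> e\<bar> * fiber_norm e \<noteq> 0" if "e \<in> V" for e
        using \<kappa>(2) [OF that] fiber_norm_pos [of e X n] V(3) that by auto
      then show "continuous_map (subtopology (bundle_space X n) V) euclideanreal ?c"
        by (intro continuous_map_real_divide continuous_map_real_mult continuous_map_real_abs \<kappa>
            continuous_map_from_subtopology continuous_map_fiber_norm) auto
    qed
    then have "continuous_map (subtopology ?E0 V) ?E0 g"
      using gV openin_subset [OF V(1)] by (auto simp: VE continuous_map_into_nonzero_space)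
    then have "continuous_map (subtopology ?E0 V) ?E0 (s \<circ> ray_line)"
      by (rule continuous_map_eq) (use V(3) s in \<open>auto simp: Int_absorb1\<close>)
    then show "continuous_map (subtopology ?P W) ?E0 s"
      by (rule continuous_compose_quotient_map [OF q])
    fix l assume "l \<in> W"
    then obtain e where e: "e \<in> V" "l = ray_line e" by (auto simp: W_def)
    have "fiber_norm (g e) = 1"
      using \<kappa>(2) [OF e(1)] fiber_norm_pos [OF subsetD [OF V(3) e(1)]]
      by (simp add: g_def fiber_norm_fscale abs_mult)
    moreover have "g e \<in> ray_line e" by (simp add: g_def)
    ultimately show "s l \<in> l \<and> fiber_norm (s l) = 1"
      using s [OF e(1)] e(2) by simp
  qed
qed

section \<open>Lifting simplices from the projectivization\<close>

text \<open>Near a point the factor between the two lifts has the sign of the product of their local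
  coordinates, which is continuous. The constant c selects the sign in question.\<close>

lemma lift_sign_open:
  fixes X :: "'a topology"
  assumes X: "Hausdorff_space X"
    and f: "continuous_map Z (nonzero_space X n) f" and g: "continuous_map Z (nonzero_space X n) g"
    and fg: "\<And>z. z \<in> topspace Z \<Longrightarrow> g z \<in> ray_line (f z)" and "c \<noteq> 0"
  shows "openin Z {z \<in> topspace Z. \<exists>a. c * a > 0 \<and> g z = fscale a (f z)}"
proof (subst openin_subopen, intro ballI)
  fix z0 assume "z0 \<in> {z \<in> topspace Z. \<exists>a. c * a > 0 \<and> g z = fscale a (f z)}"
  then obtain a0 where z0: "z0 \<in> topspace Z" "c * a0 > 0" "g z0 = fscale a0 (f z0)" by auto
  have fZ: "f z \<in> topspace (nonzero_space X n)" "g z \<in> topspace (nonzero_space X n)" if "z \<in> topspace Z" for z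
    using f g that by (auto simp: continuous_map_def)
  obtain V \<kappa> where V: "openin (bundle_space X n) V" "f z0 \<in> V" "V \<subseteq> topspace (nonzero_space X n)"
    and \<kappa>: "continuous_map (subtopology (bundle_space X n) V) euclideanreal \<kappa>" and k: "\<forall>e\<in>V. \<kappa> e \<noteq> 0"
    and sck: "\<forall>e\<in>V. \<forall>a. a \<noteq> 0 \<longrightarrow> fscale a e \<in> V \<and> \<kappa> (fscale a e) = a * \<kappa> e"
    using local_coordinate [OF X fZ(1) [OF z0(1)]] .
  note \<kappa> = \<kappa> k [rule_format]
  note sc = sck [rule_format]
  have fE: "continuous_map Z (bundle_space X n) f" and gE: "continuous_map Z (bundle_space X n) g"
    using f g by (auto simp: continuous_map_into_nonzero_space)
  define M where "M = {z \<in> topspace Z. f z \<in> V}"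
  have M: "openin Z M"
    unfolding M_def by (rule openin_continuous_map_preimage [OF fE V(1)])
  have gz: "\<exists>a. a \<noteq> 0 \<and> g z = fscale a (f z)" if "z \<in> topspace Z" for z
    using ray_line_eqI(2) [OF fZ(1) [OF that] fZ(2) [OF that] fg [OF that]] .
  have gM: "g z \<in> V" if "z \<in> M" for z
  proof -
    have "z \<in> topspace Z" "f z \<in> V" using that by (simp_all add: M_def)
    obtain a where "a \<noteq> 0" "g z = fscale a (f z)" using gz [OF \<open>z \<in> topspace Z\<close>] by blast
    show ?thesis unfolding \<open>g z = _\<close> by (rule sc [OF \<open>f z \<in> V\<close> \<open>a \<noteq> 0\<close>, THEN conjunct1])
  qed
  have fM: "continuous_map (subtopology Z M) (subtopology (bundle_space X n) V) f"
    and gM': "continuous_map (subtopology Z M) (subtopology (bundle_space X n) V) g"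
    by (intro continuous_map_into_subtopology continuous_map_from_subtopology fE gE Pi_I; simp add: gM M_def)+
  from continuous_map_compose [OF fM \<kappa>(1)] continuous_map_compose [OF gM' \<kappa>(1)]
  have "continuous_map (subtopology Z M) euclideanreal (\<lambda>z. c * (\<kappa> (f z) * \<kappa> (g z)))"
    by (intro continuous_map_real_mult continuous_map_const [THEN iffD2]) (auto simp: comp_def)
  then have "openin (subtopology Z M) {z \<in> topspace (subtopology Z M). c * (\<kappa> (f z) * \<kappa> (g z)) \<in> {0<..}}"
    by (rule openin_continuous_map_preimage) (simp add: open_greaterThan)
  from openin_trans_full [OF this M]
  have "openin Z {z \<in> topspace (subtopology Z M). c * (\<kappa> (f z) * \<kappa> (g z)) \<in> {0<..}}" .
  moreover have "topspace (subtopology Z M) = M"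
    using openin_subset [OF M] by (simp add: Int_absorb1)
  ultimately have N: "openin Z {z \<in> M. c * (\<kappa> (f z) * \<kappa> (g z)) > 0}"
    by (simp only: greaterThan_iff)
  have eq: "c * (\<kappa> (f z) * \<kappa> (fscale a (f z))) = c * a * (\<kappa> (f z) * \<kappa> (f z))" if "f z \<in> V" "a \<noteq> 0" for z a
    using sc [OF that] by simp
  have pos: "\<kappa> (f z) * \<kappa> (f z) > 0" if "f z \<in> V" for z
    using \<kappa>(2) [OF that] by (auto simp: zero_less_mult_iff)
  show "\<exists>T. openin Z T \<and> z0 \<in> T \<and> T \<subseteq> {z \<in> topspace Z. \<exists>a. c * a > 0 \<and> g z = fscale a (f z)}"
  proof (intro exI conjI)
    show "openin Z {z \<in> M. c * (\<kappa> (f z) * \<kappa> (g z)) > 0}" by (rule N)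
    have "a0 \<noteq> 0" using z0(2) by auto
    have "c * (\<kappa> (f z0) * \<kappa> (g z0)) > 0"
      unfolding z0(3) eq [OF V(2) \<open>a0 \<noteq> 0\<close>] by (rule mult_pos_pos [OF z0(2) pos [OF V(2)]])
    then show "z0 \<in> {z \<in> M. c * (\<kappa> (f z) * \<kappa> (g z)) > 0}"
      using z0(1) V(2) by (simp add: M_def)
    show "{z \<in> M. c * (\<kappa> (f z) * \<kappa> (g z)) > 0} \<subseteq> {z \<in> topspace Z. \<exists>a. c * a > 0 \<and> g z = fscale a (f z)}"
    proof
      fix z assume "z \<in> {z \<in> M. c * (\<kappa> (f z) * \<kappa> (g z)) > 0}"
      then have z: "z \<in> topspace Z" "f z \<in> V" "c * (\<kappa> (f z) * \<kappa> (g z)) > 0" by (auto simp: M_def)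
      obtain a where a: "a \<noteq> 0" "g z = fscale a (f z)" using gz [OF z(1)] by blast
      have "c * a * (\<kappa> (f z) * \<kappa> (f z)) > 0"
        using z(3) unfolding a(2) eq [OF z(2) a(1)] .
      then have "c * a > 0"
        using zero_less_mult_pos2 pos [OF z(2)] by blast
      with a(2) z(1) show "z \<in> {z \<in> topspace Z. \<exists>a. c * a > 0 \<and> g z = fscale a (f z)}" by blast
    qed
  qed
qed

text \<open>The points with positive and with negative factor form two disjoint open sets that cover
  the space.\<close>

lemma lift_sign_constant:
  fixes X :: "'a topology"
  assumes X: "Hausdorff_space X" and "connected_space Z"
    and f: "continuous_map Z (nonzero_space X n) f" and g: "continuous_map Z (nonzero_space X n) g"
    and fg: "\<And>z. z \<in> topspace Z \<Longrightarrow> g z \<in> ray_line (f z)"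
  shows "(\<forall>z\<in>topspace Z. \<exists>a>0. g z = fscale a (f z)) \<or> (\<forall>z\<in>topspace Z. \<exists>a<0. g z = fscale a (f z))"
proof -
  let ?S = "\<lambda>c :: real. {z \<in> topspace Z. \<exists>a. c * a > 0 \<and> g z = fscale a (f z)}"
  have fZ: "f z \<in> topspace (nonzero_space X n)" "g z \<in> topspace (nonzero_space X n)" if "z \<in> topspace Z" for z
    using f g that by (auto simp: continuous_map_def)
  define P Q where "P = ?S 1" and "Q = ?S (- 1)"
  have "openin Z P" "openin Z Q"
    unfolding P_def Q_def by (rule lift_sign_open [OF X f g fg]; simp)+
  moreover have "topspace Z \<subseteq> P \<union> Q"
  proof
    fix z assume z: "z \<in> topspace Z"
    obtain a where "a \<noteq> 0" "g z = fscale a (f z)"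
      using ray_line_eqI(2) [OF fZ(1) [OF z] fZ(2) [OF z] fg [OF z]] by blast
    then have "1 * a > 0 \<or> - 1 * a > 0" by linarith
    with z \<open>g z = fscale a (f z)\<close> show "z \<in> P \<union> Q"
      unfolding P_def Q_def by blast
  qed
  moreover have "P \<inter> Q = {}"
  proof (rule equals0I)
    fix z assume z: "z \<in> P \<inter> Q"
    obtain a where a: "z \<in> topspace Z" "a > 0" "g z = fscale a (f z)"
      using IntD1 [OF z] unfolding P_def by auto
    obtain b where b: "b < 0" "g z = fscale b (f z)"
      using IntD2 [OF z] unfolding Q_def by auto
    have "a = b"
      using fscale_inject [OF fZ(1) [OF a(1)]] a(3) b(2) by metis
    with a(2) b(1) show False by linarith
  qed
  ultimately have "P = {} \<or> Q = {}"
    using \<open>connected_space Z\<close> [unfolded connected_space_def] by metis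
  with \<open>topspace Z \<subseteq> P \<union> Q\<close> have "topspace Z \<subseteq> P \<or> topspace Z \<subseteq> Q"
    by blast
  then show ?thesis
  proof
    assume *: "topspace Z \<subseteq> P"
    have "\<exists>a>0. g z = fscale a (f z)" if "z \<in> topspace Z" for z
      using subsetD [OF * that] by (simp add: P_def Q_def)
    then show ?thesis by blast
  next
    assume *: "topspace Z \<subseteq> Q"
    have "\<exists>a<0. g z = fscale a (f z)" if "z \<in> topspace Z" for z
      using subsetD [OF * that] by (simp add: P_def Q_def)
    then show ?thesis by blast
  qed
qed

lemma ray_line_unique:
  assumes "l \<in> topspace (projective_space X n)" "e \<in> l" "e \<in> topspace (nonzero_space X n)"
  shows "l = ray_line e"
proof -
  obtain e0 where e0: "e0 \<in> topspace (nonzero_space X n)" "l = ray_line e0"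
    using projectivization_cases [OF assms(1)] .
  show ?thesis
    using ray_line_eqI(1) [OF e0(1) assms(3)] assms(2) unfolding e0(2) by argo
qed

lemma continuous_map_fscale_nonzero:
  fixes X :: "'a topology"
  assumes "continuous_map Z (nonzero_space X n) f" "a \<noteq> 0"
  shows "continuous_map Z (nonzero_space X n) (\<lambda>z. fscale a (f z))"
proof -
  have f: "continuous_map Z (bundle_space X n) f" "\<forall>z\<in>topspace Z. f z \<in> topspace (nonzero_space X n)"
    using assms(1) unfolding continuous_map_into_nonzero_space by blast+
  have "continuous_map Z euclideanreal (\<lambda>z. a)" by simp
  then show ?thesis
    unfolding continuous_map_into_nonzero_space
    using continuous_map_fscale [OF f(1)] f(2) fscale_nonzero assms(2) by blast
qed

section \<open>Lifts of norm one over parts of the simplex\<close>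

definition has_unit_lift :: "'a topology \<Rightarrow> nat \<Rightarrow> ((nat \<Rightarrow> real) \<Rightarrow> ('a set \<times> ('a \<Rightarrow> real)) set) \<Rightarrow> (nat \<Rightarrow> real) set \<Rightarrow> bool" where
  "has_unit_lift X n \<sigma> A \<longleftrightarrow> (\<exists>s. continuous_map (subtopology (powertop_real UNIV) A) (nonzero_space X n) s \<and>
     (\<forall>x\<in>A. s x \<in> \<sigma> x \<and> fiber_norm (s x) = 1))"

lemma has_unit_lift_mono:
  assumes "has_unit_lift X n \<sigma> A" "B \<subseteq> A"
  shows "has_unit_lift X n \<sigma> B"
proof -
  obtain s where "continuous_map (subtopology (powertop_real UNIV) A) (nonzero_space X n) s"
    "\<forall>x\<in>A. s x \<in> \<sigma> x \<and> fiber_norm (s x) = 1"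
    using assms(1) unfolding has_unit_lift_def by blast
  then show ?thesis
    unfolding has_unit_lift_def using continuous_map_from_subtopology_mono [OF _ assms(2)] assms(2) by blast
qed

lemma connected_space_convex_functions:
  fixes S :: "(nat \<Rightarrow> real) set"
  assumes S: "\<And>x y u. \<lbrakk>x \<in> S; y \<in> S; 0 \<le> u; u \<le> 1\<rbrakk> \<Longrightarrow> (\<lambda>i. (1 - u) * x i + u * y i) \<in> S"
  shows "connected_space (subtopology (powertop_real UNIV) S)"
proof (rule path_connected_imp_connected_space)
  show "path_connected_space (subtopology (powertop_real UNIV) S)"
    unfolding path_connected_space_def
  proof (intro ballI)
    fix x y assume "x \<in> topspace (subtopology (powertop_real UNIV) S)" "y \<in> topspace (subtopology (powertop_real UNIV) S)"
    then have xy: "x \<in> S" "y \<in> S" by auto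
    let ?g = "\<lambda>u i. (1 - u) * x i + u * y i"
    have "continuous_map (subtopology euclideanreal {0..1}) (powertop_real UNIV) ?g"
      unfolding continuous_map_componentwise_UNIV by (force intro: continuous_intros)
    then have "pathin (subtopology (powertop_real UNIV) S) ?g"
      unfolding pathin_def continuous_map_in_subtopology using S [OF xy] by auto
    then show "\<exists>g. pathin (subtopology (powertop_real UNIV) S) g \<and> g 0 = x \<and> g 1 = y"
      by (intro exI [of _ ?g]) simp
  qed
qed

text \<open>Lifts of norm one that agree up to sign can be glued after multiplying one of them with \<open>- 1\<close>.\<close>

lemma has_unit_lift_glue:
  fixes X :: "'a topology"
  assumes X: "Hausdorff_space X"
    and \<sigma>: "\<And>x. x \<in> A \<Longrightarrow> \<sigma> x \<in> topspace (projective_space X n)"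
    and lo: "has_unit_lift X n \<sigma> {x \<in> A. x j \<le> b}" and hi: "has_unit_lift X n \<sigma> {x \<in> A. b \<le> x j}"
    and conv: "\<And>x y u. \<lbrakk>x \<in> A; y \<in> A; 0 \<le> u; u \<le> 1\<rbrakk> \<Longrightarrow> (\<lambda>i. (1 - u) * x i + u * y i) \<in> A"
  shows "has_unit_lift X n \<sigma> A"
proof -
  let ?T = "\<lambda>A. subtopology (powertop_real UNIV) A" and ?E = "nonzero_space X n"
  let ?S = "{x \<in> A. x j = b}"
  obtain f where f: "continuous_map (?T {x \<in> A. x j \<le> b}) ?E f"
    "\<forall>x\<in>{x \<in> A. x j \<le> b}. f x \<in> \<sigma> x \<and> fiber_norm (f x) = 1"
    using lo unfolding has_unit_lift_def by blast
  obtain g where g: "continuous_map (?T {x \<in> A. b \<le> x j}) ?E g"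
    "\<forall>x\<in>{x \<in> A. b \<le> x j}. g x \<in> \<sigma> x \<and> fiber_norm (g x) = 1"
    using hi unfolding has_unit_lift_def by blast
  have fS: "continuous_map (?T ?S) ?E f" and gS: "continuous_map (?T ?S) ?E g"
    by (rule continuous_map_from_subtopology_mono [OF f(1)], force,
        rule continuous_map_from_subtopology_mono [OF g(1)], force)
  have topS: "topspace (?T ?S) = ?S" by simp
  have mem: "f x \<in> topspace ?E" "g x \<in> topspace ?E" if "x \<in> ?S" for x
    using continuous_map_funspace [OF fS] continuous_map_funspace [OF gS] that unfolding topS by blast+
  have ray: "g x \<in> ray_line (f x)" if "x \<in> topspace (?T ?S)" for x
  proof -
    have x: "x \<in> ?S" using that topS by blast
    then have "\<sigma> x = ray_line (f x)"
      using f(2) by (intro ray_line_unique [OF \<sigma>] mem) auto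
    moreover have "g x \<in> \<sigma> x" using g(2) x by simp
    ultimately show ?thesis by argo
  qed
  have conn: "connected_space (?T ?S)"
  proof (rule connected_space_convex_functions)
    fix x y :: "nat \<Rightarrow> real" and u :: real
    assume "x \<in> ?S" "y \<in> ?S" "0 \<le> u" "u \<le> 1"
    then show "(\<lambda>i. (1 - u) * x i + u * y i) \<in> ?S"
      using conv [of x y u] by (simp add: algebra_simps)
  qed
  have "(\<forall>z\<in>topspace (?T ?S). \<exists>a>0. g z = fscale a (f z)) \<or> (\<forall>z\<in>topspace (?T ?S). \<exists>a<0. g z = fscale a (f z))"
    by (rule lift_sign_constant [OF X conn fS gS]) (rule ray)
  then have "\<exists>\<epsilon> :: real. \<bar>\<epsilon>\<bar> = 1 \<and> (\<forall>x\<in>?S. \<exists>a. \<epsilon> * a > 0 \<and> g x = fscale a (f x))"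
  proof
    assume *: "\<forall>z\<in>topspace (?T ?S). \<exists>a>0. g z = fscale a (f z)"
    have "\<exists>a. 1 * a > 0 \<and> g x = fscale a (f x)" if "x \<in> ?S" for x
      using * [unfolded topS, rule_format, OF that] by simp
    then show ?thesis by (intro exI [of _ 1]) simp
  next
    assume *: "\<forall>z\<in>topspace (?T ?S). \<exists>a<0. g z = fscale a (f z)"
    have "\<exists>a. - 1 * a > 0 \<and> g x = fscale a (f x)" if "x \<in> ?S" for x
      using * [unfolded topS, rule_format, OF that] by simp
    then show ?thesis by (intro exI [of _ "- 1"]) simp
  qed
  then obtain \<epsilon> :: real where \<epsilon>: "\<bar>\<epsilon>\<bar> = 1" "\<forall>x\<in>?S. \<exists>a. \<epsilon> * a > 0 \<and> g x = fscale a (f x)"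
    by blast
  have eq: "f x = fscale \<epsilon> (g x)" if x: "x \<in> ?S" for x
  proof -
    obtain a where a: "\<epsilon> * a > 0" "g x = fscale a (f x)" using bspec [OF \<epsilon>(2) x] by blast
    have "fiber_norm (f x) = 1" "fiber_norm (g x) = 1" using f(2) g(2) x by simp_all
    then have "\<bar>a\<bar> = 1" unfolding a(2) fiber_norm_fscale by simp
    then have "\<epsilon> * a = 1" using a(1) \<epsilon>(1) by (auto simp: abs_if split: if_splits)
    then have "fscale \<epsilon> (g x) = fscale 1 (f x)" unfolding a(2) fscale_simps by simp
    also have "\<dots> = f x" using mem(1) [OF x] by (intro fscale_one [of _ X n]) (simp add: topspace_nonzero_space)
    finally show ?thesis ..
  qed
  have topA: "topspace (?T A) = A" by simp
  have sub: "subtopology (?T A) {x \<in> topspace (?T A). P x} = ?T {x \<in> A. P x}" for P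
    unfolding topA subtopology_subtopology by (rule arg_cong [where f = ?T]) blast
  have "continuous_map (?T A) ?E (\<lambda>x. if x j \<le> b then f x else fscale \<epsilon> (g x))"
  proof (rule continuous_map_cases_le)
    show "continuous_map (?T A) euclideanreal (\<lambda>x. x j)"
      by (intro continuous_map_from_subtopology continuous_map_product_projection) simp
    show "continuous_map (subtopology (?T A) {x \<in> topspace (?T A). x j \<le> b}) ?E f"
      unfolding sub by (rule f(1))
    show "continuous_map (subtopology (?T A) {x \<in> topspace (?T A). b \<le> x j}) ?E (\<lambda>x. fscale \<epsilon> (g x))"
      unfolding sub using \<epsilon>(1) by (intro continuous_map_fscale_nonzero [OF g(1)]) auto
    show "f x = fscale \<epsilon> (g x)" if "x \<in> topspace (?T A)" "x j = b" for x
      using that by (intro eq) simp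
  qed simp
  moreover have "(if x j \<le> b then f x else fscale \<epsilon> (g x)) \<in> \<sigma> x \<and>
      fiber_norm (if x j \<le> b then f x else fscale \<epsilon> (g x)) = 1" if x: "x \<in> A" for x
  proof (cases "x j \<le> b")
    case True then show ?thesis using f(2) x by simp
  next
    case False
    then have x': "x \<in> {x \<in> A. b \<le> x j}" using x by simp
    then have g': "g x \<in> \<sigma> x" "fiber_norm (g x) = 1" using g(2) by blast+
    moreover have "g x \<in> topspace ?E"
      using continuous_map_funspace [OF g(1)] x' by auto
    ultimately have "\<sigma> x = ray_line (g x)"
      using ray_line_unique [OF \<sigma> [OF x]] by blast
    then show ?thesis
      using False g'(2) \<epsilon>(1) by (simp add: fiber_norm_fscale)
  qed
  ultimately show ?thesis
    unfolding has_unit_lift_def by blast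
qed

lemma box_in_open:
  fixes U :: "(nat \<Rightarrow> real) set"
  assumes "openin (powertop_real UNIV) U" "c \<in> U"
  obtains d where "d > 0" "\<And>x. \<lbrakk>\<And>i. i \<le> k \<Longrightarrow> \<bar>x i - c i\<bar> \<le> d; \<And>i. i > k \<Longrightarrow> x i = c i\<rbrakk> \<Longrightarrow> x \<in> U"
proof -
  obtain V where V: "\<And>i. open (V i)" "\<And>i. c i \<in> V i" "\<And>x. (\<forall>i. x i \<in> V i) \<Longrightarrow> x \<in> U"
    using assms(1)[unfolded openin_product_topology_alt, rule_format, OF assms(2)]
    by (auto simp: PiE_UNIV_domain Pi_iff subset_iff)
  have "\<exists>e>0. cball (c i) e \<subseteq> V i" for i
    using V(1,2) open_contains_cball by blast
  then obtain e where e: "\<And>i. e i > (0 :: real)" "\<And>i. cball (c i) (e i) \<subseteq> V i" by metis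
  show thesis
  proof
    show "Min (e ` {..k}) > 0" using e(1) by simp
    fix x assume x: "\<And>i. i \<le> k \<Longrightarrow> \<bar>x i - c i\<bar> \<le> Min (e ` {..k})" "\<And>i. i > k \<Longrightarrow> x i = c i"
    have "x i \<in> V i" for i
    proof (cases "i \<le> k")
      case True
      then have "\<bar>x i - c i\<bar> \<le> e i" using x(1) [OF True] by simp
      then have "x i \<in> cball (c i) (e i)" by (simp add: dist_real_def abs_minus_commute)
      then show ?thesis using e(2) by blast
    next
      case False
      then show ?thesis using x(2) V(2) by simp
    qed
    then show "x \<in> U" using V(3) by blast
  qed
qed

text \<open>The centre c is arbitrary, which suits the induction over the coordinates. If its
  truncation to the coordinates up to k is not in the simplex, a small box around it misses the
  simplex altogether, since the simplex is closed.\<close>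

lemma local_unit_lift:
  fixes X :: "'a topology"
  assumes X: "Hausdorff_space X"
    and \<sigma>: "continuous_map (subtopology (powertop_real UNIV) (standard_simplex k)) (projective_space X n) \<sigma>"
  shows "\<exists>d>0. has_unit_lift X n \<sigma> {x \<in> standard_simplex k. \<forall>i\<le>k. \<bar>x i - c i\<bar> \<le> d}"
proof -
  let ?T = "\<lambda>A. subtopology (powertop_real UNIV) A" and ?P = "projective_space X n"
  define c' where "c' i = (if i \<le> k then c i else 0)" for i
  show ?thesis
  proof (cases "c' \<in> standard_simplex k")
    case True
    then have "\<sigma> c' \<in> topspace ?P"
      using continuous_map_funspace [OF \<sigma>] by auto
    then obtain W s where W: "openin ?P W" "\<sigma> c' \<in> W" and s: "continuous_map (subtopology ?P W) (nonzero_space X n) s"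
      and sl: "\<And>l. l \<in> W \<Longrightarrow> s l \<in> l \<and> fiber_norm (s l) = 1"
      using local_unit_section [OF X] by metis
    have "openin (?T (standard_simplex k)) {x \<in> topspace (?T (standard_simplex k)). \<sigma> x \<in> W}"
      by (rule openin_continuous_map_preimage [OF \<sigma> W(1)])
    then obtain U where U: "openin (powertop_real UNIV) U" "{x \<in> standard_simplex k. \<sigma> x \<in> W} = U \<inter> standard_simplex k"
      by (auto simp: openin_subtopology)
    have "c' \<in> U" using True W(2) U(2) by blast
    then obtain d where d: "d > 0" "\<And>x. \<lbrakk>\<And>i. i \<le> k \<Longrightarrow> \<bar>x i - c' i\<bar> \<le> d; \<And>i. i > k \<Longrightarrow> x i = c' i\<rbrakk> \<Longrightarrow> x \<in> U"
      using box_in_open [OF U(1), of c' k] by metis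
    let ?A = "{x \<in> standard_simplex k. \<forall>i\<le>k. \<bar>x i - c i\<bar> \<le> d}"
    have AW: "\<sigma> x \<in> W" if "x \<in> ?A" for x
    proof -
      have "x \<in> U"
        by (rule d(2)) (use that in \<open>auto simp: c'_def standard_simplex_def\<close>)
      then show ?thesis using U(2) that by blast
    qed
    have "continuous_map (?T ?A) (subtopology ?P W) \<sigma>"
      by (intro continuous_map_into_subtopology continuous_map_from_subtopology_mono [OF \<sigma>]) (use AW in auto)
    from continuous_map_compose [OF this s] have "continuous_map (?T ?A) (nonzero_space X n) (s \<circ> \<sigma>)" .
    moreover have "\<forall>x\<in>?A. (s \<circ> \<sigma>) x \<in> \<sigma> x \<and> fiber_norm ((s \<circ> \<sigma>) x) = 1"
      using sl AW by (simp del: split_paired_All)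
    ultimately show ?thesis
      unfolding has_unit_lift_def using d(1) by blast
  next
    case False
    have "openin (powertop_real UNIV) (topspace (powertop_real UNIV) - standard_simplex k)"
      using closedin_standard_simplex by (rule openin_diff [OF openin_topspace])
    moreover have "c' \<in> topspace (powertop_real UNIV) - standard_simplex k"
      using False by simp
    ultimately obtain d where d: "d > 0" "\<And>x. \<lbrakk>\<And>i. i \<le> k \<Longrightarrow> \<bar>x i - c' i\<bar> \<le> d; \<And>i. i > k \<Longrightarrow> x i = c' i\<rbrakk> \<Longrightarrow>
        x \<in> topspace (powertop_real UNIV) - standard_simplex k"
      using box_in_open [of "topspace (powertop_real UNIV) - standard_simplex k" c' k] by metis
    have "x \<in> topspace (powertop_real UNIV) - standard_simplex k"
      if "x \<in> {x \<in> standard_simplex k. \<forall>i\<le>k. \<bar>x i - c i\<bar> \<le> d}" for x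
      by (rule d(2)) (use that in \<open>auto simp: c'_def standard_simplex_def\<close>)
    then have "{x \<in> standard_simplex k. \<forall>i\<le>k. \<bar>x i - c i\<bar> \<le> d} = {}" by blast
    moreover have "has_unit_lift X n \<sigma> {}"
      by (auto simp: has_unit_lift_def)
    ultimately have "has_unit_lift X n \<sigma> {x \<in> standard_simplex k. \<forall>i\<le>k. \<bar>x i - c i\<bar> \<le> d}"
      by argo
    with d(1) show ?thesis by blast
  qed
qed

text \<open>The box with index j constrains the coordinates from j to k only. A step of the
  induction frees coordinate j by bisection of the interval from 0 to 1: lifts over two adjacent
  slabs are glued along their common convex boundary. At the end no constraint is left and the lift
  covers the whole simplex.\<close>

lemma unit_lift:
  fixes X :: "'a topology"
  assumes X: "Hausdorff_space X"
    and \<sigma>: "continuous_map (subtopology (powertop_real UNIV) (standard_simplex k)) (projective_space X n) \<sigma>"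
  shows "has_unit_lift X n \<sigma> (standard_simplex k)"
proof -
  let ?P = "projective_space X n"
  let ?box = "\<lambda>j c d. {x \<in> standard_simplex k. \<forall>i. j \<le> i \<longrightarrow> i \<le> k \<longrightarrow> \<bar>x i - c i\<bar> \<le> d}"
  have \<sigma>P: "\<sigma> x \<in> topspace ?P" if "x \<in> standard_simplex k" for x
    using continuous_map_funspace [OF \<sigma>] that by auto
  have "\<forall>c. \<exists>d>0. has_unit_lift X n \<sigma> (?box j c d)" for j
  proof (induction j)
    case 0
    then show ?case using local_unit_lift [OF X \<sigma>] by simp
  next
    case (Suc j)
    show ?case
    proof
      fix c
      define P where "P a b \<longleftrightarrow> (\<exists>d>0. has_unit_lift X n \<sigma> {x \<in> ?box (Suc j) c d. a \<le> x j \<and> x j \<le> b})" for a b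
      have "P 0 1"
      proof (rule Bolzano)
        show "(0 :: real) \<le> 1" by simp
      next
        fix a b e assume ab: "P a b" and be: "P b e" and le: "a \<le> b" "b \<le> e"
        obtain d1 where d1: "d1 > 0" "has_unit_lift X n \<sigma> {x \<in> ?box (Suc j) c d1. a \<le> x j \<and> x j \<le> b}"
          using ab unfolding P_def by blast
        obtain d2 where d2: "d2 > 0" "has_unit_lift X n \<sigma> {x \<in> ?box (Suc j) c d2. b \<le> x j \<and> x j \<le> e}"
          using be unfolding P_def by blast
        define A where "A = {x \<in> ?box (Suc j) c (min d1 d2). a \<le> x j \<and> x j \<le> e}"
        have "has_unit_lift X n \<sigma> A"
        proof (rule has_unit_lift_glue [OF X, where j = j and b = b])
          show "\<sigma> x \<in> topspace ?P" if "x \<in> A" for x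
            using \<sigma>P that by (simp add: A_def)
          show "has_unit_lift X n \<sigma> {x \<in> A. x j \<le> b}"
            by (rule has_unit_lift_mono [OF d1(2)]) (auto simp: A_def)
          show "has_unit_lift X n \<sigma> {x \<in> A. b \<le> x j}"
            by (rule has_unit_lift_mono [OF d2(2)]) (auto simp: A_def)
          fix x y :: "nat \<Rightarrow> real" and u :: real assume xy: "x \<in> A" "y \<in> A" and u: "0 \<le> u" "u \<le> 1"
          let ?z = "\<lambda>i. (1 - u) * x i + u * y i"
          have bnd: "l \<le> (1 - u) * p + u * q \<and> (1 - u) * p + u * q \<le> h"
            if "l \<le> p" "p \<le> h" "l \<le> q" "q \<le> h" for l h p q :: real
          proof -
            have "(1 - u) * l + u * l \<le> (1 - u) * p + u * q" "(1 - u) * p + u * q \<le> (1 - u) * h + u * h"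
              using that u by (intro add_mono mult_left_mono; simp)+
            then show ?thesis by (simp add: algebra_simps)
          qed
          have "?z \<in> standard_simplex k"
            using xy u by (intro convex_standard_simplex) (auto simp: A_def)
          moreover have "\<bar>?z i - c i\<bar> \<le> min d1 d2" if "Suc j \<le> i" "i \<le> k" for i
          proof -
            have "\<bar>x i - c i\<bar> \<le> min d1 d2" "\<bar>y i - c i\<bar> \<le> min d1 d2"
              using xy that unfolding A_def by blast+
            then show ?thesis
              using bnd [of "c i - min d1 d2" "x i" "c i + min d1 d2" "y i"] unfolding abs_le_iff by linarith
          qed
          moreover have "a \<le> ?z j \<and> ?z j \<le> e"
            using xy by (intro bnd) (simp_all add: A_def)
          ultimately show "?z \<in> A" unfolding A_def by blast
        qed
        then show "P a e"
          unfolding P_def A_def using d1(1) d2(1) min_less_iff_conj by (intro exI [of _ "min d1 d2"] conjI) auto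
      next
        fix x0 :: real
        \<comment> \<open>The induction hypothesis with the j-th coordinate of the centre moved to
          \<open>x0\<close>; every slab around \<open>x0\<close> of width less than d lies in this
          box.\<close>
        obtain d where d: "d > 0" "has_unit_lift X n \<sigma> (?box j (c(j := x0)) d)"
          using Suc by blast
        have "P a b" if ab: "a \<le> x0" "x0 \<le> b" "b - a < d" for a b
        proof -
          have "{x \<in> ?box (Suc j) c d. a \<le> x j \<and> x j \<le> b} \<subseteq> ?box j (c(j := x0)) d"
          proof
            fix x assume x: "x \<in> {x \<in> ?box (Suc j) c d. a \<le> x j \<and> x j \<le> b}"
            have "\<bar>x i - (c(j := x0)) i\<bar> \<le> d" if "j \<le> i" "i \<le> k" for i
            proof (cases "i = j")
              case True
              then show ?thesis using x ab by (auto simp: abs_le_iff)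
            next
              case False
              then show ?thesis using x that by simp
            qed
            then show "x \<in> ?box j (c(j := x0)) d" using x by blast
          qed
          then show ?thesis unfolding P_def using has_unit_lift_mono [OF d(2)] d(1) by blast
        qed
        then show "\<exists>d>0. \<forall>a b. a \<le> x0 \<and> x0 \<le> b \<and> b - a < d \<longrightarrow> P a b"
          using d(1) by blast
      qed
      then obtain d where d: "d > 0" "has_unit_lift X n \<sigma> {x \<in> ?box (Suc j) c d. 0 \<le> x j \<and> x j \<le> 1}"
        unfolding P_def by blast
      have "?box (Suc j) c d \<subseteq> {x \<in> ?box (Suc j) c d. 0 \<le> x j \<and> x j \<le> 1}"
        by (auto simp: standard_simplex_def)
      then show "\<exists>d>0. has_unit_lift X n \<sigma> (?box (Suc j) c d)"
        using has_unit_lift_mono [OF d(2)] d(1) by blast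
    qed
  qed
  from this [of "Suc k"] have "\<exists>d>0. has_unit_lift X n \<sigma> (?box (Suc k) (\<lambda>_. 0) d)" by (rule spec)
  then obtain d where "d > 0" "has_unit_lift X n \<sigma> (?box (Suc k) (\<lambda>_. 0) d)" by blast
  then show ?thesis
    using has_unit_lift_mono [of X n \<sigma> "?box (Suc k) (\<lambda>_. 0) d" "standard_simplex k"] by fastforce
qed


lemma singular_simplex_lift:
  fixes X :: "'a topology"
  assumes X: "Hausdorff_space X" and \<sigma>: "singular_simplex k (projective_space X n) \<sigma>"
  obtains \<tau> where "singular_simplex k (nonzero_space X n) \<tau>" "\<sigma> = simplex_map k ray_line \<tau>"
proof -
  have c: "continuous_map (subtopology (powertop_real UNIV) (standard_simplex k)) (projective_space X n) \<sigma>"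
    and ext: "\<sigma> \<in> extensional (standard_simplex k)"
    using \<sigma> by (auto simp: singular_simplex_def)
  obtain s where s: "continuous_map (subtopology (powertop_real UNIV) (standard_simplex k)) (nonzero_space X n) s"
    "\<forall>x\<in>standard_simplex k. s x \<in> \<sigma> x \<and> fiber_norm (s x) = 1"
    using unit_lift [OF X c] unfolding has_unit_lift_def by blast
  show thesis
  proof
    show "singular_simplex k (nonzero_space X n) (restrict s (standard_simplex k))"
      unfolding singular_simplex_def by (auto intro: continuous_map_eq [OF s(1)])
    have "\<sigma> x = ray_line (s x)" if x: "x \<in> standard_simplex k" for x
    proof (rule ray_line_unique)
      show "\<sigma> x \<in> topspace (projective_space X n)"
        using continuous_map_funspace [OF c] x by auto
      show "s x \<in> topspace (nonzero_space X n)"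
        using continuous_map_funspace [OF s(1)] x by auto
    qed (use s(2) x in blast)
    then show "\<sigma> = simplex_map k ray_line (restrict s (standard_simplex k))"
      unfolding simplex_map_def by (intro extensionalityI [OF ext]) auto
  qed
qed

section \<open>The tautological class\<close>

definition line_sections :: "'a topology \<Rightarrow> nat \<Rightarrow> (('a set \<times> ('a \<Rightarrow> real)) set \<Rightarrow> 'a set \<times> ('a \<Rightarrow> real)) set" where
  "line_sections X n = {s. \<forall>l\<in>topspace (projective_space X n). s l \<in> l \<inter> topspace (nonzero_space X n)}"

definition section_sign ::
    "(('a set \<times> ('a \<Rightarrow> real)) set \<Rightarrow> 'a set \<times> ('a \<Rightarrow> real)) \<Rightarrow> 'a set \<times> ('a \<Rightarrow> real) \<Rightarrow> bit" where
  "section_sign s e = (if \<exists>a>0. e = fscale a (s (ray_line e)) then 0 else 1)"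

lemma continuous_map_ray_line:
  "continuous_map (nonzero_space X n) (projective_space X n) ray_line"
  using quotient_map_ray_line quotient_imp_continuous_map by blast

lemma ray_line_in_projectivization:
  "e \<in> topspace (nonzero_space X n) \<Longrightarrow> ray_line e \<in> topspace (projective_space X n)"
  using continuous_map_funspace [OF continuous_map_ray_line] by blast

lemma line_section:
  assumes s: "s \<in> line_sections X n" and e: "e \<in> topspace (nonzero_space X n)"
  obtains a where "a \<noteq> 0" "e = fscale a (s (ray_line e))" "section_sign s e = 0 \<longleftrightarrow> a > 0"
proof -
  have "s (ray_line e) \<in> ray_line e \<inter> topspace (nonzero_space X n)"
    using s ray_line_in_projectivization [OF e] unfolding line_sections_def by blast
  then have sE: "s (ray_line e) \<in> ray_line e" "s (ray_line e) \<in> topspace (nonzero_space X n)"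
    by blast+
  then obtain b where b: "b \<noteq> 0" "s (ray_line e) = fscale b e"
    using ray_line_eqI(2) [OF e sE(2,1)] by blast
  have e1: "fscale 1 e = e"
    using e by (intro fscale_one [of _ X n]) (simp add: topspace_nonzero_space)
  have eq: "e = fscale (1 / b) (s (ray_line e))"
    unfolding b(2) fscale_simps using b(1) e1 by simp
  have "section_sign s e = 0 \<longleftrightarrow> 1 / b > 0"
  proof
    assume "section_sign s e = 0"
    then obtain a where a: "a > 0" "e = fscale a (s (ray_line e))"
      by (auto simp: section_sign_def split: if_splits)
    then have "a = 1 / b"
      using eq by (intro fscale_inject [OF sE(2)]) simp
    with a(1) show "1 / b > 0" by simp
  next
    assume "1 / b > 0"
    then show "section_sign s e = 0"
      unfolding section_sign_def using eq by metis
  qed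
  then show thesis
    using that [of "1 / b"] b(1) eq by simp
qed

lemma section_sign_scale:
  assumes s: "s \<in> line_sections X n" and e: "e \<in> topspace (nonzero_space X n)"
    and e': "e' \<in> topspace (nonzero_space X n)" "ray_line e' = ray_line e" "e' = fscale b e"
  shows "section_sign s e' = section_sign s e \<longleftrightarrow> b > 0"
proof -
  have "b \<noteq> 0" using e' fscale_nonzero [OF e] by simp
  obtain a where a: "a \<noteq> 0" "e = fscale a (s (ray_line e))" "section_sign s e = 0 \<longleftrightarrow> a > 0"
    using line_section [OF s e] .
  obtain a' where a': "a' \<noteq> 0" "e' = fscale a' (s (ray_line e'))" "section_sign s e' = 0 \<longleftrightarrow> a' > 0"
    using line_section [OF s e'(1)] .
  have sE: "s (ray_line e) \<in> topspace (nonzero_space X n)"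
    using s ray_line_in_projectivization [OF e] unfolding line_sections_def by blast
  have "fscale a' (s (ray_line e)) = e'" using a'(2) e'(2) by argo
  also have "\<dots> = fscale (b * a) (s (ray_line e))"
    using e'(3) a(2) fscale_simps(3) by metis
  finally have "a' = b * a" by (rule fscale_inject [OF sE])
  then have "a' > 0 \<longleftrightarrow> (b > 0 \<longleftrightarrow> a > 0)"
    using a(1) \<open>b \<noteq> 0\<close> by (auto simp: zero_less_mult_iff)
  then show ?thesis
    using a(3) a'(3) by (cases "section_sign s e"; cases "section_sign s e'") auto
qed

lemma simplicial_vertex_map:
  "i \<le> k \<Longrightarrow> simplicial_vertex i (simplex_map k f \<sigma>) = f (simplicial_vertex i \<sigma>)"
  by (simp add: simplicial_vertex_def simplex_map_def)

text \<open>Two lifts of the same path of lines differ by a factor of constant sign. Hence a lift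
  whose two ends are positive multiples of the chosen vectors exists if and only if \<tau> and the
  chosen vectors are equally oriented at both ends or oppositely oriented at both ends; in the
  second case the negative of \<tau> is such a lift.\<close>

lemma tautological_cocycle_lift:
  fixes X :: "'a topology"
  assumes X: "Hausdorff_space X" and s: "s \<in> line_sections X n" and \<tau>: "singular_simplex 1 (nonzero_space X n) \<tau>"
  shows "tautological_cocycle (regular_bundle X n) s 1 (simplex_map 1 ray_line \<tau>)
    = section_sign s (simplicial_vertex 0 \<tau>) + section_sign s (simplicial_vertex 1 \<tau>)"
proof -
  let ?E = "nonzero_space X n" and ?P = "projective_space X n" and ?\<sigma> = "simplex_map 1 ray_line \<tau>"
  let ?Q = "\<lambda>\<tau>'. singular_simplex 1 ?E \<tau>' \<and> (\<forall>x\<in>standard_simplex 1. \<tau>' x \<in> ?\<sigma> x) \<and>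
      (\<forall>i\<le>1. \<exists>a>0. simplicial_vertex i \<tau>' = fscale a (s (simplicial_vertex i ?\<sigma>)))"
  have \<sigma>P: "singular_simplex 1 ?P ?\<sigma>"
    by (rule singular_simplex_simplex_map [OF \<tau> continuous_map_ray_line])
  have \<sigma>x: "?\<sigma> x = ray_line (\<tau> x)" if "x \<in> standard_simplex 1" for x
    using that by (simp add: simplex_map_def)
  have topS: "topspace (subtopology (powertop_real UNIV) (standard_simplex 1)) = standard_simplex 1" by simp
  have cont: "continuous_map (subtopology (powertop_real UNIV) (standard_simplex 1)) ?E \<tau>'"
    if "singular_simplex 1 ?E \<tau>'" for \<tau>'
    using that by (simp add: singular_simplex_def)
  have mem: "\<tau>' x \<in> topspace ?E" if "singular_simplex 1 ?E \<tau>'" "x \<in> standard_simplex 1" for \<tau>' x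
    using continuous_map_funspace [OF cont [OF that(1)]] that(2) unfolding topS by blast
  have same: "ray_line (\<tau>' x) = ray_line (\<tau> x)" "\<exists>a. a \<noteq> 0 \<and> \<tau>' x = fscale a (\<tau> x)"
    if "singular_simplex 1 ?E \<tau>'" "\<forall>x\<in>standard_simplex 1. \<tau>' x \<in> ?\<sigma> x" "x \<in> standard_simplex 1" for \<tau>' x
    using ray_line_eqI [OF mem [OF \<tau> that(3)] mem [OF that(1,3)]] bspec [OF that(2,3)] unfolding \<sigma>x [OF that(3)]
    by blast+
  have vx: "(\<lambda>j. if j = i then 1 else 0) \<in> standard_simplex 1" if "i \<le> 1" for i using that by simp
  have vsign: "(\<exists>a>0. simplicial_vertex i \<tau>' = fscale a (s (simplicial_vertex i ?\<sigma>))) \<longleftrightarrow>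
      section_sign s (simplicial_vertex i \<tau>') = 0"
    if "singular_simplex 1 ?E \<tau>'" "\<forall>x\<in>standard_simplex 1. \<tau>' x \<in> ?\<sigma> x" "i \<le> 1" for \<tau>' i
  proof -
    have "simplicial_vertex i ?\<sigma> = ray_line (simplicial_vertex i \<tau>')"
      using same(1) [OF that(1,2) vx [OF that(3)]] simplicial_vertex_map [OF that(3), of ray_line \<tau>]
      unfolding simplicial_vertex_def by argo
    then show ?thesis by (simp add: section_sign_def)
  qed
  have Q_iff: "?Q \<tau>' \<longleftrightarrow> singular_simplex 1 ?E \<tau>' \<and> (\<forall>x\<in>standard_simplex 1. \<tau>' x \<in> ?\<sigma> x) \<and>
      (\<forall>i\<le>1. section_sign s (simplicial_vertex i \<tau>') = 0)" for \<tau>'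
    using vsign by (intro conj_cong refl all_cong) blast
  have "(\<exists>\<tau>'. ?Q \<tau>') \<longleftrightarrow> section_sign s (simplicial_vertex 0 \<tau>) = section_sign s (simplicial_vertex 1 \<tau>)"
  proof
    assume "\<exists>\<tau>'. ?Q \<tau>'"
    then obtain \<tau>' where Q: "?Q \<tau>'" by (rule exE)
    note Q' = Q_iff [THEN iffD1, OF Q]
    note \<tau>' = Q' [THEN conjunct1] Q' [THEN conjunct2, THEN conjunct1] Q' [THEN conjunct2, THEN conjunct2]
    have "(\<forall>z\<in>topspace (subtopology (powertop_real UNIV) (standard_simplex 1)). \<exists>a>0. \<tau>' z = fscale a (\<tau> z)) \<or>
      (\<forall>z\<in>topspace (subtopology (powertop_real UNIV) (standard_simplex 1)). \<exists>a<0. \<tau>' z = fscale a (\<tau> z))"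
    proof (rule lift_sign_constant [OF X _ cont [OF \<tau>] cont [OF \<tau>'(1)]])
      show "connected_space (subtopology (powertop_real UNIV) (standard_simplex 1))"
        using connectedin_standard_simplex [of 1] unfolding connectedin_def by (rule conjunct2)
      show "\<tau>' z \<in> ray_line (\<tau> z)" if "z \<in> topspace (subtopology (powertop_real UNIV) (standard_simplex 1))" for z
      proof -
        have z: "z \<in> standard_simplex 1" using that unfolding topS .
        show ?thesis using bspec [OF \<tau>'(2) z] unfolding \<sigma>x [OF z] .
      qed
    qed
    then have "(\<forall>z\<in>standard_simplex 1. \<exists>a>0. \<tau>' z = fscale a (\<tau> z)) \<or> (\<forall>z\<in>standard_simplex 1. \<exists>a<0. \<tau>' z = fscale a (\<tau> z))"
      unfolding topS .
    then have "\<exists>b. \<forall>z\<in>standard_simplex 1. \<exists>a. (a > 0 \<longleftrightarrow> b) \<and> \<tau>' z = fscale a (\<tau> z)"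
    proof
      assume "\<forall>z\<in>standard_simplex 1. \<exists>a>0. \<tau>' z = fscale a (\<tau> z)"
      then have "\<forall>z\<in>standard_simplex 1. \<exists>a. (a > 0 \<longleftrightarrow> True) \<and> \<tau>' z = fscale a (\<tau> z)" by simp
      then show ?thesis by (rule exI)
    next
      assume *: "\<forall>z\<in>standard_simplex 1. \<exists>a<0. \<tau>' z = fscale a (\<tau> z)"
      have "\<exists>a. (a > 0 \<longleftrightarrow> False) \<and> \<tau>' z = fscale a (\<tau> z)" if "z \<in> standard_simplex 1" for z
        using bspec [OF * that] less_asym by blast
      then show ?thesis by blast
    qed
    then obtain b :: bool where b: "\<forall>z\<in>standard_simplex 1. \<exists>a. (a > 0 \<longleftrightarrow> b) \<and> \<tau>' z = fscale a (\<tau> z)"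
      by (rule exE)
    have "section_sign s (simplicial_vertex i \<tau>') = section_sign s (simplicial_vertex i \<tau>) \<longleftrightarrow> b" if i: "i \<le> 1" for i
    proof -
      let ?v = "\<lambda>j. if j = i then 1 else 0 :: real"
      obtain a where a: "a > 0 \<longleftrightarrow> b" "\<tau>' ?v = fscale a (\<tau> ?v)"
        using bspec [OF b vx [OF i]] by blast
      show ?thesis
        unfolding simplicial_vertex_def a(1) [symmetric]
        by (rule section_sign_scale [OF s mem [OF \<tau> vx [OF i]] mem [OF \<tau>'(1) vx [OF i]]
              same(1) [OF \<tau>'(1,2) vx [OF i]] a(2)])
    qed
    from this [of 0] this [of 1]
    show "section_sign s (simplicial_vertex 0 \<tau>) = section_sign s (simplicial_vertex 1 \<tau>)"
      using \<tau>'(3) [rule_format, of 0] \<tau>'(3) [rule_format, of 1]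
      by (cases "section_sign s (simplicial_vertex 0 \<tau>)"; cases "section_sign s (simplicial_vertex 1 \<tau>)") auto
  next
    assume eq: "section_sign s (simplicial_vertex 0 \<tau>) = section_sign s (simplicial_vertex 1 \<tau>)"
    have i01: "i = 0 \<or> i = 1" if "i \<le> 1" for i :: nat using that by linarith
    show "\<exists>\<tau>'. ?Q \<tau>'"
    proof (cases "section_sign s (simplicial_vertex 0 \<tau>) = 0")
      case True
      have "?Q \<tau>"
        unfolding Q_iff
      proof (intro conjI ballI allI impI \<tau>)
        show "\<tau> x \<in> ?\<sigma> x" if "x \<in> standard_simplex 1" for x
          unfolding \<sigma>x [OF that] by (rule mem_ray_line [OF mem [OF \<tau> that]])
        show "section_sign s (simplicial_vertex i \<tau>) = 0" if "i \<le> 1" for i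
          using i01 [OF that] eq True by auto
      qed
      then show ?thesis by (rule exI [of ?Q \<tau>])
    next
      case False
      define \<tau>' where "\<tau>' = simplex_map 1 (fscale (- 1)) \<tau>"
      have "continuous_map ?E ?E (fscale (- 1))"
        using continuous_map_fscale_nonzero [of ?E X n "\<lambda>e. e" "- 1"] by simp
      then have \<tau>'E: "singular_simplex 1 ?E \<tau>'"
        unfolding \<tau>'_def by (rule singular_simplex_simplex_map [OF \<tau>])
      have \<tau>'x: "\<tau>' x = fscale (- 1) (\<tau> x)" if "x \<in> standard_simplex 1" for x
        using that by (simp add: \<tau>'_def simplex_map_def)
      have \<tau>'\<sigma>: "\<tau>' x \<in> ?\<sigma> x" if "x \<in> standard_simplex 1" for x
        unfolding \<sigma>x [OF that] \<tau>'x [OF that] by (rule rangeI)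
      have "?Q \<tau>'"
        unfolding Q_iff
      proof (intro conjI ballI allI impI \<tau>'E \<tau>'\<sigma>)
        fix i :: nat assume i: "i \<le> 1"
        have "section_sign s (simplicial_vertex i \<tau>') = section_sign s (simplicial_vertex i \<tau>) \<longleftrightarrow> (- 1 :: real) > 0"
          unfolding simplicial_vertex_def
          by (rule section_sign_scale [OF s mem [OF \<tau> vx [OF i]] mem [OF \<tau>'E vx [OF i]] _ \<tau>'x [OF vx [OF i]]])
            (rule same(1) [OF \<tau>'E _ vx [OF i]], blast intro: \<tau>'\<sigma>)
        moreover have "section_sign s (simplicial_vertex i \<tau>) \<noteq> 0"
          using i01 [OF i] eq False by auto
        ultimately show "section_sign s (simplicial_vertex i \<tau>') = 0"
          by (cases "section_sign s (simplicial_vertex i \<tau>')"; cases "section_sign s (simplicial_vertex i \<tau>)") auto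
      qed assumption
      then show ?thesis by (rule exI [of ?Q \<tau>'])
    qed
  qed
  moreover have "tautological_cocycle (regular_bundle X n) s 1 ?\<sigma> = (if \<exists>\<tau>'. ?Q \<tau>' then 0 else 1)"
    unfolding tautological_cocycle_def regular_bundle_simps using \<sigma>P by simp
  ultimately show ?thesis
    by (cases "section_sign s (simplicial_vertex 0 \<tau>)"; cases "section_sign s (simplicial_vertex 1 \<tau>)") auto
qed


lemma tautological_cocycle_zero:
  assumes "\<not> (k = 1 \<and> singular_simplex k (projectivization \<xi>) \<sigma>)"
  shows "tautological_cocycle \<xi> s k \<sigma> = 0"
  unfolding tautological_cocycle_def
  by (intro if_not_P notI, elim conjE, rule notE [OF assms], rule conjI, assumption) (simp only:)

text \<open>On nonzero vectors there is a tautological orientation, and the cocycle becomes the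
  coboundary of its comparison with s. This identifies pullbacks of the tautological class with sign
  classes.\<close>

lemma pullback_tautological_cocycle:
  fixes X :: "'a topology"
  assumes X: "Hausdorff_space X" and s: "s \<in> line_sections X n"
  shows "cochain_pullback (nonzero_space X n) ray_line (tautological_cocycle (regular_bundle X n) s)
    = coboundary (nonzero_space X n) (point_cochain (nonzero_space X n) (section_sign s))"
proof (intro ext)
  let ?E = "nonzero_space X n"
  fix k \<tau>
  show "cochain_pullback ?E ray_line (tautological_cocycle (regular_bundle X n) s) k \<tau>
    = coboundary ?E (point_cochain ?E (section_sign s)) k \<tau>"
  proof (cases "k = 1 \<and> singular_simplex k ?E \<tau>")
    case True
    then have k: "k = 1" by (rule conjunct1)
    have \<tau>: "singular_simplex 1 ?E \<tau>" using True [THEN conjunct2] unfolding k .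
    have face: "point_cochain ?E (section_sign s) 0 (singular_face 1 i \<tau>) = section_sign s (simplicial_vertex (1 - i) \<tau>)"
      if "i \<le> 1" for i
    proof -
      have "singular_simplex 0 ?E (singular_face 1 i \<tau>)"
        using singular_simplex_singular_face [OF \<tau> _ that] by simp
      moreover have "simplical_face i (\<lambda>j. if j = 0 then 1 else 0) = (\<lambda>j. if j = 1 - i then 1 else 0 :: real)"
      proof -
        have "i = 0 \<or> i = 1" using that by linarith
        then show ?thesis by (auto simp: simplical_face_def fun_eq_iff)
      qed
      ultimately show ?thesis
        by (simp add: point_cochain_def singular_face_def simplicial_vertex_def)
    qed
    have "coboundary ?E (point_cochain ?E (section_sign s)) 1 \<tau>
        = (\<Sum>i\<le>1. point_cochain ?E (section_sign s) 0 (singular_face 1 i \<tau>))"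
      using \<tau> by (simp add: coboundary_def)
    also have "\<dots> = (\<Sum>i\<le>1. section_sign s (simplicial_vertex (1 - i) \<tau>))"
      by (intro sum.cong refl face) simp
    also have "\<dots> = section_sign s (simplicial_vertex 0 \<tau>) + section_sign s (simplicial_vertex 1 \<tau>)"
      by (simp add: add.commute)
    finally show ?thesis
      unfolding k cochain_pullback_def using \<tau> tautological_cocycle_lift [OF X s \<tau>] by argo
  next
    case False
    have "coboundary ?E (point_cochain ?E (section_sign s)) k \<tau> = 0"
    proof (cases "k \<noteq> 0 \<and> singular_simplex k ?E \<tau>")
      case True
      then have "k - 1 \<noteq> 0" using False by linarith
      then show ?thesis by (simp add: coboundary_def point_cochain_def)
    next
      case False
      then show ?thesis unfolding coboundary_def by (rule if_not_P)
    qed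
    moreover have "cochain_pullback ?E ray_line (tautological_cocycle (regular_bundle X n) s) k \<tau> = 0"
    proof (cases "singular_simplex k ?E \<tau>")
      case True
      then have "k \<noteq> 1" using False by blast
      then have "tautological_cocycle (regular_bundle X n) s k (simplex_map k ray_line \<tau>) = 0"
        by (intro tautological_cocycle_zero) blast
      then show ?thesis unfolding cochain_pullback_def by simp
    next
      case False
      then show ?thesis unfolding cochain_pullback_def by (rule if_not_P)
    qed
    ultimately show ?thesis by argo
  qed
qed

text \<open>Every simplex of lines lifts to nonzero vectors, so a cochain on the projectivization is
  determined by its pullback, and identities between cochains may be checked there.\<close>

lemma pullback_ray_line_inject:
  fixes X :: "'a topology"
  assumes X: "Hausdorff_space X"
    and c: "\<And>k \<sigma>. \<not> singular_simplex k (projective_space X n) \<sigma> \<Longrightarrow> c k \<sigma> = 0"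
    and d: "\<And>k \<sigma>. \<not> singular_simplex k (projective_space X n) \<sigma> \<Longrightarrow> d k \<sigma> = 0"
    and eq: "cochain_pullback (nonzero_space X n) ray_line c = cochain_pullback (nonzero_space X n) ray_line d"
  shows "c = d"
proof (intro ext)
  fix k \<sigma>
  show "c k \<sigma> = d k \<sigma>"
  proof (cases "singular_simplex k (projective_space X n) \<sigma>")
    case True
    obtain \<tau> where \<tau>: "singular_simplex k (nonzero_space X n) \<tau>" "\<sigma> = simplex_map k ray_line \<tau>"
      using singular_simplex_lift [OF X True] .
    have "cochain_pullback (nonzero_space X n) ray_line c k \<tau> = cochain_pullback (nonzero_space X n) ray_line d k \<tau>"
      unfolding eq ..
    then show ?thesis
      unfolding cochain_pullback_def \<tau>(2) using \<tau>(1) by argo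
  qed (simp add: c d)
qed

lemma tautological_cocycle:
  fixes X :: "'a topology"
  assumes X: "Hausdorff_space X" and s: "s \<in> line_sections X n"
  shows "tautological_cocycle (regular_bundle X n) s \<in> inv_cocycles (projective_space X n) {}"
proof -
  let ?P = "projective_space X n" and ?t = "tautological_cocycle (regular_bundle X n) s"
  have t0: "?t k \<sigma> = 0" if "\<not> singular_simplex k ?P \<sigma>" for k \<sigma>
    by (rule tautological_cocycle_zero) (use that in blast)
  have "coboundary ?P ?t = 0"
  proof (rule pullback_ray_line_inject [OF X])
    show "coboundary ?P ?t k \<sigma> = 0" if "\<not> singular_simplex k ?P \<sigma>" for k \<sigma>
      using that by (simp add: coboundary_def)
    show "cochain_pullback (nonzero_space X n) ray_line (coboundary ?P ?t) = cochain_pullback (nonzero_space X n) ray_line 0"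
      unfolding cochain_pullback_coboundary [OF continuous_map_ray_line] pullback_tautological_cocycle [OF X s]
        coboundary_coboundary cochain_pullback_0 ..
  qed simp
  moreover have "finite {k. ?t k \<noteq> 0}"
  proof (rule finite_subset [of _ "{1}"])
    have "?t k = 0" if "k \<noteq> 1" for k
      by (intro ext) (use that tautological_cocycle_zero in fastforce)
    then show "{k. ?t k \<noteq> 0} \<subseteq> {1}" by blast
  qed simp
  ultimately show ?thesis
    using t0 by (simp add: inv_cocycles_def inv_cochains_iff)
qed

lemma tautological_cocycle_independent:
  fixes X :: "'a topology"
  assumes X: "Hausdorff_space X" and s: "s \<in> line_sections X n" "s' \<in> line_sections X n"
  shows "inv_class (projective_space X n) {} (tautological_cocycle (regular_bundle X n) s)
    = inv_class (projective_space X n) {} (tautological_cocycle (regular_bundle X n) s')"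
proof -
  let ?P = "projective_space X n" and ?t = "tautological_cocycle (regular_bundle X n)"
  \<comment> \<open>The orientation of the vector chosen by s' relative to s. It is a function on
    lines, in contrast to the two signs whose sum it is.\<close>
  let ?E = "nonzero_space X n" and ?h = "\<lambda>l. section_sign s (s' l)"
  have h: "section_sign s e + section_sign s' e = ?h (ray_line e)" if e: "e \<in> topspace ?E" for e
  proof -
    obtain a where a: "a \<noteq> 0" "e = fscale a (s' (ray_line e))" "section_sign s' e = 0 \<longleftrightarrow> a > 0"
      using line_section [OF s(2) e] .
    have "s' (ray_line e) \<in> ray_line e \<inter> topspace ?E"
      using s(2) ray_line_in_projectivization [OF e] unfolding line_sections_def by blast
    then have s'e: "s' (ray_line e) \<in> ray_line e" "s' (ray_line e) \<in> topspace ?E" by blast+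
    have "ray_line e = ray_line (s' (ray_line e))"
      using ray_line_eqI(1) [OF e s'e(2,1)] by (rule sym)
    then have "section_sign s e = section_sign s (s' (ray_line e)) \<longleftrightarrow> a > 0"
      by (intro section_sign_scale [OF s(1) s'e(2) e _ a(2)])
    then show ?thesis
      using a(3) by (cases "section_sign s e"; cases "section_sign s' e"; cases "section_sign s (s' (ray_line e))") auto
  qed
  have "?t s + ?t s' = coboundary ?P (point_cochain ?P ?h)"
  proof (rule pullback_ray_line_inject [OF X])
    show "(?t s + ?t s') k \<sigma> = 0" if "\<not> singular_simplex k ?P \<sigma>" for k \<sigma>
      using that by (simp add: tautological_cocycle_zero)
    show "coboundary ?P (point_cochain ?P ?h) k \<sigma> = 0" if "\<not> singular_simplex k ?P \<sigma>" for k \<sigma>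
      using that by (simp add: coboundary_def)
    have "point_cochain ?E (\<lambda>e. ?h (ray_line e)) = point_cochain ?E (\<lambda>e. section_sign s e + section_sign s' e)"
      by (rule point_cochain_cong) (rule h [symmetric])
    then show "cochain_pullback ?E ray_line (?t s + ?t s') = cochain_pullback ?E ray_line (coboundary ?P (point_cochain ?P ?h))"
      unfolding cochain_pullback_add pullback_tautological_cocycle [OF X s(1)] pullback_tautological_cocycle [OF X s(2)]
        cochain_pullback_coboundary [OF continuous_map_ray_line] cochain_pullback_point [OF continuous_map_ray_line]
      by (simp only: point_cochain_add coboundary_add)
  qed
  moreover have "point_cochain ?P ?h \<in> inv_cochains ?P {}"
    by (rule point_cochain_invariant) auto
  ultimately show ?thesis
    unfolding inv_class_eq_iff inv_coboundaries_def by blast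
qed

lemma tautological_class_eq:
  fixes X :: "'a topology"
  assumes X: "Hausdorff_space X" and s: "s \<in> line_sections X n"
  shows "tautological_class (regular_bundle X n)
    = inv_class (projective_space X n) {} (tautological_cocycle (regular_bundle X n) s)"
  unfolding tautological_class_def line_sections_def [symmetric] inv_class_empty [symmetric]
  by (rule UN_constant_eq [OF s]) (intro ballI tautological_cocycle_independent [OF X _ s])

lemma line_sections_nonempty: "\<exists>s. s \<in> line_sections X n"
proof -
  have "\<forall>l\<in>topspace (projective_space X n). \<exists>e. e \<in> l \<inter> topspace (nonzero_space X n)"
  proof
    fix l assume "l \<in> topspace (projective_space X n)"
    then obtain e where e: "e \<in> topspace (nonzero_space X n)" "l = ray_line e"
      by (rule projectivization_cases)
    show "\<exists>e. e \<in> l \<inter> topspace (nonzero_space X n)"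
      unfolding e(2) using mem_ray_line [OF e(1)] e(1) by (intro exI IntI)
  qed
  from bchoice [OF this] show ?thesis unfolding line_sections_def by simp
qed

section \<open>Pulling back the defining relation of the Stiefel--Whitney classes\<close>

lemma projectivization_proj_ray_line: "projectivization_proj (regular_bundle X n) (ray_line e) = fst e"
proof -
  have "fst ` ray_line e = {fst e}" by (auto simp: image_image)
  then show ?thesis by (simp add: projectivization_proj_def regular_bundle_simps)
qed

lemma continuous_map_projectivization_proj:
  "continuous_map (projective_space X n) (configuration_space X n) (projectivization_proj (regular_bundle X n))"
proof (rule continuous_compose_quotient_map [OF quotient_map_ray_line])
  have "continuous_map (nonzero_space X n) (configuration_space X n) fst"
    unfolding nonzero_vectors_def by (intro continuous_map_from_subtopology continuous_map_bundle_fst)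
  then show "continuous_map (nonzero_space X n) (configuration_space X n) (projectivization_proj (regular_bundle X n) \<circ> ray_line)"
    by (simp add: comp_def projectivization_proj_ray_line)
qed

lemma stiefel_whitney_closed:
  assumes "stiefel_whitney_classes n \<xi> w"
  shows "w k \<in> carrier (inv_cohomology_ring (base_space \<xi>) {})"
proof -
  have "w k \<in> cohomology k (base_space \<xi>)"
    using assms unfolding stiefel_whitney_classes_def by blast
  then obtain c where "c \<in> carrier (cocycle_ring (base_space \<xi>))" "w k = cohomology_class (base_space \<xi>) c"
    unfolding cohomology_def by auto
  then show ?thesis
    unfolding inv_cohomology_carrier inv_cocycle_ring_empty [symmetric] inv_cocycle_ring_simps inv_class_empty by blast
qed

text \<open>The defining relation in the form of a polynomial expression over
  \<open>ring_product\<close>, ready to be carried along by \<open>matches\<close>.\<close>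

lemma projective_relation:
  fixes X :: "'a topology"
  assumes X: "Hausdorff_space X" and sw: "stiefel_whitney_classes n (regular_bundle X n) w"
  shows "component (inv_cohomology_ring (projective_space X n) {})
      (\<Sum>k\<le>n. embed_component (inv_cohomology_ring (projective_space X n) {})
          (inv_pullback (projective_space X n) {} (projectivization_proj (regular_bundle X n)) (w k)) *
        embed_component (inv_cohomology_ring (projective_space X n) {})
          (tautological_class (regular_bundle X n)) ^ (n - k))
    = \<zero>\<^bsub>inv_cohomology_ring (projective_space X n) {}\<^esub>"
proof -
  let ?\<xi> = "regular_bundle X n"
  let ?P = "projectivization ?\<xi>" and ?B = "configuration_space X n"
  let ?H = "inv_cohomology_ring ?P {}"
  have c2: "cring2 ?H" by (rule cring2_inv_cohomology_ring) simp
  obtain s where s: "s \<in> line_sections X n" using line_sections_nonempty by blast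
  have t: "tautological_class ?\<xi> \<in> carrier ?H"
    unfolding tautological_class_eq [OF X s] inv_cohomology_carrier using tautological_cocycle [OF X s] by blast
  have "equivariant_map ?P {} ?B {} (projectivization_proj ?\<xi>)"
    using continuous_map_projectivization_proj by (simp add: equivariant_map_def)
  then have p: "inv_pullback ?P {} (projectivization_proj ?\<xi>) (w k) \<in> carrier ?H" for k
    by (rule inv_pullback_closed)
      (use stiefel_whitney_closed [OF sw, of k] in \<open>simp_all add: regular_bundle_simps\<close>)
  have trm: "component ?H (embed_component ?H (inv_pullback ?P {} (projectivization_proj ?\<xi>) (w k)) *
        embed_component ?H (tautological_class ?\<xi>) ^ (n - k))
      = cohomology_pullback ?P (projectivization_proj ?\<xi>) (w k) \<otimes>\<^bsub>?H\<^esub> tautological_class ?\<xi> [^]\<^bsub>?H\<^esub> (n - k)" for k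
    unfolding component_simps(4) [OF c2] component_pow [OF c2] component_embed_self [OF p c2]
      component_embed_self [OF t c2] unfolding inv_pullback_empty ..
  show ?thesis
    unfolding component_sum [OF c2 finite_atMost] trm
    using sw unfolding stiefel_whitney_classes_def inv_cohomology_ring_empty by blast
qed

text \<open>The lines through the values of f form a map to the projectivization that is constant
  along the generators, even where f itself changes sign. Pulling the relation back along this map
  turns the tautological class into the sign class of f.\<close>

theorem regular_bundle_relation:
  fixes X :: "'a topology" and Y :: "'b topology"
  assumes X: "Hausdorff_space X" and sw: "stiefel_whitney_classes n (regular_bundle X n) w"
    and s: "s \<in> line_sections X n" and G: "acts_on Y G"
    and f: "continuous_map Y (nonzero_space X n) f"
    and inv: "\<And>g y. \<lbrakk>g \<in> G; y \<in> topspace Y\<rbrakk> \<Longrightarrow> ray_line (f (g y)) = ray_line (f y)"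
  shows "component (inv_cohomology_ring Y G)
      (\<Sum>k\<le>n. embed_component (inv_cohomology_ring Y G) (inv_pullback Y G (\<lambda>y. fst (f y)) (w k)) *
        embed_component (inv_cohomology_ring Y G) (sign_class Y G (\<lambda>y. section_sign s (f y))) ^ (n - k))
    = \<zero>\<^bsub>inv_cohomology_ring Y G\<^esub>"
proof -
  let ?\<xi> = "regular_bundle X n"
  let ?P = "projectivization ?\<xi>" and ?B = "configuration_space X n" and ?E = "nonzero_space X n"
  let ?H = "inv_cohomology_ring ?P {}" and ?K = "inv_cohomology_ring Y G"
  let ?h = "\<lambda>y. ray_line (f y)"
  have cH: "cring2 ?H" by (rule cring2_inv_cohomology_ring) simp
  have cK: "cring2 ?K" by (rule cring2_inv_cohomology_ring [OF G])
  have hc: "continuous_map Y ?P ?h"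
    using continuous_map_compose [OF f continuous_map_ray_line] by (simp add: comp_def)
  have h: "equivariant_map Y G ?P {} ?h"
    unfolding equivariant_map_def by (intro conjI ballI disjI1 hc inv)
  have hom: "inv_pullback Y G ?h \<in> ring_hom ?H ?K"
    by (rule inv_pullback_hom [OF h G]) simp
  have eP: "equivariant_map ?P {} ?B {} (projectivization_proj ?\<xi>)"
    using continuous_map_projectivization_proj by (simp add: equivariant_map_def)
  have wB: "w k \<in> carrier (inv_cohomology_ring ?B {})" for k
    using stiefel_whitney_closed [OF sw, of k] by (simp add: regular_bundle_simps)
  have p: "inv_pullback ?P {} (projectivization_proj ?\<xi>) (w k) \<in> carrier ?H" for k
    by (rule inv_pullback_closed [OF eP _ _ wB]) simp_all
  have t: "tautological_class ?\<xi> \<in> carrier ?H"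
    unfolding tautological_class_eq [OF X s] inv_cohomology_carrier using tautological_cocycle [OF X s] by blast
  have pw: "inv_pullback Y G ?h (inv_pullback ?P {} (projectivization_proj ?\<xi>) (w k)) = inv_pullback Y G (\<lambda>y. fst (f y)) (w k)" for k
    using inv_pullback_compose [OF h eP G _ wB] by (simp add: comp_def projectivization_proj_ray_line)
  have "inv_pullback Y G ?h (tautological_class ?\<xi>)
      = inv_class Y G (cochain_pullback Y ?h (tautological_cocycle ?\<xi> s))"
    unfolding tautological_class_eq [OF X s] by (rule inv_pullback_class [OF h G])
  also have "cochain_pullback Y ?h (tautological_cocycle ?\<xi> s)
      = cochain_pullback Y f (cochain_pullback ?E ray_line (tautological_cocycle ?\<xi> s))"
    using cochain_pullback_compose [OF f, of ray_line "tautological_cocycle ?\<xi> s"] by (simp add: comp_def)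
  also have "\<dots> = coboundary Y (point_cochain Y (\<lambda>y. section_sign s (f y)))"
    unfolding pullback_tautological_cocycle [OF X s] cochain_pullback_coboundary [OF f] cochain_pullback_point [OF f] ..
  finally have pt: "inv_pullback Y G ?h (tautological_class ?\<xi>) = sign_class Y G (\<lambda>y. section_sign s (f y))"
    unfolding sign_class_def .
  have "matches (inv_pullback Y G ?h) ?H ?K
      (\<Sum>k\<le>n. embed_component ?H (inv_pullback ?P {} (projectivization_proj ?\<xi>) (w k)) *
        embed_component ?H (tautological_class ?\<xi>) ^ (n - k))
      (\<Sum>k\<le>n. embed_component ?K (inv_pullback Y G ?h (inv_pullback ?P {} (projectivization_proj ?\<xi>) (w k))) *
        embed_component ?K (inv_pullback Y G ?h (tautological_class ?\<xi>)) ^ (n - k))"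
    by (intro matches_sum [OF cH cK hom] matches_mult [OF cH cK hom] matches_pow [OF cH cK hom]
        matches_embed [OF cH cK hom p] matches_embed [OF cH cK hom t])
  then show "component ?K (\<Sum>k\<le>n. embed_component ?K (inv_pullback Y G (\<lambda>y. fst (f y)) (w k)) *
        embed_component ?K (sign_class Y G (\<lambda>y. section_sign s (f y))) ^ (n - k)) = \<zero>\<^bsub>?K\<^esub>"
    unfolding matches_def pw pt projective_relation [OF X sw] inv_pullback_zero [OF h G] by (rule sym)
qed

section \<open>Independent chord diagrams from planar configurations\<close>

abbreviation (input) plane :: "(real^2) topology" where
  "plane \<equiv> euclidean"

text \<open>Pigeonhole: the n half-open intervals of length \<eta> that end at \<eta>, ..., n \<eta>
  are disjoint, and fewer than n points are to be avoided.\<close>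

lemma cut_avoiding_points:
  fixes Q :: "real set"
  assumes "finite Q" "card Q < n" "\<eta> > 0"
  obtains k where "1 \<le> k" "k \<le> n" "\<And>q. q \<in> Q \<Longrightarrow> \<not> (real k * \<eta> - \<eta> \<le> q \<and> q < real k * \<eta>)"
proof -
  define hit where "hit q = nat \<lfloor>q / \<eta>\<rfloor> + 1" for q
  have "\<not> {1..n} \<subseteq> hit ` Q"
    using card_image_le [OF assms(1), of hit] card_mono [OF finite_imageI [OF assms(1)], of "{1..n}" hit] assms(2) by force
  then obtain k where "k \<in> {1..n}" and k3: "k \<notin> hit ` Q" by blast
  then have k: "1 \<le> k" "k \<le> n" "k \<notin> hit ` Q" by simp_all
  have "\<not> (real k * \<eta> - \<eta> \<le> q \<and> q < real k * \<eta>)" if "q \<in> Q" for q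
  proof
    assume "real k * \<eta> - \<eta> \<le> q \<and> q < real k * \<eta>"
    then have "real k - 1 \<le> q / \<eta>" "q / \<eta> < real k"
      using assms(3) by (simp_all add: field_simps)
    then have "\<lfloor>q / \<eta>\<rfloor> = int k - 1"
      by (intro floor_unique) auto
    then have "hit q = k" using k(1) by (simp add: hit_def)
    then show False using k(3) that by blast
  qed
  then show thesis using that k by blast
qed

text \<open>
  The row of \<open>z\<close> is the line through \<open>(X z, Y z)\<close> of slope \<open>- T\<close>, its column is the vertical
  line. If the support is nonempty, take \<open>p\<close> in it with \<open>Y p\<close> maximal. The row of \<open>p\<close> stays
  to the right of \<open>X p + s\<close>, where the cut \<open>s\<close> is chosen such that no other row crosses it: hence the
  points to the left of the cut form a union of columns, and without \<open>p\<close> a union of rows.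
\<close>

lemma rows_and_columns_independent:
  fixes X y :: "'a \<Rightarrow> real" and c :: "'a \<Rightarrow> real"
  defines "Y \<equiv> \<lambda>K z. exp (K * y z)"
  assumes S: "finite S"
    and sep: "\<And>z w. \<lbrakk>z \<in> S; w \<in> S; z \<noteq> w\<rbrakk> \<Longrightarrow> \<delta> \<le> \<bar>X z - X w\<bar> + \<bar>y z - y w\<bar>"
    and \<delta>: "\<delta> > 0" and K: "K > 0" "(real (card S) + 1) * exp (- (K * \<delta> / 2)) \<le> 1"
    and T: "T > 0" "\<And>z. z \<in> S \<Longrightarrow> 4 * Y K z < T * \<delta>"
    and col: "\<And>x. (\<Sum>z\<in>{z \<in> S. X z = x}. c z) = 0"
    and row: "\<And>b. (\<Sum>z\<in>{z \<in> S. T * X z + Y K z = b}. c z) = 0"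
    and "z \<in> S"
  shows "c z = 0"
proof (rule ccontr)
  assume "c z \<noteq> 0"
  define R where "R = {z \<in> S. c z \<noteq> 0}"
  have R: "finite R" "R \<noteq> {}" "R \<subseteq> S" "card R \<le> card S"
    using S \<open>z \<in> S\<close> \<open>c z \<noteq> 0\<close> by (auto simp: R_def intro: card_mono)
  obtain p where p: "p \<in> R" and "\<forall>q\<in>R. y q \<le> y p"
  proof -
    have "Max (y ` R) \<in> y ` R" using R by (intro Max_in) auto
    then obtain p where "p \<in> R" "y p = Max (y ` R)" by auto
    then show thesis using that R by simp
  qed
  then have yp: "y q \<le> y p" if "q \<in> R" for q using that by blast
  \<comment> \<open>u is the horizontal distance from p to the point where its row meets height
    zero, the largest such distance in the support. \<eta> will bound this distance for all other
    points of the support near p.\<close>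
  define u \<eta> where "u = Y K p / T" and "\<eta> = exp (- (K * \<delta> / 2)) * u"
  have Y: "Y K q > 0" for q by (simp add: Y_def)
  have Ymono: "Y K q \<le> Y K p" if "q \<in> R" for q
    using yp [OF that] K(1) by (simp add: Y_def)
  have u: "u > 0" "4 * u < \<delta>"
    using Y T R(3) p by (auto simp: u_def field_simps)
  have \<eta>: "\<eta> > 0" using u by (simp add: \<eta>_def)
  \<comment> \<open>As 2 u is less than \<delta> / 2, separation forces such a point to lie more
    than \<delta> / 2 below p in the coordinate y, and the exponential makes its height smaller than
    that of p by the factor exp (- K \<delta> / 2).\<close>
  have near: "Y K q < T * \<eta>" if q: "q \<in> R" "q \<noteq> p" "\<bar>X q - X p\<bar> \<le> 2 * u" for q
  proof -
    have "\<delta> \<le> \<bar>X q - X p\<bar> + \<bar>y q - y p\<bar>" using sep [of q p] q p R(3) by blast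
    then have "y q < y p - \<delta> / 2" using yp [OF q(1)] q(3) u(2) by linarith
    then have "K * y q < K * (y p - \<delta> / 2)" using K(1) by (rule mult_strict_left_mono)
    then have "K * y q < - (K * \<delta> / 2) + K * y p" by (simp add: algebra_simps)
    then have "Y K q < exp (- (K * \<delta> / 2)) * Y K p" unfolding Y_def exp_add [symmetric] by simp
    then show ?thesis using T(1) by (simp add: \<eta>_def u_def)
  qed
  let ?b = "\<lambda>z. T * X z + Y K z"
  have disp: "X q' - X q = (Y K q - Y K q') / T" if "?b q = ?b q'" for q q'
    using that T(1) by (simp add: field_simps)
  have row_p: "X q \<ge> X p + u - \<eta>" if q: "q \<in> R" "q \<noteq> p" "?b q = ?b p" for q
  proof -
    have d: "X q - X p = u - Y K q / T"
      using disp [of p q] q(3) by (simp add: u_def diff_divide_distrib)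
    have "Y K q / T > 0" "Y K q / T \<le> u"
      using Y [of q] T(1) Ymono [OF q(1)] by (simp_all add: u_def divide_right_mono)
    then have "\<bar>X q - X p\<bar> \<le> 2 * u" using d u by linarith
    from near [OF q(1,2) this] have "Y K q / T < \<eta>" using T(1) by (simp add: field_simps)
    then show ?thesis using d by linarith
  qed
  have "card ((\<lambda>q. X q - X p) ` (R - {p})) \<le> card (R - {p})" by (rule card_image_le) (use R in simp)
  also have "\<dots> < card S" using R p by (metis card_Diff1_less order_less_le_trans)
  finally obtain k where k: "1 \<le> k" "k \<le> card S"
    "\<And>q. q \<in> (\<lambda>q. X q - X p) ` (R - {p}) \<Longrightarrow> \<not> (real k * \<eta> - \<eta> \<le> q \<and> q < real k * \<eta>)"
    using cut_avoiding_points [of "(\<lambda>q. X q - X p) ` (R - {p})" "card S" \<eta>] R(1) \<eta> by blast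
  define s where "s = real k * \<eta>"
  have s0: "s > 0" using k(1) \<eta> by (simp add: s_def)
  have "s \<le> real (card S) * \<eta>" using k(2) \<eta> by (simp add: s_def)
  \<comment> \<open>The size of K provides room for as many intervals of length \<eta> as there are
    points, and for one more, which separates the cut from the other points in the row of p.\<close>
  moreover have "(real (card S) + 1) * \<eta> \<le> u"
    using mult_right_mono [OF K(2), of u] u(1) by (simp add: \<eta>_def algebra_simps)
  ultimately have s: "s \<le> u - \<eta>" by (simp add: algebra_simps)
  have gap: "X q < X p + s - \<eta> \<or> X q \<ge> X p + s" if "q \<in> R" "q \<noteq> p" for q
    using k(3) [of "X q - X p"] that by (auto simp: s_def)
  define C where "C = {q \<in> R. X q < X p + s}"
  have closed: "q' \<in> C - {p}" if q: "q \<in> C - {p}" and q': "q' \<in> R" "?b q' = ?b q" for q q'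
  proof -
    have qR: "q \<in> R" "q \<noteq> p" "X q < X p + s" using q by (auto simp: C_def)
    have "q' \<noteq> p"
    proof
      assume "q' = p"
      then have "X q \<ge> X p + u - \<eta>" using row_p [OF qR(1,2)] q'(2) by simp
      then show False using qR(3) s by linarith
    qed
    moreover have "X q' < X p + s"
    proof (rule ccontr)
      \<comment> \<open>A row that crosses the cut has a point q on the left of it near p, whose
        displacement is less than \<eta>. Then q lies in the interval of length \<eta> in front of
        the cut, which was chosen free of points other than p.\<close>
      assume far: "\<not> X q' < X p + s"
      have d: "X q' - X q = Y K q / T - Y K q' / T"
        using disp [of q q'] q'(2) by (simp add: diff_divide_distrib)
      have "Y K q / T > 0" "Y K q / T \<le> u" "Y K q' / T > 0" "Y K q' / T \<le> u"
        using Y [of q] Y [of q'] T(1) Ymono [OF qR(1)] Ymono [OF q'(1)] by (simp_all add: u_def divide_right_mono)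
      then have "\<bar>X q - X p\<bar> \<le> 2 * u" using d far qR(3) s s0 \<eta> by linarith
      then have "Y K q / T < \<eta>" using near [OF qR(1,2)] T(1) by (simp add: field_simps)
      then have "X q \<ge> X p + s - \<eta>" using d far \<open>Y K q' / T > 0\<close> by linarith
      then show False using gap [OF qR(1,2)] qR(3) by linarith
    qed
    ultimately show ?thesis using q'(1) by (simp add: C_def)
  qed
  have sum0: "sum c {q \<in> R. P q} = sum c {q \<in> S. P q}" for P
    using S by (intro sum.mono_neutral_left) (auto simp: R_def)
  have finC: "finite C" using R by (simp add: C_def)
  have "sum c C = (\<Sum>x\<in>X ` C. sum c {q \<in> C. X q = x})"
    by (rule sum.image_gen [OF finC])
  also have "\<dots> = 0"
  proof (rule sum.neutral, rule ballI)
    fix x assume "x \<in> X ` C"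
    then have "{q \<in> C. X q = x} = {q \<in> R. X q = x}" by (auto simp: C_def)
    then show "sum c {q \<in> C. X q = x} = 0" using col [of x] sum0 [of "\<lambda>q. X q = x"] by simp
  qed
  finally have C0: "sum c C = 0" .
  have "sum c (C - {p}) = (\<Sum>b\<in>?b ` (C - {p}). sum c {q \<in> C - {p}. ?b q = b})"
    by (rule sum.image_gen) (use finC in simp)
  also have "\<dots> = 0"
  proof (rule sum.neutral, rule ballI)
    fix b assume "b \<in> ?b ` (C - {p})"
    then obtain q where q: "q \<in> C - {p}" "b = ?b q" by blast
    have "{q' \<in> C - {p}. ?b q' = b} = {q' \<in> R. ?b q' = b}"
      using closed [OF q(1)] unfolding q(2) C_def by blast
    then show "sum c {q' \<in> C - {p}. ?b q' = b} = 0" using row [of b] sum0 [of "\<lambda>q. ?b q = b"] by simp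
  qed
  finally have "sum c (C - {p}) = 0" .
  moreover have "p \<in> C" using p s0 by (simp add: C_def)
  ultimately have "c p = 0" using C0 finC by (simp add: sum.remove)
  then show False using p by (simp add: R_def)
qed

text \<open>By induction there is a dual system for the old functionals. Some f in V is killed by
  these but not by the new functional, since otherwise the new one would be a linear combination of
  the old ones on V. Normalizing f and correcting the old system by multiples of it completes the
  step.\<close>

lemma dual_basis:
  fixes \<phi> :: "'a \<Rightarrow> ('b \<Rightarrow> real) \<Rightarrow> real"
  assumes S: "finite S"
    and lin: "\<And>z f g a. \<phi> z (\<lambda>x. f x + a * g x) = \<phi> z f + a * \<phi> z g"
    and V: "\<And>f g a. \<lbrakk>f \<in> V; g \<in> V\<rbrakk> \<Longrightarrow> (\<lambda>x. f x + a * g x) \<in> V" "(\<lambda>x. 0) \<in> V"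
    and indep: "\<And>c z. \<lbrakk>\<forall>f\<in>V. (\<Sum>z\<in>S. c z * \<phi> z f) = 0; z \<in> S\<rbrakk> \<Longrightarrow> c z = 0"
  shows "\<exists>g. \<forall>z\<in>S. g z \<in> V \<and> (\<forall>w\<in>S. \<phi> w (g z) = (if w = z then 1 else 0))"
  using S indep
proof (induction S)
  case empty
  show ?case by simp
next
  case (insert a S)
  have "\<exists>g. \<forall>z\<in>S. g z \<in> V \<and> (\<forall>w\<in>S. \<phi> w (g z) = (if w = z then 1 else 0))"
  proof (rule insert.IH)
    fix c z assume c: "\<forall>f\<in>V. (\<Sum>z\<in>S. c z * \<phi> z f) = 0" and z: "z \<in> S"
    have "(if z = a then 0 else c z) = 0"
    proof (rule insert.prems [of "\<lambda>z. if z = a then 0 else c z"])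
      have "(\<Sum>z\<in>S. (if z = a then 0 else c z) * \<phi> z f) = (\<Sum>z\<in>S. c z * \<phi> z f)" for f
        using insert.hyps(2) by (intro sum.cong) auto
      then show "\<forall>f\<in>V. (\<Sum>z\<in>insert a S. (if z = a then 0 else c z) * \<phi> z f) = 0"
        using c insert.hyps by simp
    qed (use z in simp)
    then show "c z = 0" using z insert.hyps(2) by (auto split: if_splits)
  qed
  then obtain g where g: "\<And>z. z \<in> S \<Longrightarrow> g z \<in> V" "\<And>z w. \<lbrakk>z \<in> S; w \<in> S\<rbrakk> \<Longrightarrow> \<phi> w (g z) = (if w = z then 1 else 0)"
    by blast
  have zero: "\<phi> z (\<lambda>x. 0) = 0" for z
    using lin [of z "\<lambda>x. 0" "- 1" "\<lambda>x. 0"] by simp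
  have comb: "\<phi> z (\<lambda>x. f x + (\<Sum>w\<in>A. k w * h w x)) = \<phi> z f + (\<Sum>w\<in>A. k w * \<phi> z (h w))" if "finite A" for z f k h and A :: "'a set"
    using that
  proof (induction A)
    case (insert b A)
    have "\<phi> z (\<lambda>x. f x + (\<Sum>w\<in>insert b A. k w * h w x)) = \<phi> z (\<lambda>x. (f x + (\<Sum>w\<in>A. k w * h w x)) + k b * h b x)"
      using insert.hyps by (simp add: algebra_simps)
    also have "\<dots> = \<phi> z (\<lambda>x. f x + (\<Sum>w\<in>A. k w * h w x)) + k b * \<phi> z (h b)" by (rule lin)
    finally show ?case using insert by simp
  qed simp
  have Vsum: "(\<lambda>x. f x + (\<Sum>w\<in>A. k w * h w x)) \<in> V" if "finite A" "f \<in> V" "\<And>w. w \<in> A \<Longrightarrow> h w \<in> V" for f k h and A :: "'a set"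
    using that
  proof (induction A)
    case (insert b A)
    have "(\<lambda>x. (f x + (\<Sum>w\<in>A. k w * h w x)) + k b * h b x) \<in> V"
      using insert by (intro V(1)) auto
    then show ?case using insert.hyps by (simp add: algebra_simps)
  qed simp
  have "\<exists>f\<in>V. (\<forall>w\<in>S. \<phi> w f = 0) \<and> \<phi> a f \<noteq> 0"
  proof (rule ccontr)
    assume no: "\<not> ?thesis"
    \<comment> \<open>The coefficients with which the new functional would be a combination of the
      old ones, read off from its values on the dual system.\<close>
    let ?c = "\<lambda>z. if z = a then 1 else - \<phi> a (g z)"
    have "?c a = 0"
    proof (rule insert.prems [of ?c a])
      show "\<forall>f\<in>V. (\<Sum>z\<in>insert a S. ?c z * \<phi> z f) = 0"
      proof
        fix f assume f: "f \<in> V"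
        let ?f = "\<lambda>x. f x + (\<Sum>w\<in>S. (- \<phi> w f) * g w x)"
        have "?f \<in> V" using insert.hyps(1) f g(1) by (intro Vsum)
        moreover have "\<phi> w ?f = 0" if "w \<in> S" for w
        proof -
          have "\<phi> w ?f = \<phi> w f + (\<Sum>z\<in>S. if z = w then - \<phi> w f else 0)"
            unfolding comb [OF insert.hyps(1)] using g(2) [OF _ that] by (intro arg_cong2 [where f = "(+)"] refl sum.cong) auto
          then show ?thesis using insert.hyps(1) that by simp
        qed
        ultimately have "\<phi> a ?f = 0" using no by blast
        then have "\<phi> a f + (\<Sum>z\<in>S. - \<phi> z f * \<phi> a (g z)) = 0" unfolding comb [OF insert.hyps(1)] .
        moreover have "(\<Sum>z\<in>S. ?c z * \<phi> z f) = (\<Sum>z\<in>S. - \<phi> z f * \<phi> a (g z))"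
          using insert.hyps(2) by (intro sum.cong) auto
        ultimately show "(\<Sum>z\<in>insert a S. ?c z * \<phi> z f) = 0" using insert.hyps by simp
      qed
    qed simp
    then show False by simp
  qed
  then obtain f where f: "f \<in> V" "\<forall>w\<in>S. \<phi> w f = 0" "\<phi> a f \<noteq> 0" by blast
  define ga where "ga = (\<lambda>x. 0 + (1 / \<phi> a f) * f x)"
  have gaV: "ga \<in> V" unfolding ga_def by (rule V(1) [OF V(2) f(1)])
  have "\<phi> z ga = \<phi> z (\<lambda>x. 0) + (1 / \<phi> a f) * \<phi> z f" for z unfolding ga_def by (rule lin)
  then have ga: "\<phi> a ga = 1" "\<And>w. w \<in> S \<Longrightarrow> \<phi> w ga = 0" using f by (simp_all add: zero)
  define g' where "g' z = (if z = a then ga else (\<lambda>x. g z x + (- \<phi> a (g z)) * ga x))" for z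
  have g'S: "g' z = (\<lambda>x. g z x + (- \<phi> a (g z)) * ga x)" if "z \<in> S" for z
    using that insert.hyps(2) by (auto simp: g'_def)
  have "g' z \<in> V \<and> (\<forall>w\<in>insert a S. \<phi> w (g' z) = (if w = z then 1 else 0))" if z: "z \<in> insert a S" for z
  proof (cases "z = a")
    case True
    then show ?thesis using gaV ga insert.hyps(2) by (auto simp: g'_def)
  next
    case False
    then have zS: "z \<in> S" using z by simp
    show ?thesis
      unfolding g'S [OF zS] lin
    proof (intro conjI ballI V(1) g(1) zS gaV)
      fix w assume "w \<in> insert a S"
      then show "\<phi> w (g z) + - \<phi> a (g z) * \<phi> w ga = (if w = z then 1 else 0)"
        using ga g(2) [OF zS] False by auto
    qed
  qed
  then show ?case by blast
qed


text \<open>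
  Points of \<open>S\<close> have distance at least \<open>1 / spread S\<close>. The rate makes the weights
  \<open>exp (chord_rate S * y)\<close> of points that are half that distance apart vertically differ by a factor
  greater than \<open>card S\<close>, and the slope makes the rows steep in comparison with that distance.
\<close>

definition spread :: "(real^2) set \<Rightarrow> real" where
  "spread S = 1 + (\<Sum>z\<in>S. \<Sum>w\<in>S. inverse (dist z w))"

definition chord_rate :: "(real^2) set \<Rightarrow> real" where
  "chord_rate S = 2 * real (card S) * spread S"

definition chord_slope :: "(real^2) set \<Rightarrow> real" where
  "chord_slope S = 4 * spread S * (1 + (\<Sum>z\<in>S. exp (chord_rate S * z $ 2)))"

text \<open>With the two exponentials all left ends are negative and all right ends positive, so
  that a left end never coincides with a right end. Left ends then encode the columns, and right
  ends the rows.\<close>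

definition chord_left :: "real^2 \<Rightarrow> real" where
  "chord_left z = - exp (z $ 1)"

definition chord_right :: "(real^2) set \<Rightarrow> real^2 \<Rightarrow> real" where
  "chord_right S z = exp (chord_slope S * z $ 1 + exp (chord_rate S * z $ 2))"

definition chords :: "(real^2) set \<Rightarrow> real set set" where
  "chords S = (\<lambda>z. {chord_left z, chord_right S z}) ` S"

lemma spread_ge_1: "spread S \<ge> 1"
  by (simp add: spread_def sum_nonneg)

text \<open>The sum of all inverse distances dominates each of them and is continuous in the
  configuration. The diagonal causes no harm because the inverse of zero is zero.\<close>

lemma dist_spread:
  assumes S: "finite S" and zw: "z \<in> S" "w \<in> S" "z \<noteq> w"
  shows "1 / spread S \<le> dist z w"
proof -
  have "inverse (dist z w) \<le> (\<Sum>w\<in>S. inverse (dist z w))"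
    using S zw by (intro member_le_sum) auto
  also have "\<dots> \<le> (\<Sum>z\<in>S. \<Sum>w\<in>S. inverse (dist z w))"
    using S zw(1) by (intro member_le_sum [of z S "\<lambda>z. \<Sum>w\<in>S. inverse (dist z w)"] sum_nonneg) auto
  finally have "inverse (dist z w) \<le> spread S" by (simp add: spread_def)
  then show ?thesis using zw(3) spread_ge_1 [of S] by (simp add: field_simps)
qed

lemma planar_dist_le: "dist z w \<le> \<bar>z $ 1 - w $ 1\<bar> + \<bar>z $ 2 - w $ 2\<bar>" for z w :: "real^2"
  using norm_le_l1_cart [of "z - w"] by (simp add: dist_norm sum_2)

text \<open>The relation is tested on Lagrange polynomials, equal to one at one end point and zero
  at all others. This shows that the coefficients sum to zero over each column and over each row,
  and \<open>rows_and_columns_independent\<close> concludes.\<close>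

lemma chord_functionals_independent:
  fixes S :: "(real^2) set" and c :: "real^2 \<Rightarrow> real"
  assumes S: "finite S"
    and c: "\<forall>f\<in>continuous_functions. (\<Sum>z\<in>S. c z * (f (chord_right S z) - f (chord_left z))) = 0"
    and "z \<in> S"
  shows "c z = 0"
proof -
  let ?Q = "chord_left ` S \<union> chord_right S ` S"
  have lr: "chord_left z < 0" "chord_right S z > 0" for z
    by (simp_all add: chord_left_def chord_right_def)
  define L where "L q t = (\<Prod>r\<in>?Q - {q}. (t - r) / (q - r))" for q t
  have Q: "finite ?Q" using S by simp
  have L1: "L q q = 1" for q
    unfolding L_def by (rule prod.neutral) simp
  have L2: "L q t = 0" if "t \<in> ?Q" "t \<noteq> q" for q t
    unfolding L_def using Q that by (intro prod_zero) (auto intro!: bexI [of _ t])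
  have L3: "L q \<in> continuous_functions" for q
    unfolding L_def continuous_functions_def mem_Collect_eq by (intro continuous_intros) auto
  note L = L1 L2 L3
  have col: "(\<Sum>z\<in>{z \<in> S. chord_left z = q}. c z) = 0" if "q < 0" for q
  proof -
    have "(\<Sum>z\<in>S. c z * (L q (chord_right S z) - L q (chord_left z))) = (\<Sum>z\<in>S. if chord_left z = q then - c z else 0)"
    proof (rule sum.cong [OF refl])
      fix z assume z: "z \<in> S"
      have "chord_right S z \<noteq> q" using lr(2) [of z] that by linarith
      then have "L q (chord_right S z) = 0" using z by (intro L(2)) auto
      moreover have "L q (chord_left z) = (if chord_left z = q then 1 else 0)"
        using L(1) [of q] L(2) [of "chord_left z" q] z by auto
      ultimately show "c z * (L q (chord_right S z) - L q (chord_left z)) = (if chord_left z = q then - c z else 0)"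
        by simp
    qed
    also have "\<dots> = - (\<Sum>z\<in>{z \<in> S. chord_left z = q}. c z)"
      using S by (simp add: sum.inter_filter flip: sum_negf) (rule sum.cong; simp)
    finally show ?thesis using c L(3) [of q] by auto
  qed
  have row: "(\<Sum>z\<in>{z \<in> S. chord_right S z = q}. c z) = 0" if "q > 0" for q
  proof -
    have "(\<Sum>z\<in>S. c z * (L q (chord_right S z) - L q (chord_left z))) = (\<Sum>z\<in>S. if chord_right S z = q then c z else 0)"
    proof (rule sum.cong [OF refl])
      fix z assume z: "z \<in> S"
      have "chord_left z \<noteq> q" using lr(1) [of z] that by linarith
      then have "L q (chord_left z) = 0" using z by (intro L(2)) auto
      moreover have "L q (chord_right S z) = (if chord_right S z = q then 1 else 0)"
        using L(1) [of q] L(2) [of "chord_right S z" q] z by auto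
      ultimately show "c z * (L q (chord_right S z) - L q (chord_left z)) = (if chord_right S z = q then c z else 0)"
        by simp
    qed
    also have "\<dots> = (\<Sum>z\<in>{z \<in> S. chord_right S z = q}. c z)"
      using S by (simp add: sum.inter_filter)
    finally show ?thesis using c L(3) [of q] by auto
  qed
  have n: "real (card S) \<ge> 1" using S \<open>z \<in> S\<close> by (metis One_nat_def Suc_leI card_gt_0_iff empty_iff of_nat_1 of_nat_mono)
  show ?thesis
  proof (rule rows_and_columns_independent [where X = "\<lambda>z. z $ 1" and y = "\<lambda>z. z $ 2" and \<delta> = "1 / spread S"
        and K = "chord_rate S" and T = "chord_slope S" and S = S and c = c])
    show "1 / spread S \<le> \<bar>z $ 1 - w $ 1\<bar> + \<bar>z $ 2 - w $ 2\<bar>" if "z \<in> S" "w \<in> S" "z \<noteq> w" for z w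
      using dist_spread [OF S that] planar_dist_le [of z w] by linarith
    show "1 / spread S > 0" using spread_ge_1 [of S] by simp
    show "chord_rate S > 0" using spread_ge_1 [of S] n by (simp add: chord_rate_def)
    \<comment> \<open>The factor \<open>2 * card S\<close> in the rate makes the exponent equal to
      \<open>card S\<close>, and exp (card S) is at least \<open>card S + 1\<close>.\<close>
    have "exp (- (chord_rate S * (1 / spread S) / 2)) = exp (- real (card S))"
      using spread_ge_1 [of S] by (simp add: chord_rate_def)
    moreover have "(real (card S) + 1) \<le> exp (real (card S))" using exp_ge_add_one_self [of "real (card S)"] by linarith
    ultimately show "(real (card S) + 1) * exp (- (chord_rate S * (1 / spread S) / 2)) \<le> 1"
      by (simp add: exp_minus field_simps)
    have pos: "(\<Sum>z\<in>S. exp (chord_rate S * z $ 2)) \<ge> 0" by (simp add: sum_nonneg)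
    then show "chord_slope S > 0" using spread_ge_1 [of S] by (simp add: chord_slope_def zero_less_mult_iff)
    \<comment> \<open>The slope contains the sum of all heights plus one: the sum dominates every
      single height, and the one makes the inequality strict.\<close>
    show "4 * exp (chord_rate S * z $ 2) < chord_slope S * (1 / spread S)" if "z \<in> S" for z
    proof -
      have "exp (chord_rate S * z $ 2) \<le> (\<Sum>z\<in>S. exp (chord_rate S * z $ 2))"
        using S that by (intro member_le_sum [of z S "\<lambda>z. exp (chord_rate S * z $ 2)"]) auto
      then show ?thesis using spread_ge_1 [of S] by (simp add: chord_slope_def)
    qed
    show "(\<Sum>z\<in>{z \<in> S. z $ 1 = x}. c z) = 0" for x
      using col [of "- exp x"] by (simp add: chord_left_def)
    show "(\<Sum>z\<in>{z \<in> S. chord_slope S * z $ 1 + exp (chord_rate S * z $ 2) = b}. c z) = 0" for b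
      using row [of "exp b"] by (simp add: chord_right_def)
  qed (use S \<open>z \<in> S\<close> in auto)
qed


section \<open>The chord diagram of a planar configuration\<close>

lemma chords_inject:
  assumes S: "finite S" "z \<in> S" "w \<in> S" and eq: "{chord_left z, chord_right S z} = {chord_left w, chord_right S w}"
  shows "z = w"
proof -
  have "chord_left z < chord_right S w" "chord_left w < chord_right S z"
    by (simp_all add: chord_left_def chord_right_def) (smt (verit) exp_gt_zero)+
  then have "chord_left z = chord_left w" "chord_right S z = chord_right S w"
    using eq by (auto simp: doubleton_eq_iff)
  then have z: "z $ 1 = w $ 1" "chord_rate S * z $ 2 = chord_rate S * w $ 2"
    by (simp_all add: chord_left_def chord_right_def)
  have "card S \<noteq> 0" using S by auto
  then have "chord_rate S \<noteq> 0" using spread_ge_1 [of S] by (simp add: chord_rate_def)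
  then show ?thesis using z by (simp add: vec_eq_iff forall_2)
qed

lemma respects_chords_iff:
  "respects_chords (chords S) f \<longleftrightarrow> (\<forall>z\<in>S. f (chord_right S z) - f (chord_left z) = 0)"
  unfolding respects_chords_def chords_def by (auto simp: doubleton_eq_iff)

text \<open>A dual system for the chord functionals represents a basis of the quotient: modulo
  functions that respect the chords, the coefficients of f are forced to be the differences of its
  values at the ends of the chords.\<close>

lemma independent_chords:
  assumes S: "finite S"
  shows "independent_chord_diagram (card S) (chords S)"
proof -
  let ?V = continuous_functions and ?W = "{f \<in> continuous_functions. respects_chords (chords S) f}"
  let ?\<phi> = "\<lambda>z (f :: real \<Rightarrow> real). f (chord_right S z) - f (chord_left z)"
  have inj: "inj_on (\<lambda>z. {chord_left z, chord_right S z}) S"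
    using chords_inject [OF S] by (intro inj_onI) blast
  have lr: "chord_left z \<noteq> chord_right S z" for z
    by (simp add: chord_left_def chord_right_def) (smt (verit) exp_gt_zero)
  have diag: "chord_diagram (card S) (chords S)"
    unfolding chord_diagram_def
  proof (intro conjI ballI)
    show "finite (chords S)" "card (chords S) = card S" using S card_image [OF inj] by (simp_all add: chords_def)
    show "\<exists>a b. a \<noteq> b \<and> d = {a, b}" if "d \<in> chords S" for d
      using that lr by (auto simp: chords_def)
  qed
  have V: "(\<lambda>x. f x + a * g x) \<in> ?V" if "f \<in> ?V" "g \<in> ?V" for f g a
    using that by (auto simp: continuous_functions_def intro!: continuous_intros)
  have V0: "(\<lambda>x. 0) \<in> ?V" by (simp add: continuous_functions_def)
  have "\<exists>g. \<forall>z\<in>S. g z \<in> ?V \<and> (\<forall>w\<in>S. ?\<phi> w (g z) = (if w = z then 1 else 0))"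
  proof (rule dual_basis [OF S _ V V0])
    show "?\<phi> z (\<lambda>x. f x + a * g x) = ?\<phi> z f + a * ?\<phi> z g" for z f g a by (simp add: algebra_simps)
    show "c z = 0" if "\<forall>f\<in>?V. (\<Sum>z\<in>S. c z * ?\<phi> z f) = 0" "z \<in> S" for c z
      by (rule chord_functionals_independent [OF S that])
  qed
  then obtain g where g: "\<And>z. z \<in> S \<Longrightarrow> g z \<in> ?V"
    "\<And>z w. \<lbrakk>z \<in> S; w \<in> S\<rbrakk> \<Longrightarrow> ?\<phi> w (g z) = (if w = z then 1 else 0)"
    by blast
  have inj_g: "inj_on g S"
  proof (rule inj_onI)
    fix z w assume zw: "z \<in> S" "w \<in> S" "g z = g w"
    then show "z = w" using g(2) [of z z] g(2) [of w z] by (auto split: if_splits)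
  qed
  have W: "(\<lambda>x. f x - (\<Sum>b\<in>g ` S. c b * b x)) \<in> ?W \<longleftrightarrow> (\<forall>z\<in>S. c (g z) = ?\<phi> z f)" if f: "f \<in> ?V" for f c
  proof -
    have sum: "(\<Sum>b\<in>g ` S. c b * b x) = (\<Sum>z\<in>S. c (g z) * g z x)" for x
      by (simp add: sum.reindex [OF inj_g])
    have inV: "(\<lambda>x. f x - (\<Sum>b\<in>g ` S. c b * b x)) \<in> ?V"
      unfolding sum using f g(1) by (auto simp: continuous_functions_def intro!: continuous_intros)
    have \<phi>w: "?\<phi> w (\<lambda>x. f x - (\<Sum>b\<in>g ` S. c b * b x)) = ?\<phi> w f - c (g w)" if w: "w \<in> S" for w
    proof -
      have "(\<Sum>z\<in>S. c (g z) * g z (chord_right S w)) - (\<Sum>z\<in>S. c (g z) * g z (chord_left w)) = (\<Sum>z\<in>S. c (g z) * ?\<phi> w (g z))"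
        by (simp add: sum_subtractf right_diff_distrib)
      also have "\<dots> = (\<Sum>z\<in>S. if z = w then c (g w) else 0)"
        using g(2) [OF _ w] by (intro sum.cong refl) auto
      also have "\<dots> = c (g w)" using S w by simp
      finally show ?thesis unfolding sum by simp
    qed
    have "(\<lambda>x. f x - (\<Sum>b\<in>g ` S. c b * b x)) \<in> ?W \<longleftrightarrow> (\<forall>w\<in>S. ?\<phi> w f - c (g w) = 0)"
      unfolding respects_chords_iff mem_Collect_eq using inV \<phi>w by (simp only: simp_thms cong: ball_cong)
    then show ?thesis by auto
  qed
  have "\<exists>!c. c \<in> extensional (g ` S) \<and> (\<lambda>x. f x - (\<Sum>b\<in>g ` S. c b * b x)) \<in> ?W" if f: "f \<in> ?V" for f
  proof (rule ex1I [where a = "\<lambda>b\<in>g ` S. ?\<phi> (inv_into S g b) f"])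
    show "(\<lambda>b\<in>g ` S. ?\<phi> (inv_into S g b) f) \<in> extensional (g ` S) \<and>
        (\<lambda>x. f x - (\<Sum>b\<in>g ` S. (\<lambda>b\<in>g ` S. ?\<phi> (inv_into S g b) f) b * b x)) \<in> ?W"
      unfolding W [OF f] using inj_g by (auto simp: inv_into_f_f)
    fix c assume "c \<in> extensional (g ` S) \<and> (\<lambda>x. f x - (\<Sum>b\<in>g ` S. c b * b x)) \<in> ?W"
    then have c: "c \<in> extensional (g ` S)" "\<forall>z\<in>S. c (g z) = ?\<phi> z f" unfolding W [OF f] by blast+
    show "c = (\<lambda>b\<in>g ` S. ?\<phi> (inv_into S g b) f)"
      by (rule extensionalityI [OF c(1)]) (use c(2) inj_g in \<open>auto simp: inv_into_f_f\<close>)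
  qed
  moreover have "card (g ` S) = card S" by (rule card_image [OF inj_g])
  moreover have "func.subspace ?V"
    unfolding func.subspace_def by (auto simp: continuous_functions_def zero_fun_def plus_fun_def intro!: continuous_intros)
  moreover have "func.subspace ?W"
    unfolding func.subspace_def respects_chords_iff
    by (auto simp: continuous_functions_def zero_fun_def plus_fun_def algebra_simps intro!: continuous_intros)
  ultimately have "has_codimension ?V ?W (card S)"
    unfolding has_codimension_def using S g(1) by (intro conjI exI [of _ "g ` S"]) auto
  then show ?thesis unfolding independent_chord_diagram_def using diag by blast
qed

section \<open>Where the relation holds\<close>

lemma open_map_prod_id:
  assumes "open_map X Y f"
  shows "open_map (prod_topology X Z) (prod_topology Y Z) (\<lambda>(x, z). (f x, z))"
  unfolding open_map_def
proof (intro allI impI)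
  fix W assume W: "openin (prod_topology X Z) W"
  show "openin (prod_topology Y Z) ((\<lambda>(x, z). (f x, z)) ` W)"
    unfolding openin_prod_topology_alt
  proof (intro allI impI)
    fix y z assume "(y, z) \<in> (\<lambda>(x, z). (f x, z)) ` W"
    then obtain x where x: "(x, z) \<in> W" "y = f x" by auto
    then obtain U V where UV: "openin X U" "openin Z V" "x \<in> U" "z \<in> V" "U \<times> V \<subseteq> W"
      using W unfolding openin_prod_topology_alt by metis
    then have "openin Y (f ` U)" "f ` U \<times> V \<subseteq> (\<lambda>(x, z). (f x, z)) ` W"
      using assms by (auto simp: open_map_def)
    then show "\<exists>U V. openin Y U \<and> openin Z V \<and> y \<in> U \<and> z \<in> V \<and> U \<times> V \<subseteq> (\<lambda>(x, z). (f x, z)) ` W"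
      using UV x(2) by blast
  qed
qed

definition section_of :: "('z \<Rightarrow> 'a set \<Rightarrow> 'a \<Rightarrow> real) \<Rightarrow> 'a set \<Rightarrow> 'z \<Rightarrow> 'a set \<times> ('a \<Rightarrow> real)" where
  "section_of \<phi> S z = (S, \<lambda>p\<in>S. \<phi> z S p)"

text \<open>Continuity is tested on ordered configurations. Forgetting the order is an open map,
  hence remains a quotient map after taking the product with an arbitrary space Z of
  parameters.\<close>

lemma continuous_map_section_of:
  fixes X :: "'a topology"
  assumes \<phi>: "\<And>i. i < n \<Longrightarrow> continuous_map (prod_topology (ordered_configurations X n) Z) euclideanreal
    (\<lambda>(x, z). \<phi> z (x ` {..<n}) (x i))"
  shows "continuous_map (prod_topology (configuration_space X n) Z) (bundle_space X n) (\<lambda>(S, z). section_of \<phi> S z)"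
proof -
  let ?F = "ordered_configurations X n" and ?B = "configuration_space X n"
  let ?q = "\<lambda>(x, z). (x ` {..<n}, z)"
  have qc: "continuous_map ?F ?B (\<lambda>x. x ` {..<n})"
    using quotient_map_configuration quotient_imp_continuous_map by blast
  have q: "quotient_map (prod_topology ?F Z) (prod_topology ?B Z) ?q"
  proof (rule continuous_open_imp_quotient_map)
    show "continuous_map (prod_topology ?F Z) (prod_topology ?B Z) ?q"
      using continuous_map_compose [OF continuous_map_fst qc]
      by (auto simp: continuous_map_pairwise comp_def case_prod_beta intro: continuous_map_snd)
    show "open_map (prod_topology ?F Z) (prod_topology ?B Z) ?q"
      by (rule open_map_prod_id [OF open_map_configuration_space])
    show "?q ` topspace (prod_topology ?F Z) = topspace (prod_topology ?B Z)"
      by (force simp: configuration_space_def)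
  qed
  let ?l = "\<lambda>(x, z). (x, \<lambda>i. if i < n then \<phi> z (x ` {..<n}) (x i) else 0)"
  have "continuous_map (prod_topology ?F Z) (prod_topology ?F (Euclidean_space n)) ?l"
    unfolding continuous_map_pairwise
  proof (intro conjI)
    show "continuous_map (prod_topology ?F Z) ?F (fst \<circ> ?l)"
      by (simp add: comp_def case_prod_beta continuous_map_fst)
    have "continuous_map (prod_topology ?F Z) euclideanreal (\<lambda>w. if i < n then \<phi> (snd w) (fst w ` {..<n}) (fst w i) else 0)" for i
      using \<phi> [of i] unfolding split_def by (cases "i < n") simp_all
    then show "continuous_map (prod_topology ?F Z) (Euclidean_space n) (snd \<circ> ?l)"
      by (simp add: continuous_map_into_Euclidean_space case_prod_beta)
  qed
  from continuous_map_compose [OF this quotient_imp_continuous_map [OF quotient_map_label]]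
  have "continuous_map (prod_topology ?F Z) (bundle_space X n) (label_configuration n \<circ> ?l)" .
  moreover have "(label_configuration n \<circ> ?l) w = ((\<lambda>(S, z). section_of \<phi> S z) \<circ> ?q) w"
    if w: "w \<in> topspace (prod_topology ?F Z)" for w
  proof -
    obtain x z where xz: "w = (x, z)" "x \<in> topspace ?F" using w by auto
    have "snd (label_configuration n (x, \<lambda>i. if i < n then \<phi> z (x ` {..<n}) (x i) else 0)) p
        = (\<lambda>p\<in>x ` {..<n}. \<phi> z (x ` {..<n}) p) p" for p
    proof (cases "p \<in> x ` {..<n}")
      case True
      then obtain i where "i < n" "p = x i" by auto
      then show ?thesis using label_configuration_value [OF xz(2), of i] by simp
    qed (simp add: label_configuration_def)
    then show ?thesis
      unfolding xz(1) section_of_def by (intro prod_eqI ext) (simp_all add: label_configuration_apply)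
  qed
  ultimately have "continuous_map (prod_topology ?F Z) (bundle_space X n) ((\<lambda>(S, z). section_of \<phi> S z) \<circ> ?q)"
    by (rule continuous_map_eq)
  then show ?thesis
    by (rule continuous_compose_quotient_map [OF q])
qed

text \<open>A continuous function without zeros has the same sign at both ends of a path.\<close>

lemma coboundary_point_sign:
  assumes h: "continuous_map X euclideanreal h" "\<And>x. x \<in> topspace X \<Longrightarrow> h x \<noteq> 0"
  shows "coboundary X (point_cochain X (\<lambda>x. if h x > 0 then 1 else 0)) = 0"
proof (intro ext)
  let ?e = "\<lambda>x. if h x > 0 then 1 else 0 :: bit"
  fix k \<sigma>
  show "coboundary X (point_cochain X ?e) k \<sigma> = 0 k \<sigma>"
  proof (cases "k = 1 \<and> singular_simplex k X \<sigma>")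
    case True
    then have k: "k = 1" by (rule conjunct1)
    have \<sigma>: "singular_simplex 1 X \<sigma>" using True [THEN conjunct2] unfolding k .
    have c: "continuous_map (subtopology (powertop_real UNIV) (standard_simplex 1)) X \<sigma>"
      using \<sigma> by (simp add: singular_simplex_def)
    have "connectedin (subtopology (powertop_real UNIV) (standard_simplex 1)) (standard_simplex 1)"
      using connectedin_standard_simplex by (simp add: connectedin_subtopology)
    from connectedin_continuous_map_image [OF continuous_map_compose [OF c h(1)] this]
    have conn: "connected ((h \<circ> \<sigma>) ` standard_simplex 1)" by simp
    have nz: "h (\<sigma> v) \<noteq> 0" if "v \<in> standard_simplex 1" for v
      using h(2) continuous_map_funspace [OF c] that by auto
    have same: "h (\<sigma> v) > 0 \<longleftrightarrow> h (\<sigma> w) > 0" if v: "v \<in> standard_simplex 1" and w: "w \<in> standard_simplex 1" for v w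
    proof (rule ccontr)
      assume "\<not> ?thesis"
      then have "min (h (\<sigma> v)) (h (\<sigma> w)) \<le> 0 \<and> 0 \<le> max (h (\<sigma> v)) (h (\<sigma> w))" by linarith
      moreover have "min (h (\<sigma> v)) (h (\<sigma> w)) \<in> (h \<circ> \<sigma>) ` standard_simplex 1"
        "max (h (\<sigma> v)) (h (\<sigma> w)) \<in> (h \<circ> \<sigma>) ` standard_simplex 1"
        using v w by (auto simp: min_def max_def)
      ultimately have "0 \<in> (h \<circ> \<sigma>) ` standard_simplex 1"
        using conn connectedD_interval by blast
      then show False using nz by force
    qed
    have face: "point_cochain X ?e 0 (singular_face 1 i \<sigma>) = ?e (\<sigma> (\<lambda>j. if j = 0 then 1 else 0))" if "i \<le> 1" for i
    proof -
      have "singular_simplex 0 X (singular_face 1 i \<sigma>)"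
        using singular_simplex_singular_face [OF \<sigma> _ that] by simp
      moreover have "simplical_face i (\<lambda>j. if j = 0 then 1 else 0) \<in> standard_simplex 1"
        using that by (intro simplical_face_in_standard_simplex) auto
      then have "?e (\<sigma> (simplical_face i (\<lambda>j. if j = 0 then 1 else 0))) = ?e (\<sigma> (\<lambda>j. if j = 0 then 1 else 0))"
        using same [of "simplical_face i (\<lambda>j. if j = 0 then 1 else 0)" "\<lambda>j. if j = 0 then 1 else 0"] by simp
      ultimately show ?thesis
        by (simp add: point_cochain_def singular_face_def)
    qed
    have "coboundary X (point_cochain X ?e) 1 \<sigma> = (\<Sum>i\<le>1. point_cochain X ?e 0 (singular_face 1 i \<sigma>))"
      using \<sigma> by (simp add: coboundary_def)
    also have "\<dots> = (\<Sum>i\<le>(1::nat). ?e (\<sigma> (\<lambda>j. if j = 0 then 1 else 0)))"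
      by (intro sum.cong refl face) simp
    also have "\<dots> = 0" by simp
    finally show ?thesis unfolding k by simp
  next
    case False
    have "coboundary X (point_cochain X ?e) k \<sigma> = 0"
    proof (cases "k \<noteq> 0 \<and> singular_simplex k X \<sigma>")
      case True
      then have "k - 1 \<noteq> 0" using False by linarith
      then show ?thesis by (simp add: coboundary_def point_cochain_def)
    next
      case False
      then show ?thesis unfolding coboundary_def by (rule if_not_P)
    qed
    then show ?thesis by simp
  qed
qed

text \<open>Where h is not zero, e may be replaced by the sign of h, since both change under the
  same generators; and the coboundary of that sign is zero.\<close>

lemma sign_class_vanishes_on:
  assumes G: "acts_on Y G" and h: "continuous_map Y euclideanreal h"
    and e: "\<And>g. g \<in> G \<Longrightarrow> (\<forall>y\<in>topspace Y. h (g y) = h y \<and> e (g y) = e y) \<or>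
      (\<forall>y\<in>topspace Y. h (g y) = - h y \<and> e (g y) = e y + 1)"
  shows "vanishes_on Y G {y \<in> topspace Y. h y \<noteq> 0} (sign_class Y G e)"
proof -
  let ?U = "{y \<in> topspace Y. h y \<noteq> 0}" and ?e = "\<lambda>y. if h y > 0 then 1 else 0 :: bit"
  have gY: "g y \<in> topspace Y" if "g \<in> G" "y \<in> topspace Y" for g y
    using G that continuous_map_funspace [of Y Y g] by (auto simp: acts_on_def)
  have "openin Y {y \<in> topspace Y. h y \<in> - {0}}"
    by (rule openin_continuous_map_preimage [OF h]) (simp add: open_Compl)
  then have U: "openin Y ?U" by simp
  have hg: "h (g y) \<noteq> 0 \<longleftrightarrow> h y \<noteq> 0" if "g \<in> G" "y \<in> topspace Y" for g y
    using e [OF that(1)] that(2) by auto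
  then have st: "stable_set Y G ?U"
    using gY by (auto simp: stable_set_def)
  have GU: "acts_on (subtopology Y ?U) G" by (rule acts_on_subtopology [OF G st])
  have sf: "sign_function Y G e"
    unfolding sign_function_def
  proof
    fix g assume "g \<in> G"
    from e [OF this] show "\<exists>b. \<forall>x\<in>topspace Y. e (g x) = e x + b"
      by (elim disjE) (rule exI [of _ 0], simp, rule exI [of _ 1], simp)
  qed
  have "inv_pullback (subtopology Y ?U) G (\<lambda>x. x) (sign_class Y G e) = sign_class (subtopology Y ?U) G e"
    by (rule sign_class_pullback [OF equivariant_map_inclusion_UNIV GU])
  also have "\<dots> = sign_class (subtopology Y ?U) G ?e"
  proof (rule sign_class_cong [OF GU])
    fix g y assume g: "g \<in> G" and "y \<in> topspace (subtopology Y ?U)"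
    then have y: "y \<in> topspace Y" "h y \<noteq> 0" by auto
    from e [OF g] y(1) have "h (g y) = h y \<and> e (g y) = e y \<or> h (g y) = - h y \<and> e (g y) = e y + 1" by blast
    then show "e (g y) + ?e (g y) = e y + ?e y"
      using y(2) by (auto simp: add.assoc)
  qed
  also have "\<dots> = \<zero>\<^bsub>inv_cohomology_ring (subtopology Y ?U) G\<^esub>"
    unfolding sign_class_def inv_cohomology_zero
    by (subst coboundary_point_sign) (auto intro: continuous_map_from_subtopology [OF h])
  finally show ?thesis
    using U st sign_class_closed [OF G sf] by (simp add: vanishes_on_def)
qed


lemma sign_function_vector_sign:
  assumes \<zeta>: "continuous_map Y (punctured m) \<zeta>"
    and sym: "(\<forall>y\<in>topspace Y. \<zeta> (g y) = \<zeta> y) \<or> (\<forall>y\<in>topspace Y. \<zeta> (g y) = vector_neg (\<zeta> y))"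
  shows "(\<forall>y\<in>topspace Y. \<zeta> (g y) = \<zeta> y \<and> vector_sign (\<zeta> (g y)) = vector_sign (\<zeta> y)) \<or>
    (\<forall>y\<in>topspace Y. \<zeta> (g y) = vector_neg (\<zeta> y) \<and> vector_sign (\<zeta> (g y)) = vector_sign (\<zeta> y) + 1)"
  using sym
proof
  assume *: "\<forall>y\<in>topspace Y. \<zeta> (g y) = vector_neg (\<zeta> y)"
  have "vector_sign (\<zeta> (g y)) = vector_sign (\<zeta> y) + 1" if "y \<in> topspace Y" for y
  proof -
    have "\<zeta> y \<noteq> (\<lambda>_. 0)"
      using continuous_map_funspace [OF \<zeta>] that by (auto simp: topspace_punctured)
    then show ?thesis unfolding bspec [OF * that] by (rule vector_sign_neg)
  qed
  then show ?thesis using * by blast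
next
  assume "\<forall>y\<in>topspace Y. \<zeta> (g y) = \<zeta> y"
  then show ?thesis by simp
qed

text \<open>The set in question is where the section given by \<phi>, taken along Y, is not the zero
  vector. There \<open>regular_bundle_relation\<close> applies. By oddness the section changes sign
  under the same generators as \<zeta>, so its orientation and the sign of \<zeta> define the same
  class; the latter is defined on all of Y.\<close>

lemma relation_vanishes_on:
  fixes X :: "'a topology" and Y :: "'b topology" and \<phi> :: "(nat \<Rightarrow> real) \<Rightarrow> 'a set \<Rightarrow> 'a \<Rightarrow> real"
  assumes X: "Hausdorff_space X" and sw: "stiefel_whitney_classes n (regular_bundle X n) w"
    and G: "acts_on Y G" and \<beta>: "equivariant_map Y G (configuration_space X n) {} \<beta>"
    and \<zeta>: "continuous_map Y (punctured m) \<zeta>"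
    and sym: "\<And>g. g \<in> G \<Longrightarrow> (\<forall>y\<in>topspace Y. \<zeta> (g y) = \<zeta> y) \<or> (\<forall>y\<in>topspace Y. \<zeta> (g y) = vector_neg (\<zeta> y))"
    and \<phi>: "\<And>i. i < n \<Longrightarrow> continuous_map (prod_topology (ordered_configurations X n) (punctured m)) euclideanreal
      (\<lambda>(x, z). \<phi> z (x ` {..<n}) (x i))"
    and odd: "\<And>z S p. \<phi> (vector_neg z) S p = - \<phi> z S p"
  shows "vanishes_on Y G {y \<in> topspace Y. \<exists>p\<in>\<beta> y. \<phi> (\<zeta> y) (\<beta> y) p \<noteq> 0}
    (component (inv_cohomology_ring Y G)
      (\<Sum>k\<le>n. embed_component (inv_cohomology_ring Y G) (inv_pullback Y G \<beta> (w k)) *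
        embed_component (inv_cohomology_ring Y G) (sign_class Y G (\<lambda>y. vector_sign (\<zeta> y))) ^ (n - k)))"
proof -
  let ?B = "configuration_space X n" and ?K = "inv_cohomology_ring Y G" and ?e = "\<lambda>y. vector_sign (\<zeta> y)"
  define U where "U = {y \<in> topspace Y. \<exists>p\<in>\<beta> y. \<phi> (\<zeta> y) (\<beta> y) p \<noteq> 0}"
  define F where "F y = section_of \<phi> (\<beta> y) (\<zeta> y)" for y
  have \<beta>c: "continuous_map Y ?B \<beta>" using \<beta> by (simp add: equivariant_map_def)
  have \<beta>g: "\<beta> (g y) = \<beta> y" if "g \<in> G" "y \<in> topspace Y" for g y
    using \<beta> that by (auto simp: equivariant_map_def)
  have fstF: "fst (F y) = \<beta> y" for y by (simp add: F_def section_of_def)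
  have "continuous_map Y (prod_topology ?B (punctured m)) (\<lambda>y. (\<beta> y, \<zeta> y))"
    using \<beta>c \<zeta> by (simp add: continuous_map_pairwise comp_def)
  from continuous_map_compose [OF this continuous_map_section_of [OF \<phi>]]
  have Fc: "continuous_map Y (bundle_space X n) F"
    by (simp add: comp_def F_def [abs_def])
  have Fg: "F (g y) = F y \<and> ?e (g y) = ?e y \<or> F (g y) = fscale (- 1) (F y) \<and> ?e (g y) = ?e y + 1"
    if "g \<in> G" "y \<in> topspace Y" for g y
    using sign_function_vector_sign [OF \<zeta> sym [OF that(1)]]
  proof
    assume "\<forall>y\<in>topspace Y. \<zeta> (g y) = \<zeta> y \<and> ?e (g y) = ?e y"
    then have "\<zeta> (g y) = \<zeta> y" using that(2) by blast
    then show ?thesis by (simp add: F_def \<beta>g that)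
  next
    assume "\<forall>y\<in>topspace Y. \<zeta> (g y) = vector_neg (\<zeta> y) \<and> ?e (g y) = ?e y + 1"
    then have *: "\<zeta> (g y) = vector_neg (\<zeta> y)" "?e (g y) = ?e y + 1" using that(2) by blast+
    have "F (g y) = fscale (- 1) (F y)"
      unfolding F_def section_of_def fscale_def \<beta>g [OF that] *(1) by (auto simp: odd intro!: restrict_ext)
    with *(2) show ?thesis by blast
  qed
  have "y \<in> U \<longleftrightarrow> F y \<in> topspace (nonzero_space X n)" if y: "y \<in> topspace Y" for y
  proof -
    have "F y \<in> topspace (bundle_space X n)" using continuous_map_funspace [OF Fc] y by blast
    then show ?thesis using y by (auto simp: topspace_nonzero_space U_def F_def section_of_def)
  qed
  then have UF: "U = {y \<in> topspace Y. F y \<in> topspace (nonzero_space X n)}" by (auto simp: U_def)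
  have norm_iff: "fiber_norm e \<noteq> 0 \<longleftrightarrow> e \<in> topspace (nonzero_space X n)" if "e \<in> topspace (bundle_space X n)" for e
  proof
    assume "fiber_norm e \<noteq> 0"
    then have "\<exists>p\<in>fst e. snd e p \<noteq> 0" by (rule contrapos_np) (simp add: fiber_norm_def)
    then show "e \<in> topspace (nonzero_space X n)" using that by (simp add: topspace_nonzero_space)
  next
    assume "e \<in> topspace (nonzero_space X n)"
    from fiber_norm_pos [OF this] show "fiber_norm e \<noteq> 0" by linarith
  qed
  have "openin Y {y \<in> topspace Y. (fiber_norm \<circ> F) y \<in> - {0}}"
    by (rule openin_continuous_map_preimage [OF continuous_map_compose [OF Fc continuous_map_fiber_norm]]) (simp add: open_Compl)
  moreover have "{y \<in> topspace Y. (fiber_norm \<circ> F) y \<in> - {0}} = U"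
  proof -
    have "fiber_norm (F y) \<noteq> 0 \<longleftrightarrow> F y \<in> topspace (nonzero_space X n)" if "y \<in> topspace Y" for y
      by (rule norm_iff) (use continuous_map_funspace [OF Fc] that in blast)
    then show ?thesis unfolding UF by (auto simp del: split_paired_All)
  qed
  ultimately have Uo: "openin Y U" by simp
  have gY: "g y \<in> topspace Y" if "g \<in> G" "y \<in> topspace Y" for g y
    using G that continuous_map_funspace [of Y Y g] by (auto simp: acts_on_def)
  have st: "stable_set Y G U"
    unfolding stable_set_def
  proof (intro ballI)
    fix g y assume g: "g \<in> G" and y: "y \<in> topspace Y"
    have FE: "F y \<in> topspace (bundle_space X n)" "F (g y) \<in> topspace (bundle_space X n)"
      using continuous_map_funspace [OF Fc] y gY [OF g y] by blast+
    have "fiber_norm (F (g y)) = fiber_norm (F y)"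
      using Fg [OF g y] by (auto simp: fiber_norm_fscale)
    then have "F (g y) \<in> topspace (nonzero_space X n) \<longleftrightarrow> F y \<in> topspace (nonzero_space X n)"
      unfolding norm_iff [OF FE(1), symmetric] norm_iff [OF FE(2), symmetric] by (rule arg_cong)
    then show "g y \<in> U \<longleftrightarrow> y \<in> U"
      unfolding UF mem_Collect_eq using y gY [OF g y] by blast
  qed
  let ?YU = "subtopology Y U"
  let ?L = "inv_cohomology_ring ?YU G"
  have GU: "acts_on ?YU G" by (rule acts_on_subtopology [OF G st])
  have topU: "topspace ?YU = U" using openin_subset [OF Uo] by auto
  have UY: "y \<in> topspace Y" "F y \<in> topspace (nonzero_space X n)" if "y \<in> topspace ?YU" for y
    using that unfolding topU UF by simp_all
  have FU: "continuous_map ?YU (nonzero_space X n) F"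
    unfolding continuous_map_into_nonzero_space using continuous_map_from_subtopology [OF Fc] UY(2) by blast
  obtain s where s: "s \<in> line_sections X n" using line_sections_nonempty by blast
  have gU: "g y \<in> topspace ?YU" if "g \<in> G" "y \<in> topspace ?YU" for g y
    using GU that continuous_map_funspace [of ?YU ?YU g] by (auto simp: acts_on_def)
  have ray: "ray_line (F (g y)) = ray_line (F y)" if g: "g \<in> G" and y: "y \<in> topspace ?YU" for g y
  proof (rule ray_line_eqI(1) [OF UY(2) [OF y] UY(2) [OF gU [OF g y]]])
    show "F (g y) \<in> ray_line (F y)"
      using Fg [OF g UY(1) [OF y]] mem_ray_line [OF UY(2) [OF y]] by auto
  qed
  have rel: "component ?L (\<Sum>k\<le>n. embed_component ?L (inv_pullback ?YU G (\<lambda>y. fst (F y)) (w k)) *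
      embed_component ?L (sign_class ?YU G (\<lambda>y. section_sign s (F y))) ^ (n - k)) = \<zero>\<^bsub>?L\<^esub>"
    by (rule regular_bundle_relation [OF X sw s GU FU]) (rule ray)
  have sc: "sign_class ?YU G (\<lambda>y. section_sign s (F y)) = sign_class ?YU G ?e"
  proof (rule sign_class_cong [OF GU])
    fix g y assume g: "g \<in> G" and y: "y \<in> topspace ?YU"
    from Fg [OF g UY(1) [OF y]]
    show "section_sign s (F (g y)) + ?e (g y) = section_sign s (F y) + ?e y"
    proof
      assume *: "F (g y) = fscale (- 1) (F y) \<and> ?e (g y) = ?e y + 1"
      have "section_sign s (F (g y)) = section_sign s (F y) \<longleftrightarrow> (- 1 :: real) > 0"
        by (rule section_sign_scale [OF s UY(2) [OF y] UY(2) [OF gU [OF g y]] ray [OF g y] conjunct1 [OF *]])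
      then have "section_sign s (F (g y)) = section_sign s (F y) + 1"
        by (cases "section_sign s (F (g y))"; cases "section_sign s (F y)") auto
      then show ?thesis using * by (simp add: add_ac)
    qed simp
  qed
  have sf: "sign_function Y G ?e"
    unfolding sign_function_def
  proof
    fix g assume "g \<in> G"
    from sign_function_vector_sign [OF \<zeta> sym [OF this]] show "\<exists>b. \<forall>y\<in>topspace Y. ?e (g y) = ?e y + b"
    proof
      assume "\<forall>y\<in>topspace Y. \<zeta> (g y) = vector_neg (\<zeta> y) \<and> ?e (g y) = ?e y + 1"
      then show ?thesis by blast
    next
      assume "\<forall>y\<in>topspace Y. \<zeta> (g y) = \<zeta> y \<and> ?e (g y) = ?e y"
      then have "\<forall>y\<in>topspace Y. ?e (g y) = ?e y + 0" by simp
      then show ?thesis by (rule exI)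
    qed
  qed
  have cK: "cring2 ?K" and cL: "cring2 ?L" by (rule cring2_inv_cohomology_ring [OF G], rule cring2_inv_cohomology_ring [OF GU])
  note i = equivariant_map_inclusion_UNIV [of Y U G]
  have hom: "inv_pullback ?YU G (\<lambda>x. x) \<in> ring_hom ?K ?L" by (rule inv_pullback_hom [OF i GU G])
  have wB: "w k \<in> carrier (inv_cohomology_ring ?B {})" for k
    using stiefel_whitney_closed [OF sw, of k] by (simp add: regular_bundle_simps)
  have p: "inv_pullback Y G \<beta> (w k) \<in> carrier ?K" for k
    by (rule inv_pullback_closed [OF \<beta> G _ wB]) simp
  have t: "sign_class Y G ?e \<in> carrier ?K" by (rule sign_class_closed [OF G sf])
  have ip: "inv_pullback ?YU G (\<lambda>x. x) (inv_pullback Y G \<beta> (w k)) = inv_pullback ?YU G (\<lambda>y. fst (F y)) (w k)" for k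
    using inv_pullback_compose [OF i \<beta> GU G wB] by (simp add: comp_def fstF)
  have it: "inv_pullback ?YU G (\<lambda>x. x) (sign_class Y G ?e) = sign_class ?YU G (\<lambda>y. section_sign s (F y))"
    unfolding sc by (rule sign_class_pullback [OF i GU])
  let ?A = "\<Sum>k\<le>n. embed_component ?K (inv_pullback Y G \<beta> (w k)) * embed_component ?K (sign_class Y G ?e) ^ (n - k)"
  have "matches (inv_pullback ?YU G (\<lambda>x. x)) ?K ?L ?A
      (\<Sum>k\<le>n. embed_component ?L (inv_pullback ?YU G (\<lambda>x. x) (inv_pullback Y G \<beta> (w k))) *
        embed_component ?L (inv_pullback ?YU G (\<lambda>x. x) (sign_class Y G ?e)) ^ (n - k))"
    by (intro matches_sum [OF cK cL hom] matches_mult [OF cK cL hom] matches_pow [OF cK cL hom]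
        matches_embed [OF cK cL hom p] matches_embed [OF cK cL hom t])
  then have "inv_pullback ?YU G (\<lambda>x. x) (component ?K ?A) = \<zero>\<^bsub>?L\<^esub>"
    unfolding matches_def ip it rel .
  then show ?thesis
    unfolding vanishes_on_def U_def [symmetric] using Uo st component_closed [OF cK] by blast
qed

section \<open>Continuity of the chords in the configuration\<close>

lemma continuous_map_continuous_on:
  assumes "continuous_map Z euclidean f" "continuous_on UNIV g"
  shows "continuous_map Z euclidean (\<lambda>z. g (f z))"
  using continuous_map_compose [of Z euclidean f euclidean g] assms by (simp add: comp_def)

lemma continuous_map_configuration_point:
  assumes "i < n"
  shows "continuous_map (ordered_configurations X n) X (\<lambda>x. x i)"
  unfolding ordered_configurations_def using assms
  by (intro continuous_map_from_subtopology continuous_map_product_projection) simp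

lemma ordered_configurations_inj: "x \<in> topspace (ordered_configurations X n) \<Longrightarrow> inj_on x {..<n}"
  by (simp add: ordered_configurations_def)

lemma continuous_map_spread:
  "continuous_map (ordered_configurations plane n) euclideanreal (\<lambda>x. spread (x ` {..<n}))"
proof -
  let ?F = "ordered_configurations plane n"
  have "continuous_map ?F euclideanreal (\<lambda>x. inverse (dist (x i) (x j)))" if ij: "i < n" "j < n" for i j
  proof (cases "i = j")
    case False
    have "continuous_map ?F euclideanreal (\<lambda>x. norm (x i - x j))"
      using ij by (intro continuous_intros continuous_map_configuration_point)
    moreover have "norm (x i - x j) \<noteq> 0" if "x \<in> topspace ?F" for x
      using ordered_configurations_inj [OF that] ij False by (auto simp: inj_on_eq_iff)
    ultimately show ?thesis
      unfolding dist_norm by (intro continuous_map_real_inverse)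
  qed simp
  then have "continuous_map ?F euclideanreal (\<lambda>x. 1 + (\<Sum>i<n. \<Sum>j<n. inverse (dist (x i) (x j))))"
    by (intro continuous_map_add continuous_map_sum) auto
  then show ?thesis
  proof (rule continuous_map_eq)
    fix x assume "x \<in> topspace ?F"
    then have "inj_on x {..<n}" by (rule ordered_configurations_inj)
    then show "1 + (\<Sum>i<n. \<Sum>j<n. inverse (dist (x i) (x j))) = spread (x ` {..<n})"
      by (simp add: spread_def sum.reindex)
  qed
qed

lemma continuous_map_chord_rate:
  "continuous_map (ordered_configurations plane n) euclideanreal (\<lambda>x. chord_rate (x ` {..<n}))"
proof (rule continuous_map_eq)
  show "continuous_map (ordered_configurations plane n) euclideanreal (\<lambda>x. 2 * real n * spread (x ` {..<n}))"
    by (intro continuous_map_real_mult_left continuous_map_spread)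
  fix x assume "x \<in> topspace (ordered_configurations plane n)"
  then have "inj_on x {..<n}" by (rule ordered_configurations_inj)
  then show "2 * real n * spread (x ` {..<n}) = chord_rate (x ` {..<n})"
    by (simp add: chord_rate_def card_image)
qed

lemma continuous_map_configuration_coordinate:
  assumes "i < n"
  shows "continuous_map (ordered_configurations plane n) euclideanreal (\<lambda>x. x i $ k)"
  by (rule continuous_map_continuous_on [OF continuous_map_configuration_point [OF assms] linear_continuous_on [OF bounded_linear_vec_nth]])

lemma continuous_map_exp:
  "continuous_map Z euclideanreal f \<Longrightarrow> continuous_map Z euclideanreal (\<lambda>z. exp (f z))"
  by (rule continuous_map_continuous_on [where g = exp]) (auto intro: continuous_intros)

lemma continuous_map_chord_slope:
  "continuous_map (ordered_configurations plane n) euclideanreal (\<lambda>x. chord_slope (x ` {..<n}))"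
proof (rule continuous_map_eq)
  let ?F = "ordered_configurations plane n"
  show "continuous_map ?F euclideanreal (\<lambda>x. 4 * spread (x ` {..<n}) * (1 + (\<Sum>i<n. exp (chord_rate (x ` {..<n}) * x i $ 2))))"
    by (intro continuous_map_real_mult continuous_map_add continuous_map_sum continuous_map_exp continuous_map_spread
        continuous_map_chord_rate continuous_map_configuration_coordinate) auto
  fix x assume "x \<in> topspace ?F"
  then have "inj_on x {..<n}" by (rule ordered_configurations_inj)
  then show "4 * spread (x ` {..<n}) * (1 + (\<Sum>i<n. exp (chord_rate (x ` {..<n}) * x i $ 2))) = chord_slope (x ` {..<n})"
    by (simp add: chord_slope_def sum.reindex)
qed

text \<open>The difference between the two ends of the chord of p of the function with coefficient
  vector u. It vanishes for all p in S exactly if this function respects the chords, i.e. if u is in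
  the kernel of the map to the fibre over S.\<close>

definition chord_section :: "nat \<Rightarrow> (nat \<Rightarrow> real \<Rightarrow> real) \<Rightarrow> (nat \<Rightarrow> real) \<Rightarrow> (real^2) set \<Rightarrow> real^2 \<Rightarrow> real" where
  "chord_section N f u S p = (\<Sum>j<N. u j * (f j (chord_right S p) - f j (chord_left p)))"

lemma continuous_map_chord_section:
  assumes f: "\<And>j. j < N \<Longrightarrow> continuous_on UNIV (f j)" and i: "i < n"
  shows "continuous_map (prod_topology (ordered_configurations plane n) (punctured m)) euclideanreal
    (\<lambda>(x, u). chord_section N f u (x ` {..<n}) (x i))"
proof -
  let ?F = "ordered_configurations plane n"
  let ?D = "prod_topology ?F (punctured m)"
  have r: "continuous_map ?F euclideanreal (\<lambda>x. chord_right (x ` {..<n}) (x i))"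
    unfolding chord_right_def
    by (intro continuous_map_real_mult continuous_map_add continuous_map_exp continuous_map_chord_slope
        continuous_map_chord_rate continuous_map_configuration_coordinate i)
  have l: "continuous_map ?F euclideanreal (\<lambda>x. chord_left (x i))"
    unfolding chord_left_def
    by (intro continuous_map_minus continuous_map_exp continuous_map_configuration_coordinate i)
  have "continuous_map ?D euclideanreal (\<lambda>w. f j (chord_right (fst w ` {..<n}) (fst w i)) - f j (chord_left (fst w i)))" if "j < N" for j
  proof -
    have "continuous_map ?F euclideanreal (\<lambda>x. f j (chord_right (x ` {..<n}) (x i)) - f j (chord_left (x i)))"
      by (intro continuous_map_diff continuous_map_continuous_on [OF r f [OF that]] continuous_map_continuous_on [OF l f [OF that]])
    from continuous_map_compose [OF continuous_map_fst this] show ?thesis by (simp add: comp_def)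
  qed
  moreover have "continuous_map ?D euclideanreal (\<lambda>w. snd w j)" for j
    using continuous_map_compose [OF continuous_map_snd continuous_map_punctured_component [of m j]] by (simp add: comp_def)
  ultimately show ?thesis
    unfolding chord_section_def split_def by (intro continuous_map_sum continuous_map_real_mult) auto
qed

section \<open>Squares of the Stiefel--Whitney classes\<close>

definition planar_complex :: "real^2 \<Rightarrow> complex" where
  "planar_complex p = Complex (p $ 1) (p $ 2)"

text \<open>Consecutive pairs of coordinates are the real and imaginary parts of the coefficients,
  so 2 n real coordinates describe the complex polynomials of degree less than n. Negating the
  vector negates the value.\<close>

definition polynomial_value :: "nat \<Rightarrow> (nat \<Rightarrow> real) \<Rightarrow> real^2 \<Rightarrow> complex" where
  "polynomial_value n v p = (\<Sum>j<n. Complex (v (2 * j)) (v (2 * j + 1)) * planar_complex p ^ j)"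

lemma polynomial_value_nonzero:
  assumes v: "v \<noteq> (\<lambda>_. 0)" "\<And>i. i \<ge> 2 * n \<Longrightarrow> v i = 0" and S: "finite S" "card S = n"
  shows "\<exists>p\<in>S. polynomial_value n v p \<noteq> 0"
proof (rule ccontr)
  assume no: "\<not> ?thesis"
  obtain i where i: "v i \<noteq> 0" using v(1) by auto
  then have "i < 2 * n" using v(2) not_le by blast
  then have "i div 2 < n" by auto
  then obtain m where n: "n = Suc m" by (cases n) auto
  let ?c = "\<lambda>j. Complex (v (2 * j)) (v (2 * j + 1))"
  have "i = 2 * (i div 2) \<or> i = 2 * (i div 2) + 1" by presburger
  then have "?c (i div 2) \<noteq> 0" using i by (auto simp: complex_eq_iff)
  then have fin: "finite {z. (\<Sum>j\<le>m. ?c j * z ^ j) = 0}" and card: "card {z. (\<Sum>j\<le>m. ?c j * z ^ j) = 0} \<le> m"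
    using polyfun_rootbound [of ?c "i div 2" m] \<open>i div 2 < n\<close> n by auto
  have "planar_complex ` S \<subseteq> {z. (\<Sum>j\<le>m. ?c j * z ^ j) = 0}"
    using no by (auto simp: polynomial_value_def n lessThan_Suc_atMost)
  from card_mono [OF fin this] card have "card (planar_complex ` S) \<le> m" by (rule order_trans)
  moreover have "inj_on planar_complex S"
    by (intro inj_onI) (simp add: planar_complex_def vec_eq_iff forall_2)
  then have "card (planar_complex ` S) = n" using S(2) by (simp add: card_image)
  ultimately show False using n by simp
qed

text \<open>\<open>part\<close> is to be the real or the imaginary part. Real linearity expresses
  the value through the real coordinates of the vector and continuous functions of the
  point.\<close>

lemma continuous_map_polynomial_value:
  assumes i: "i < n" and part: "continuous_on UNIV part" "\<And>x y. part (x + y) = part x + part y" "\<And>a x. part (of_real a * x) = a * part x"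
  shows "continuous_map (prod_topology (ordered_configurations plane n) (punctured m)) euclideanreal
    (\<lambda>(x, v). part (polynomial_value n v (x i)))"
proof -
  let ?F = "ordered_configurations plane n"
  let ?D = "prod_topology ?F (punctured m)"
  have part0: "part 0 = 0" using part(2) [of 0 0] by simp
  have split: "part (polynomial_value n v p) = (\<Sum>j<n. v (2 * j) * part (planar_complex p ^ j) + v (2 * j + 1) * part (\<i> * planar_complex p ^ j))" for v p
  proof -
    have "part (sum h A) = (\<Sum>j\<in>A. part (h j))" if "finite A" for h and A :: "nat set"
      using that by (induction A) (simp_all add: part0 part(2))
    moreover have "part (Complex a b * z) = a * part z + b * part (\<i> * z)" for a b z
      by (simp add: complex_eq_cancel_iff2 Complex_eq distrib_right part mult.assoc mult.left_commute [of \<i>])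
    ultimately show ?thesis by (simp add: polynomial_value_def)
  qed
  have pc: "continuous_on UNIV planar_complex"
    unfolding planar_complex_def Complex_eq
    by (intro continuous_intros linear_continuous_on [OF bounded_linear_vec_nth])
  have comp: "continuous_map ?D euclideanreal (\<lambda>w. part (c * planar_complex (fst w i) ^ j))" for c j
  proof -
    have "continuous_on UNIV (\<lambda>p. part (c * planar_complex p ^ j))"
      by (rule continuous_on_compose2 [OF part(1)]) (intro continuous_intros pc, simp)
    from continuous_map_compose [OF continuous_map_fst continuous_map_continuous_on [OF continuous_map_configuration_point [OF i] this]]
    show ?thesis by (simp add: comp_def)
  qed
  have snd: "continuous_map ?D euclideanreal (\<lambda>w. snd w j)" for j
    using continuous_map_compose [OF continuous_map_snd continuous_map_punctured_component [of m j]] by (simp add: comp_def)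
  show ?thesis
    unfolding split split_def using comp [of 1] comp [of \<i>] snd
    by (intro continuous_map_sum continuous_map_add continuous_map_real_mult) auto
qed

text \<open>The m sets on which a given coordinate of \<zeta> is not zero cover Y, and the class
  vanishes on each of them.\<close>

lemma sign_class_power_zero:
  assumes G: "acts_on Y G" and \<zeta>: "continuous_map Y (punctured m) \<zeta>" and "m > 0"
    and sym: "\<And>g. g \<in> G \<Longrightarrow> (\<forall>y\<in>topspace Y. \<zeta> (g y) = \<zeta> y) \<or> (\<forall>y\<in>topspace Y. \<zeta> (g y) = vector_neg (\<zeta> y))"
  shows "embed_component (inv_cohomology_ring Y G) (sign_class Y G (\<lambda>y. vector_sign (\<zeta> y))) ^ m = 0"
proof -
  let ?K = "inv_cohomology_ring Y G" and ?t = "sign_class Y G (\<lambda>y. vector_sign (\<zeta> y))"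
  have cK: "cring2 ?K" by (rule cring2_inv_cohomology_ring [OF G])
  have "vanishes_on Y G {y \<in> topspace Y. \<zeta> y j \<noteq> 0} ?t" for j
  proof (rule sign_class_vanishes_on [OF G])
    show "continuous_map Y euclideanreal (\<lambda>y. \<zeta> y j)"
      using continuous_map_compose [OF \<zeta> continuous_map_punctured_component] by (simp add: comp_def)
    fix g assume "g \<in> G"
    from sign_function_vector_sign [OF \<zeta> sym [OF this]]
    show "(\<forall>y\<in>topspace Y. \<zeta> (g y) j = \<zeta> y j \<and> vector_sign (\<zeta> (g y)) = vector_sign (\<zeta> y)) \<or>
      (\<forall>y\<in>topspace Y. \<zeta> (g y) j = - \<zeta> y j \<and> vector_sign (\<zeta> (g y)) = vector_sign (\<zeta> y) + 1)"
      by (rule disj_forward) (meson fun_cong)+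
  qed
  note van = this
  then have t: "?t \<in> carrier ?K" by (simp add: vanishes_on_def)
  have "vanishes_on Y G (\<Union>j\<in>{..<m}. {y \<in> topspace Y. \<zeta> y j \<noteq> 0}) (component ?K (\<Prod>j\<in>{..<m}. embed_component ?K ?t))"
    by (rule vanishes_on_prod [OF G]) (simp_all add: t cK van)
  moreover have "topspace Y \<subseteq> (\<Union>j\<in>{..<m}. {y \<in> topspace Y. \<zeta> y j \<noteq> 0})"
  proof
    fix y assume y: "y \<in> topspace Y"
    then have "\<zeta> y \<noteq> (\<lambda>_. 0)" "\<And>i. i \<ge> m \<Longrightarrow> \<zeta> y i = 0"
      using continuous_map_funspace [OF \<zeta>] by (auto simp: topspace_punctured)
    then obtain j where "\<zeta> y j \<noteq> 0" "j < m" by (meson ext not_le)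
    then show "y \<in> (\<Union>j\<in>{..<m}. {y \<in> topspace Y. \<zeta> y j \<noteq> 0})" using y by blast
  qed
  ultimately have "component ?K (embed_component ?K ?t ^ m) = \<zero>\<^bsub>?K\<^esub>"
    using vanishes_on_topspace [OF G] by simp
  then have "?t [^]\<^bsub>?K\<^esub> m = \<zero>\<^bsub>?K\<^esub>"
    by (simp add: component_pow cK t)
  then show ?thesis
    using embed_component_pow [OF cK t \<open>m > 0\<close>] embed_component_hom(1) [OF cK] by simp
qed

lemma sum_even_odd: "(\<Sum>j<2 * n. f j) = (\<Sum>i<n. f (2 * i) + f (2 * i + 1))" for f :: "nat \<Rightarrow> 'a :: comm_monoid_add"
  by (induction n) (simp_all add: add.assoc)

text \<open>In characteristic two the square of the relation contains only the even powers 2 (n - k)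
  of the line class t, with the squares of the classes w_k as coefficients. The vectors have 2 n
  real coordinates, so t ^ (2 n) = 0 removes exactly the term k = 0, and all remaining powers are
  independent over the cohomology of the configuration space.\<close>

lemma stiefel_whitney_square:
  assumes sw: "stiefel_whitney_classes n (regular_bundle plane n) w" and "k > 0"
  shows "w k \<otimes>\<^bsub>inv_cohomology_ring (configuration_space plane n) {}\<^esub> w k
    = \<zero>\<^bsub>inv_cohomology_ring (configuration_space plane n) {}\<^esub>"
proof -
  let ?X = "euclidean :: (real^2) topology"
  let ?B = "configuration_space ?X n"
  let ?H = "inv_cohomology_ring ?B {}"
  let ?Y = "line_space ?B (2 * n)" and ?G = "line_group {} :: ((real^2) set \<times> (nat \<Rightarrow> real) \<Rightarrow> (real^2) set \<times> (nat \<Rightarrow> real)) set"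
  let ?K = "inv_cohomology_ring ?Y ?G"
  have wB: "w k \<in> carrier ?H" for k
    using stiefel_whitney_closed [OF sw, of k] by (simp add: regular_bundle_simps)
  have cH: "cring2 ?H" by (rule cring2_inv_cohomology_ring) simp
  have G: "acts_on ?Y ?G" by (rule acts_on_line_group) simp
  have cK: "cring2 ?K" by (rule cring2_inv_cohomology_ring [OF G])
  interpret H: cring ?H by (rule cring2_D [OF cH])
  interpret K: cring ?K by (rule cring2_D [OF cK])
  have zeroB: "\<zero>\<^bsub>cohomology_ring (base_space (regular_bundle ?X n))\<^esub> = \<zero>\<^bsub>?H\<^esub>"
    by (simp add: regular_bundle_simps inv_cohomology_ring_empty)
  show ?thesis
  proof (cases "k \<le> n")
    case False
    then have "w k = \<zero>\<^bsub>?H\<^esub>"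
      using sw unfolding stiefel_whitney_classes_def zeroB by simp
    then show ?thesis by simp
  next
    case True
    then have n: "2 * n > 0" using \<open>k > 0\<close> by simp
    have \<beta>: "equivariant_map ?Y ?G ?B {} fst" by (rule equivariant_map_line_fst)
    have \<zeta>: "continuous_map ?Y (punctured (2 * n)) snd"
      unfolding line_space_def by (rule continuous_map_snd)
    have sym: "(\<forall>y\<in>topspace ?Y. snd (g y) = snd y) \<or> (\<forall>y\<in>topspace ?Y. snd (g y) = vector_neg (snd y))" if "g \<in> ?G" for g
      using that by (auto simp: line_group_def)
    let ?t = "line_class ?B {} (2 * n)"
    let ?p = "\<lambda>k. inv_pullback ?Y ?G fst (w k)"
    let ?T = "embed_component ?K ?t" and ?W = "\<lambda>k. embed_component ?K (?p k)"
    let ?P = "\<Sum>k\<le>n. ?W k * ?T ^ (n - k)"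
    \<comment> \<open>The real and the imaginary part of the polynomial are sections of the same
      bundle with the same sign change, so it is the same class that vanishes on both sets.\<close>
    have P: "vanishes_on ?Y ?G {y \<in> topspace ?Y. \<exists>p\<in>fst y. part (polynomial_value n (snd y) p) \<noteq> 0} (component ?K ?P)"
      if part: "continuous_on UNIV part" "\<And>x y. part (x + y) = part x + part y" "\<And>a x. part (of_real a * x) = a * part x"
      for part :: "complex \<Rightarrow> real"
      unfolding line_class_def
    proof (rule relation_vanishes_on [OF _ sw G \<beta> \<zeta> sym])
      show "continuous_map (prod_topology (ordered_configurations ?X n) (punctured (2 * n))) euclideanreal
          (\<lambda>(x, v). part (polynomial_value n v (x i)))" if "i < n" for i
        by (rule continuous_map_polynomial_value [OF that part])
      have neg: "part (- z) = - part z" for z using part(3) [of "- 1" z] by simp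
      have "polynomial_value n (vector_neg v) p = - polynomial_value n v p" for v p
        unfolding polynomial_value_def sum_negf [symmetric]
        by (intro sum.cong refl) (simp add: complex_eq_iff)
      then show "part (polynomial_value n (vector_neg v) p) = - part (polynomial_value n v p)" for v S p
        by (simp add: neg)
    qed simp_all
    have "component ?K ?P \<otimes>\<^bsub>?K\<^esub> component ?K ?P = \<zero>\<^bsub>?K\<^esub>"
    proof (rule vanishes_on_cover_mult [OF G P [of Re] P [of Im]])
      show "topspace ?Y \<subseteq> {y \<in> topspace ?Y. \<exists>p\<in>fst y. Re (polynomial_value n (snd y) p) \<noteq> 0} \<union>
        {y \<in> topspace ?Y. \<exists>p\<in>fst y. Im (polynomial_value n (snd y) p) \<noteq> 0}"
      proof
        fix y assume y: "y \<in> topspace ?Y"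
        then have v: "snd y \<noteq> (\<lambda>_. 0)" "\<And>i. i \<ge> 2 * n \<Longrightarrow> snd y i = 0" and B: "fst y \<in> topspace ?B"
          by (auto simp: topspace_line_space)
        obtain x where x: "x \<in> topspace (ordered_configurations ?X n)" "fst y = x ` {..<n}"
          using B topspace_configuration_space by metis
        then have "finite (fst y)" "card (fst y) = n"
          using ordered_configurations_inj [OF x(1)] by (simp_all add: card_image)
        then obtain p where "p \<in> fst y" "polynomial_value n (snd y) p \<noteq> 0"
          using polynomial_value_nonzero [OF v] by blast
        then show "y \<in> {y \<in> topspace ?Y. \<exists>p\<in>fst y. Re (polynomial_value n (snd y) p) \<noteq> 0} \<union>
          {y \<in> topspace ?Y. \<exists>p\<in>fst y. Im (polynomial_value n (snd y) p) \<noteq> 0}"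
          using y unfolding complex_eq_iff by auto
      qed
    qed (auto intro: continuous_intros)
    then have "component ?K (?P * ?P) = \<zero>\<^bsub>?K\<^esub>"
      by (simp add: component_simps cK)
    moreover have "?P * ?P = (\<Sum>j<2 * n. embed_component ?K (inv_pullback ?Y ?G fst
        (if even j then w (n - j div 2) \<otimes>\<^bsub>?H\<^esub> w (n - j div 2) else \<zero>\<^bsub>?H\<^esub>)) * ?T ^ j)"
    proof -
      have hom: "inv_pullback ?Y ?G fst \<in> ring_hom ?H ?K" by (rule inv_pullback_hom [OF \<beta> G]) simp
      have p: "?p k \<in> carrier ?K" for k by (rule inv_pullback_closed [OF \<beta> G _ wB]) simp
      have T: "?T ^ (2 * n) = 0"
        unfolding line_class_def by (rule sign_class_power_zero [OF G \<zeta> n sym])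
      have "?P * ?P = (\<Sum>k\<le>n. (?W k * ?T ^ (n - k)) * (?W k * ?T ^ (n - k)))"
        by (rule sum_square_char2) (rule ring_product_add_self)
      also have "\<dots> = (\<Sum>k\<le>n. ?W k * ?W k * ?T ^ (2 * (n - k)))"
        unfolding mult_2 power_add by (simp only: mult_ac)
      also have "\<dots> = (\<Sum>i\<le>n. ?W (n - i) * ?W (n - i) * ?T ^ (2 * i))"
        by (rule sum.reindex_bij_witness [of _ "\<lambda>i. n - i" "\<lambda>i. n - i"]) auto
      also have "\<dots> = (\<Sum>i<n. ?W (n - i) * ?W (n - i) * ?T ^ (2 * i))"
        using T by (simp add: lessThan_Suc_atMost [symmetric])
      also have "\<dots> = (\<Sum>j<2 * n. embed_component ?K (inv_pullback ?Y ?G fst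
          (if even j then w (n - j div 2) \<otimes>\<^bsub>?H\<^esub> w (n - j div 2) else \<zero>\<^bsub>?H\<^esub>)) * ?T ^ j)"
        unfolding sum_even_odd
        by (intro sum.cong refl)
          (simp add: ring_hom_mult [OF hom wB wB] embed_component_hom [OF cK] p inv_pullback_zero [OF \<beta> G])
      finally show ?thesis .
    qed
    ultimately have z: "component ?K (\<Sum>j<2 * n. embed_component ?K (inv_pullback ?Y ?G fst
        (if even j then w (n - j div 2) \<otimes>\<^bsub>?H\<^esub> w (n - j div 2) else \<zero>\<^bsub>?H\<^esub>)) * ?T ^ j) = \<zero>\<^bsub>?K\<^esub>"
      by argo
    have "(if even (2 * (n - k)) then w (n - 2 * (n - k) div 2) \<otimes>\<^bsub>?H\<^esub> w (n - 2 * (n - k) div 2) else \<zero>\<^bsub>?H\<^esub>) = \<zero>\<^bsub>?H\<^esub>"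
    proof (rule line_class_independent [OF _ _ z])
      show "acts_on ?B {}" by simp
      show "(if even j then w (n - j div 2) \<otimes>\<^bsub>?H\<^esub> w (n - j div 2) else \<zero>\<^bsub>?H\<^esub>) \<in> carrier ?H" for j
        using wB by simp
      show "2 * (n - k) < 2 * n" using \<open>k > 0\<close> True by simp
    qed
    then show ?thesis using True by simp
  qed
qed

section \<open>The main theorem\<close>

lemma sum_fun_apply: "(\<Sum>i\<in>A. g i) x = (\<Sum>i\<in>A. g i x)" for g :: "'i \<Rightarrow> 'b \<Rightarrow> 'c :: comm_monoid_add"
  by (induction A rule: infinite_finite_induct) (simp_all add: plus_fun_def zero_fun_def)

text \<open>Orthogonality makes the coefficient vectors independent: pairing a relation with one of
  them isolates its coefficient. Containment in the span of the finite set B matters because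
  \<open>dim\<close> is zero for spaces of infinite dimension.\<close>

lemma dim_ge_orthogonal:
  fixes N r :: nat
  assumes B: "func.independent B" "bij_betw f {..<N} B"
    and orth: "\<And>i k. \<lbrakk>i < r; k < r; i \<noteq> k\<rbrakk> \<Longrightarrow> (\<Sum>j<N. u i j * u k j) = 0"
    and nz: "\<And>i. i < r \<Longrightarrow> (\<Sum>j<N. u i j * u i j) \<noteq> 0"
    and V: "V \<subseteq> func.span B" "\<And>i. i < r \<Longrightarrow> (\<lambda>x. \<Sum>j<N. u i j * f j x) \<in> V"
  shows "r \<le> func.dim V"
proof -
  have fB: "inj_on f {..<N}" "B = f ` {..<N}" using B(2) by (simp_all add: bij_betw_def)
  then have fin: "finite B" by simp
  have coeff: "a j = 0" if a: "\<And>x. (\<Sum>j<N. a j * f j x) = 0" and j: "j < N" for a :: "nat \<Rightarrow> real" and j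
  proof -
    let ?inv = "inv_into {..<N} f"
    have "(\<Sum>v\<in>B. (\<lambda>x. a (?inv v) * v x)) = 0"
    proof
      fix x
      have "(\<Sum>v\<in>B. (\<lambda>x. a (?inv v) * v x)) x = (\<Sum>v\<in>f ` {..<N}. a (?inv v) * v x)"
        unfolding fB(2) sum_fun_apply ..
      also have "\<dots> = (\<Sum>j<N. a j * f j x)"
        unfolding sum.reindex [OF fB(1)] using fB(1) by (intro sum.cong) auto
      finally show "(\<Sum>v\<in>B. (\<lambda>x. a (?inv v) * v x)) x = 0 x" using a by simp
    qed
    then have "a (?inv (f j)) = 0"
      by (rule func.independentD [OF B(1) fin order_refl]) (use B(2) j in \<open>auto simp: bij_betw_def\<close>)
    then show ?thesis using B(2) j by (simp add: bij_betw_def)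
  qed
  define g where "g i = (\<lambda>x. \<Sum>j<N. u i j * f j x)" for i
  have inj: "inj_on g {..<r}"
  proof (rule inj_onI, rule ccontr)
    fix i k assume ik: "i \<in> {..<r}" "k \<in> {..<r}" "g i = g k" "i \<noteq> k"
    have "u i j - u k j = 0" if "j < N" for j
    proof (rule coeff [OF _ that])
      fix x
      have "g i x = g k x" using ik by simp
      then show "(\<Sum>j<N. (u i j - u k j) * f j x) = 0"
        by (simp add: g_def left_diff_distrib sum_subtractf)
    qed
    then have "(\<Sum>j<N. u i j * u k j) = (\<Sum>j<N. u i j * u i j)" by (intro sum.cong) auto
    then show False using orth nz ik by simp
  qed
  have "func.independent (g ` {..<r})"
  proof (rule func.independent_if_scalars_zero)
    fix c v assume c: "(\<Sum>v\<in>g ` {..<r}. (\<lambda>x. c v * v x)) = 0" and "v \<in> g ` {..<r}"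
    then obtain k where k: "k < r" "v = g k" by auto
    have "(\<Sum>i<r. c (g i) * u i j) = 0" if "j < N" for j
    proof (rule coeff [OF _ that])
      fix x
      have "(\<Sum>j<N. (\<Sum>i<r. c (g i) * u i j) * f j x) = (\<Sum>j<N. \<Sum>i<r. c (g i) * (u i j * f j x))"
        by (simp add: sum_distrib_right mult.assoc)
      also have "\<dots> = (\<Sum>i<r. c (g i) * g i x)"
        by (subst sum.swap) (simp add: g_def sum_distrib_left)
      also have "\<dots> = (\<Sum>v\<in>g ` {..<r}. (\<lambda>x. c v * v x)) x"
        by (simp add: sum_fun_apply sum.reindex [OF inj])
      finally show "(\<Sum>j<N. (\<Sum>i<r. c (g i) * u i j) * f j x) = 0" using c by simp
    qed
    then have "0 = (\<Sum>j<N. (\<Sum>i<r. c (g i) * u i j) * u k j)" by simp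
    also have "\<dots> = (\<Sum>i<r. c (g i) * (\<Sum>j<N. u i j * u k j))"
      by (simp add: sum_distrib_right sum_distrib_left mult.assoc) (rule sum.swap)
    also have "\<dots> = (\<Sum>i<r. if i = k then c (g k) * (\<Sum>j<N. u k j * u k j) else 0)"
      using orth k(1) by (intro sum.cong refl) auto
    also have "\<dots> = c (g k) * (\<Sum>j<N. u k j * u k j)" using k(1) by simp
    finally show "c v = 0" using nz [OF k(1)] k(2) by simp
  qed simp
  moreover have gV: "g ` {..<r} \<subseteq> V" using V(2) by (auto simp: g_def)
  ultimately obtain A where A: "g ` {..<r} \<subseteq> A" "A \<subseteq> V" "func.independent A" "V \<subseteq> func.span A"
    using func.maximal_independent_subset_extend [of "g ` {..<r}" V] by blast
  have "finite A" using func.independent_span_bound [OF fin A(3)] A(2) V(1) by blast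
  have "r = card (g ` {..<r})" using card_image [OF inj] by simp
  also have "\<dots> \<le> card A" by (rule card_mono [OF \<open>finite A\<close> A(1)])
  also have "card A = func.dim V" by (rule func.basis_card_eq_dim [OF A(2,4,3)])
  finally show ?thesis .
qed

lemma sign_class_add:
  assumes G: "acts_on X G" and e: "sign_function X G e" "sign_function X G e'"
  shows "sign_class X G (\<lambda>x. e x + e' x) = sign_class X G e \<oplus>\<^bsub>inv_cohomology_ring X G\<^esub> sign_class X G e'"
  unfolding sign_class_def point_cochain_add coboundary_add
  by (rule inv_class_simps(2) [OF G sign_cocycle [OF G e(1)] sign_cocycle [OF G e(2)]])

text \<open>The scalar product of two of the vectors changes sign exactly under the two flips of
  these vectors, and so does the sum of their signs.\<close>

lemma lines_sum_vanishes_on: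
  fixes B :: "'b topology"
  assumes ij: "i < r" "j < r" "i \<noteq> j"
  shows "vanishes_on (lines_space B N r) (flip_line ` {..<r})
    {y \<in> topspace (lines_space B N r). (\<Sum>k<N. snd y j k * snd y i k) \<noteq> 0}
    (component (lines_ring B N r) (embed_component (lines_ring B N r) (lines_class B N r j) +
      embed_component (lines_ring B N r) (lines_class B N r i)))"
proof -
  let ?Y = "lines_space B N r" and ?G = "flip_line ` {..<r} :: ('b \<times> (nat \<Rightarrow> nat \<Rightarrow> real) \<Rightarrow> _) set"
  let ?e = "\<lambda>y :: 'b \<times> (nat \<Rightarrow> nat \<Rightarrow> real). vector_sign (snd y j) + vector_sign (snd y i)"
  let ?h = "\<lambda>y :: 'b \<times> (nat \<Rightarrow> nat \<Rightarrow> real). \<Sum>k<N. snd y j k * snd y i k"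
  have "component (lines_ring B N r) (embed_component (lines_ring B N r) (lines_class B N r j) +
      embed_component (lines_ring B N r) (lines_class B N r i)) = sign_class ?Y ?G ?e"
    using sign_class_add [OF acts_on_lines [of B N r] sign_function_lines [OF ij(2)] sign_function_lines [OF ij(1)], symmetric]
      lines_class_closed [OF ij(1), of B N] lines_class_closed [OF ij(2), of B N]
    by (simp add: component_simps cring2_lines lines_class_def)
  moreover have "vanishes_on ?Y ?G {y \<in> topspace ?Y. ?h y \<noteq> 0} (sign_class ?Y ?G ?e)"
  proof (rule sign_class_vanishes_on [OF acts_on_lines])
    have "continuous_map ?Y euclideanreal (\<lambda>y. snd y l k)" if "l < r" for l k
      using continuous_map_compose [OF continuous_map_lines_component [OF that, of B N] continuous_map_punctured_component]
      by (simp add: comp_def)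
    then show "continuous_map ?Y euclideanreal ?h"
      using ij by (intro continuous_map_sum continuous_map_real_mult) auto
    fix g assume "g \<in> ?G"
    then obtain l where l: "g = flip_line l" "l < r" by auto
    have nz: "snd y l \<noteq> (\<lambda>_. 0)" if "y \<in> topspace ?Y" for y
      using that l(2) by (auto simp: topspace_lines_space topspace_punctured PiE_iff)
    have *: "snd (flip_line l y) m = (if m = l then vector_neg (snd y l) else snd y m)" for y :: "'b \<times> (nat \<Rightarrow> nat \<Rightarrow> real)" and m
      by (simp add: flip_line_def split_def)
    show "(\<forall>y\<in>topspace ?Y. ?h (g y) = ?h y \<and> ?e (g y) = ?e y) \<or>
      (\<forall>y\<in>topspace ?Y. ?h (g y) = - ?h y \<and> ?e (g y) = ?e y + 1)"
    proof (cases "l = i \<or> l = j")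
      case True
      have "?h (g y) = - ?h y \<and> ?e (g y) = ?e y + 1" if y: "y \<in> topspace ?Y" for y
        using True ij(3) vector_sign_neg [OF nz [OF y]] unfolding l(1) *
        by (auto simp: sum_negf ac_simps)
      then show ?thesis by blast
    next
      case False
      then show ?thesis unfolding l(1) * by simp
    qed
  qed
  ultimately show ?thesis by argo
qed


text \<open>\<open>cover\<close> states that no configuration admits r mutually orthogonal nonzero
  vectors in the kernel. Hence the open set of tuples with some nonzero scalar product, where the
  Vandermonde product vanishes, and the open set of those with some vector outside the kernel, where
  the product of the relations vanishes, cover the whole space.\<close>

lemma Hankel_product_zero:
  fixes w :: "nat \<Rightarrow> (real^2) set cochain set" and f :: "nat \<Rightarrow> real \<Rightarrow> real"
  assumes sw: "stiefel_whitney_classes n (regular_bundle plane n) w"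
    and Nn: "N \<le> n" "r \<le> N" "0 < N" and f: "\<And>j. j < N \<Longrightarrow> continuous_on UNIV (f j)"
    and cover: "\<And>S u. \<lbrakk>S \<in> topspace (configuration_space plane n);
        \<And>i. i < r \<Longrightarrow> u i \<in> topspace (punctured N);
        \<And>i p. \<lbrakk>i < r; p \<in> S\<rbrakk> \<Longrightarrow> chord_section N f (u i) S p = 0;
        \<And>i j. \<lbrakk>i < j; j < r\<rbrakk> \<Longrightarrow> (\<Sum>k<N. u j k * u i k) = 0\<rbrakk> \<Longrightarrow> False"
  defines "H \<equiv> inv_cohomology_ring (configuration_space plane n) {}"
  shows "component H (\<Prod>i<r. embed_component H (w (n - N + 1 + 2 * i))) = \<zero>\<^bsub>H\<^esub>"
proof -
  let ?X = "euclidean :: (real^2) topology"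
  let ?B = "configuration_space ?X n"
  let ?Y = "lines_space ?B N r" and ?G = "flip_line ` {..<r} :: ((real^2) set \<times> (nat \<Rightarrow> nat \<Rightarrow> real) \<Rightarrow> _) set"
  let ?K = "lines_ring ?B N r"
  have wB: "w k \<in> carrier H" for k
    using stiefel_whitney_closed [OF sw, of k] by (simp add: regular_bundle_simps H_def)
  have w0: "w k = \<zero>\<^bsub>H\<^esub>" if "k > n" for k
    using sw that unfolding stiefel_whitney_classes_def H_def by (simp add: regular_bundle_simps inv_cohomology_ring_empty)
  have cH: "cring2 H" unfolding H_def by (rule cring2_inv_cohomology_ring) simp
  have G: "acts_on ?Y ?G" by (rule acts_on_lines)
  have cK: "cring2 ?K" by (rule cring2_lines)
  have \<beta>: "equivariant_map ?Y ?G ?B {} fst" by (rule equivariant_map_lines_fst)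
  have hom: "lines_pullback ?B N r \<in> ring_hom H ?K"
    unfolding H_def by (rule inv_pullback_hom [OF \<beta> G]) simp
  let ?x = "\<lambda>i. embed_component ?K (lines_class ?B N r i)"
  let ?W = "\<lambda>k. embed_component ?K (lines_pullback ?B N r (w k))"
  have sym: "(\<forall>y\<in>topspace ?Y. snd (g y) i = snd y i) \<or> (\<forall>y\<in>topspace ?Y. snd (g y) i = vector_neg (snd y i))"
    if "g \<in> ?G" for g i
  proof -
    obtain l where l: "g = flip_line l" using \<open>g \<in> ?G\<close> by auto
    show ?thesis unfolding l by (cases "l = i") (simp_all add: flip_line_def split_def)
  qed
  let ?V = "\<Union>j\<in>{..<r}. \<Union>i\<in>{..<j}. {y \<in> topspace ?Y. (\<Sum>k<N. snd y j k * snd y i k) \<noteq> 0}"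
  let ?U = "\<Union>i\<in>{..<r}. {y \<in> topspace ?Y. \<exists>p\<in>fst y. chord_section N f (snd y i) (fst y) p \<noteq> 0}"
  let ?A = "\<Prod>j\<in>{..<r}. \<Prod>i\<in>{..<j}. ?x j + ?x i" and ?C = "\<Prod>i\<in>{..<r}. \<Sum>k\<le>n. ?W k * ?x i ^ (n - k)"
  have A: "vanishes_on ?Y ?G ?V (component ?K ?A)"
  proof (rule vanishes_on_prod [OF G finite_lessThan])
    fix j assume "j \<in> {..<r}"
    then show "vanishes_on ?Y ?G (\<Union>i\<in>{..<j}. {y \<in> topspace ?Y. (\<Sum>k<N. snd y j k * snd y i k) \<noteq> 0})
        (component ?K (\<Prod>i\<in>{..<j}. ?x j + ?x i))"
      by (intro vanishes_on_prod [OF G finite_lessThan] lines_sum_vanishes_on) auto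
  qed
  have C: "vanishes_on ?Y ?G ?U (component ?K ?C)"
  proof (rule vanishes_on_prod [OF G finite_lessThan])
    fix i assume "i \<in> {..<r}"
    then have i: "i < r" by simp
    show "vanishes_on ?Y ?G {y \<in> topspace ?Y. \<exists>p\<in>fst y. chord_section N f (snd y i) (fst y) p \<noteq> 0}
        (component ?K (\<Sum>k\<le>n. ?W k * ?x i ^ (n - k)))"
      unfolding lines_class_def
    proof (rule relation_vanishes_on [OF _ sw G \<beta> continuous_map_lines_component [OF i] sym])
      show "continuous_map (prod_topology (ordered_configurations ?X n) (punctured N)) euclideanreal
          (\<lambda>(x, z). chord_section N f z (x ` {..<n}) (x l))" if "l < n" for l
        by (rule continuous_map_chord_section [OF f that])
      show "chord_section N f (vector_neg z) S p = - chord_section N f z S p" for z S p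
        by (simp add: chord_section_def sum_negf)
    qed simp_all
  qed
  have "topspace ?Y \<subseteq> ?V \<union> ?U"
  proof (rule subsetI, rule ccontr)
    fix y assume y: "y \<in> topspace ?Y" and no: "y \<notin> ?V \<union> ?U"
    show False
    proof (rule cover [of "fst y" "snd y"])
      show "fst y \<in> topspace ?B"
        using y unfolding topspace_lines_space mem_Times_iff by (rule conjunct1)
      have "snd y \<in> PiE {..<r} (\<lambda>_. topspace (punctured N))"
        using y unfolding topspace_lines_space mem_Times_iff by (rule conjunct2)
      then show "snd y i \<in> topspace (punctured N)" if "i < r" for i
        by (rule PiE_mem) (simp add: that)
      show "chord_section N f (snd y i) (fst y) p = 0" if "i < r" "p \<in> fst y" for i p
      proof (rule ccontr)
        assume ne: "chord_section N f (snd y i) (fst y) p \<noteq> 0"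
        have "y \<in> ?U"
          by (intro UN_I [of i] CollectI conjI y bexI [of _ p] ne that) (simp add: that)
        then show False using no by (simp only: Un_iff simp_thms)
      qed
      show "(\<Sum>k<N. snd y j k * snd y i k) = 0" if "i < j" "j < r" for i j
      proof (rule ccontr)
        assume ne: "(\<Sum>k<N. snd y j k * snd y i k) \<noteq> 0"
        have "y \<in> ?V"
          by (intro UN_I [of j] UN_I [of i] CollectI conjI y ne) (use that in simp_all)
        then show False using no by (simp only: Un_iff simp_thms)
      qed
    qed
  qed
  then have "component ?K (?A * ?C) = \<zero>\<^bsub>?K\<^esub>"
    using vanishes_on_cover_mult [OF G A C] by (simp add: component_simps cK)
  moreover have "?A * ?C = (\<Sum>e\<in>PiE {..<r} (\<lambda>_. {..<N}). permanent r (\<lambda>i j. ?W (n + j - e i)) * (\<Prod>i<r. ?x i ^ e i))"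
  proof (rule porteous_expansion [OF ring_product_add_self Nn(1)])
    show "?W j = 0" if "j > n" for j
      using inv_pullback_zero [OF \<beta> G] by (simp add: w0 [OF that] H_def embed_component_hom(1) [OF cK])
    show "?x i ^ N = 0" if "i < r" for i
      unfolding lines_class_def
      by (rule sign_class_power_zero [OF G continuous_map_lines_component [OF that] Nn(3) sym])
  qed
  ultimately have z: "component ?K (\<Sum>e\<in>PiE {..<r} (\<lambda>_. {..<N}). permanent r (\<lambda>i j. ?W (n + j - e i)) * (\<Prod>i<r. ?x i ^ e i))
      = \<zero>\<^bsub>?K\<^esub>"
    by argo
  \<comment> \<open>The permanents are formed in the cohomology of the configuration space, because
    independence of the monomials is about coefficients that are pulled back from there.\<close>
  let ?c = "\<lambda>e :: nat \<Rightarrow> nat. component H (permanent r (\<lambda>i j. embed_component H (w (n + j - e i))))"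
  have cc: "?c e \<in> carrier H" for e by (rule component_closed [OF cH])
  have match: "lines_pullback ?B N r (?c e) = component ?K (permanent r (\<lambda>i j. ?W (n + j - e i)))" for e
  proof -
    have "matches (lines_pullback ?B N r) H ?K (permanent r (\<lambda>i j. embed_component H (w (n + j - e i))))
        (permanent r (\<lambda>i j. ?W (n + j - e i)))"
      unfolding permanent_def
      by (intro matches_sum [OF cH cK hom] matches_prod [OF cH cK hom] matches_embed [OF cH cK hom wB])
    then show ?thesis by (simp add: matches_def)
  qed
  have "component ?K (\<Sum>e\<in>PiE {..<r} (\<lambda>_. {..<N}). embed_component ?K (lines_pullback ?B N r (?c e)) * (\<Prod>i<r. ?x i ^ e i))
      = component ?K (\<Sum>e\<in>PiE {..<r} (\<lambda>_. {..<N}). permanent r (\<lambda>i j. ?W (n + j - e i)) * (\<Prod>i<r. ?x i ^ e i))"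
  proof -
    have fin: "finite (PiE {..<r} (\<lambda>_. {..<N}))" by (intro finite_PiE) simp_all
    have eq: "component ?K (embed_component ?K (lines_pullback ?B N r (?c e)) * (\<Prod>i<r. ?x i ^ e i))
        = component ?K (permanent r (\<lambda>i j. ?W (n + j - e i)) * (\<Prod>i<r. ?x i ^ e i))" for e
      unfolding component_simps(4) [OF cK] match component_embed_self [OF component_closed [OF cK] cK] ..
    show ?thesis unfolding component_sum [OF cK fin] eq ..
  qed
  note z' = this [unfolded z]
  \<comment> \<open>the exponents for which the coefficient is a Hankel permanent\<close>
  define e where "e = (\<lambda>i\<in>{..<r}. N - 1 - i)"
  have e: "e \<in> PiE {..<r} (\<lambda>_. {..<N})" using Nn by (auto simp: e_def)
  have "?c e = \<zero>\<^bsub>H\<^esub>"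
    unfolding H_def by (rule lines_classes_independent [OF _ z' [unfolded H_def] e]) (use cc in \<open>simp add: H_def\<close>)
  moreover have "permanent r (\<lambda>i j. embed_component H (w (n + j - e i))) = permanent r (\<lambda>i j. embed_component H (w (n - N + 1 + (i + j))))"
    unfolding permanent_def
  proof (intro sum.cong prod.cong refl)
    fix \<sigma> i assume "i \<in> {..<r}"
    then have "n + \<sigma> i - e i = n - N + 1 + (i + \<sigma> i)" using Nn by (simp add: e_def)
    then show "embed_component H (w (n + \<sigma> i - e i)) = embed_component H (w (n - N + 1 + (i + \<sigma> i)))" by simp
  qed
  moreover have "\<dots> = (\<Prod>i<r. embed_component H (w (n - N + 1 + 2 * i)))"
  proof (rule Hankel_char2 [OF ring_product_add_self])
    fix m
    have sq: "w (n - N + 1 + m) \<otimes>\<^bsub>H\<^esub> w (n - N + 1 + m) = \<zero>\<^bsub>H\<^esub>"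
      unfolding H_def by (rule stiefel_whitney_square [OF sw]) simp
    show "embed_component H (w (n - N + 1 + m)) * embed_component H (w (n - N + 1 + m)) = 0"
      unfolding embed_component_hom(3) [OF cH wB wB, symmetric] sq by (rule embed_component_hom(1) [OF cH])
  qed
  ultimately show ?thesis by argo
qed

text \<open>A tuple of mutually orthogonal nonzero vectors in the kernel is converted into a chord
  diagram: linear combinations of the basis with these coefficient vectors respect the chords of S,
  and orthogonality bounds the dimension from below.\<close>

lemma chord_section_zero:
  assumes S: "finite S" "card S = n"
    and B: "func.independent B" "bij_betw f {..<N} B" "func.span B = F"
    and u: "\<And>i. i < r \<Longrightarrow> u i \<in> topspace (punctured N)"
    and zero: "\<And>i p. \<lbrakk>i < r; p \<in> S\<rbrakk> \<Longrightarrow> chord_section N f (u i) S p = 0"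
    and orth: "\<And>i j. \<lbrakk>i < j; j < r\<rbrakk> \<Longrightarrow> (\<Sum>k<N. u j k * u i k) = 0"
  shows "\<exists>D. independent_chord_diagram n D \<and> r \<le> func.dim {f \<in> F. respects_chords D f}"
proof (intro exI conjI)
  show "independent_chord_diagram n (chords S)"
    using independent_chords [OF S(1)] S(2) by simp
  show "r \<le> func.dim {f \<in> F. respects_chords (chords S) f}"
  proof (rule dim_ge_orthogonal [OF B(1,2)])
    show "(\<Sum>j<N. u i j * u k j) = 0" if ik: "i < r" "k < r" "i \<noteq> k" for i k
    proof (cases "i < k")
      case True
      then show ?thesis using orth [of i k] ik by (simp add: mult.commute)
    next
      case False
      then show ?thesis using orth [of k i] ik by simp
    qed
    show "(\<Sum>j<N. u i j * u i j) \<noteq> 0" if i: "i < r" for i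
    proof
      assume "(\<Sum>j<N. u i j * u i j) = 0"
      then have "u i j = 0" if "j < N" for j
        using that sum_nonneg_eq_0_iff [of "{..<N}" "\<lambda>j. u i j * u i j"] by simp
      moreover have "u i j = 0" if "j \<ge> N" for j using u [OF i] that by (simp add: topspace_punctured)
      ultimately have "u i = (\<lambda>_. 0)" by (metis not_le ext)
      then show False using u [OF i] by (simp add: topspace_punctured)
    qed
    show "{f \<in> F. respects_chords (chords S) f} \<subseteq> func.span B" using B(3) by blast
    show "(\<lambda>x. \<Sum>j<N. u i j * f j x) \<in> {f \<in> F. respects_chords (chords S) f}" if i: "i < r" for i
    proof (intro CollectI conjI)
      have "(\<Sum>j<N. (\<lambda>x. u i j * f j x)) \<in> func.span B"
        using B(2) by (intro func.span_sum func.span_scale func.span_base) (auto simp: bij_betw_def)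
      moreover have "(\<Sum>j<N. (\<lambda>x. u i j * f j x)) = (\<lambda>x. \<Sum>j<N. u i j * f j x)"
        by (intro ext) (rule sum_fun_apply)
      ultimately show "(\<lambda>x. \<Sum>j<N. u i j * f j x) \<in> F" unfolding B(3) by argo
      show "respects_chords (chords S) (\<lambda>x. \<Sum>j<N. u i j * f j x)"
        unfolding respects_chords_iff using zero [OF i]
        by (simp add: chord_section_def right_diff_distrib sum_subtractf)
    qed
  qed
qed

theorem theorem3:
  fixes N n r :: nat
    and w :: "nat \<Rightarrow> (real^2) set cochain set"
    and F :: "(real \<Rightarrow> real) set"
  assumes "N \<le> n"
    and "stiefel_whitney_classes n (regular_bundle (euclidean :: (real^2) topology) n) w"
    and "(\<Otimes>\<^bsub>cohomology_ring (configuration_space (euclidean :: (real^2) topology) n)\<^esub> i \<in> {1..r}.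
            w (n - N + 2 * i - 1))
          \<noteq> \<zero>\<^bsub>cohomology_ring (configuration_space (euclidean :: (real^2) topology) n)\<^esub>"
    and "F \<subseteq> continuous_functions"
    and "has_dimension F N"
  shows "\<exists>D. independent_chord_diagram n D \<and> r \<le> func.dim {f \<in> F. respects_chords D f}"
proof (rule ccontr)
  assume no: "\<not> ?thesis"
  let ?B = "configuration_space (euclidean :: (real^2) topology) n"
  define H where "H = inv_cohomology_ring ?B {}"
  have cH: "cring2 H" unfolding H_def by (rule cring2_inv_cohomology_ring) simp
  have wB: "w k \<in> carrier H" for k
    using stiefel_whitney_closed [OF assms(2), of k] by (simp add: regular_bundle_simps H_def)
  have w0: "w k = \<zero>\<^bsub>H\<^esub>" if "k > n" for k
    using assms(2) that unfolding stiefel_whitney_classes_def H_def by (simp add: regular_bundle_simps inv_cohomology_ring_empty)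
  obtain Bs where Bs: "finite Bs" "card Bs = N" "func.independent Bs" "func.span Bs = F"
    using assms(5) unfolding has_dimension_def by blast
  obtain f where f: "bij_betw f {..<N} Bs"
    using ex_bij_betw_nat_finite [OF Bs(1)] Bs(2) by (auto simp: atLeast0LessThan)
  have fc: "continuous_on UNIV (f j)" if "j < N" for j
  proof -
    have "f j \<in> Bs" using f that by (auto simp: bij_betw_def)
    then have "f j \<in> F" using func.span_base Bs(4) by blast
    then show ?thesis using assms(4) by (auto simp: continuous_functions_def)
  qed
  have "component H (\<Prod>i<r. embed_component H (w (n - N + 1 + 2 * i))) = \<zero>\<^bsub>H\<^esub>"
  proof (cases "r \<le> N \<and> 0 < N")
    case True
    then show ?thesis
      unfolding H_def
    proof (intro Hankel_product_zero [OF assms(2,1) _ _ fc])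
      fix S u assume S: "S \<in> topspace ?B" and *: "\<And>i. i < r \<Longrightarrow> u i \<in> topspace (punctured N)"
        "\<And>i p. \<lbrakk>i < r; p \<in> S\<rbrakk> \<Longrightarrow> chord_section N f (u i) S p = 0"
        "\<And>i j. \<lbrakk>i < j; j < r\<rbrakk> \<Longrightarrow> (\<Sum>k<N. u j k * u i k) = 0"
      obtain x where x: "x \<in> topspace (ordered_configurations (euclidean :: (real^2) topology) n)" "S = x ` {..<n}"
        using S topspace_configuration_space by metis
      then have "finite S" "card S = n" using ordered_configurations_inj [OF x(1)] by (simp_all add: card_image)
      then have "\<exists>D. independent_chord_diagram n D \<and> r \<le> func.dim {f \<in> F. respects_chords D f}"
        by (rule chord_section_zero [OF _ _ Bs(3) f Bs(4)]) (fact *)+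
      with no show False by (rule notE)
    qed simp_all
  next
    case False
    \<comment> \<open>Here r exceeds N or N is zero, so either r = 0 or r > N.\<close>
    show ?thesis
    proof (cases "r = 0")
      case True
      \<comment> \<open>Nothing is required of the functions if r = 0, so any n points will do;
        these lie on the diagonal.\<close>
      define S :: "(real^2) set" where "S = (\<lambda>i. vec (real i)) ` {..<n}"
      have "inj_on (\<lambda>i. vec (real i) :: real^2) {..<n}" by (intro inj_onI) (simp add: vec_eq_iff)
      then have "finite S" "card S = n" by (simp_all add: S_def card_image)
      then have False using independent_chords [of S] no True by auto
      then show ?thesis ..
    next
      case r: False
      with False have "r > N" by linarith
      \<comment> \<open>For r > N the index n - N + 2 r - 1 of the last factor is larger than
        n.\<close>
      then have "w (n - N + 1 + 2 * (r - 1)) = \<zero>\<^bsub>H\<^esub>" using assms(1) by (intro w0) linarith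
      then have "embed_component H (w (n - N + 1 + 2 * (r - 1))) = 0" by (simp add: embed_component_hom(1) [OF cH])
      then have "(\<Prod>i<r. embed_component H (w (n - N + 1 + 2 * i))) = 0"
        using r by (intro prod_zero bexI [of _ "r - 1"]) auto
      then show ?thesis by (simp add: component_simps(1) [OF cH])
    qed
  qed
  \<comment> \<open>The index is shifted by one; as it is positive in the second product,
    subtracting one there is exact.\<close>
  moreover have "(\<Prod>i<r. embed_component H (w (n - N + 1 + 2 * i))) = (\<Prod>i\<in>{1..r}. embed_component H (w (n - N + 2 * i - 1)))"
    by (rule prod.reindex_bij_witness [of _ "\<lambda>i. i - 1" "\<lambda>i. i + 1"]) auto
  moreover have "component H (\<Prod>i\<in>{1..r}. embed_component H (w (n - N + 2 * i - 1))) = (\<Otimes>\<^bsub>H\<^esub> i\<in>{1..r}. w (n - N + 2 * i - 1))"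
    unfolding component_prod [OF cH finite_atLeastAtMost] component_embed_self [OF wB cH] ..
  ultimately have "(\<Otimes>\<^bsub>H\<^esub> i\<in>{1..r}. w (n - N + 2 * i - 1)) = \<zero>\<^bsub>H\<^esub>" by argo
  then show False using assms(3) unfolding H_def inv_cohomology_ring_empty by contradiction
qed

end
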